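(* Let $A$ and $B$ be rings and let ${}_B\Sigma_A$ be a $(B,A)$-bimodule such that ${}_B\Sigma$ is faithful and $\Sigma_A$ is finitely generated and projective. Let $S=\mathrm{End}(\Sigma_A)$, regard $B$ as a subring of $S$ via the (injective) canonical ring map $B\to S$, and let $\Sigma^*\otimes_B\Sigma$ be the comatrix $A$-coring associated to $\Sigma$. Suppose that at least one of the following holds: (a) ${}_B\Sigma$ or $\Sigma^*_B$ is a faithfully flat module; or (b) ${}_B\Sigma_A$ is a separable bimodule. Then there is an isomorphism of groups $$\Gamma:\mathbf{Inv}_B(S)\longrightarrow \mathrm{Aut}_{A\text{-}cor}(\Sigma^*\otimes_B\Sigma)$$ from the group of invertible $B$-sub-bimodules of $S$ to the group of $A$-coring automorphisms of $\Sigma^*\otimes_B\Sigma$.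
   Context: All rings are unital algebras over a commutative ring $K$, modules are unital, and bimodules are central over $K$. An $A$-coring is an $A$-bimodule $\mathfrak{C}$ with $A$-bilinear maps $\Delta:\mathfrak{C}\to\mathfrak{C}\otimes_A\mathfrak{C}$ and $\varepsilon:\mathfrak{C}\to A$ satisfying coassociativity and the counit axioms. A morphism of $A$-corings is an $A$-bilinear map $\phi$ commuting with comultiplications ($\Delta\circ\phi=(\phi\otimes_A\phi)\circ\Delta$) and counits ($\varepsilon\circ\phi=\varepsilon$). $\mathrm{Aut}_{A\text{-}cor}(\mathfrak{C})$ is the group, under composition, of bijective $A$-coring endomorphisms of $\mathfrak{C}$. Comatrix coring: for a $(B,A)$-bimodule $\Sigma$ with $\Sigma_A$ finitely generated and projective, put $\Sigma^*=\mathrm{Hom}(\Sigma_A,A_A)$ (an $(A,B)$-bimodule) and let $\{(e_i,e_i^* )\}_{i}\subset\Sigma\times\Sigma^*$ be a finite dual basis of $\Sigma_A$. The $A$-bimodule $\Sigma^*\otimes_B\Sigma$ is an $A$-coring with $\Delta(u^*\otimes_B u)=\sum_i u^*\otimes_B e_i\otimes_A e_i^*\otimes_B u$ and $\varepsilon(u^*\otimes_B u)=u^*(u)$; this does not depend on the chosen dual basis. $S=\mathrm{End}(\Sigma_A)$ is the ring of right $A$-linear endomorphisms of $\Sigma$ (with composition), acting on the left of $\Sigma$; the canonical ring map $B\to S$ is given by the left $B$-action on $\Sigma$. The set of all $B$-sub-bimodules of $S$ is a monoid under the product $IJ=\{\text{finite sums }\sum xy: x\in I,\,y\in J\}$, with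 unit $B$; $\mathbf{Inv}_B(S)$ is its group of invertible elements (those $I$ for which there is a $B$-sub-bimodule $J\subseteq S$ with $IJ=JI=B$). ${}_B\Sigma_A$ is a separable bimodule if the evaluation map $\Sigma\otimes_A{}^*\Sigma\to B$, $m\otimes_A\varphi\mapsto\varphi(m)$, where ${}^*\Sigma=\mathrm{Hom}({}_B\Sigma,{}_BB)$, is a split epimorphism of $(B,B)$-bimodules. *)

theory Defs
  imports "HOL-Algebra.Free_Abelian_Groups" "HOL-Algebra.Ideal_Product" "HOL-Algebra.Bij"
begin

section \<open>Algebras, modules and bimodules\<close>

text \<open>A unital algebra over the commutative ring \<open>K\<close>: a ring together with a unital ring
  homomorphism \<open>\<eta>\<close> from \<open>K\<close> into its centre.\<close>

locale unital_algebra = K?: cring K + A?: ring A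
  for K :: "'k ring" (structure) and A :: "'a ring" (structure) and \<eta> :: "'k \<Rightarrow> 'a" +
  assumes unit_hom: "\<eta> \<in> ring_hom K A"
    and unit_central: "\<lbrakk>k \<in> carrier K; a \<in> carrier A\<rbrakk> \<Longrightarrow> \<eta> k \<otimes>\<^bsub>A\<^esub> a = a \<otimes>\<^bsub>A\<^esub> \<eta> k"

text \<open>As in the library theory of modules, the underlying abelian group is stored in a ring
  record whose multiplicative fields are meaningless in general.  One-sided modules live in the
  same record type; the action on the other side is then ignored.\<close>

record ('l, 'r, 'm) bimodule = "'m ring" +
  lact :: "'l \<Rightarrow> 'm \<Rightarrow> 'm"
  ract :: "'m \<Rightarrow> 'r \<Rightarrow> 'm"

locale left_module = L?: ring L + M?: abelian_group M
  for L :: "'l ring" (structure) and M :: "('l, 'r, 'm, 'z) bimodule_scheme" (structure) +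
  assumes lact_closed: "\<lbrakk>a \<in> carrier L; x \<in> carrier M\<rbrakk> \<Longrightarrow> lact M a x \<in> carrier M"
    and lact_l_distr: "\<lbrakk>a \<in> carrier L; b \<in> carrier L; x \<in> carrier M\<rbrakk> \<Longrightarrow>
          lact M (a \<oplus>\<^bsub>L\<^esub> b) x = lact M a x \<oplus>\<^bsub>M\<^esub> lact M b x"
    and lact_r_distr: "\<lbrakk>a \<in> carrier L; x \<in> carrier M; y \<in> carrier M\<rbrakk> \<Longrightarrow>
          lact M a (x \<oplus>\<^bsub>M\<^esub> y) = lact M a x \<oplus>\<^bsub>M\<^esub> lact M a y"
    and lact_assoc: "\<lbrakk>a \<in> carrier L; b \<in> carrier L; x \<in> carrier M\<rbrakk> \<Longrightarrow>
          lact M (a \<otimes>\<^bsub>L\<^esub> b) x = lact M a (lact M b x)"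
    and lact_one: "x \<in> carrier M \<Longrightarrow> lact M \<one>\<^bsub>L\<^esub> x = x"

locale right_module = R?: ring R + M?: abelian_group M
  for R :: "'r ring" (structure) and M :: "('l, 'r, 'm, 'z) bimodule_scheme" (structure) +
  assumes ract_closed: "\<lbrakk>x \<in> carrier M; a \<in> carrier R\<rbrakk> \<Longrightarrow> ract M x a \<in> carrier M"
    and ract_r_distr: "\<lbrakk>x \<in> carrier M; a \<in> carrier R; b \<in> carrier R\<rbrakk> \<Longrightarrow>
          ract M x (a \<oplus>\<^bsub>R\<^esub> b) = ract M x a \<oplus>\<^bsub>M\<^esub> ract M x b"
    and ract_l_distr: "\<lbrakk>x \<in> carrier M; y \<in> carrier M; a \<in> carrier R\<rbrakk> \<Longrightarrow>
          ract M (x \<oplus>\<^bsub>M\<^esub> y) a = ract M x a \<oplus>\<^bsub>M\<^esub> ract M y a"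
    and ract_assoc: "\<lbrakk>x \<in> carrier M; a \<in> carrier R; b \<in> carrier R\<rbrakk> \<Longrightarrow>
          ract M x (a \<otimes>\<^bsub>R\<^esub> b) = ract M (ract M x a) b"
    and ract_one: "x \<in> carrier M \<Longrightarrow> ract M x \<one>\<^bsub>R\<^esub> = x"

locale bimodule = left_module L M + right_module R M
  for L :: "'l ring" and R :: "'r ring" and M :: "('l, 'r, 'm, 'z) bimodule_scheme" +
  assumes lact_ract: "\<lbrakk>a \<in> carrier L; x \<in> carrier M; b \<in> carrier R\<rbrakk> \<Longrightarrow>
          ract M (lact M a x) b = lact M a (ract M x b)"

text \<open>A bimodule over the \<open>K\<close>-algebras \<open>(L, \<eta>\<^sub>L)\<close> and \<open>(R, \<eta>\<^sub>R)\<close> that is central over \<open>K\<close>.\<close>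

locale central_bimodule = bimodule L R M
  for K :: "'k ring" and L :: "'l ring" and \<eta>\<^sub>L :: "'k \<Rightarrow> 'l"
    and R :: "'r ring" and \<eta>\<^sub>R :: "'k \<Rightarrow> 'r"
    and M :: "('l, 'r, 'm, 'z) bimodule_scheme" +
  assumes central: "\<lbrakk>k \<in> carrier K; x \<in> carrier M\<rbrakk> \<Longrightarrow> lact M (\<eta>\<^sub>L k) x = ract M x (\<eta>\<^sub>R k)"

definition regular_bimodule :: "'a ring \<Rightarrow> ('a, 'a, 'a) bimodule" where
  "regular_bimodule R =
    \<lparr>carrier = carrier R, monoid.mult = monoid.mult R, one = one R, zero = zero R, add = add R,
     lact = monoid.mult R, ract = monoid.mult R\<rparr>"

definition left_hom ::
    "'l ring \<Rightarrow> ('l, 'r, 'm, 'y) bimodule_scheme \<Rightarrow> ('l, 's, 'n, 'z) bimodule_scheme \<Rightarrow> ('m \<Rightarrow> 'n) set"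
  where "left_hom R M N = {f \<in> hom (add_monoid M) (add_monoid N).
     \<forall>a\<in>carrier R. \<forall>x\<in>carrier M. f (lact M a x) = lact N a (f x)}"

definition right_hom ::
    "'r ring \<Rightarrow> ('l, 'r, 'm, 'y) bimodule_scheme \<Rightarrow> ('s, 'r, 'n, 'z) bimodule_scheme \<Rightarrow> ('m \<Rightarrow> 'n) set"
  where "right_hom R M N = {f \<in> hom (add_monoid M) (add_monoid N).
     \<forall>x\<in>carrier M. \<forall>a\<in>carrier R. f (ract M x a) = ract N (f x) a}"

definition faithful_left_module :: "'l ring \<Rightarrow> ('l, 'r, 'm, 'z) bimodule_scheme \<Rightarrow> bool" where
  "faithful_left_module R M \<longleftrightarrow> left_module R M \<and>
     (\<forall>a\<in>carrier R. (\<forall>x\<in>carrier M. lact M a x = \<zero>\<^bsub>M\<^esub>) \<longrightarrow> a = \<zero>\<^bsub>R\<^esub>)"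


section \<open>Finitely generated projective modules\<close>

definition fin_gen_right_module :: "'r ring \<Rightarrow> ('l, 'r, 'm, 'z) bimodule_scheme \<Rightarrow> bool" where
  "fin_gen_right_module R M \<longleftrightarrow> right_module R M \<and>
     (\<exists>X. finite X \<and> X \<subseteq> carrier M \<and>
        (\<forall>y\<in>carrier M. \<exists>c\<in>X \<rightarrow> carrier R. y = (\<Oplus>\<^bsub>M\<^esub>x\<in>X. ract M x (c x))))"

text \<open>The free right module \<open>R\<^sup>(\<^sup>X\<^sup>)\<close> of finitely supported families indexed by \<open>X\<close>.\<close>

definition free_right_module :: "'r ring \<Rightarrow> 'x set \<Rightarrow> (unit, 'r, 'x \<Rightarrow> 'r) bimodule" where
  "free_right_module R X =
    \<lparr>carrier = {f \<in> X \<rightarrow>\<^sub>E carrier R. finite {x \<in> X. f x \<noteq> \<zero>\<^bsub>R\<^esub>}},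
     monoid.mult = undefined, one = undefined,
     zero = (\<lambda>x\<in>X. \<zero>\<^bsub>R\<^esub>), add = (\<lambda>f g. \<lambda>x\<in>X. f x \<oplus>\<^bsub>R\<^esub> g x),
     lact = undefined, ract = (\<lambda>f a. \<lambda>x\<in>X. f x \<otimes>\<^bsub>R\<^esub> a)\<rparr>"

text \<open>Projective means being a direct summand of a free module.  Since every module is a quotient
  of the free module on its own elements, it is no restriction to index the free module by
  a set of elements of the carrier type.\<close>

definition projective_right_module :: "'r ring \<Rightarrow> ('l, 'r, 'm, 'z) bimodule_scheme \<Rightarrow> bool" where
  "projective_right_module R M \<longleftrightarrow> right_module R M \<and>
     (\<exists>(X :: 'm set).
        \<exists>\<iota> \<in> right_hom R M (free_right_module R X). \<exists>\<pi> \<in> right_hom R (free_right_module R X) M.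
          \<forall>x\<in>carrier M. \<pi> (\<iota> x) = x)"


section \<open>Tensor products\<close>

text \<open>\<open>M \<otimes>\<^sub>R N\<close> is the free abelian group on \<open>M \<times> N\<close> modulo the subgroup generated by the
  bilinearity and balancing relations; its elements are cosets of formal integer combinations
  of pairs.\<close>

definition tensor_rels ::
    "'c ring \<Rightarrow> ('l, 'c, 'm, 'y) bimodule_scheme \<Rightarrow> ('c, 'r, 'n, 'z) bimodule_scheme
      \<Rightarrow> ('m \<times> 'n \<Rightarrow>\<^sub>0 int) set"
  where "tensor_rels R M N =
     {frag_of (x \<oplus>\<^bsub>M\<^esub> x', y) - frag_of (x, y) - frag_of (x', y) | x x' y.
        x \<in> carrier M \<and> x' \<in> carrier M \<and> y \<in> carrier N}
   \<union> {frag_of (x, y \<oplus>\<^bsub>N\<^esub> y') - frag_of (x, y) - frag_of (x, y') | x y y'.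
        x \<in> carrier M \<and> y \<in> carrier N \<and> y' \<in> carrier N}
   \<union> {frag_of (ract M x a, y) - frag_of (x, lact N a y) | x a y.
        x \<in> carrier M \<and> a \<in> carrier R \<and> y \<in> carrier N}"

definition tensor_kernel ::
    "'c ring \<Rightarrow> ('l, 'c, 'm, 'y) bimodule_scheme \<Rightarrow> ('c, 'r, 'n, 'z) bimodule_scheme
      \<Rightarrow> ('m \<times> 'n \<Rightarrow>\<^sub>0 int) set"
  where "tensor_kernel R M N =
     generate (free_Abelian_group (carrier M \<times> carrier N)) (tensor_rels R M N)"

definition tensor_group ::
    "'c ring \<Rightarrow> ('l, 'c, 'm, 'y) bimodule_scheme \<Rightarrow> ('c, 'r, 'n, 'z) bimodule_scheme
      \<Rightarrow> ('m \<times> 'n \<Rightarrow>\<^sub>0 int) set monoid"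
  where "tensor_group R M N = free_Abelian_group (carrier M \<times> carrier N) Mod tensor_kernel R M N"

definition pure_tensor ::
    "'c ring \<Rightarrow> ('l, 'c, 'm, 'y) bimodule_scheme \<Rightarrow> ('c, 'r, 'n, 'z) bimodule_scheme
      \<Rightarrow> 'm \<Rightarrow> 'n \<Rightarrow> ('m \<times> 'n \<Rightarrow>\<^sub>0 int) set"
  where "pure_tensor R M N x y =
     tensor_kernel R M N #>\<^bsub>free_Abelian_group (carrier M \<times> carrier N)\<^esub> frag_of (x, y)"

text \<open>The additive map out of a tensor product induced by a balanced biadditive map \<open>f\<close>,
  evaluated on an arbitrary representative of the coset \<open>t\<close>; for balanced biadditive \<open>f\<close>
  the value does not depend on the representative.\<close>

definition tensor_lift ::
    "('g, 'z) ring_scheme \<Rightarrow> ('m \<Rightarrow> 'n \<Rightarrow> 'g) \<Rightarrow> ('m \<times> 'n \<Rightarrow>\<^sub>0 int) set \<Rightarrow> 'g"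
  where "tensor_lift G f t = (let c = (SOME c. c \<in> t) in
     (\<Oplus>\<^bsub>G\<^esub>p \<in> Poly_Mapping.keys c. add_pow G (Poly_Mapping.lookup c p) (f (fst p) (snd p))))"

definition tensor_ring ::
    "'c ring \<Rightarrow> ('l, 'c, 'm, 'y) bimodule_scheme \<Rightarrow> ('c, 'r, 'n, 'z) bimodule_scheme
      \<Rightarrow> ('m \<times> 'n \<Rightarrow>\<^sub>0 int) set ring"
  where "tensor_ring R M N =
    \<lparr>carrier = carrier (tensor_group R M N), monoid.mult = undefined, one = undefined,
     zero = one (tensor_group R M N), add = monoid.mult (tensor_group R M N)\<rparr>"

definition tensor ::
    "'c ring \<Rightarrow> ('l, 'c, 'm, 'y) bimodule_scheme \<Rightarrow> ('c, 'r, 'n, 'z) bimodule_scheme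
      \<Rightarrow> ('l, 'r, ('m \<times> 'n \<Rightarrow>\<^sub>0 int) set) bimodule"
  where "tensor R M N = ring.extend (tensor_ring R M N) (bimodule.fields
     (\<lambda>a. tensor_lift (tensor_ring R M N) (\<lambda>x y. pure_tensor R M N (lact M a x) y))
     (\<lambda>t b. tensor_lift (tensor_ring R M N) (\<lambda>x y. pure_tensor R M N x (ract N y b)) t))"

definition tensor_map ::
    "'c ring \<Rightarrow> ('l, 'c, 'm, 'y) bimodule_scheme \<Rightarrow> ('c, 'r, 'n, 'z) bimodule_scheme
      \<Rightarrow> ('m' \<Rightarrow> 'm) \<Rightarrow> ('n' \<Rightarrow> 'n) \<Rightarrow> ('m' \<times> 'n' \<Rightarrow>\<^sub>0 int) set \<Rightarrow> ('m \<times> 'n \<Rightarrow>\<^sub>0 int) set"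
  where "tensor_map R M N f g =
     tensor_lift (tensor R M N) (\<lambda>x y. pure_tensor R M N (f x) (g y))"


section \<open>Faithful flatness\<close>

definition exact_at ::
    "('x, 'u) ring_scheme \<Rightarrow> ('y, 'v) ring_scheme \<Rightarrow> ('z, 'w) ring_scheme
      \<Rightarrow> ('x \<Rightarrow> 'y) \<Rightarrow> ('y \<Rightarrow> 'z) \<Rightarrow> bool"
  where "exact_at M' M M'' f g \<longleftrightarrow> f ` carrier M' = a_kernel M M'' g"

text \<open>\<open>M\<close> is faithfully flat if a sequence of modules is exact if and only if the sequence obtained
  by tensoring it with \<open>M\<close> is.  As one cannot quantify over types, the test modules range over
  all modules whose carrier is a subset of the type \<open>'u\<close>.  This is faithful flatness in the
  usual sense as soon as \<open>'u\<close> is infinite and \<open>carrier R\<close> injects into it: then every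
  finitely generated module is isomorphic to a test module, flatness of \<open>M\<close> is detected by the
  inclusions of ideals into \<open>R\<close>, and a flat \<open>M\<close> is faithfully flat if no non-zero cyclic module
  is annihilated by tensoring with \<open>M\<close>.\<close>

definition faithfully_flat_left ::
    "'u itself \<Rightarrow> 'c ring \<Rightarrow> ('c, 'r, 'm, 'z) bimodule_scheme \<Rightarrow> bool"
  where "faithfully_flat_left U R M \<longleftrightarrow> left_module R M \<and>
     (\<forall>(N' :: (unit, 'c, 'u) bimodule) (N :: (unit, 'c, 'u) bimodule)
         (N'' :: (unit, 'c, 'u) bimodule) f g.
        right_module R N' \<and> right_module R N \<and> right_module R N'' \<and>
        f \<in> right_hom R N' N \<and> g \<in> right_hom R N N'' \<longrightarrow>
        (exact_at N' N N'' f g \<longleftrightarrow>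
         exact_at (tensor R N' M) (tensor R N M) (tensor R N'' M)
           (tensor_map R N M f id) (tensor_map R N'' M g id)))"

definition faithfully_flat_right ::
    "'u itself \<Rightarrow> 'c ring \<Rightarrow> ('l, 'c, 'm, 'z) bimodule_scheme \<Rightarrow> bool"
  where "faithfully_flat_right U R M \<longleftrightarrow> right_module R M \<and>
     (\<forall>(N' :: ('c, unit, 'u) bimodule) (N :: ('c, unit, 'u) bimodule)
         (N'' :: ('c, unit, 'u) bimodule) f g.
        left_module R N' \<and> left_module R N \<and> left_module R N'' \<and>
        f \<in> left_hom R N' N \<and> g \<in> left_hom R N N'' \<longrightarrow>
        (exact_at N' N N'' f g \<longleftrightarrow>
         exact_at (tensor R M N') (tensor R M N) (tensor R M N'')
           (tensor_map R M N id f) (tensor_map R M N'' id g)))"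


text \<open>A type to take the test modules from that meets the above conditions for \<open>R = B\<close>.  It is
  larger than necessary so that it also has room for sub-modules and quotients of \<open>B\<close>, \<open>\<Sigma>\<close>,
  \<open>\<Sigma>\<^sup>*\<close> and \<open>End(\<Sigma>\<^sub>A)\<close>, and for tensor products of any two of these.\<close>

type_synonym ('a, 'b, 'm) test_base = "'a + 'b + 'm + ('m \<Rightarrow> 'a) + ('m \<Rightarrow> 'm)"

type_synonym ('a, 'b, 'm) test_universe =
  "(('a, 'b, 'm) test_base \<times> ('a, 'b, 'm) test_base \<Rightarrow>\<^sub>0 int) set"


section \<open>Dual bimodules and separable bimodules\<close>

text \<open>Maps are taken extensional, so that each linear map is represented exactly once.\<close>

text \<open>\<open>\<Sigma>\<^sup>* = Hom(\<Sigma>\<^sub>A, A\<^sub>A)\<close>, an \<open>(A, B)\<close>-bimodule.\<close>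

definition right_dual ::
    "'a ring \<Rightarrow> ('b, 'a, 'm, 'z) bimodule_scheme \<Rightarrow> ('a, 'b, 'm \<Rightarrow> 'a) bimodule"
  where "right_dual A M =
    \<lparr>carrier = right_hom A M (regular_bimodule A) \<inter> extensional (carrier M),
     monoid.mult = undefined, one = undefined,
     zero = (\<lambda>x\<in>carrier M. \<zero>\<^bsub>A\<^esub>), add = (\<lambda>f g. \<lambda>x\<in>carrier M. f x \<oplus>\<^bsub>A\<^esub> g x),
     lact = (\<lambda>a f. \<lambda>x\<in>carrier M. a \<otimes>\<^bsub>A\<^esub> f x), ract = (\<lambda>f b. \<lambda>x\<in>carrier M. f (lact M b x))\<rparr>"

text \<open>\<open>\<^sup>*\<Sigma> = Hom(\<^sub>B\<Sigma>, \<^sub>BB)\<close>, again an \<open>(A, B)\<close>-bimodule.\<close>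

definition left_dual ::
    "'b ring \<Rightarrow> ('b, 'a, 'm, 'z) bimodule_scheme \<Rightarrow> ('a, 'b, 'm \<Rightarrow> 'b) bimodule"
  where "left_dual B M =
    \<lparr>carrier = left_hom B M (regular_bimodule B) \<inter> extensional (carrier M),
     monoid.mult = undefined, one = undefined,
     zero = (\<lambda>x\<in>carrier M. \<zero>\<^bsub>B\<^esub>), add = (\<lambda>f g. \<lambda>x\<in>carrier M. f x \<oplus>\<^bsub>B\<^esub> g x),
     lact = (\<lambda>a f. \<lambda>x\<in>carrier M. f (ract M x a)), ract = (\<lambda>f b. \<lambda>x\<in>carrier M. f x \<otimes>\<^bsub>B\<^esub> b)\<rparr>"

definition left_evaluation ::
    "'b ring \<Rightarrow> ('m \<times> ('m \<Rightarrow> 'b) \<Rightarrow>\<^sub>0 int) set \<Rightarrow> 'b"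
  where "left_evaluation B = tensor_lift B (\<lambda>x \<phi>. \<phi> x)"

definition separable_bimodule ::
    "'b ring \<Rightarrow> 'a ring \<Rightarrow> ('b, 'a, 'm, 'z) bimodule_scheme \<Rightarrow> bool"
  where "separable_bimodule B A M \<longleftrightarrow> bimodule B A M \<and>
     (let T = tensor A M (left_dual B M) in
       \<exists>\<sigma> \<in> left_hom B (regular_bimodule B) T \<inter> right_hom B (regular_bimodule B) T.
         \<forall>b\<in>carrier B. left_evaluation B (\<sigma> b) = b)"


section \<open>Corings and comatrix corings\<close>

record ('a, 'c) coring = "('a, 'a, 'c) bimodule" +
  comult :: "'c \<Rightarrow> ('c \<times> 'c \<Rightarrow>\<^sub>0 int) set"
  counit :: "'c \<Rightarrow> 'a"

definition tensor_assoc ::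
    "'a ring \<Rightarrow> ('a, 'a, 'c, 'z) bimodule_scheme
      \<Rightarrow> (('c \<times> 'c \<Rightarrow>\<^sub>0 int) set \<times> 'c \<Rightarrow>\<^sub>0 int) set \<Rightarrow> ('c \<times> ('c \<times> 'c \<Rightarrow>\<^sub>0 int) set \<Rightarrow>\<^sub>0 int) set"
  where "tensor_assoc A C =
    (let T = tensor A C (tensor A C C) in
     tensor_lift T (\<lambda>s z. tensor_lift T
       (\<lambda>x y. pure_tensor A C (tensor A C C) x (pure_tensor A C C y z)) s))"

locale coring = bimodule A A C
  for A :: "'a ring" and C :: "('a, 'c) coring" +
  assumes comult_hom: "comult C \<in> left_hom A C (tensor A C C) \<inter> right_hom A C (tensor A C C)"
    and counit_hom: "counit C \<in> left_hom A C (regular_bimodule A) \<inter> right_hom A C (regular_bimodule A)"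
    and coassoc: "x \<in> carrier C \<Longrightarrow>
          tensor_assoc A C (tensor_map A (tensor A C C) C (comult C) id (comult C x)) =
          tensor_map A C (tensor A C C) id (comult C) (comult C x)"
    and counit_left: "x \<in> carrier C \<Longrightarrow>
          tensor_lift C (\<lambda>y z. lact C (counit C y) z) (comult C x) = x"
    and counit_right: "x \<in> carrier C \<Longrightarrow>
          tensor_lift C (\<lambda>y z. ract C y (counit C z)) (comult C x) = x"

text \<open>The notion of a morphism, and hence the following group, only involves the data of
  a coring, not the axioms collected in \<^locale>\<open>coring\<close>.\<close>

definition coring_hom :: "'a ring \<Rightarrow> ('a, 'c) coring \<Rightarrow> ('a, 'd) coring \<Rightarrow> ('c \<Rightarrow> 'd) set" where
  "coring_hom A C D = {\<phi> \<in> left_hom A C D \<inter> right_hom A C D.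
     (\<forall>x\<in>carrier C. comult D (\<phi> x) = tensor_map A D D \<phi> \<phi> (comult C x)) \<and>
     (\<forall>x\<in>carrier C. counit D (\<phi> x) = counit C x)}"

definition coring_aut_group :: "'a ring \<Rightarrow> ('a, 'c) coring \<Rightarrow> ('c \<Rightarrow> 'c) monoid" where
  "coring_aut_group A C = BijGroup (carrier C) \<lparr>carrier := Bij (carrier C) \<inter> coring_hom A C C\<rparr>"

definition is_dual_basis ::
    "'a ring \<Rightarrow> ('b, 'a, 'm, 'z) bimodule_scheme \<Rightarrow> ('m \<times> ('m \<Rightarrow> 'a)) set \<Rightarrow> bool"
  where "is_dual_basis A M D \<longleftrightarrow> finite D \<and> D \<subseteq> carrier M \<times> carrier (right_dual A M) \<and>
     (\<forall>x\<in>carrier M. x = (\<Oplus>\<^bsub>M\<^esub>p\<in>D. ract M (fst p) (snd p x)))"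

text \<open>The comultiplication of the comatrix coring does not depend on the dual basis it is
  computed with, so an arbitrary one is selected.\<close>

definition dual_basis ::
    "'a ring \<Rightarrow> ('b, 'a, 'm, 'z) bimodule_scheme \<Rightarrow> ('m \<times> ('m \<Rightarrow> 'a)) set"
  where "dual_basis A M = (SOME D. is_dual_basis A M D)"

definition comatrix_bimodule ::
    "'a ring \<Rightarrow> 'b ring \<Rightarrow> ('b, 'a, 'm) bimodule
      \<Rightarrow> ('a, 'a, (('m \<Rightarrow> 'a) \<times> 'm \<Rightarrow>\<^sub>0 int) set) bimodule"
  where "comatrix_bimodule A B M = tensor B (right_dual A M) M"

definition comatrix_coring ::
    "'a ring \<Rightarrow> 'b ring \<Rightarrow> ('b, 'a, 'm) bimodule
      \<Rightarrow> ('a, (('m \<Rightarrow> 'a) \<times> 'm \<Rightarrow>\<^sub>0 int) set) coring"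
  where "comatrix_coring A B M =
    (let C = comatrix_bimodule A B M; pt = pure_tensor B (right_dual A M) M in
     bimodule.extend C (coring.fields
       (tensor_lift (tensor A C C) (\<lambda>f u.
          \<Oplus>\<^bsub>tensor A C C\<^esub>p\<in>dual_basis A M. pure_tensor A C C (pt f (fst p)) (pt (snd p) u)))
       (tensor_lift A (\<lambda>f u. f u))))"


section \<open>The endomorphism ring and its invertible sub-bimodules\<close>

definition canonical_map :: "('b, 'a, 'm, 'z) bimodule_scheme \<Rightarrow> 'b \<Rightarrow> 'm \<Rightarrow> 'm" where
  "canonical_map M b = (\<lambda>x\<in>carrier M. lact M b x)"

text \<open>\<open>S = End(\<Sigma>\<^sub>A)\<close>: here the multiplicative fields of the record are meaningful (composition),
  and the \<open>B\<close>-actions are multiplication by elements of \<open>B\<close> along the canonical map.\<close>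

definition end_ring ::
    "'a ring \<Rightarrow> ('b, 'a, 'm, 'z) bimodule_scheme \<Rightarrow> ('b, 'b, 'm \<Rightarrow> 'm) bimodule"
  where "end_ring A M =
    \<lparr>carrier = right_hom A M M \<inter> extensional (carrier M),
     monoid.mult = compose (carrier M), one = (\<lambda>x\<in>carrier M. x),
     zero = (\<lambda>x\<in>carrier M. \<zero>\<^bsub>M\<^esub>), add = (\<lambda>f g. \<lambda>x\<in>carrier M. f x \<oplus>\<^bsub>M\<^esub> g x),
     lact = (\<lambda>b s. compose (carrier M) (canonical_map M b) s),
     ract = (\<lambda>s b. compose (carrier M) s (canonical_map M b))\<rparr>"

definition sub_bimodule ::
    "'l ring \<Rightarrow> 'r ring \<Rightarrow> ('l, 'r, 'm, 'z) bimodule_scheme \<Rightarrow> 'm set \<Rightarrow> bool"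
  where "sub_bimodule L R M I \<longleftrightarrow> additive_subgroup I M \<and>
     (\<forall>a\<in>carrier L. \<forall>x\<in>I. lact M a x \<in> I) \<and> (\<forall>x\<in>I. \<forall>b\<in>carrier R. ract M x b \<in> I)"

text \<open>The library's \<^const>\<open>ideal_prod\<close> makes sense for arbitrary subsets: it is the set of
  (non-empty) finite sums of products.  The unit is the image of \<open>B\<close> in \<open>S\<close>.\<close>

definition sub_bimodule_monoid ::
    "'a ring \<Rightarrow> 'b ring \<Rightarrow> ('b, 'a, 'm, 'z) bimodule_scheme \<Rightarrow> ('m \<Rightarrow> 'm) set monoid"
  where "sub_bimodule_monoid A B M =
    \<lparr>carrier = {I. sub_bimodule B B (end_ring A M) I},
     monoid.mult = ideal_prod (end_ring A M),
     one = canonical_map M ` carrier B\<rparr>"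

definition invertible_sub_bimodules ::
    "'a ring \<Rightarrow> 'b ring \<Rightarrow> ('b, 'a, 'm, 'z) bimodule_scheme \<Rightarrow> ('m \<Rightarrow> 'm) set monoid"
  where "invertible_sub_bimodules A B M = units_of (sub_bimodule_monoid A B M)"

end

theory Submission
  imports Defs
begin

text \<open>Write \<open>S = End(\<Sigma>\<^sub>A)\<close> and \<open>C = \<Sigma>\<^sup>* \<otimes>\<^sub>B \<Sigma>\<close>.  The inverse of \<open>\<Gamma>\<close> sends a coring automorphism \<open>\<phi>\<close> to
  \<open>J(\<phi>) = {s \<in> S. \<phi>(fs \<otimes> u) = f \<otimes> su}\<close>.  Always \<open>J(\<phi>)J(\<psi>) \<subseteq> J(\<phi>\<psi>)\<close>, and an invertible \<open>I\<close> with
  \<open>\<Sum>xy = 1\<close>, \<open>x \<in> I\<inverse>\<close>, \<open>y \<in> I\<close>, is \<open>J(\<phi>)\<close> for \<open>\<phi>(f \<otimes> u) = \<Sum>fx \<otimes> yu\<close>.  So everything reduces to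
  \<open>J(id) = B\<close> and \<open>1 \<in> J(\<phi>)J(\<phi>\<inverse>)\<close>, which is where the hypotheses enter.  Every \<open>A\<close>-bilinear \<open>\<phi>\<close> is
  \<open>f \<otimes> u \<mapsto> \<Sum>fx\<^sub>k \<otimes> y\<^sub>ku\<close> for some \<open>x\<^sub>k, y\<^sub>k \<in> S\<close>, and for a coring map \<open>\<Sum>x\<^sub>ky\<^sub>k = 1\<close> and
  \<open>\<Sum>x\<^sub>k \<otimes> 1 \<otimes> y\<^sub>k = \<Sum>x\<^sub>k \<otimes> y\<^sub>kx\<^sub>l \<otimes> y\<^sub>l\<close>.  If \<open>\<Sigma>\<close> is faithfully flat, this puts \<open>\<Sum>x\<^sub>k \<otimes> y\<^sub>ku\<close> into the
  kernel of \<open>s \<mapsto> \<Sum>x\<^sub>k \<otimes> y\<^sub>ks - s \<otimes> 1\<close> tensored with \<open>\<Sigma>\<close>, hence \<open>J(\<phi>\<inverse>)\<Sigma> = \<Sigma>\<close>;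
  then the ideal \<open>J(\<phi>)J(\<phi>\<inverse>)\<close> of \<open>B\<close> fixes \<open>\<Sigma>\<close> and so is \<open>B\<close>.  If \<open>\<Sigma>\<close> is
  separable, there is a bimodule retraction \<open>E : S \<rightarrow> B\<close>, and \<open>s \<mapsto> \<Sum>x\<^sub>kE(y\<^sub>ks)\<close> projects \<open>S\<close> onto
  \<open>J(\<phi>\<inverse>)\<close>.  The case of \<open>\<Sigma>\<^sup>*\<close> is the first one over opposite rings.\<close>

section \<open>Finite sums indexed by lists\<close>

text \<open>The inclusion J(\<phi>)J(\<psi>) \<subseteq> J(\<phi>\<psi>) only moves factors: \<psi>
  takes t across in f s t \<otimes> u, then \<phi> takes s across. Equality, which makes J a
  homomorphism, is forced by J(\<psi>\<inverse>)J(\<psi>) = B. Identities on C come with a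
  functional f in front. The rank-one maps e_i e_i^* of a dual basis add up to 1 in S, so taking f =
  e_i^*, multiplying by e_i and summing removes it; in this way statements about C reach S \<otimes>
  \<Sigma> and S \<otimes> S \<otimes> \<Sigma>. For t in J(id) the result is t \<otimes> u = 1
  \<otimes> tu, and over a faithfully flat \<Sigma> the module of such t agrees with B after
  tensoring, hence equals B. Faithful flatness speaks of test modules inside one fixed type, where
  neither S nor S \<otimes> S is found. It is therefore used in two forms, one for kernels and one
  for generation, that accept any module with an injection into the test type and describe tensors
  by lists of pairs.\<close>

definition lsum :: "('g, 'z) ring_scheme \<Rightarrow> ('i \<Rightarrow> 'g) \<Rightarrow> 'i list \<Rightarrow> 'g" where
  "lsum G f xs = foldr (\<lambda>i s. f i \<oplus>\<^bsub>G\<^esub> s) xs \<zero>\<^bsub>G\<^esub>"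

text \<open>Both equations hold without any membership in the carrier, unlike those of
  \<open>finsum\<close>, and a list may repeat an entry; sums of pure tensors call for exactly such
  a notation.\<close>

lemma lsum_Nil [simp]: "lsum G f [] = \<zero>\<^bsub>G\<^esub>"
  and lsum_Cons [simp]: "lsum G f (x # xs) = f x \<oplus>\<^bsub>G\<^esub> lsum G f xs"
  by (simp_all add: lsum_def)

lemma lsum_map: "lsum G f (map h xs) = lsum G (\<lambda>i. f (h i)) xs"
  by (induction xs) simp_all

lemma lsum_cong: "(\<And>i. i \<in> set xs \<Longrightarrow> f i = g i) \<Longrightarrow> lsum G f xs = lsum G g xs"
  by (induction xs) simp_all

context abelian_group
begin

lemma add_minus_minus: "x \<in> carrier G \<Longrightarrow> y \<in> carrier G \<Longrightarrow> x \<oplus> y \<ominus> x \<ominus> y = \<zero>"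
  by (simp add: a_minus_def a_comm[of "x \<oplus> y"] r_neg1 r_neg)

lemma lsum_closed: "(\<And>i. i \<in> set xs \<Longrightarrow> f i \<in> carrier G) \<Longrightarrow> lsum G f xs \<in> carrier G"
  by (induction xs) simp_all

lemma lsum_append:
  assumes "\<And>i. i \<in> set xs \<Longrightarrow> f i \<in> carrier G" and "\<And>i. i \<in> set ys \<Longrightarrow> f i \<in> carrier G"
  shows "lsum G f (xs @ ys) = lsum G f xs \<oplus> lsum G f ys"
  using assms by (induction xs) (simp_all add: lsum_closed a_assoc)

lemma lsum_add:
  assumes "\<And>i. i \<in> set xs \<Longrightarrow> f i \<in> carrier G" and "\<And>i. i \<in> set xs \<Longrightarrow> g i \<in> carrier G"
  shows "lsum G (\<lambda>i. f i \<oplus> g i) xs = lsum G f xs \<oplus> lsum G g xs"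
  using assms by (induction xs) (simp_all add: lsum_closed a_ac)

lemma lsum_zero: "(\<And>i. i \<in> set xs \<Longrightarrow> f i = \<zero>) \<Longrightarrow> lsum G f xs = \<zero>"
  by (induction xs) simp_all

lemma lsum_commute:
  assumes "\<And>i j. i \<in> set xs \<Longrightarrow> j \<in> set ys \<Longrightarrow> f i j \<in> carrier G"
  shows "lsum G (\<lambda>i. lsum G (\<lambda>j. f i j) ys) xs = lsum G (\<lambda>j. lsum G (\<lambda>i. f i j) xs) ys"
  using assms by (induction xs) (simp_all add: lsum_closed lsum_zero flip: lsum_add)

lemma lsum_product:
  assumes "\<And>i j. i \<in> set xs \<Longrightarrow> j \<in> set ys \<Longrightarrow> f i j \<in> carrier G"
  shows "lsum G (\<lambda>p. f (fst p) (snd p)) (List.product xs ys) = lsum G (\<lambda>i. lsum G (\<lambda>j. f i j) ys) xs"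
  using assms
proof (induction xs)
  case (Cons a xs)
  have "lsum G (\<lambda>p. f (fst p) (snd p)) (map (Pair a) ys) = lsum G (f a) ys"
    by (simp add: lsum_map)
  moreover have "lsum G (\<lambda>p. f (fst p) (snd p)) (map (Pair a) ys @ List.product xs ys) =
      lsum G (\<lambda>p. f (fst p) (snd p)) (map (Pair a) ys) \<oplus> lsum G (\<lambda>p. f (fst p) (snd p)) (List.product xs ys)"
    using Cons.prems by (intro lsum_append) auto
  ultimately show ?case
    using Cons by simp
qed simp

lemma finsum_eq_lsum:
  assumes "distinct xs" and "\<And>i. i \<in> set xs \<Longrightarrow> f i \<in> carrier G"
  shows "(\<Oplus>i\<in>set xs. f i) = lsum G f xs"
  using assms by (induction xs) (auto simp: Pi_def)

end

lemma pairs_fst: "set xs \<subseteq> X \<times> Y \<Longrightarrow> p \<in> set xs \<Longrightarrow> fst p \<in> X"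
  and pairs_snd: "set xs \<subseteq> X \<times> Y \<Longrightarrow> p \<in> set xs \<Longrightarrow> snd p \<in> Y"
  by auto

section \<open>Additive maps and their values on finite sums\<close>

abbreviation add_hom :: "('g, 'y) ring_scheme \<Rightarrow> ('h, 'z) ring_scheme \<Rightarrow> ('g \<Rightarrow> 'h) set" where
  "add_hom G H \<equiv> hom (add_monoid G) (add_monoid H)"

lemma add_homI:
  assumes "\<And>x. x \<in> carrier G \<Longrightarrow> f x \<in> carrier H"
    and "\<And>x y. x \<in> carrier G \<Longrightarrow> y \<in> carrier G \<Longrightarrow> f (x \<oplus>\<^bsub>G\<^esub> y) = f x \<oplus>\<^bsub>H\<^esub> f y"
  shows "f \<in> add_hom G H"
  using assms by (simp add: hom_def)

lemma add_hom_closed: "f \<in> add_hom G H \<Longrightarrow> x \<in> carrier G \<Longrightarrow> f x \<in> carrier H"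
  by (auto simp: hom_def)

lemma add_hom_add:
  "f \<in> add_hom G H \<Longrightarrow> x \<in> carrier G \<Longrightarrow> y \<in> carrier G \<Longrightarrow> f (x \<oplus>\<^bsub>G\<^esub> y) = f x \<oplus>\<^bsub>H\<^esub> f y"
  by (auto simp: hom_def)

lemma add_hom_zero:
  assumes "abelian_group G" and "abelian_group H" and "f \<in> add_hom G H"
  shows "f \<zero>\<^bsub>G\<^esub> = \<zero>\<^bsub>H\<^esub>"
  using hom_one[OF assms(3)] assms(1,2)[THEN abelian_group.a_group] by simp

lemma add_hom_a_inv:
  assumes "abelian_group G" and "abelian_group H" and "f \<in> add_hom G H" and "x \<in> carrier G"
  shows "f (\<ominus>\<^bsub>G\<^esub> x) = \<ominus>\<^bsub>H\<^esub> f x"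
proof -
  interpret group_hom "add_monoid G" "add_monoid H" f
    using assms(1,2)[THEN abelian_group.a_group] assms(3)
    by (simp add: group_hom_def group_hom_axioms_def)
  show ?thesis
    using assms(4) hom_inv by (simp add: a_inv_def)
qed

lemma add_hom_lsum:
  assumes "abelian_group G" and "abelian_group H" and "f \<in> add_hom G H"
    and "\<And>i. i \<in> set xs \<Longrightarrow> h i \<in> carrier G"
  shows "f (lsum G h xs) = lsum H (\<lambda>i. f (h i)) xs"
  using assms(4)
proof (induction xs)
  case Nil
  show ?case
    using add_hom_zero[OF assms(1-3)] by simp
next
  case (Cons x xs)
  then show ?case
    using add_hom_add[OF assms(3)] abelian_group.lsum_closed[OF assms(1), of xs h] by simp
qed

lemma add_hom_compose:
  "f \<in> add_hom G H \<Longrightarrow> g \<in> add_hom H J \<Longrightarrow> (\<lambda>x. g (f x)) \<in> add_hom G J"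
  by (auto simp: hom_def Pi_def)

lemma add_hom_id: "(\<lambda>x. x) \<in> add_hom G G"
  by (simp add: hom_def)

lemma add_hom_plus:
  assumes "abelian_group H" and "f \<in> add_hom G H" and "g \<in> add_hom G H"
  shows "(\<lambda>x. f x \<oplus>\<^bsub>H\<^esub> g x) \<in> add_hom G H"
proof (rule add_homI)
  interpret abelian_group H by fact
  show "f x \<oplus>\<^bsub>H\<^esub> g x \<in> carrier H" if "x \<in> carrier G" for x
    using that assms(2,3) by (simp add: add_hom_closed)
  show "f (x \<oplus>\<^bsub>G\<^esub> y) \<oplus>\<^bsub>H\<^esub> g (x \<oplus>\<^bsub>G\<^esub> y) = (f x \<oplus>\<^bsub>H\<^esub> g x) \<oplus>\<^bsub>H\<^esub> (f y \<oplus>\<^bsub>H\<^esub> g y)"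
    if "x \<in> carrier G" "y \<in> carrier G" for x y
    using that assms(2,3) by (simp add: add_hom_closed add_hom_add a_ac)
qed

lemma add_hom_lsum_fun:
  assumes "abelian_group H" and "\<And>i. i \<in> set xs \<Longrightarrow> f i \<in> add_hom G H"
  shows "(\<lambda>x. lsum H (\<lambda>i. f i x) xs) \<in> add_hom G H"
proof (rule add_homI)
  interpret abelian_group H by fact
  show "lsum H (\<lambda>i. f i x) xs \<in> carrier H" if "x \<in> carrier G" for x
    using that by (intro lsum_closed add_hom_closed[OF assms(2)])
  show "lsum H (\<lambda>i. f i (x \<oplus>\<^bsub>G\<^esub> y)) xs = lsum H (\<lambda>i. f i x) xs \<oplus>\<^bsub>H\<^esub> lsum H (\<lambda>i. f i y) xs"
    if "x \<in> carrier G" "y \<in> carrier G" for x y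
  proof -
    have "lsum H (\<lambda>i. f i (x \<oplus>\<^bsub>G\<^esub> y)) xs = lsum H (\<lambda>i. f i x \<oplus>\<^bsub>H\<^esub> f i y) xs"
      using that assms(2) by (intro lsum_cong) (simp add: add_hom_add)
    also have "\<dots> = lsum H (\<lambda>i. f i x) xs \<oplus>\<^bsub>H\<^esub> lsum H (\<lambda>i. f i y) xs"
      using that assms(2) by (intro lsum_add) (blast intro: add_hom_closed)+
    finally show ?thesis .
  qed
qed

text \<open>Made for \<open>J\<close>, whose defining condition says for each f and u that two
  additive maps in s take the same value.\<close>

lemma equalizer_subgroup:
  assumes "abelian_group G" and "abelian_group H"
    and "\<And>i. i \<in> I \<Longrightarrow> F i \<in> add_hom G H" and "\<And>i. i \<in> I \<Longrightarrow> F' i \<in> add_hom G H"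
  shows "additive_subgroup {s \<in> carrier G. \<forall>i\<in>I. F i s = F' i s} G"
proof -
  interpret G: abelian_group G by fact
  show ?thesis
  proof (intro additive_subgroup.intro group.subgroupI[OF G.a_group])
    have "\<zero>\<^bsub>G\<^esub> \<in> {s \<in> carrier G. \<forall>i\<in>I. F i s = F' i s}"
      using add_hom_zero[OF assms(1,2) assms(3)] add_hom_zero[OF assms(1,2) assms(4)] by simp
    then show "{s \<in> carrier G. \<forall>i\<in>I. F i s = F' i s} \<noteq> {}" by blast
  qed (auto simp: add_hom_add[OF assms(3)] add_hom_add[OF assms(4)] add_hom_a_inv[OF assms(1-3)]
      add_hom_a_inv[OF assms(1,2,4)] simp flip: a_inv_def)
qed

lemma subgroup_lsum:
  assumes "additive_subgroup I G" and "\<And>i. i \<in> set xs \<Longrightarrow> f i \<in> I"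
  shows "lsum G f xs \<in> I"
  using assms(2)
  by (induction xs) (simp_all add: additive_subgroup.zero_closed[OF assms(1)]
      subgroup.m_closed[OF additive_subgroup.a_subgroup[OF assms(1)], simplified])

lemma lsum_concat_map:
  assumes "abelian_group G" and "\<And>i j. i \<in> set L \<Longrightarrow> j \<in> set (F i) \<Longrightarrow> f j \<in> carrier G"
  shows "lsum G f (concat (map F L)) = lsum G (\<lambda>i. lsum G f (F i)) L"
  using assms(2)
proof (induction L)
  case (Cons a L)
  have "lsum G f (F a @ concat (map F L)) = lsum G f (F a) \<oplus>\<^bsub>G\<^esub> lsum G f (concat (map F L))"
    using Cons.prems by (intro abelian_group.lsum_append[OF assms(1)]) auto
  moreover have "lsum G f (concat (map F L)) = lsum G (\<lambda>i. lsum G f (F i)) L"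
    by (rule Cons.IH) (use Cons.prems in auto)
  ultimately show ?case
    by simp
qed simp

lemma (in abelian_group) minus_zeroD:
  "x \<ominus> y = \<zero> \<Longrightarrow> x \<in> carrier G \<Longrightarrow> y \<in> carrier G \<Longrightarrow> x = y"
  using minus_equality[of x "\<ominus> y"] by (simp add: a_minus_def)

lemma lsum_diff:
  assumes "abelian_group G" and "\<And>i. i \<in> set xs \<Longrightarrow> f i \<in> carrier G" and "\<And>i. i \<in> set xs \<Longrightarrow> g i \<in> carrier G"
  shows "lsum G (\<lambda>i. f i \<ominus>\<^bsub>G\<^esub> g i) xs = lsum G f xs \<ominus>\<^bsub>G\<^esub> lsum G g xs"
proof -
  interpret abelian_group G by fact
  have "(\<lambda>x. \<ominus>\<^bsub>G\<^esub> x) \<in> add_hom G G"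
    by (rule add_homI) (simp_all add: minus_add)
  then have "\<ominus>\<^bsub>G\<^esub> lsum G g xs = lsum G (\<lambda>i. \<ominus>\<^bsub>G\<^esub> g i) xs"
    using assms(3) by (rule add_hom_lsum[OF assms(1,1)])
  moreover have "lsum G (\<lambda>i. f i \<oplus>\<^bsub>G\<^esub> \<ominus>\<^bsub>G\<^esub> g i) xs = lsum G f xs \<oplus>\<^bsub>G\<^esub> lsum G (\<lambda>i. \<ominus>\<^bsub>G\<^esub> g i) xs"
    using assms(2,3) by (intro lsum_add) auto
  ultimately show ?thesis
    by (simp add: a_minus_def)
qed

text \<open>The lists found for the single terms are concatenated. In effect additive spans absorb
  sums, so that elements of I\<Sigma> can be handled without introducing that submodule.\<close>

lemma lsum_list_choice:
  assumes "abelian_group G" and "\<And>w. w \<in> W \<Longrightarrow> h w \<in> carrier G"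
    and "\<And>i. i \<in> set xs \<Longrightarrow> \<exists>ws. set ws \<subseteq> W \<and> g i = lsum G h ws"
  shows "\<exists>ws. set ws \<subseteq> W \<and> lsum G g xs = lsum G h ws"
  using assms(3)
proof (induction xs)
  case Nil
  show ?case by (rule exI[of _ "[]"]) simp
next
  case (Cons x xs)
  obtain vs where vs: "set vs \<subseteq> W" "g x = lsum G h vs"
    using Cons.prems[of x] by auto
  obtain ws where ws: "set ws \<subseteq> W" "lsum G g xs = lsum G h ws"
    using Cons by auto
  have "lsum G h (vs @ ws) = lsum G h vs \<oplus>\<^bsub>G\<^esub> lsum G h ws"
    using vs(1) ws(1) assms(2) by (intro abelian_group.lsum_append[OF assms(1)]) auto
  then show ?case
    using vs ws by (intro exI[of _ "vs @ ws"]) simp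
qed

section \<open>Balanced maps and tensor products\<close>

text \<open>Additivity is stated for the partial applications, so that \<open>add_hom_lsum\<close>
  pulls sums out of either argument directly.\<close>

definition balanced ::
    "'c ring \<Rightarrow> ('l, 'c, 'm, 'y) bimodule_scheme \<Rightarrow> ('c, 'r, 'n, 'z) bimodule_scheme
      \<Rightarrow> ('g, 'w) ring_scheme \<Rightarrow> ('m \<Rightarrow> 'n \<Rightarrow> 'g) \<Rightarrow> bool"
  where "balanced R M N G \<beta> \<longleftrightarrow>
     (\<forall>x\<in>carrier M. \<beta> x \<in> add_hom N G) \<and>
     (\<forall>y\<in>carrier N. (\<lambda>x. \<beta> x y) \<in> add_hom M G) \<and>
     (\<forall>x\<in>carrier M. \<forall>a\<in>carrier R. \<forall>y\<in>carrier N. \<beta> (ract M x a) y = \<beta> x (lact N a y))"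

lemma balancedI:
  assumes "\<And>x y. x \<in> carrier M \<Longrightarrow> y \<in> carrier N \<Longrightarrow> \<beta> x y \<in> carrier G"
    and "\<And>x x' y. x \<in> carrier M \<Longrightarrow> x' \<in> carrier M \<Longrightarrow> y \<in> carrier N \<Longrightarrow>
           \<beta> (x \<oplus>\<^bsub>M\<^esub> x') y = \<beta> x y \<oplus>\<^bsub>G\<^esub> \<beta> x' y"
    and "\<And>x y y'. x \<in> carrier M \<Longrightarrow> y \<in> carrier N \<Longrightarrow> y' \<in> carrier N \<Longrightarrow>
           \<beta> x (y \<oplus>\<^bsub>N\<^esub> y') = \<beta> x y \<oplus>\<^bsub>G\<^esub> \<beta> x y'"
    and "\<And>x a y. x \<in> carrier M \<Longrightarrow> a \<in> carrier R \<Longrightarrow> y \<in> carrier N \<Longrightarrow>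
           \<beta> (ract M x a) y = \<beta> x (lact N a y)"
  shows "balanced R M N G \<beta>"
  using assms by (auto simp: balanced_def intro!: add_homI)

lemma balancedD:
  assumes "balanced R M N G \<beta>"
  shows "\<And>x. x \<in> carrier M \<Longrightarrow> \<beta> x \<in> add_hom N G"
    and "\<And>y. y \<in> carrier N \<Longrightarrow> (\<lambda>x. \<beta> x y) \<in> add_hom M G"
    and "\<And>x a y. x \<in> carrier M \<Longrightarrow> a \<in> carrier R \<Longrightarrow> y \<in> carrier N \<Longrightarrow>
           \<beta> (ract M x a) y = \<beta> x (lact N a y)"
    and "\<And>x y. x \<in> carrier M \<Longrightarrow> y \<in> carrier N \<Longrightarrow> \<beta> x y \<in> carrier G"
  using assms by (auto simp: balanced_def hom_def Pi_def)

lemma tensor_carrier: "carrier (tensor R M N) = carrier (tensor_group R M N)"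
  and tensor_add: "add (tensor R M N) = monoid.mult (tensor_group R M N)"
  and tensor_zero: "zero (tensor R M N) = one (tensor_group R M N)"
  and tensor_lact: "lact (tensor R M N) =
        (\<lambda>a. tensor_lift (tensor_ring R M N) (\<lambda>x y. pure_tensor R M N (lact M a x) y))"
  and tensor_ract: "ract (tensor R M N) =
        (\<lambda>t b. tensor_lift (tensor_ring R M N) (\<lambda>x y. pure_tensor R M N x (ract N y b)) t)"
  by (simp_all add: tensor_def ring.defs bimodule.defs tensor_ring_def)

text \<open>The actions of a tensor product are lifts into \<open>tensor_ring\<close>, the group
  before it has actions. The two records have different types but the same carrier, addition and
  zero, and nothing else enters a lift; hence the unfolding down to \<open>finprod\<close> and
  powers.\<close>

lemma tensor_lift_tensor_ring: "tensor_lift (tensor_ring R M N) = tensor_lift (tensor R M N)"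
  by (intro ext) (simp add: tensor_lift_def finsum_def finprod_def add_pow_def int_pow_def nat_pow_def
      m_inv_def tensor_carrier tensor_add tensor_zero tensor_ring_def cong: if_cong)

locale tensor_product = M: right_module R M + N: left_module R N
  for R :: "'c ring" and M :: "('l, 'c, 'm, 'y) bimodule_scheme"
    and N :: "('c, 'r, 'n, 'z) bimodule_scheme"
begin

abbreviation "F \<equiv> free_Abelian_group (carrier M \<times> carrier N)"
abbreviation "Ker \<equiv> tensor_kernel R M N"
abbreviation "T \<equiv> tensor R M N"
abbreviation "pt \<equiv> pure_tensor R M N"

lemma F_group: "comm_group F" "group F"
  using abelian_free_Abelian_group comm_group.axioms(2) by blast+

lemma rels_subset: "tensor_rels R M N \<subseteq> carrier F"
proof -
  have sub: "a - b \<in> carrier F" if "a \<in> carrier F" "b \<in> carrier F" for a b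
    using that keys_diff[of a b] by auto
  have "frag_of (x, y) \<in> carrier F" if "x \<in> carrier M" "y \<in> carrier N" for x y
    using that by simp
  then show ?thesis
    unfolding tensor_rels_def by (auto simp del: carrier_free_Abelian_group_iff
        intro!: sub simp: M.ract_closed N.lact_closed)
qed

lemma Ker_subgroup: "subgroup Ker F"
  unfolding tensor_kernel_def using F_group(2) rels_subset by (rule group.generate_is_subgroup)

lemma Ker_normal: "Ker \<lhd> F"
  using comm_group.subgroup_imp_normal[OF F_group(1) Ker_subgroup] .

lemma coset_hom: "(\<lambda>a. Ker #>\<^bsub>F\<^esub> a) \<in> hom F (tensor_group R M N)"
  unfolding tensor_group_def by (rule normal.r_coset_hom_Mod[OF Ker_normal])

lemma coset_eqI:
  assumes "a \<in> carrier F" and "b \<in> carrier F" and "a - b \<in> Ker"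
  shows "Ker #>\<^bsub>F\<^esub> a = Ker #>\<^bsub>F\<^esub> b"
proof -
  have "a \<in> Ker #>\<^bsub>F\<^esub> b"
    using subgroup.rcos_module_rev[OF Ker_subgroup F_group(2) assms(2,1)] assms by simp
  then show ?thesis
    using group.repr_independence[OF F_group(2) _ assms(2) Ker_subgroup] by auto
qed

lemma rels_in_Ker: "r \<in> tensor_rels R M N \<Longrightarrow> r \<in> Ker"
  unfolding tensor_kernel_def by (rule generate.incl)

lemma abelian_group_tensor: "abelian_group T"
proof (rule comm_group_abelian_groupI)
  interpret G: comm_group "tensor_group R M N"
    unfolding tensor_group_def by (rule comm_group.abelian_FactGroup[OF F_group(1) Ker_subgroup])
  show "comm_group (add_monoid T)"
  proof (rule comm_groupI)
    fix x assume "x \<in> carrier (add_monoid T)"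
    then show "\<exists>y\<in>carrier (add_monoid T). y \<otimes>\<^bsub>add_monoid T\<^esub> x = \<one>\<^bsub>add_monoid T\<^esub>"
      by (auto simp: tensor_carrier tensor_add tensor_zero intro!: bexI[of _ "inv\<^bsub>tensor_group R M N\<^esub> x"])
  qed (auto simp: tensor_carrier tensor_add tensor_zero G.m_ac)
qed

sublocale T: abelian_group T by (rule abelian_group_tensor)

lemma coset_add:
  "a \<in> carrier F \<Longrightarrow> b \<in> carrier F \<Longrightarrow> Ker #>\<^bsub>F\<^esub> (a + b) = (Ker #>\<^bsub>F\<^esub> a) \<oplus>\<^bsub>T\<^esub> (Ker #>\<^bsub>F\<^esub> b)"
  using hom_mult[OF coset_hom, of a b] by (simp add: tensor_add)

lemma pure_closed: "x \<in> carrier M \<Longrightarrow> y \<in> carrier N \<Longrightarrow> pt x y \<in> carrier T"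
  using hom_in_carrier[OF coset_hom, of "frag_of (x, y)"] by (simp add: tensor_carrier pure_tensor_def)

lemma F_sum: "a \<in> carrier F \<Longrightarrow> b \<in> carrier F \<Longrightarrow> a + b \<in> carrier F"
  using monoid.m_closed[OF group.is_monoid[OF F_group(2)], of a b] by simp

lemma pure_add_left:
  assumes "x \<in> carrier M" "x' \<in> carrier M" "y \<in> carrier N"
  shows "pt (x \<oplus>\<^bsub>M\<^esub> x') y = pt x y \<oplus>\<^bsub>T\<^esub> pt x' y"
proof -
  have "frag_of (x \<oplus>\<^bsub>M\<^esub> x', y) - (frag_of (x, y) + frag_of (x', y)) \<in> Ker"
    by (rule rels_in_Ker) (use assms in \<open>fastforce simp: tensor_rels_def diff_diff_add\<close>)
  moreover have "frag_of (x \<oplus>\<^bsub>M\<^esub> x', y) \<in> carrier F" "frag_of (x, y) \<in> carrier F" "frag_of (x', y) \<in> carrier F"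
    using assms by simp_all
  ultimately show ?thesis
    unfolding pure_tensor_def by (metis coset_eqI F_sum coset_add)
qed

lemma pure_add_right:
  assumes "x \<in> carrier M" "y \<in> carrier N" "y' \<in> carrier N"
  shows "pt x (y \<oplus>\<^bsub>N\<^esub> y') = pt x y \<oplus>\<^bsub>T\<^esub> pt x y'"
proof -
  have "frag_of (x, y \<oplus>\<^bsub>N\<^esub> y') - (frag_of (x, y) + frag_of (x, y')) \<in> Ker"
    by (rule rels_in_Ker) (use assms in \<open>fastforce simp: tensor_rels_def diff_diff_add\<close>)
  moreover have "frag_of (x, y \<oplus>\<^bsub>N\<^esub> y') \<in> carrier F" "frag_of (x, y) \<in> carrier F" "frag_of (x, y') \<in> carrier F"
    using assms by simp_all
  ultimately show ?thesis
    unfolding pure_tensor_def by (metis coset_eqI F_sum coset_add)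
qed

lemma pure_balanced:
  assumes "x \<in> carrier M" "a \<in> carrier R" "y \<in> carrier N"
  shows "pt (ract M x a) y = pt x (lact N a y)"
proof -
  have "frag_of (ract M x a, y) - frag_of (x, lact N a y) \<in> Ker"
    by (rule rels_in_Ker) (use assms in \<open>fastforce simp: tensor_rels_def\<close>)
  then show ?thesis
    unfolding pure_tensor_def
    using assms by (intro coset_eqI) (auto simp: M.ract_closed N.lact_closed)
qed

lemma balanced_pure: "balanced R M N T pt"
  by (intro balancedI pure_closed pure_add_left pure_add_right pure_balanced)

lemma tensor_coset: "t \<in> carrier T \<Longrightarrow> \<exists>c\<in>carrier F. t = Ker #>\<^bsub>F\<^esub> c"
  unfolding tensor_carrier tensor_group_def carrier_FactGroup by auto

text \<open>The step is a difference, as in the induction rule for free Abelian groups from which it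
  comes; this takes care of negatives.\<close>

lemma tensor_induct [consumes 1, case_names zero pure diff]:
  assumes "t \<in> carrier T" and "P \<zero>\<^bsub>T\<^esub>"
    and "\<And>x y. x \<in> carrier M \<Longrightarrow> y \<in> carrier N \<Longrightarrow> P (pt x y)"
    and "\<And>s t. s \<in> carrier T \<Longrightarrow> t \<in> carrier T \<Longrightarrow> P s \<Longrightarrow> P t \<Longrightarrow> P (s \<ominus>\<^bsub>T\<^esub> t)"
  shows "P t"
proof -
  obtain c where c: "c \<in> carrier F" "t = Ker #>\<^bsub>F\<^esub> c"
    using tensor_coset[OF assms(1)] by auto
  have closed: "Ker #>\<^bsub>F\<^esub> a \<in> carrier T" if "a \<in> carrier F" for a
    using hom_in_carrier[OF coset_hom that] by (simp add: tensor_carrier)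
  have "P (Ker #>\<^bsub>F\<^esub> c)"
  proof (rule free_Abelian_group_induct[where P = "\<lambda>c. P (Ker #>\<^bsub>F\<^esub> c)"])
    show "Poly_Mapping.keys c \<subseteq> carrier M \<times> carrier N"
      using c(1) by simp
    have "Ker #>\<^bsub>F\<^esub> 0 = Ker"
      using group.coset_mult_one[OF F_group(2) subgroup.subset[OF Ker_subgroup]] by simp
    then show "P (Ker #>\<^bsub>F\<^esub> 0)"
      using assms(2) by (simp add: tensor_zero tensor_group_def)
  next
    fix a b
    assume ab: "Poly_Mapping.keys a \<subseteq> carrier M \<times> carrier N" "Poly_Mapping.keys b \<subseteq> carrier M \<times> carrier N"
      and P: "P (Ker #>\<^bsub>F\<^esub> a)" "P (Ker #>\<^bsub>F\<^esub> b)"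
    have d: "a - b \<in> carrier F"
      using ab keys_diff[of a b] by auto
    have "Ker #>\<^bsub>F\<^esub> a = (Ker #>\<^bsub>F\<^esub> (a - b)) \<oplus>\<^bsub>T\<^esub> (Ker #>\<^bsub>F\<^esub> b)"
      using coset_add[OF d, of b] ab by simp
    then have "Ker #>\<^bsub>F\<^esub> (a - b) = (Ker #>\<^bsub>F\<^esub> a) \<ominus>\<^bsub>T\<^esub> (Ker #>\<^bsub>F\<^esub> b)"
      using closed[OF d] closed[of b] ab by (simp add: a_minus_def T.a_assoc T.r_neg)
    then show "P (Ker #>\<^bsub>F\<^esub> (a - b))"
      using assms(4)[OF closed closed P] ab by simp
  next
    fix p assume "p \<in> carrier M \<times> carrier N"
    then show "P (Ker #>\<^bsub>F\<^esub> frag_of p)"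
      using assms(3) by (auto simp: pure_tensor_def)
  qed
  then show ?thesis
    using c(2) by simp
qed

lemma pure_zero_left: "y \<in> carrier N \<Longrightarrow> pt \<zero>\<^bsub>M\<^esub> y = \<zero>\<^bsub>T\<^esub>"
  using add_hom_zero[OF M.abelian_group_axioms abelian_group_tensor balancedD(2)[OF balanced_pure]] .

lemma pure_zero_right: "x \<in> carrier M \<Longrightarrow> pt x \<zero>\<^bsub>N\<^esub> = \<zero>\<^bsub>T\<^esub>"
  using add_hom_zero[OF N.abelian_group_axioms abelian_group_tensor balancedD(1)[OF balanced_pure]] .

lemma pure_neg_left: "x \<in> carrier M \<Longrightarrow> y \<in> carrier N \<Longrightarrow> pt (\<ominus>\<^bsub>M\<^esub> x) y = \<ominus>\<^bsub>T\<^esub> pt x y"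
  using add_hom_a_inv[OF M.abelian_group_axioms abelian_group_tensor balancedD(2)[OF balanced_pure]] .

lemma pure_lsum_left:
  "(\<And>i. i \<in> set xs \<Longrightarrow> f i \<in> carrier M) \<Longrightarrow> y \<in> carrier N \<Longrightarrow>
     pt (lsum M f xs) y = lsum T (\<lambda>i. pt (f i) y) xs"
  using add_hom_lsum[OF M.abelian_group_axioms abelian_group_tensor balancedD(2)[OF balanced_pure]] .

lemma pure_lsum_right:
  "x \<in> carrier M \<Longrightarrow> (\<And>i. i \<in> set xs \<Longrightarrow> f i \<in> carrier N) \<Longrightarrow>
     pt x (lsum N f xs) = lsum T (\<lambda>i. pt x (f i)) xs"
  using add_hom_lsum[OF N.abelian_group_axioms abelian_group_tensor balancedD(1)[OF balanced_pure]] .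

lemma tensor_list:
  assumes "t \<in> carrier T"
  obtains xs where "set xs \<subseteq> carrier M \<times> carrier N" and "t = lsum T (\<lambda>p. pt (fst p) (snd p)) xs"
proof -
  have "\<exists>xs. set xs \<subseteq> carrier M \<times> carrier N \<and> t = lsum T (\<lambda>p. pt (fst p) (snd p)) xs"
    using assms
  proof (induction rule: tensor_induct)
    case zero
    show ?case by (rule exI[of _ "[]"]) simp
  next
    case (pure x y)
    then show ?case by (intro exI[of _ "[(x, y)]"]) (simp add: pure_closed)
  next
    case (diff s t)
    then obtain xs ys where xs: "set xs \<subseteq> carrier M \<times> carrier N" "s = lsum T (\<lambda>p. pt (fst p) (snd p)) xs"
      and ys: "set ys \<subseteq> carrier M \<times> carrier N" "t = lsum T (\<lambda>p. pt (fst p) (snd p)) ys"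
      by blast
    \<comment> \<open>Negation is absorbed by the left factors, -(x \<otimes> y) = (-x) \<otimes> y,
      so that lists without integer coefficients suffice.\<close>
    define zs where "zs = map (\<lambda>p. (\<ominus>\<^bsub>M\<^esub> fst p, snd p)) ys"
    have "\<ominus>\<^bsub>T\<^esub> lsum T (\<lambda>p. pt (fst p) (snd p)) ys = lsum T (\<lambda>p. pt (fst p) (snd p)) zs"
      using ys(1) unfolding zs_def
    proof (induction ys)
      case (Cons p ys)
      have "pt (fst q) (snd q) \<in> carrier T" if "q \<in> set (p # ys)" for q
        using that Cons.prems by (intro pure_closed pairs_fst pairs_snd)
      then have "pt (fst p) (snd p) \<in> carrier T" "lsum T (\<lambda>p. pt (fst p) (snd p)) ys \<in> carrier T"
        by (auto intro: T.lsum_closed)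
      moreover have "pt (\<ominus>\<^bsub>M\<^esub> fst p) (snd p) = \<ominus>\<^bsub>T\<^esub> pt (fst p) (snd p)"
        using Cons.prems by (intro pure_neg_left pairs_fst[of "p # ys"] pairs_snd[of "p # ys"]) auto
      ultimately show ?case
        using Cons by (simp add: T.minus_add)
    qed simp
    moreover have "set zs \<subseteq> carrier M \<times> carrier N"
      using ys(1) by (auto simp: zs_def)
    ultimately show ?case
      using xs ys by (intro exI[of _ "xs @ zs"], subst T.lsum_append)
        (auto simp: a_minus_def intro!: pure_closed)
  qed
  then show thesis using that by blast
qed

text \<open>Nearly every identity on tensor products below is obtained in this way, both sides being
  presented as composites of additive maps and compared on pure tensors.\<close>

lemma add_hom_tensor_eqI:
  assumes "abelian_group G" and "f \<in> add_hom T G" and "g \<in> add_hom T G"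
    and "\<And>x y. x \<in> carrier M \<Longrightarrow> y \<in> carrier N \<Longrightarrow> f (pt x y) = g (pt x y)"
    and "t \<in> carrier T"
  shows "f t = g t"
proof -
  from \<open>t \<in> carrier T\<close> obtain xs where
    xs: "set xs \<subseteq> carrier M \<times> carrier N" "t = lsum T (\<lambda>p. pt (fst p) (snd p)) xs"
    by (rule tensor_list)
  have "pt (fst p) (snd p) \<in> carrier T" if "p \<in> set xs" for p
    using that xs(1) by (intro pure_closed pairs_fst pairs_snd)
  then have "f t = lsum G (\<lambda>p. f (pt (fst p) (snd p))) xs" "g t = lsum G (\<lambda>p. g (pt (fst p) (snd p))) xs"
    unfolding xs(2) by (auto intro!: add_hom_lsum[OF abelian_group_tensor assms(1)] assms(2,3))
  moreover have "lsum G (\<lambda>p. f (pt (fst p) (snd p))) xs = lsum G (\<lambda>p. g (pt (fst p) (snd p))) xs"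
    using xs(1) by (intro lsum_cong assms(4)) auto
  ultimately show ?thesis
    by simp
qed

text \<open>The universal property of the free Abelian group yields some homomorphism k with the
  right values on generators; expanding c into generators shows that the explicit sum over keys, as
  used by \<open>tensor_lift\<close>, is this k.\<close>

lemma frag_hom:
  assumes "abelian_group G" and "\<And>x y. x \<in> carrier M \<Longrightarrow> y \<in> carrier N \<Longrightarrow> \<beta> x y \<in> carrier G"
  defines "h \<equiv> \<lambda>c :: 'm \<times> 'n \<Rightarrow>\<^sub>0 int. (\<Oplus>\<^bsub>G\<^esub>p \<in> Poly_Mapping.keys c. add_pow G (Poly_Mapping.lookup c p) (\<beta> (fst p) (snd p)))"
  shows "h \<in> hom F (add_monoid G)"
    and "\<And>x y. x \<in> carrier M \<Longrightarrow> y \<in> carrier N \<Longrightarrow> h (frag_of (x, y)) = \<beta> x y"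
proof -
  interpret G: abelian_group G by fact
  have "(\<lambda>p. \<beta> (fst p) (snd p)) ` (carrier M \<times> carrier N) \<subseteq> carrier (add_monoid G)"
    using assms(2) by auto
  then obtain k where k: "k \<in> hom F (add_monoid G)"
    "\<And>p. p \<in> carrier M \<times> carrier N \<Longrightarrow> k (frag_of p) = \<beta> (fst p) (snd p)"
    by (rule comm_group.free_Abelian_group_universal[OF G.a_comm_group]) blast
  interpret k: group_hom F "add_monoid G" k
    using k(1) F_group(2) G.a_group by (simp add: group_hom_def group_hom_axioms_def)
  have hk: "h c = k c" if c: "c \<in> carrier F" for c
  proof -
    have cmul: "frag_cmul n (frag_of p) \<in> carrier F" if "p \<in> carrier M \<times> carrier N" for n p
      using that keys_cmul[of n "frag_of p"] by auto
    have *: "k (\<Sum>p\<in>X. frag_cmul (Poly_Mapping.lookup c p) (frag_of p)) =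
      (\<Oplus>\<^bsub>G\<^esub>p\<in>X. add_pow G (Poly_Mapping.lookup c p) (\<beta> (fst p) (snd p)))"
      if "finite X" "X \<subseteq> carrier M \<times> carrier N" for X
      using that
    proof (induction X rule: finite_induct)
      case empty
      show ?case using k.hom_one by simp
    next
      case (insert p X)
      let ?a = "frag_cmul (Poly_Mapping.lookup c p) (frag_of p)"
      let ?b = "\<Sum>p\<in>X. frag_cmul (Poly_Mapping.lookup c p) (frag_of p)"
      have b: "?b \<in> carrier F"
        using insert.prems by (intro sum_closed_free_Abelian_group cmul) auto
      have a: "?a = frag_of p [^]\<^bsub>F\<^esub> Poly_Mapping.lookup c p"
        using insert.prems by (subst int_pow_free_Abelian_group) auto
      have "k ?a = add_pow G (Poly_Mapping.lookup c p) (\<beta> (fst p) (snd p))"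
        unfolding a using k.hom_int_pow[of "frag_of p"] insert.prems k(2)[of p]
        by (simp add: add_pow_def)
      moreover have "k (?a + ?b) = k ?a \<oplus>\<^bsub>G\<^esub> k ?b"
        using k.hom_mult[OF cmul b, of p "Poly_Mapping.lookup c p"] insert.prems by simp
      moreover have "add_pow G (Poly_Mapping.lookup c q) (\<beta> (fst q) (snd q)) \<in> carrier G" if "q \<in> insert p X" for q
        using that insert.prems assms(2) by (auto intro!: G.add.int_pow_closed)
      then have "(\<Oplus>\<^bsub>G\<^esub>p\<in>insert p X. add_pow G (Poly_Mapping.lookup c p) (\<beta> (fst p) (snd p))) =
          add_pow G (Poly_Mapping.lookup c p) (\<beta> (fst p) (snd p)) \<oplus>\<^bsub>G\<^esub>
          (\<Oplus>\<^bsub>G\<^esub>p\<in>X. add_pow G (Poly_Mapping.lookup c p) (\<beta> (fst p) (snd p)))"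
        using insert.hyps by (intro G.finsum_insert) auto
      ultimately show ?case
        using insert by simp
    qed
    have "k c = k (\<Sum>p\<in>Poly_Mapping.keys c. frag_cmul (Poly_Mapping.lookup c p) (frag_of p))"
      using frag_expansion[of c] unfolding frag_extend_def by simp
    also have "\<dots> = h c"
      unfolding h_def using c by (intro *) auto
    finally show ?thesis by simp
  qed
  show "h \<in> hom F (add_monoid G)"
  proof (rule homI)
    show "h c \<in> carrier (add_monoid G)" if "c \<in> carrier F" for c
      using hk that k.hom_closed by auto
    show "h (a \<otimes>\<^bsub>F\<^esub> b) = h a \<otimes>\<^bsub>add_monoid G\<^esub> h b" if "a \<in> carrier F" "b \<in> carrier F" for a b
      using hk[OF that(1)] hk[OF that(2)] hk[OF F_sum[OF that]] k.hom_mult[OF that] by simp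
  qed
  show "h (frag_of (x, y)) = \<beta> x y" if "x \<in> carrier M" "y \<in> carrier N" for x y
    using that hk k(2) by simp
qed

text \<open>The explicit sum is a homomorphism that kills the three kinds of relations, hence
  \<open>Ker\<close>. The representative selected by \<open>tensor_lift\<close> differs from c by an
  element of \<open>Ker\<close>, which therefore contributes zero.\<close>

lemma tensor_lift_coset:
  assumes "abelian_group G" and "balanced R M N G \<beta>" and "c \<in> carrier F"
  shows "tensor_lift G \<beta> (Ker #>\<^bsub>F\<^esub> c) =
    (\<Oplus>\<^bsub>G\<^esub>p \<in> Poly_Mapping.keys c. add_pow G (Poly_Mapping.lookup c p) (\<beta> (fst p) (snd p)))"
proof -
  interpret G: abelian_group G by fact
  define h where
    "h = (\<lambda>c :: 'm \<times> 'n \<Rightarrow>\<^sub>0 int. (\<Oplus>\<^bsub>G\<^esub>p \<in> Poly_Mapping.keys c. add_pow G (Poly_Mapping.lookup c p) (\<beta> (fst p) (snd p))))"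
  have hom: "h \<in> hom F (add_monoid G)"
    "\<And>x y. x \<in> carrier M \<Longrightarrow> y \<in> carrier N \<Longrightarrow> h (frag_of (x, y)) = \<beta> x y"
    unfolding h_def by (rule frag_hom[where \<beta> = \<beta>, OF assms(1) balancedD(4)[OF assms(2)]]; assumption)+
  interpret h: group_hom F "add_monoid G" h
    using hom(1) F_group(2) G.a_group by (simp add: group_hom_def group_hom_axioms_def)
  have diff: "h (a - b) = h a \<ominus>\<^bsub>G\<^esub> h b" if ab: "a \<in> carrier F" "b \<in> carrier F" for a b
  proof -
    have d: "a - b \<in> carrier F"
      using ab keys_diff[of a b] by auto
    have "h a = h (a - b) \<oplus>\<^bsub>G\<^esub> h b"
      using h.hom_mult[OF d ab(2)] by simp
    moreover have "h (a - b) \<in> carrier G" "h b \<in> carrier G"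
      using h.hom_closed[OF d] h.hom_closed[OF ab(2)] by simp_all
    ultimately show ?thesis
      by (simp add: a_minus_def G.a_assoc G.r_neg)
  qed
  have frag: "frag_of (x, y) \<in> carrier F" if "x \<in> carrier M" "y \<in> carrier N" for x y
    using that by simp
  have sub: "a - b \<in> carrier F" if "a \<in> carrier F" "b \<in> carrier F" for a b
    using that keys_diff[of a b] by auto
  have "h r = \<zero>\<^bsub>G\<^esub>" if rel: "r \<in> tensor_rels R M N" for r
  proof -
    consider (l) x x' y where "r = frag_of (x \<oplus>\<^bsub>M\<^esub> x', y) - frag_of (x, y) - frag_of (x', y)"
        "x \<in> carrier M" "x' \<in> carrier M" "y \<in> carrier N"
      | (r) x y y' where "r = frag_of (x, y \<oplus>\<^bsub>N\<^esub> y') - frag_of (x, y) - frag_of (x, y')"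
        "x \<in> carrier M" "y \<in> carrier N" "y' \<in> carrier N"
      | (b) x a y where "r = frag_of (ract M x a, y) - frag_of (x, lact N a y)"
        "x \<in> carrier M" "a \<in> carrier R" "y \<in> carrier N"
      using rel unfolding tensor_rels_def by blast
    then show ?thesis
    proof cases
      case l
      have "\<beta> (x \<oplus>\<^bsub>M\<^esub> x') y = \<beta> x y \<oplus>\<^bsub>G\<^esub> \<beta> x' y"
        using add_hom_add[OF balancedD(2)[OF assms(2)]] l by auto
      then show ?thesis
        using l balancedD(4)[OF assms(2)]
        by (simp add: diff sub frag hom(2) G.add_minus_minus del: carrier_free_Abelian_group_iff)
    next
      case r
      have "\<beta> x (y \<oplus>\<^bsub>N\<^esub> y') = \<beta> x y \<oplus>\<^bsub>G\<^esub> \<beta> x y'"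
        using add_hom_add[OF balancedD(1)[OF assms(2)]] r by auto
      then show ?thesis
        using r balancedD(4)[OF assms(2)]
        by (simp add: diff sub frag hom(2) G.add_minus_minus del: carrier_free_Abelian_group_iff)
    next
      case b
      then show ?thesis
        using balancedD(3,4)[OF assms(2)]
        by (simp add: diff frag hom(2) a_minus_def G.r_neg M.ract_closed N.lact_closed
            del: carrier_free_Abelian_group_iff)
    qed
  qed
  then have "tensor_rels R M N \<subseteq> kernel F (add_monoid G) h"
    using rels_subset by (auto simp: kernel_def simp del: carrier_free_Abelian_group_iff)
  then have "Ker \<subseteq> kernel F (add_monoid G) h"
    unfolding tensor_kernel_def
    using group.generate_subgroup_incl[OF F_group(2) _ h.subgroup_kernel] by blast
  then have ker: "h a = \<zero>\<^bsub>G\<^esub>" "a \<in> carrier F" if "a \<in> Ker" for a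
    using that by (auto simp: kernel_def simp del: carrier_free_Abelian_group_iff)
  have "(SOME d. d \<in> Ker #>\<^bsub>F\<^esub> c) \<in> Ker #>\<^bsub>F\<^esub> c"
    using group.rcos_self[OF F_group(2) assms(3) Ker_subgroup] by (rule someI)
  then obtain a where "a \<in> Ker" "(SOME d. d \<in> Ker #>\<^bsub>F\<^esub> c) = a + c"
    by (auto simp: r_coset_def)
  moreover have "h (a + c) = h c" if "a \<in> Ker"
    using h.hom_mult[OF ker(2)[OF that] assms(3)] h.hom_closed[OF assms(3)] ker(1)[OF that] by simp
  ultimately show ?thesis
    by (simp add: tensor_lift_def Let_def h_def)
qed

lemma tensor_lift_hom:
  assumes "abelian_group G" and "balanced R M N G \<beta>"
  shows "tensor_lift G \<beta> \<in> add_hom T G"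
proof (rule add_homI)
  note hom = frag_hom(1)[where \<beta> = \<beta>, OF assms(1) balancedD(4)[OF assms(2)]]
  show "tensor_lift G \<beta> t \<in> carrier G" if t: "t \<in> carrier T" for t
  proof -
    obtain c where c: "c \<in> carrier F" "t = Ker #>\<^bsub>F\<^esub> c"
      using tensor_coset[OF t] by auto
    then show ?thesis
      using hom_in_carrier[OF hom c(1)] tensor_lift_coset[OF assms c(1)] by simp
  qed
  show "tensor_lift G \<beta> (s \<oplus>\<^bsub>T\<^esub> t) = tensor_lift G \<beta> s \<oplus>\<^bsub>G\<^esub> tensor_lift G \<beta> t"
    if s: "s \<in> carrier T" and t: "t \<in> carrier T" for s t
  proof -
    obtain c d where c: "c \<in> carrier F" "s = Ker #>\<^bsub>F\<^esub> c" and d: "d \<in> carrier F" "t = Ker #>\<^bsub>F\<^esub> d"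
      using tensor_coset[OF t] tensor_coset[OF s] by auto
    then show ?thesis
      using hom_mult[OF hom c(1) d(1)] tensor_lift_coset[OF assms c(1)]
        tensor_lift_coset[OF assms d(1)] tensor_lift_coset[OF assms F_sum[OF c(1) d(1)]]
      by (simp add: coset_add[symmetric])
  qed
qed

lemma tensor_lift_pure:
  assumes "abelian_group G" and "balanced R M N G \<beta>" and "x \<in> carrier M" and "y \<in> carrier N"
  shows "tensor_lift G \<beta> (pt x y) = \<beta> x y"
proof -
  have "tensor_lift G \<beta> (pt x y) = (\<Oplus>\<^bsub>G\<^esub>p \<in> Poly_Mapping.keys (frag_of (x, y)).
      add_pow G (Poly_Mapping.lookup (frag_of (x, y)) p) (\<beta> (fst p) (snd p)))"
    using assms(3,4) unfolding pure_tensor_def by (intro tensor_lift_coset[OF assms(1,2)]) simp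
  also have "\<dots> = \<beta> x y"
    using frag_hom(2)[where \<beta> = \<beta>, OF assms(1) balancedD(4)[OF assms(2)]] assms(3,4) by simp
  finally show ?thesis .
qed

lemma tensor_lift_lsum:
  assumes "abelian_group G" and "balanced R M N G \<beta>" and "set xs \<subseteq> carrier M \<times> carrier N"
  shows "tensor_lift G \<beta> (lsum T (\<lambda>p. pt (fst p) (snd p)) xs) = lsum G (\<lambda>p. \<beta> (fst p) (snd p)) xs"
proof -
  have "pt (fst p) (snd p) \<in> carrier T" if "p \<in> set xs" for p
    using that assms(3) by (intro pure_closed pairs_fst pairs_snd)
  then have "tensor_lift G \<beta> (lsum T (\<lambda>p. pt (fst p) (snd p)) xs) =
      lsum G (\<lambda>p. tensor_lift G \<beta> (pt (fst p) (snd p))) xs"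
    by (intro add_hom_lsum abelian_group_tensor assms(1) tensor_lift_hom[OF assms(1,2)])
  also have "\<dots> = lsum G (\<lambda>p. \<beta> (fst p) (snd p)) xs"
    using assms by (intro lsum_cong tensor_lift_pure) auto
  finally show ?thesis .
qed

end

section \<open>Linear maps and module structures on tensor products\<close>

lemma bimodule_left: "bimodule L R M \<Longrightarrow> left_module L M"
  and bimodule_right: "bimodule L R M \<Longrightarrow> right_module R M"
  by (auto simp: bimodule_def)

lemma left_hom_add_hom: "f \<in> left_hom R M N \<Longrightarrow> f \<in> add_hom M N"
  by (simp add: left_hom_def)

lemma right_hom_add_hom: "f \<in> right_hom R M N \<Longrightarrow> f \<in> add_hom M N"
  by (simp add: right_hom_def)

lemma left_hom_lact:
  "f \<in> left_hom R M N \<Longrightarrow> a \<in> carrier R \<Longrightarrow> x \<in> carrier M \<Longrightarrow> f (lact M a x) = lact N a (f x)"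
  by (simp add: left_hom_def)

lemma right_hom_ract:
  "f \<in> right_hom R M N \<Longrightarrow> a \<in> carrier R \<Longrightarrow> x \<in> carrier M \<Longrightarrow> f (ract M x a) = ract N (f x) a"
  by (simp add: right_hom_def)

text \<open>Each action on a tensor product comes from one of the factors, so the two are set up
  separately; \<open>bimodule_tensor\<close> joins them.\<close>

locale tensor_bimodule_left = M: bimodule L R M + N: left_module R N
  for L :: "'l ring" and R :: "'c ring" and M :: "('l, 'c, 'm, 'y) bimodule_scheme"
    and N :: "('c, 'r, 'n, 'z) bimodule_scheme"
begin

sublocale tensor_product R M N
  using M.right_module_axioms N.left_module_axioms by (rule tensor_product.intro)

lemma balanced_lact: "a \<in> carrier L \<Longrightarrow> balanced R M N T (\<lambda>x y. pt (lact M a x) y)"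
  by (rule balancedI)
    (simp_all add: pure_closed pure_add_left pure_add_right pure_balanced M.lact_closed M.lact_r_distr
      flip: M.lact_ract)

lemma tensor_lact_hom: "a \<in> carrier L \<Longrightarrow> lact T a \<in> add_hom T T"
  unfolding tensor_lact tensor_lift_tensor_ring
  by (intro tensor_lift_hom abelian_group_tensor balanced_lact)

lemma tensor_lact_pure:
  "a \<in> carrier L \<Longrightarrow> x \<in> carrier M \<Longrightarrow> y \<in> carrier N \<Longrightarrow> lact T a (pt x y) = pt (lact M a x) y"
  unfolding tensor_lact tensor_lift_tensor_ring
  by (intro tensor_lift_pure abelian_group_tensor balanced_lact)

lemma left_module_tensor: "left_module L T"
proof (intro left_module.intro left_module_axioms.intro M.R.ring_axioms)
  show "ring L" "abelian_group T"
    by (fact M.L.ring_axioms abelian_group_tensor)+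
  show "lact T a t \<in> carrier T" if "a \<in> carrier L" "t \<in> carrier T" for a t
    using that by (rule add_hom_closed[OF tensor_lact_hom])
  show "lact T a (s \<oplus>\<^bsub>T\<^esub> t) = lact T a s \<oplus>\<^bsub>T\<^esub> lact T a t"
    if "a \<in> carrier L" "s \<in> carrier T" "t \<in> carrier T" for a s t
    using that by (rule add_hom_add[OF tensor_lact_hom])
  show "lact T (a \<oplus>\<^bsub>L\<^esub> b) t = lact T a t \<oplus>\<^bsub>T\<^esub> lact T b t"
    if "a \<in> carrier L" "b \<in> carrier L" "t \<in> carrier T" for a b t
    using that by (intro add_hom_tensor_eqI[OF abelian_group_tensor, of "lact T (a \<oplus>\<^bsub>L\<^esub> b)" _ t]
        add_hom_plus abelian_group_tensor)
      (simp_all add: tensor_lact_hom tensor_lact_pure M.lact_l_distr M.lact_closed pure_add_left)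
  show "lact T (a \<otimes>\<^bsub>L\<^esub> b) t = lact T a (lact T b t)"
    if "a \<in> carrier L" "b \<in> carrier L" "t \<in> carrier T" for a b t
    using that by (intro add_hom_tensor_eqI[OF abelian_group_tensor, of "lact T (a \<otimes>\<^bsub>L\<^esub> b)" _ t]
        add_hom_compose[OF tensor_lact_hom tensor_lact_hom])
      (simp_all add: tensor_lact_hom tensor_lact_pure M.lact_assoc M.lact_closed)
  show "lact T \<one>\<^bsub>L\<^esub> t = t" if "t \<in> carrier T" for t
    using that by (intro add_hom_tensor_eqI[OF abelian_group_tensor, of "lact T \<one>\<^bsub>L\<^esub>" "\<lambda>x. x" t]
        tensor_lact_hom add_hom_id)
      (simp_all add: tensor_lact_pure M.lact_one)
qed

end

locale tensor_bimodule_right = M: right_module R M + N: bimodule R L N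
  for L :: "'l ring" and R :: "'c ring" and M :: "('k, 'c, 'm, 'y) bimodule_scheme"
    and N :: "('c, 'l, 'n, 'z) bimodule_scheme"
begin

sublocale tensor_product R M N
  using M.right_module_axioms N.left_module_axioms by (rule tensor_product.intro)

lemma balanced_ract: "a \<in> carrier L \<Longrightarrow> balanced R M N T (\<lambda>x y. pt x (ract N y a))"
  by (rule balancedI)
    (simp_all add: pure_closed pure_add_left pure_add_right pure_balanced N.ract_closed N.ract_l_distr
      N.lact_ract)

lemma tensor_ract_hom: "a \<in> carrier L \<Longrightarrow> (\<lambda>t. ract T t a) \<in> add_hom T T"
  unfolding tensor_ract tensor_lift_tensor_ring
  by (intro tensor_lift_hom abelian_group_tensor balanced_ract)

lemma tensor_ract_pure:
  "a \<in> carrier L \<Longrightarrow> x \<in> carrier M \<Longrightarrow> y \<in> carrier N \<Longrightarrow> ract T (pt x y) a = pt x (ract N y a)"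
  unfolding tensor_ract tensor_lift_tensor_ring
  by (intro tensor_lift_pure abelian_group_tensor balanced_ract)

lemma right_module_tensor: "right_module L T"
proof (intro right_module.intro right_module_axioms.intro)
  show "ring L" "abelian_group T"
    by (fact N.R.ring_axioms abelian_group_tensor)+
  show "ract T t a \<in> carrier T" if "t \<in> carrier T" "a \<in> carrier L" for a t
    using that by (rule add_hom_closed[OF tensor_ract_hom, rotated])
  show "ract T (s \<oplus>\<^bsub>T\<^esub> t) a = ract T s a \<oplus>\<^bsub>T\<^esub> ract T t a"
    if "s \<in> carrier T" "t \<in> carrier T" "a \<in> carrier L" for a s t
    using that add_hom_add[OF tensor_ract_hom] by blast
  show "ract T t (a \<oplus>\<^bsub>L\<^esub> b) = ract T t a \<oplus>\<^bsub>T\<^esub> ract T t b"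
    if "t \<in> carrier T" "a \<in> carrier L" "b \<in> carrier L" for a b t
    using that by (intro add_hom_tensor_eqI[OF abelian_group_tensor, of "\<lambda>t. ract T t (a \<oplus>\<^bsub>L\<^esub> b)" _ t]
        add_hom_plus abelian_group_tensor)
      (simp_all add: tensor_ract_hom tensor_ract_pure N.ract_r_distr N.ract_closed pure_add_right)
  show "ract T t (a \<otimes>\<^bsub>L\<^esub> b) = ract T (ract T t a) b"
    if "t \<in> carrier T" "a \<in> carrier L" "b \<in> carrier L" for a b t
    using that by (intro add_hom_tensor_eqI[OF abelian_group_tensor, of "\<lambda>t. ract T t (a \<otimes>\<^bsub>L\<^esub> b)" _ t]
        add_hom_compose[OF tensor_ract_hom tensor_ract_hom])
      (simp_all add: tensor_ract_hom tensor_ract_pure N.ract_assoc N.ract_closed)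
  show "ract T t \<one>\<^bsub>L\<^esub> = t" if "t \<in> carrier T" for t
    using that by (intro add_hom_tensor_eqI[OF abelian_group_tensor, of "\<lambda>t. ract T t \<one>\<^bsub>L\<^esub>" "\<lambda>x. x" t]
        tensor_ract_hom add_hom_id)
      (simp_all add: tensor_ract_pure N.ract_one)
qed

end

lemma bimodule_tensor:
  assumes "bimodule L R M" and "bimodule R Q N"
  shows "bimodule L Q (tensor R M N)"
proof -
  interpret M: bimodule L R M by fact
  interpret N: bimodule R Q N by fact
  interpret l: tensor_bimodule_left L R M N ..
  interpret r: tensor_bimodule_right Q R M N ..
  show ?thesis
  proof (intro bimodule.intro l.left_module_tensor r.right_module_tensor bimodule_axioms.intro)
    show "ract l.T (lact l.T a t) b = lact l.T a (ract l.T t b)"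
      if "a \<in> carrier L" "t \<in> carrier l.T" "b \<in> carrier Q" for a t b
      using that by (intro l.add_hom_tensor_eqI[OF l.abelian_group_tensor, of "\<lambda>t. ract l.T (lact l.T a t) b" _ t]
          add_hom_compose[OF l.tensor_lact_hom r.tensor_ract_hom]
          add_hom_compose[OF r.tensor_ract_hom l.tensor_lact_hom])
        (simp_all add: l.tensor_lact_pure r.tensor_ract_pure M.lact_closed N.ract_closed)
  qed
qed

section \<open>Tensor products of linear maps, and the regular bimodule\<close>

lemma balanced_tensor_map:
  assumes "tensor_product R M N" and "f \<in> right_hom R M' M" and "g \<in> left_hom R N' N"
    and "right_module R M'" and "left_module R N'"
  shows "balanced R M' N' (tensor R M N) (\<lambda>x y. pure_tensor R M N (f x) (g y))"
proof -
  interpret tensor_product R M N by fact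
  interpret M': right_module R M' by fact
  interpret N': left_module R N' by fact
  note f = add_hom_closed[OF right_hom_add_hom[OF assms(2)]] add_hom_add[OF right_hom_add_hom[OF assms(2)]]
  note g = add_hom_closed[OF left_hom_add_hom[OF assms(3)]] add_hom_add[OF left_hom_add_hom[OF assms(3)]]
  show ?thesis
    by (rule balancedI)
      (simp_all add: pure_closed pure_add_left pure_add_right pure_balanced f g
        right_hom_ract[OF assms(2)] left_hom_lact[OF assms(3)])
qed

lemma
  assumes "tensor_product R M N" and "tensor_product R M' N'"
    and "f \<in> right_hom R M' M" and "g \<in> left_hom R N' N"
  shows tensor_map_hom: "tensor_map R M N f g \<in> add_hom (tensor R M' N') (tensor R M N)"
    and tensor_map_pure: "x \<in> carrier M' \<Longrightarrow> y \<in> carrier N' \<Longrightarrow>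
      tensor_map R M N f g (pure_tensor R M' N' x y) = pure_tensor R M N (f x) (g y)"
proof -
  have bal: "balanced R M' N' (tensor R M N) (\<lambda>x y. pure_tensor R M N (f x) (g y))"
    using assms by (intro balanced_tensor_map) (auto simp: tensor_product_def)
  note ag = tensor_product.abelian_group_tensor[OF assms(1)]
  show "tensor_map R M N f g \<in> add_hom (tensor R M' N') (tensor R M N)"
    unfolding tensor_map_def by (rule tensor_product.tensor_lift_hom[OF assms(2) ag bal])
  show "x \<in> carrier M' \<Longrightarrow> y \<in> carrier N' \<Longrightarrow>
      tensor_map R M N f g (pure_tensor R M' N' x y) = pure_tensor R M N (f x) (g y)"
    unfolding tensor_map_def by (rule tensor_product.tensor_lift_pure[OF assms(2) ag bal])
qed

lemma abelian_group_cong: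
  assumes "abelian_group G" "carrier H = carrier G" "zero H = zero G" "add H = add G"
  shows "abelian_group H"
  using assms(2-4) abelian_groupE[OF assms(1)] by (intro abelian_groupI) (auto simp: Bex_def)

lemma regular_bimodule_sel [simp]:
  "carrier (regular_bimodule R) = carrier R" "zero (regular_bimodule R) = zero R" "add (regular_bimodule R) = add R"
  "lact (regular_bimodule R) = monoid.mult R" "ract (regular_bimodule R) = monoid.mult R"
  by (simp_all add: regular_bimodule_def)

lemma bimodule_regular:
  assumes "ring R"
  shows "bimodule R R (regular_bimodule R)"
proof -
  interpret ring R by fact
  have "abelian_group (regular_bimodule R)"
    by (rule abelian_group_cong[OF abelian_group_axioms]) simp_all
  then show ?thesis
    using assms by (intro bimodule.intro left_module.intro right_module.intro left_module_axioms.intro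
        right_module_axioms.intro bimodule_axioms.intro) (auto simp: l_distr r_distr m_assoc)
qed

section \<open>Consequences of faithful flatness\<close>

text \<open>Only modules whose elements lie in the universe \<open>'u\<close> may be used as test modules; any other module
  is first moved there along an injection.\<close>

definition transport ::
    "('n \<Rightarrow> 'u) \<Rightarrow> ('l, 'r, 'n, 'z) bimodule_scheme \<Rightarrow> (unit, 'r, 'u) bimodule"
  where "transport h N =
    \<lparr>carrier = h ` carrier N, monoid.mult = undefined, one = undefined,
     zero = h \<zero>\<^bsub>N\<^esub>, add = (\<lambda>x y. h (inv_into UNIV h x \<oplus>\<^bsub>N\<^esub> inv_into UNIV h y)),
     lact = undefined, ract = (\<lambda>x a. h (ract N (inv_into UNIV h x) a))\<rparr>"

lemma transport_sel:
  "carrier (transport h N) = h ` carrier N" "\<zero>\<^bsub>transport h N\<^esub> = h \<zero>\<^bsub>N\<^esub>"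
  "inj h \<Longrightarrow> h x \<oplus>\<^bsub>transport h N\<^esub> h y = h (x \<oplus>\<^bsub>N\<^esub> y)"
  "inj h \<Longrightarrow> ract (transport h N) (h x) a = h (ract N x a)"
  by (simp_all add: transport_def)

lemma right_module_transport:
  assumes "right_module R N" and "inj h"
  shows "right_module R (transport h N)"
proof -
  interpret right_module R N by fact
  show ?thesis
  proof (intro right_module.intro right_module_axioms.intro abelian_groupI)
    fix x assume "x \<in> carrier (transport h N)"
    then obtain y where y: "y \<in> carrier N" "x = h y"
      by (auto simp: transport_sel)
    show "\<exists>z\<in>carrier (transport h N). z \<oplus>\<^bsub>transport h N\<^esub> x = \<zero>\<^bsub>transport h N\<^esub>"
      using y assms(2) by (auto simp: transport_sel M.l_neg intro!: bexI[of _ "\<ominus>\<^bsub>N\<^esub> y"])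
  qed (use assms(2) in \<open>auto simp: transport_sel R.ring_axioms M.a_assoc ract_closed ract_r_distr
      ract_l_distr ract_assoc ract_one M.a_ac\<close>)
qed

lemma right_hom_transport:
  assumes "inj h"
  shows "h \<in> right_hom R N (transport h N)" and "inv_into UNIV h \<in> right_hom R (transport h N) N"
  using assms by (auto simp: right_hom_def hom_def transport_sel)

lemma right_module_restrict:
  assumes "right_module R N" and "additive_subgroup K N"
    and "\<And>x a. x \<in> K \<Longrightarrow> a \<in> carrier R \<Longrightarrow> ract N x a \<in> K"
  shows "right_module R (N\<lparr>carrier := K\<rparr>)"
proof -
  interpret right_module R N by fact
  interpret K: additive_subgroup K N by fact
  have sub: "\<And>x. x \<in> K \<Longrightarrow> x \<in> carrier N"
    using K.a_subset by auto
  show ?thesis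
  proof (intro right_module.intro right_module_axioms.intro abelian_groupI)
    fix x assume "x \<in> carrier (N\<lparr>carrier := K\<rparr>)"
    then show "\<exists>z\<in>carrier (N\<lparr>carrier := K\<rparr>). z \<oplus>\<^bsub>N\<lparr>carrier := K\<rparr>\<^esub> x = \<zero>\<^bsub>N\<lparr>carrier := K\<rparr>\<^esub>"
      using sub by (auto simp: M.l_neg intro!: bexI[of _ "\<ominus>\<^bsub>N\<^esub> x"])
  qed (use sub assms(3) in \<open>auto simp: R.ring_axioms M.a_assoc ract_r_distr
      ract_l_distr ract_assoc ract_one M.a_ac intro: subgroup.m_closed[OF K.a_subgroup, simplified]\<close>)
qed

lemma add_hom_kernel_subgroup:
  assumes "abelian_group G" and "abelian_group H" and "g \<in> add_hom G H"
  shows "additive_subgroup (a_kernel G H g) G"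
proof -
  interpret abelian_group_hom G H g
    using assms by (intro abelian_group_homI) (simp_all add: group_hom_def group_hom_axioms_def abelian_group.a_group)
  show ?thesis by (rule additive_subgroup_a_kernel)
qed

lemma id_right_hom: "carrier N \<subseteq> carrier N' \<Longrightarrow> add N = add N' \<Longrightarrow> ract N = ract N' \<Longrightarrow> id \<in> right_hom R N N'"
  by (auto simp: right_hom_def hom_def)

lemma id_left_hom: "id \<in> left_hom R N N"
  by (auto simp: left_hom_def hom_def)

text \<open>Flatness, used for the inclusion of K, the kernel of g: the sequence K \<rightarrow> N
  \<rightarrow> N' is exact at N, so the kernel of g \<otimes> M is the image of K \<otimes> M.
  Stating the result with a list of pairs avoids K \<otimes> M and lets N and N' live in any types
  that inject into \<open>'u\<close>.\<close>

lemma faithfully_flat_kernel: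
  fixes N :: "('k, 'c, 'n, 'y) bimodule_scheme" and N' :: "('k', 'c, 'o, 'w) bimodule_scheme"
    and h :: "'n \<Rightarrow> 'u" and h' :: "'o \<Rightarrow> 'u"
  assumes ff: "faithfully_flat_left TYPE('u) R M"
    and N: "right_module R N" and N': "right_module R N'"
    and h: "inj h" and h': "inj h'"
    and g: "g \<in> right_hom R N N'"
    and t: "t \<in> carrier (tensor R N M)"
    and gt: "tensor_map R N' M g id t = \<zero>\<^bsub>tensor R N' M\<^esub>"
  obtains xs where "set xs \<subseteq> a_kernel N N' g \<times> carrier M"
    and "t = lsum (tensor R N M) (\<lambda>p. pure_tensor R N M (fst p) (snd p)) xs"
proof -
  have M: "left_module R M"
    using ff by (simp add: faithfully_flat_left_def)
  define K where "K = N\<lparr>carrier := a_kernel N N' g\<rparr>"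
  define g' where "g' = (\<lambda>x. h' (g (inv_into UNIV h x)))"
  interpret N: right_module R N by fact
  interpret N': right_module R N' by fact
  have ker: "a_kernel N N' g = {x \<in> carrier N. g x = \<zero>\<^bsub>N'\<^esub>}"
    by (rule a_kernel_def')
  have zero: "ract N' \<zero>\<^bsub>N'\<^esub> a = \<zero>\<^bsub>N'\<^esub>" if "a \<in> carrier R" for a
    using that N'.ract_l_distr[of "\<zero>\<^bsub>N'\<^esub>" "\<zero>\<^bsub>N'\<^esub>" a] N'.ract_closed[of "\<zero>\<^bsub>N'\<^esub>" a]
    by (metis N'.M.add.l_cancel_one' N'.M.l_zero N'.M.zero_closed)
  have K: "right_module R K"
    unfolding K_def
    by (intro right_module_restrict N add_hom_kernel_subgroup right_hom_add_hom[OF g]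
        N.M.abelian_group_axioms N'.M.abelian_group_axioms)
      (simp add: ker N.ract_closed right_hom_ract[OF g] zero)
  note tm = right_module_transport[OF N h] right_module_transport[OF N' h'] right_module_transport[OF K h]
  \<comment> \<open>K is moved along the same h as N, so that the inclusion becomes the identity on
    the copies.\<close>
  have idh: "id \<in> right_hom R (transport h K) (transport h N)"
    by (rule id_right_hom) (auto simp: transport_def K_def ker)
  have g'h: "g' \<in> right_hom R (transport h N) (transport h' N')"
    using h h' right_hom_add_hom[OF g] right_hom_ract[OF g]
    by (auto simp: right_hom_def hom_def transport_sel g'_def)
  have g'_h: "g' (h x) = h' (g x)" for x
    using h by (simp add: g'_def)
  have "exact_at (transport h K) (transport h N) (transport h' N') id g'"
    using h h' by (auto simp: exact_at_def a_kernel_def' transport_sel g'_def K_def inj_eq)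
  then have "exact_at (tensor R (transport h K) M) (tensor R (transport h N) M) (tensor R (transport h' N') M)
           (tensor_map R (transport h N) M id id) (tensor_map R (transport h' N') M g' id)"
    using ff tm idh g'h unfolding faithfully_flat_left_def by blast
  then have ex: "tensor_map R (transport h N) M id id ` carrier (tensor R (transport h K) M) =
      {t \<in> carrier (tensor R (transport h N) M). tensor_map R (transport h' N') M g' id t =
         \<zero>\<^bsub>tensor R (transport h' N') M\<^esub>}"
    by (simp add: exact_at_def a_kernel_def')
  interpret NM: tensor_product R N M using N M by (rule tensor_product.intro)
  interpret N'M: tensor_product R N' M using N' M by (rule tensor_product.intro)
  interpret tNM: tensor_product R "transport h N" M using tm(1) M by (rule tensor_product.intro)
  interpret tN'M: tensor_product R "transport h' N'" M using tm(2) M by (rule tensor_product.intro)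
  interpret tKM: tensor_product R "transport h K" M using tm(3) M by (rule tensor_product.intro)
  note tp = NM.tensor_product_axioms N'M.tensor_product_axioms tNM.tensor_product_axioms
    tN'M.tensor_product_axioms tKM.tensor_product_axioms
  let ?t = "tensor_map R (transport h N) M h id t"
  have hh: "tensor_map R (transport h N) M h id \<in> add_hom NM.T tNM.T"
    by (intro tensor_map_hom tp right_hom_transport h id_left_hom)
  have hh': "tensor_map R (transport h' N') M h' id \<in> add_hom N'M.T tN'M.T"
    by (intro tensor_map_hom tp right_hom_transport h' id_left_hom)
  have gg': "tensor_map R (transport h' N') M g' id \<in> add_hom tNM.T tN'M.T"
    by (intro tensor_map_hom tp g'h id_left_hom)
  have gg: "tensor_map R N' M g id \<in> add_hom NM.T N'M.T"
    by (intro tensor_map_hom tp g id_left_hom)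
  have "tensor_map R (transport h' N') M g' id ?t = tensor_map R (transport h' N') M h' id (tensor_map R N' M g id t)"
  proof (rule NM.add_hom_tensor_eqI[OF tN'M.abelian_group_tensor, where
        f = "\<lambda>t. tensor_map R (transport h' N') M g' id (tensor_map R (transport h N) M h id t)"
        and g = "\<lambda>t. tensor_map R (transport h' N') M h' id (tensor_map R N' M g id t)", OF _ _ _ t])
    show "tensor_map R (transport h' N') M g' id (tensor_map R (transport h N) M h id (NM.pt x y)) =
        tensor_map R (transport h' N') M h' id (tensor_map R N' M g id (NM.pt x y))"
      if "x \<in> carrier N" "y \<in> carrier M" for x y
      using that g'_h[of x] add_hom_closed[OF right_hom_add_hom[OF g], of x]
      by (simp add: tensor_map_pure[OF tp(4,3) g'h id_left_hom] tensor_map_pure[OF tp(3,1) right_hom_transport(1)[OF h] id_left_hom]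
          tensor_map_pure[OF tp(4,2) right_hom_transport(1)[OF h'] id_left_hom] tensor_map_pure[OF tp(2,1) g id_left_hom]
          transport_sel)
  qed (intro add_hom_compose[OF hh gg'] add_hom_compose[OF gg hh'])+
  also have "\<dots> = \<zero>\<^bsub>tN'M.T\<^esub>"
    unfolding gt by (intro add_hom_zero[OF _ _ hh'] N'M.abelian_group_tensor tN'M.abelian_group_tensor)
  finally have "?t \<in> tensor_map R (transport h N) M id id ` carrier tKM.T"
    unfolding ex using add_hom_closed[OF hh t] by simp
  then obtain w where w: "w \<in> carrier tKM.T" "?t = tensor_map R (transport h N) M id id w"
    by blast
  obtain ws where ws: "set ws \<subseteq> carrier (transport h K) \<times> carrier M"
      "w = lsum tKM.T (\<lambda>p. tKM.pt (fst p) (snd p)) ws"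
    using w(1) by (rule tKM.tensor_list)
  \<comment> \<open>The preimage found among the copies is carried back along the inverse of h, term
    by term.\<close>
  let ?inv = "tensor_map R N M (inv_into UNIV h) id"
  have inv: "?inv \<in> add_hom tNM.T NM.T"
    by (intro tensor_map_hom tp right_hom_transport h id_left_hom)
  have "?inv ?t = t"
  proof (rule NM.add_hom_tensor_eqI[OF NM.abelian_group_tensor, where
        f = "\<lambda>t. ?inv (tensor_map R (transport h N) M h id t)" and g = "\<lambda>t. t", OF _ _ _ t])
    show "?inv (tensor_map R (transport h N) M h id (NM.pt x y)) = NM.pt x y"
      if "x \<in> carrier N" "y \<in> carrier M" for x y
      using that h by (simp add: tensor_map_pure[OF tp(3,1) right_hom_transport(1)[OF h] id_left_hom]
          tensor_map_pure[OF tp(1,3) right_hom_transport(2)[OF h] id_left_hom] transport_sel)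
  qed (intro add_hom_compose[OF hh inv] add_hom_id)+
  have cl: "tKM.pt (fst p) (snd p) \<in> carrier tKM.T" if "p \<in> set ws" for p
    using that ws(1) by (intro tKM.pure_closed pairs_fst pairs_snd)
  have idid: "tensor_map R (transport h N) M id id \<in> add_hom tKM.T tNM.T"
    by (intro tensor_map_hom tp idh id_left_hom)
  have "t = ?inv (tensor_map R (transport h N) M id id w)"
    using \<open>?inv ?t = t\<close> w(2) by simp
  also have "\<dots> = lsum NM.T (\<lambda>p. ?inv (tensor_map R (transport h N) M id id (tKM.pt (fst p) (snd p)))) ws"
    unfolding ws(2)
    by (rule add_hom_lsum[OF tKM.abelian_group_tensor NM.abelian_group_tensor add_hom_compose[OF idid inv] cl])
  also have "\<dots> = lsum NM.T (\<lambda>p. NM.pt (inv_into UNIV h (fst p)) (snd p)) ws"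
  proof (rule lsum_cong)
    fix p assume p: "p \<in> set ws"
    have "fst p \<in> carrier (transport h K)" "snd p \<in> carrier M"
      using p ws(1) by (auto intro: pairs_fst pairs_snd)
    moreover from this have "fst p \<in> carrier (transport h N)"
      by (auto simp: transport_sel K_def ker)
    ultimately show "?inv (tensor_map R (transport h N) M id id (tKM.pt (fst p) (snd p))) = NM.pt (inv_into UNIV h (fst p)) (snd p)"
      by (simp add: tensor_map_pure[OF tp(3,5) idh id_left_hom]
          tensor_map_pure[OF tp(1,3) right_hom_transport(2)[OF h] id_left_hom])
  qed
  finally have "t = lsum NM.T (\<lambda>p. NM.pt (fst p) (snd p)) (map (\<lambda>p. (inv_into UNIV h (fst p), snd p)) ws)"
    by (simp add: lsum_map)
  moreover have "set (map (\<lambda>p. (inv_into UNIV h (fst p), snd p)) ws) \<subseteq> a_kernel N N' g \<times> carrier M"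
    using ws(1) h by (fastforce simp: transport_sel K_def)
  ultimately show thesis by (rule that[rotated])
qed

text \<open>The other half, reflection of exactness. The assumption \<open>gen\<close> says that K
  \<otimes> M \<rightarrow> N \<otimes> M is onto, that is, K \<rightarrow> N \<rightarrow> 0
  becomes exact after tensoring; then it was exact before and K is all of N.\<close>

lemma faithfully_flat_generates:
  fixes N :: "('k, 'c, 'n, 'y) bimodule_scheme" and h :: "'n \<Rightarrow> 'u"
  assumes ff: "faithfully_flat_left TYPE('u) R M"
    and N: "right_module R N" and h: "inj h"
    and K: "additive_subgroup K N" and K_ract: "\<And>x a. x \<in> K \<Longrightarrow> a \<in> carrier R \<Longrightarrow> ract N x a \<in> K"
    and gen: "\<And>x y. x \<in> carrier N \<Longrightarrow> y \<in> carrier M \<Longrightarrow> \<exists>xs. set xs \<subseteq> K \<times> carrier M \<and>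
      pure_tensor R N M x y = lsum (tensor R N M) (\<lambda>p. pure_tensor R N M (fst p) (snd p)) xs"
  shows "carrier N \<subseteq> K"
proof -
  have M: "left_module R M"
    using ff by (simp add: faithfully_flat_left_def)
  interpret N: right_module R N by fact
  define NK where "NK = N\<lparr>carrier := K\<rparr>"
  \<comment> \<open>The zero module is cut out of N, so that the same injection h carries it into
    the test type.\<close>
  define Z where "Z = N\<lparr>carrier := {\<zero>\<^bsub>N\<^esub>}\<rparr>"
  define z where "z = (\<lambda>x :: 'u. h \<zero>\<^bsub>N\<^esub>)"
  have NK: "right_module R NK"
    unfolding NK_def by (rule right_module_restrict[OF N K K_ract])
  have zero: "ract N \<zero>\<^bsub>N\<^esub> a = \<zero>\<^bsub>N\<^esub>" if "a \<in> carrier R" for a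
    using that N.ract_l_distr[of "\<zero>\<^bsub>N\<^esub>" "\<zero>\<^bsub>N\<^esub>" a] N.ract_closed[of "\<zero>\<^bsub>N\<^esub>" a]
    by (metis N.M.add.l_cancel_one' N.M.l_zero N.M.zero_closed)
  have Z: "right_module R Z"
    unfolding Z_def
  proof (rule right_module_restrict[OF N])
    show "additive_subgroup {\<zero>\<^bsub>N\<^esub>} N"
      using group.triv_subgroup[OF N.M.a_group] by (simp add: additive_subgroup_def)
  qed (simp add: zero)
  note tm = right_module_transport[OF N h] right_module_transport[OF Z h] right_module_transport[OF NK h]
  have sub: "K \<subseteq> carrier N"
    using additive_subgroup.a_subset[OF K] .
  have idh: "id \<in> right_hom R (transport h NK) (transport h N)"
    using sub by (intro id_right_hom) (auto simp: transport_def NK_def)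
  have zh: "z \<in> right_hom R (transport h N) (transport h Z)"
    using h zero by (auto simp: right_hom_def hom_def transport_sel z_def Z_def)
  interpret NM: tensor_product R N M using N M by (rule tensor_product.intro)
  interpret tNM: tensor_product R "transport h N" M using tm(1) M by (rule tensor_product.intro)
  interpret tZM: tensor_product R "transport h Z" M using tm(2) M by (rule tensor_product.intro)
  interpret tKM: tensor_product R "transport h NK" M using tm(3) M by (rule tensor_product.intro)
  note tp = NM.tensor_product_axioms tNM.tensor_product_axioms tZM.tensor_product_axioms tKM.tensor_product_axioms
  have idid: "tensor_map R (transport h N) M id id \<in> add_hom tKM.T tNM.T"
    by (intro tensor_map_hom tp idh id_left_hom)
  have hh: "tensor_map R (transport h N) M h id \<in> add_hom NM.T tNM.T"
    by (intro tensor_map_hom tp right_hom_transport h id_left_hom)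
  have zz: "tensor_map R (transport h Z) M z id \<in> add_hom tNM.T tZM.T"
    by (intro tensor_map_hom tp zh id_left_hom)
  have "t \<in> tensor_map R (transport h N) M id id ` carrier tKM.T" if "t \<in> carrier tNM.T" for t
    using that
  proof (induction rule: tNM.tensor_induct)
    case zero
    show ?case
      using add_hom_zero[OF tKM.abelian_group_tensor tNM.abelian_group_tensor idid]
      by (metis image_eqI tKM.T.zero_closed)
  next
    case (diff s t)
    then obtain s' t' where s: "s' \<in> carrier tKM.T" "s = tensor_map R (transport h N) M id id s'"
      and t: "t' \<in> carrier tKM.T" "t = tensor_map R (transport h N) M id id t'"
      by blast
    have "s \<ominus>\<^bsub>tNM.T\<^esub> t = tensor_map R (transport h N) M id id (s' \<ominus>\<^bsub>tKM.T\<^esub> t')"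
      using s t add_hom_add[OF idid] add_hom_a_inv[OF tKM.abelian_group_tensor tNM.abelian_group_tensor idid]
      by (simp add: a_minus_def)
    then show ?case
      using s t by blast
  next
    case (pure x' y)
    then obtain x where x: "x \<in> carrier N" "x' = h x"
      by (auto simp: transport_sel)
    obtain xs where xs: "set xs \<subseteq> K \<times> carrier M" "NM.pt x y = lsum NM.T (\<lambda>p. NM.pt (fst p) (snd p)) xs"
      using gen[OF x(1) pure(2)] by blast
    have xs_in: "fst p \<in> K" "snd p \<in> carrier M" "fst p \<in> carrier N" if "p \<in> set xs" for p
      using that xs(1) sub by (auto dest: pairs_fst pairs_snd)
    let ?w = "lsum tKM.T (\<lambda>p. tKM.pt (h (fst p)) (snd p)) xs"
    have cl: "tKM.pt (h (fst p)) (snd p) \<in> carrier tKM.T" if "p \<in> set xs" for p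
      using xs_in[OF that] by (intro tKM.pure_closed) (auto simp: transport_sel NK_def)
    have h_in: "h k \<in> carrier (transport h NK)" if "k \<in> K" for k
      using that by (simp add: transport_sel NK_def)
    have "tNM.pt x' y = tensor_map R (transport h N) M h id (NM.pt x y)"
      using x pure by (simp add: tensor_map_pure[OF tp(2,1) right_hom_transport(1)[OF h] id_left_hom])
    also have "\<dots> = lsum tNM.T (\<lambda>p. tensor_map R (transport h N) M h id (NM.pt (fst p) (snd p))) xs"
      unfolding xs(2) using xs_in
      by (intro add_hom_lsum[OF NM.abelian_group_tensor tNM.abelian_group_tensor hh] NM.pure_closed)
    also have "\<dots> = lsum tNM.T (\<lambda>p. tensor_map R (transport h N) M id id (tKM.pt (h (fst p)) (snd p))) xs"
      using xs_in by (intro lsum_cong) (simp add: tensor_map_pure[OF tp(2,1) right_hom_transport(1)[OF h] id_left_hom]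
          tensor_map_pure[OF tp(2,4) idh id_left_hom] h_in)
    also have "\<dots> = tensor_map R (transport h N) M id id ?w"
      by (rule add_hom_lsum[OF tKM.abelian_group_tensor tNM.abelian_group_tensor idid cl, symmetric])
    finally show ?case
      using tKM.T.lsum_closed[OF cl] by (rule image_eqI)
  qed
  moreover have "tensor_map R (transport h Z) M z id t = \<zero>\<^bsub>tZM.T\<^esub>" if t: "t \<in> carrier tNM.T" for t
  proof (rule tNM.add_hom_tensor_eqI[OF tZM.abelian_group_tensor zz, where g = "\<lambda>_. \<zero>\<^bsub>tZM.T\<^esub>", OF _ _ t])
    show "(\<lambda>_. \<zero>\<^bsub>tZM.T\<^esub>) \<in> add_hom tNM.T tZM.T"
      by (simp add: hom_def)
    show "tensor_map R (transport h Z) M z id (tNM.pt x y) = \<zero>\<^bsub>tZM.T\<^esub>"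
      if "x \<in> carrier (transport h N)" "y \<in> carrier M" for x y
    proof -
      have "z x = \<zero>\<^bsub>transport h Z\<^esub>"
        by (simp add: z_def transport_sel Z_def)
      then show ?thesis
        using that tZM.pure_zero_left[of y] by (simp add: tensor_map_pure[OF tp(3,2) zh id_left_hom])
    qed
  qed
  ultimately have "exact_at tKM.T tNM.T tZM.T (tensor_map R (transport h N) M id id) (tensor_map R (transport h Z) M z id)"
    using add_hom_closed[OF idid] by (auto simp: exact_at_def a_kernel_def')
  then have "exact_at (transport h NK) (transport h N) (transport h Z) id z"
    using ff tm idh zh unfolding faithfully_flat_left_def by blast
  then show ?thesis
    using h by (auto simp: exact_at_def a_kernel_def' transport_sel z_def Z_def NK_def inj_image_eq_iff)
qed

section \<open>Opposite rings and modules\<close>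

definition op_ring :: "'r ring \<Rightarrow> 'r ring" where
  "op_ring R = R\<lparr>monoid.mult := \<lambda>x y. y \<otimes>\<^bsub>R\<^esub> x\<rparr>"

text \<open>The multiplication is reversed as well, so that applied to S this is the opposite ring
  of S and at the same time a bimodule over the opposite ring of B.\<close>

definition op_module :: "('l, 'r, 'm, 'z) bimodule_scheme \<Rightarrow> ('r, 'l, 'm) bimodule" where
  "op_module M = \<lparr>carrier = carrier M, monoid.mult = \<lambda>x y. y \<otimes>\<^bsub>M\<^esub> x, one = one M, zero = zero M, add = add M,
     lact = (\<lambda>a x. ract M x a), ract = (\<lambda>x a. lact M a x)\<rparr>"

lemma op_ring_sel [simp]:
  "carrier (op_ring R) = carrier R" "one (op_ring R) = one R" "zero (op_ring R) = zero R" "add (op_ring R) = add R"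
  "x \<otimes>\<^bsub>op_ring R\<^esub> y = y \<otimes>\<^bsub>R\<^esub> x"
  by (simp_all add: op_ring_def)

lemma op_module_sel [simp]:
  "carrier (op_module M) = carrier M" "zero (op_module M) = zero M" "add (op_module M) = add M"
  "one (op_module M) = one M" "x \<otimes>\<^bsub>op_module M\<^esub> y = y \<otimes>\<^bsub>M\<^esub> x"
  "lact (op_module M) a x = ract M x a" "ract (op_module M) x b = lact M b x"
  by (simp_all add: op_module_def)

lemma ring_op_ring:
  assumes "ring R"
  shows "ring (op_ring R)"
proof -
  interpret ring R by fact
  show ?thesis
    by (rule ringI) (auto intro: abelian_group_cong[OF abelian_group_axioms] monoidI simp: m_assoc l_distr r_distr)
qed

lemma right_module_op: "left_module R M \<Longrightarrow> right_module (op_ring R) (op_module M)"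
  unfolding left_module_def right_module_def left_module_axioms_def right_module_axioms_def
  by (auto simp: ring_op_ring intro: abelian_group_cong)

lemma left_module_op: "right_module R M \<Longrightarrow> left_module (op_ring R) (op_module M)"
  unfolding left_module_def right_module_def left_module_axioms_def right_module_axioms_def
  by (auto simp: ring_op_ring intro: abelian_group_cong)

lemma op_ring_op_ring [simp]: "op_ring (op_ring R) = R"
  by (simp add: op_ring_def)

lemma left_hom_op: "f \<in> left_hom R (op_module M) (op_module N) \<longleftrightarrow> f \<in> right_hom (op_ring R) M N"
  by (auto simp: left_hom_def right_hom_def hom_def)

text \<open>Exactness in the middle compares the image of the first map with the kernel of the
  second: surjectivity of \<sigma>' matches the images, injectivity of \<sigma>'' matches the
  kernels.\<close>

lemma exact_at_iso:
  assumes "abelian_group X''" and "abelian_group Y''"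
    and "\<sigma>' ` carrier X' = carrier Y'" and "bij_betw \<sigma> (carrier X) (carrier Y)"
    and "\<sigma>'' \<in> add_hom X'' Y''" and "inj_on \<sigma>'' (carrier X'')"
    and f: "\<And>x. x \<in> carrier X' \<Longrightarrow> f x \<in> carrier X" and g: "\<And>x. x \<in> carrier X \<Longrightarrow> g x \<in> carrier X''"
    and "\<And>x. x \<in> carrier X' \<Longrightarrow> f' (\<sigma>' x) = \<sigma> (f x)" and "\<And>x. x \<in> carrier X \<Longrightarrow> g' (\<sigma> x) = \<sigma>'' (g x)"
  shows "exact_at X' X X'' f g \<longleftrightarrow> exact_at Y' Y Y'' f' g'"
proof -
  have inj: "inj_on \<sigma> (carrier X)" and im: "carrier Y = \<sigma> ` carrier X"
    using assms(4) by (auto simp: bij_betw_def)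
  have "f' ` carrier Y' = \<sigma> ` f ` carrier X'"
    unfolding assms(3)[symmetric] image_image using assms(9) by (intro image_cong) auto
  moreover have "g' (\<sigma> x) = \<zero>\<^bsub>Y''\<^esub> \<longleftrightarrow> g x = \<zero>\<^bsub>X''\<^esub>" if "x \<in> carrier X" for x
    using that assms(10)[OF that] g[OF that] add_hom_zero[OF assms(1,2,5)] assms(6)
      abelian_groupE(2)[OF assms(1)] by (metis inj_onD)
  then have "a_kernel Y Y'' g' = \<sigma> ` a_kernel X X'' g"
    unfolding a_kernel_def' im by auto
  moreover have "\<sigma> ` f ` carrier X' = \<sigma> ` a_kernel X X'' g \<longleftrightarrow> f ` carrier X' = a_kernel X X'' g"
    using f by (intro inj_on_image_eq_iff[OF inj]) (auto simp: a_kernel_def')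
  ultimately show ?thesis
    unfolding exact_at_def by simp
qed

text \<open>The twist between N \<otimes> M over the opposite ring and M \<otimes> N over R. It
  appears as an additive isomorphism, exactness being a matter of the underlying groups.\<close>

locale tensor_swap = M: right_module R M + N: right_module "op_ring R" N
  for R :: "'c ring" and M :: "('l, 'c, 'm, 'y) bimodule_scheme" and N :: "('k, 'c, 'n, 'z) bimodule_scheme"
begin

sublocale X: tensor_product "op_ring R" N "op_module M"
  using N.right_module_axioms left_module_op[OF M.right_module_axioms] by (rule tensor_product.intro)

sublocale Y: tensor_product R M "op_module N"
  using M.right_module_axioms left_module_op[OF N.right_module_axioms, simplified] by (rule tensor_product.intro)

definition "swap = tensor_lift Y.T (\<lambda>x y. Y.pt y x)"

definition "unswap = tensor_lift X.T (\<lambda>y x. X.pt x y)"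

lemma balanced_swap: "balanced (op_ring R) N (op_module M) Y.T (\<lambda>x y. Y.pt y x)"
  using Y.pure_closed Y.pure_add_left Y.pure_add_right Y.pure_balanced by (intro balancedI) simp_all

lemma balanced_unswap: "balanced R M (op_module N) X.T (\<lambda>y x. X.pt x y)"
  using X.pure_closed X.pure_add_left X.pure_add_right X.pure_balanced by (intro balancedI) simp_all

lemma swap_hom: "swap \<in> add_hom X.T Y.T"
  and swap_pure: "x \<in> carrier N \<Longrightarrow> y \<in> carrier M \<Longrightarrow> swap (X.pt x y) = Y.pt y x"
  unfolding swap_def
  using X.tensor_lift_hom[OF Y.abelian_group_tensor balanced_swap]
    X.tensor_lift_pure[OF Y.abelian_group_tensor balanced_swap] by simp_all

lemma unswap_hom: "unswap \<in> add_hom Y.T X.T"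
  and unswap_pure: "x \<in> carrier N \<Longrightarrow> y \<in> carrier M \<Longrightarrow> unswap (Y.pt y x) = X.pt x y"
  unfolding unswap_def
  using Y.tensor_lift_hom[OF X.abelian_group_tensor balanced_unswap]
    Y.tensor_lift_pure[OF X.abelian_group_tensor balanced_unswap] by simp_all

lemma unswap_swap: "t \<in> carrier X.T \<Longrightarrow> unswap (swap t) = t"
  by (rule X.add_hom_tensor_eqI[OF X.abelian_group_tensor add_hom_compose[OF swap_hom unswap_hom] add_hom_id])
    (simp_all add: swap_pure unswap_pure)

lemma swap_unswap: "t \<in> carrier Y.T \<Longrightarrow> swap (unswap t) = t"
  by (rule Y.add_hom_tensor_eqI[OF Y.abelian_group_tensor add_hom_compose[OF unswap_hom swap_hom] add_hom_id])
    (simp_all add: swap_pure unswap_pure)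

lemma bij_swap: "bij_betw swap (carrier X.T) (carrier Y.T)"
  by (rule bij_betwI[where g = unswap])
    (auto simp: unswap_swap swap_unswap add_hom_closed[OF swap_hom] add_hom_closed[OF unswap_hom])

end

text \<open>\<open>op_module\<close> turns right test modules over the opposite ring into left test
  modules over R with the same carrier, so the test type \<open>'u\<close> stays the same; the twist
  then compares the tensored sequences.\<close>

lemma faithfully_flat_right_op:
  fixes M :: "('l, 'c, 'm, 'z) bimodule_scheme"
  assumes "faithfully_flat_right TYPE('u) R M"
  shows "faithfully_flat_left TYPE('u) (op_ring R) (op_module M)"
proof -
  have M: "right_module R M"
    using assms by (simp add: faithfully_flat_right_def)
  have "exact_at N' N N'' f g \<longleftrightarrow>
      exact_at (tensor (op_ring R) N' (op_module M)) (tensor (op_ring R) N (op_module M)) (tensor (op_ring R) N'' (op_module M))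
           (tensor_map (op_ring R) N (op_module M) f id) (tensor_map (op_ring R) N'' (op_module M) g id)"
    if N': "right_module (op_ring R) N'" and N: "right_module (op_ring R) N" and N'': "right_module (op_ring R) N''"
      and f: "f \<in> right_hom (op_ring R) N' N" and g: "g \<in> right_hom (op_ring R) N N''"
    for N' N N'' :: "(unit, 'c, 'u) bimodule" and f g
  proof -
    interpret s': tensor_swap R M N' using M N' by (rule tensor_swap.intro)
    interpret s: tensor_swap R M N using M N by (rule tensor_swap.intro)
    interpret s'': tensor_swap R M N'' using M N'' by (rule tensor_swap.intro)
    have lf: "f \<in> left_hom R (op_module N') (op_module N)" and lg: "g \<in> left_hom R (op_module N) (op_module N'')"
      using f g by (simp_all add: left_hom_op)
    have idr: "id \<in> right_hom R M M"
      by (rule id_right_hom) simp_all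
    have idl: "id \<in> left_hom (op_ring R) (op_module M) (op_module M)"
      by (rule id_left_hom)
    note tp = s'.X.tensor_product_axioms s'.Y.tensor_product_axioms s.X.tensor_product_axioms
      s.Y.tensor_product_axioms s''.X.tensor_product_axioms s''.Y.tensor_product_axioms
    have fX: "tensor_map (op_ring R) N (op_module M) f id \<in> add_hom s'.X.T s.X.T"
      by (intro tensor_map_hom tp f idl)
    have gX: "tensor_map (op_ring R) N'' (op_module M) g id \<in> add_hom s.X.T s''.X.T"
      by (intro tensor_map_hom tp g idl)
    have fY: "tensor_map R M (op_module N) id f \<in> add_hom s'.Y.T s.Y.T"
      by (intro tensor_map_hom tp lf idr)
    have gY: "tensor_map R M (op_module N'') id g \<in> add_hom s.Y.T s''.Y.T"
      by (intro tensor_map_hom tp lg idr)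
    have fc: "f x \<in> carrier N" if "x \<in> carrier N'" for x
      using that by (rule add_hom_closed[OF right_hom_add_hom[OF f]])
    have gc: "g x \<in> carrier N''" if "x \<in> carrier N" for x
      using that by (rule add_hom_closed[OF right_hom_add_hom[OF g]])
    have "exact_at N' N N'' f g \<longleftrightarrow> exact_at (op_module N') (op_module N) (op_module N'') f g"
      by (simp add: exact_at_def a_kernel_def')
    also have "\<dots> \<longleftrightarrow> exact_at s'.Y.T s.Y.T s''.Y.T (tensor_map R M (op_module N) id f) (tensor_map R M (op_module N'') id g)"
      using assms left_module_op[OF N'] left_module_op[OF N] left_module_op[OF N''] lf lg
      unfolding faithfully_flat_right_def by simp
    also have "\<dots> \<longleftrightarrow> exact_at s'.X.T s.X.T s''.X.T (tensor_map (op_ring R) N (op_module M) f id) (tensor_map (op_ring R) N'' (op_module M) g id)"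
    proof (rule exact_at_iso[OF s''.X.abelian_group_tensor s''.Y.abelian_group_tensor _ s.bij_swap s''.swap_hom, symmetric])
      show "s'.swap ` carrier s'.X.T = carrier s'.Y.T"
        using s'.bij_swap by (simp add: bij_betw_def)
      show "inj_on s''.swap (carrier s''.X.T)"
        using s''.bij_swap by (simp add: bij_betw_def)
      show "tensor_map (op_ring R) N (op_module M) f id t \<in> carrier s.X.T" if "t \<in> carrier s'.X.T" for t
        using that by (rule add_hom_closed[OF fX])
      show "tensor_map (op_ring R) N'' (op_module M) g id t \<in> carrier s''.X.T" if "t \<in> carrier s.X.T" for t
        using that by (rule add_hom_closed[OF gX])
      show "tensor_map R M (op_module N) id f (s'.swap t) = s.swap (tensor_map (op_ring R) N (op_module M) f id t)"
        if "t \<in> carrier s'.X.T" for t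
        by (rule s'.X.add_hom_tensor_eqI[OF s.Y.abelian_group_tensor add_hom_compose[OF s'.swap_hom fY]
              add_hom_compose[OF fX s.swap_hom] _ that])
          (simp add: s'.swap_pure s.swap_pure fc tensor_map_pure[OF tp(4,2) idr lf] tensor_map_pure[OF tp(3,1) f idl])
      show "tensor_map R M (op_module N'') id g (s.swap t) = s''.swap (tensor_map (op_ring R) N'' (op_module M) g id t)"
        if "t \<in> carrier s.X.T" for t
        by (rule s.X.add_hom_tensor_eqI[OF s''.Y.abelian_group_tensor add_hom_compose[OF s.swap_hom gY]
              add_hom_compose[OF gX s''.swap_hom] _ that])
          (simp add: s.swap_pure s''.swap_pure gc tensor_map_pure[OF tp(6,4) idr lg] tensor_map_pure[OF tp(5,3) g idl])
    qed
    finally show ?thesis .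
  qed
  then show ?thesis
    unfolding faithfully_flat_left_def using left_module_op[OF M] by blast
qed

lemma lsum_op: "lsum (op_module M) = lsum M"
  by (intro ext) (simp add: lsum_def)

lemma bimodule_op: "bimodule L R M \<Longrightarrow> bimodule (op_ring R) (op_ring L) (op_module M)"
  by (rule bimodule.intro[OF left_module_op[OF bimodule_right] right_module_op[OF bimodule_left]])
    (auto simp: bimodule.lact_ract intro!: bimodule_axioms.intro)

lemma ring_op_module:
  assumes "ring M"
  shows "ring (op_module M)"
proof -
  interpret ring M by fact
  have "abelian_group (op_module M)"
    by (rule abelian_group_cong[OF abelian_group_axioms]) simp_all
  moreover have "monoid (op_module M)"
    by (rule monoidI) (simp_all add: m_assoc)
  ultimately show ?thesis
    by (rule ringI) (simp_all add: l_distr r_distr)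
qed

section \<open>Faithfully flat ring extensions\<close>

text \<open>One setting for both faithfully flat cases: \<Sigma> with evaluation of endomorphisms,
  and over the opposite rings \<Sigma>^* with composition on the other side. By
  \<open>one_lact\<close> the two actions of B on 1 give the same map from B to S, which makes s
  \<mapsto> s \<otimes> 1 right linear.\<close>

locale extension_module = S: ring S + SB: bimodule B B S + P: left_module B P
  for B :: "'b ring" and S :: "('b, 'b, 's, 'z) bimodule_scheme" and P :: "('b, 'r, 'p, 'y) bimodule_scheme" +
  fixes act :: "'s \<Rightarrow> 'p \<Rightarrow> 'p"
  assumes mult_ract: "\<lbrakk>s \<in> carrier S; t \<in> carrier S; b \<in> carrier B\<rbrakk> \<Longrightarrow> s \<otimes>\<^bsub>S\<^esub> ract S t b = ract S (s \<otimes>\<^bsub>S\<^esub> t) b"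
    and one_lact: "b \<in> carrier B \<Longrightarrow> lact S b \<one>\<^bsub>S\<^esub> = ract S \<one>\<^bsub>S\<^esub> b"
    and balanced_act: "balanced B S P P act"
    and act_one: "u \<in> carrier P \<Longrightarrow> act \<one>\<^bsub>S\<^esub> u = u"
begin

sublocale SP: tensor_product B S P
  using SB.right_module_axioms P.left_module_axioms by (rule tensor_product.intro)

sublocale SS: tensor_bimodule_right B B S S
  using SB.right_module_axioms SB.bimodule_axioms by (rule tensor_bimodule_right.intro)

sublocale SSP: tensor_product B SS.T P
  using SS.right_module_tensor P.left_module_axioms by (rule tensor_product.intro)

lemma act_closed: "s \<in> carrier S \<Longrightarrow> u \<in> carrier P \<Longrightarrow> act s u \<in> carrier P"
  by (rule balancedD(4)[OF balanced_act])

lemma act_lift_hom: "tensor_lift P act \<in> add_hom SP.T P"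
  by (rule SP.tensor_lift_hom[OF P.abelian_group_axioms balanced_act])

text \<open>The map \<open>g\<close> has to be right B-linear before it can be tensored with P;
  \<open>c_ract\<close> and \<open>one_ract\<close> provide this. Flatness writes t as a sum of s
  \<otimes> v with s in the kernel of \<open>g\<close>. The action S \<otimes> P \<rightarrow> P
  sends t to u, by \<open>unit\<close>, and so yields the decomposition of u.\<close>

lemma faithfully_flat_descend:
  fixes h :: "'s \<Rightarrow> 'u" and h' :: "('s \<times> 's \<Rightarrow>\<^sub>0 int) set \<Rightarrow> 'u"
  assumes ff: "faithfully_flat_left TYPE('u) B P" and "inj h" and "inj h'"
    and xs: "set xs \<subseteq> carrier S \<times> carrier S" and u: "u \<in> carrier P"
    and cocycle: "lsum SSP.T (\<lambda>q. lsum SSP.T (\<lambda>p. SSP.pt (SS.pt (fst p) (snd p \<otimes>\<^bsub>S\<^esub> fst q)) (act (snd q) u)) xs) xs =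
      lsum SSP.T (\<lambda>q. SSP.pt (SS.pt (fst q) \<one>\<^bsub>S\<^esub>) (act (snd q) u)) xs"
    and unit: "lsum P (\<lambda>q. act (fst q) (act (snd q) u)) xs = u"
  obtains ws where "set ws \<subseteq> {s \<in> carrier S. lsum SS.T (\<lambda>p. SS.pt (fst p) (snd p \<otimes>\<^bsub>S\<^esub> s)) xs = SS.pt s \<one>\<^bsub>S\<^esub>} \<times> carrier P"
    and "u = lsum P (\<lambda>p. act (fst p) (snd p)) ws"
proof -
  have x: "fst p \<in> carrier S" "snd p \<in> carrier S" if "p \<in> set xs" for p
    using that xs by (auto dest: pairs_fst pairs_snd)
  define c where "c = (\<lambda>s. lsum SS.T (\<lambda>p. SS.pt (fst p) (snd p \<otimes>\<^bsub>S\<^esub> s)) xs)"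
  define g where "g = (\<lambda>s. c s \<ominus>\<^bsub>SS.T\<^esub> SS.pt s \<one>\<^bsub>S\<^esub>)"
  have c_hom: "c \<in> add_hom S SS.T"
    unfolding c_def
  proof (rule add_hom_lsum_fun[OF SS.abelian_group_tensor])
    show "(\<lambda>s. SS.pt (fst p) (snd p \<otimes>\<^bsub>S\<^esub> s)) \<in> add_hom S SS.T" if "p \<in> set xs" for p
      using x[OF that] by (intro add_homI) (simp_all add: SS.pure_closed S.r_distr SS.pure_add_right)
  qed
  have c_ract: "c (ract S s b) = ract SS.T (c s) b" if "s \<in> carrier S" "b \<in> carrier B" for s b
  proof -
    have "c (ract S s b) = lsum SS.T (\<lambda>p. ract SS.T (SS.pt (fst p) (snd p \<otimes>\<^bsub>S\<^esub> s)) b) xs"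
      unfolding c_def using x that by (intro lsum_cong) (simp add: SS.tensor_ract_pure mult_ract)
    also have "\<dots> = ract SS.T (c s) b"
      unfolding c_def using x that
      by (intro add_hom_lsum[OF SS.abelian_group_tensor SS.abelian_group_tensor SS.tensor_ract_hom, symmetric])
        (simp_all add: SS.pure_closed)
    finally show ?thesis .
  qed
  have neg: "ract SS.T (\<ominus>\<^bsub>SS.T\<^esub> t) b = \<ominus>\<^bsub>SS.T\<^esub> ract SS.T t b" if "t \<in> carrier SS.T" "b \<in> carrier B" for t b
    using add_hom_a_inv[OF SS.abelian_group_tensor SS.abelian_group_tensor SS.tensor_ract_hom[OF that(2)] that(1)] .
  have one_ract: "SS.pt (ract S s b) \<one>\<^bsub>S\<^esub> = ract SS.T (SS.pt s \<one>\<^bsub>S\<^esub>) b" if "s \<in> carrier S" "b \<in> carrier B" for s b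
    using that by (simp add: SS.pure_balanced SS.tensor_ract_pure one_lact)
  have g_hom: "g \<in> right_hom B S SS.T"
    unfolding right_hom_def
  proof (intro CollectI conjI ballI)
    show "g \<in> add_hom S SS.T"
      using add_hom_closed[OF c_hom] by (intro add_homI)
        (simp_all add: g_def a_minus_def add_hom_add[OF c_hom] SS.pure_closed SS.pure_add_left SS.T.minus_add SS.T.a_ac)
    show "g (ract S s b) = ract SS.T (g s) b" if "s \<in> carrier S" "b \<in> carrier B" for s b
      using that add_hom_closed[OF c_hom] add_hom_add[OF SS.tensor_ract_hom[OF that(2)]]
      by (simp add: g_def a_minus_def c_ract one_ract SS.pure_closed neg)
  qed
  define t where "t = lsum SP.T (\<lambda>q. SP.pt (fst q) (act (snd q) u)) xs"
  have t_in: "SP.pt (fst q) (act (snd q) u) \<in> carrier SP.T" if "q \<in> set xs" for q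
    using x[OF that] u by (simp add: SP.pure_closed act_closed)
  have gm: "tensor_map B SS.T P g id \<in> add_hom SP.T SSP.T"
    by (rule tensor_map_hom[OF SSP.tensor_product_axioms SP.tensor_product_axioms g_hom id_left_hom])
  have "tensor_map B SS.T P g id t = lsum SSP.T (\<lambda>q. SSP.pt (g (fst q)) (act (snd q) u)) xs"
    unfolding t_def
    apply (subst add_hom_lsum[OF SP.abelian_group_tensor SSP.abelian_group_tensor gm t_in], assumption)
    apply (rule lsum_cong)
    using x u by (simp add: tensor_map_pure[OF SSP.tensor_product_axioms SP.tensor_product_axioms g_hom id_left_hom] act_closed)
  also have "\<dots> = lsum SSP.T (\<lambda>q. lsum SSP.T (\<lambda>p. SSP.pt (SS.pt (fst p) (snd p \<otimes>\<^bsub>S\<^esub> fst q)) (act (snd q) u)) xs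
      \<ominus>\<^bsub>SSP.T\<^esub> SSP.pt (SS.pt (fst q) \<one>\<^bsub>S\<^esub>) (act (snd q) u)) xs"
  proof (rule lsum_cong)
    fix q assume q: "q \<in> set xs"
    have "SSP.pt (g (fst q)) (act (snd q) u) =
        SSP.pt (c (fst q)) (act (snd q) u) \<ominus>\<^bsub>SSP.T\<^esub> SSP.pt (SS.pt (fst q) \<one>\<^bsub>S\<^esub>) (act (snd q) u)"
      using x[OF q] u add_hom_closed[OF c_hom]
      by (simp add: g_def a_minus_def SSP.pure_add_left SSP.pure_neg_left SS.pure_closed act_closed)
    moreover have "SSP.pt (c (fst q)) (act (snd q) u) =
        lsum SSP.T (\<lambda>p. SSP.pt (SS.pt (fst p) (snd p \<otimes>\<^bsub>S\<^esub> fst q)) (act (snd q) u)) xs"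
      unfolding c_def using x x[OF q] u by (intro SSP.pure_lsum_left) (simp_all add: SS.pure_closed act_closed)
    ultimately show "SSP.pt (g (fst q)) (act (snd q) u) =
        lsum SSP.T (\<lambda>p. SSP.pt (SS.pt (fst p) (snd p \<otimes>\<^bsub>S\<^esub> fst q)) (act (snd q) u)) xs
          \<ominus>\<^bsub>SSP.T\<^esub> SSP.pt (SS.pt (fst q) \<one>\<^bsub>S\<^esub>) (act (snd q) u)"
      by simp
  qed
  also have "\<dots> = \<zero>\<^bsub>SSP.T\<^esub>"
  proof (subst lsum_diff[OF SSP.abelian_group_tensor])
    show b: "SSP.pt (SS.pt (fst q) \<one>\<^bsub>S\<^esub>) (act (snd q) u) \<in> carrier SSP.T" if "q \<in> set xs" for q
      using x[OF that] u by (intro SSP.pure_closed SS.pure_closed act_closed) simp_all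
    show "lsum SSP.T (\<lambda>p. SSP.pt (SS.pt (fst p) (snd p \<otimes>\<^bsub>S\<^esub> fst q)) (act (snd q) u)) xs \<in> carrier SSP.T"
      if "q \<in> set xs" for q
      using x x[OF that] u by (intro SSP.T.lsum_closed SSP.pure_closed SS.pure_closed act_closed) simp_all
    show "lsum SSP.T (\<lambda>q. lsum SSP.T (\<lambda>p. SSP.pt (SS.pt (fst p) (snd p \<otimes>\<^bsub>S\<^esub> fst q)) (act (snd q) u)) xs) xs
        \<ominus>\<^bsub>SSP.T\<^esub> lsum SSP.T (\<lambda>q. SSP.pt (SS.pt (fst q) \<one>\<^bsub>S\<^esub>) (act (snd q) u)) xs = \<zero>\<^bsub>SSP.T\<^esub>"
      unfolding cocycle a_minus_def by (rule SSP.T.r_neg[OF SSP.T.lsum_closed[OF b]])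
  qed
  finally have "tensor_map B SS.T P g id t = \<zero>\<^bsub>SSP.T\<^esub>" .
  moreover have "t \<in> carrier SP.T"
    unfolding t_def by (rule SP.T.lsum_closed[OF t_in])
  ultimately obtain ws where ws: "set ws \<subseteq> a_kernel S SS.T g \<times> carrier P"
      "t = lsum SP.T (\<lambda>p. SP.pt (fst p) (snd p)) ws"
    using faithfully_flat_kernel[OF ff SB.right_module_axioms SS.right_module_tensor assms(2,3) g_hom] by blast
  have ker: "a_kernel S SS.T g \<subseteq> {s \<in> carrier S. c s = SS.pt s \<one>\<^bsub>S\<^esub>}"
    using add_hom_closed[OF c_hom] SS.T.minus_zeroD[of "c s" "SS.pt s \<one>\<^bsub>S\<^esub>" for s]
    unfolding a_kernel_def' g_def using SS.pure_closed[OF _ S.one_closed] by blast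
  have "tensor_lift P act t = lsum P (\<lambda>q. tensor_lift P act (SP.pt (fst q) (act (snd q) u))) xs"
    unfolding t_def by (rule add_hom_lsum[OF SP.abelian_group_tensor P.abelian_group_axioms act_lift_hom t_in])
  also have "\<dots> = lsum P (\<lambda>q. act (fst q) (act (snd q) u)) xs"
    using x u by (intro lsum_cong) (simp add: SP.tensor_lift_pure[OF P.abelian_group_axioms balanced_act] act_closed)
  also note unit
  finally have "u = tensor_lift P act t" by simp
  also have "\<dots> = lsum P (\<lambda>p. act (fst p) (snd p)) ws"
    unfolding ws(2) using ws(1) ker by (intro SP.tensor_lift_lsum[OF P.abelian_group_axioms balanced_act]) auto
  finally show thesis
    using ws(1) ker that[of ws] by (auto simp: c_def)
qed

text \<open>In B \<otimes> P a pure tensor b \<otimes> u equals 1 \<otimes> bu; writing bu as an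
  element of I P and moving the coefficients back to the left shows that I generates B \<otimes>
  P.\<close>

lemma faithfully_flat_ideal:
  fixes h :: "'b \<Rightarrow> 'u"
  assumes ff: "faithfully_flat_left TYPE('u) B P" and "inj h"
    and "additive_subgroup I B" and "\<And>x b. x \<in> I \<Longrightarrow> b \<in> carrier B \<Longrightarrow> x \<otimes>\<^bsub>B\<^esub> b \<in> I"
    and gen: "\<And>u. u \<in> carrier P \<Longrightarrow> \<exists>xs. set xs \<subseteq> I \<times> carrier P \<and> u = lsum P (\<lambda>p. lact P (fst p) (snd p)) xs"
  shows "carrier B \<subseteq> I"
proof -
  interpret R: bimodule B B "regular_bimodule B"
    by (rule bimodule_regular[OF SB.L.ring_axioms])
  interpret RP: tensor_product B "regular_bimodule B" P
    using R.right_module_axioms P.left_module_axioms by (rule tensor_product.intro)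
  have sub: "I \<subseteq> carrier B"
    using additive_subgroup.a_subset[OF assms(3)] .
  have "carrier (regular_bimodule B) \<subseteq> I"
  proof (rule faithfully_flat_generates[OF ff R.right_module_axioms assms(2)])
    show "additive_subgroup I (regular_bimodule B)"
      using additive_subgroup.a_subgroup[OF assms(3)]
      by (auto simp: additive_subgroup_def subgroup_def m_inv_def)
    show "\<exists>xs. set xs \<subseteq> I \<times> carrier P \<and> RP.pt b u = lsum RP.T (\<lambda>p. RP.pt (fst p) (snd p)) xs"
      if "b \<in> carrier (regular_bimodule B)" "u \<in> carrier P" for b u
    proof -
      from that obtain xs where xs: "set xs \<subseteq> I \<times> carrier P" "lact P b u = lsum P (\<lambda>p. lact P (fst p) (snd p)) xs"
        using gen[of "lact P b u"] P.lact_closed by auto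
      have x: "fst p \<in> carrier B" "snd p \<in> carrier P" if "p \<in> set xs" for p
        using that xs(1) sub by (auto dest: pairs_fst pairs_snd)
      have move: "RP.pt \<one>\<^bsub>B\<^esub> (lact P b u) = RP.pt b u" if "b \<in> carrier B" "u \<in> carrier P" for b u
        using that RP.pure_balanced[of "\<one>\<^bsub>B\<^esub>" b u] by simp
      have "RP.pt b u = RP.pt \<one>\<^bsub>B\<^esub> (lact P b u)"
        using that by (simp add: move)
      also have "\<dots> = lsum RP.T (\<lambda>p. RP.pt \<one>\<^bsub>B\<^esub> (lact P (fst p) (snd p))) xs"
        unfolding xs(2) using x by (intro RP.pure_lsum_right) (simp_all add: P.lact_closed)
      also have "\<dots> = lsum RP.T (\<lambda>p. RP.pt (fst p) (snd p)) xs"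
        using x by (intro lsum_cong) (simp add: move)
      finally show ?thesis
        using xs(1) by blast
    qed
  qed (use assms(4) in simp)
  then show ?thesis by simp
qed

text \<open>The module X of all s with s \<otimes> u = 1 \<otimes> su contains the image K of B. In
  X \<otimes> P the tensor s \<otimes> u can be rewritten as 1 \<otimes> su with 1 in K, so K
  generates X after tensoring and hence equals X.\<close>

lemma faithfully_flat_base:
  fixes h :: "'s \<Rightarrow> 'u"
  assumes ff: "faithfully_flat_left TYPE('u) B P" and "inj h"
    and t: "t \<in> carrier S" and t_act: "\<And>u. u \<in> carrier P \<Longrightarrow> SP.pt t u = SP.pt \<one>\<^bsub>S\<^esub> (act t u)"
  shows "\<exists>b\<in>carrier B. t = ract S \<one>\<^bsub>S\<^esub> b"
proof -
  define X where "X = {s \<in> carrier S. \<forall>u\<in>carrier P. SP.pt s u = SP.pt \<one>\<^bsub>S\<^esub> (act s u)}"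
  define N where "N = S\<lparr>carrier := X\<rparr>"
  define K where "K = (\<lambda>b. ract S \<one>\<^bsub>S\<^esub> b) ` carrier B"
  note act = act_closed add_hom_add[OF balancedD(2)[OF balanced_act]] balancedD(3)[OF balanced_act]
  have neg: "act (\<ominus>\<^bsub>S\<^esub> s) u = \<ominus>\<^bsub>P\<^esub> act s u" if "s \<in> carrier S" "u \<in> carrier P" for s u
    using add_hom_a_inv[OF S.abelian_group_axioms P.abelian_group_axioms balancedD(2)[OF balanced_act]] that by simp
  have neg_right: "SP.pt \<one>\<^bsub>S\<^esub> (\<ominus>\<^bsub>P\<^esub> u) = \<ominus>\<^bsub>SP.T\<^esub> SP.pt \<one>\<^bsub>S\<^esub> u" if "u \<in> carrier P" for u
    using add_hom_a_inv[OF P.abelian_group_axioms SP.abelian_group_tensor balancedD(1)[OF SP.balanced_pure]] that by simp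
  have X: "additive_subgroup X S"
  proof (intro additive_subgroup.intro subgroup.intro)
    show "\<one>\<^bsub>add_monoid S\<^esub> \<in> X"
      using add_hom_zero[OF S.abelian_group_axioms P.abelian_group_axioms balancedD(2)[OF balanced_act]]
      by (simp add: X_def SP.pure_zero_left SP.pure_zero_right)
    show "inv\<^bsub>add_monoid S\<^esub> x \<in> X" if "x \<in> X" for x
      using that unfolding a_inv_def[symmetric] by (simp add: X_def SP.pure_neg_left neg act neg_right)
  qed (auto simp: X_def SP.pure_add_left SP.pure_add_right act)
  have N: "right_module B N"
    unfolding N_def
    by (rule right_module_restrict[OF SB.right_module_axioms X])
      (auto simp: X_def SB.ract_closed SP.pure_balanced P.lact_closed act)
  interpret N: right_module B N by fact
  interpret NP: tensor_product B N P
    using N P.left_module_axioms by (rule tensor_product.intro)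
  have KX: "K \<subseteq> X"
    by (auto simp: K_def X_def SB.ract_closed SP.pure_balanced P.lact_closed act act_one)
  have K: "additive_subgroup K N"
  proof (intro additive_subgroup.intro group.subgroupI N.M.a_group)
    show "K \<subseteq> carrier (add_monoid N)" using KX by (simp add: N_def)
    show "K \<noteq> {}" using SB.L.zero_closed by (auto simp: K_def)
    show "k \<otimes>\<^bsub>add_monoid N\<^esub> k' \<in> K" if kk: "k \<in> K" "k' \<in> K" for k k'
    proof -
      from kk obtain b b' where b: "b \<in> carrier B" "k = ract S \<one>\<^bsub>S\<^esub> b" "b' \<in> carrier B" "k' = ract S \<one>\<^bsub>S\<^esub> b'"
        unfolding K_def by blast
      then have "k \<otimes>\<^bsub>add_monoid N\<^esub> k' = ract S \<one>\<^bsub>S\<^esub> (b \<oplus>\<^bsub>B\<^esub> b')"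
        by (simp add: N_def SB.ract_r_distr)
      then show ?thesis using b unfolding K_def by (intro image_eqI[of _ _ "b \<oplus>\<^bsub>B\<^esub> b'"]) simp_all
    qed
    show "inv\<^bsub>add_monoid N\<^esub> k \<in> K" if "k \<in> K" for k
    proof -
      from that obtain b where b: "b \<in> carrier B" "k = ract S \<one>\<^bsub>S\<^esub> b"
        unfolding K_def by blast
      have "ract S \<one>\<^bsub>S\<^esub> \<zero>\<^bsub>B\<^esub> = \<zero>\<^bsub>S\<^esub>"
        using SB.ract_r_distr[of "\<one>\<^bsub>S\<^esub>" "\<zero>\<^bsub>B\<^esub>" "\<zero>\<^bsub>B\<^esub>"] SB.ract_closed[of "\<one>\<^bsub>S\<^esub>" "\<zero>\<^bsub>B\<^esub>"]
        by (metis SB.L.l_zero SB.L.zero_closed S.add.l_cancel_one' S.one_closed)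
      then have "ract S \<one>\<^bsub>S\<^esub> (\<ominus>\<^bsub>B\<^esub> b) \<oplus>\<^bsub>N\<^esub> k = \<zero>\<^bsub>N\<^esub>"
        using b by (simp add: N_def SB.L.l_neg flip: SB.ract_r_distr)
      moreover have "ract S \<one>\<^bsub>S\<^esub> (\<ominus>\<^bsub>B\<^esub> b) \<in> K"
        using b by (simp add: K_def)
      ultimately have "inv\<^bsub>add_monoid N\<^esub> k = ract S \<one>\<^bsub>S\<^esub> (\<ominus>\<^bsub>B\<^esub> b)"
        using that KX by (intro group.inv_equality[OF N.M.a_group]) (auto simp: N_def)
      then show ?thesis
        using \<open>ract S \<one>\<^bsub>S\<^esub> (\<ominus>\<^bsub>B\<^esub> b) \<in> K\<close> by simp
    qed
  qed
  have "carrier N \<subseteq> K"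
  proof (rule faithfully_flat_generates[OF ff N assms(2) K])
    show "ract N x a \<in> K" if "x \<in> K" "a \<in> carrier B" for x a
    proof -
      from that obtain b where b: "b \<in> carrier B" "x = ract S \<one>\<^bsub>S\<^esub> b"
        unfolding K_def by blast
      then have "ract N x a = ract S \<one>\<^bsub>S\<^esub> (b \<otimes>\<^bsub>B\<^esub> a)"
        using that by (simp add: N_def SB.ract_assoc)
      then show ?thesis using b that by (simp add: K_def)
    qed
    fix s u assume s: "s \<in> carrier N" and u: "u \<in> carrier P"
    have s': "s \<in> carrier S" "SP.pt s u = SP.pt \<one>\<^bsub>S\<^esub> (act s u)"
      using s u by (auto simp: N_def X_def)
    have one: "\<one>\<^bsub>S\<^esub> \<in> K" "\<one>\<^bsub>S\<^esub> \<in> carrier N"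
      using KX SB.ract_one[of "\<one>\<^bsub>S\<^esub>"] SB.L.one_closed unfolding K_def N_def by force+
    \<comment> \<open>The equation s \<otimes> u = 1 \<otimes> su is given in S \<otimes> P.
      Flatness, applied to the inclusion of X into S with its zero kernel, makes X \<otimes> P
      \<rightarrow> S \<otimes> P injective, so the equation already holds in X \<otimes> P.\<close>
    let ?d = "NP.pt s u \<ominus>\<^bsub>NP.T\<^esub> NP.pt \<one>\<^bsub>S\<^esub> (act s u)"
    have idh: "id \<in> right_hom B N S"
      by (rule id_right_hom) (auto simp: N_def X_def)
    have idm: "tensor_map B S P id id \<in> add_hom NP.T SP.T"
      by (rule tensor_map_hom[OF SP.tensor_product_axioms NP.tensor_product_axioms idh id_left_hom])
    have cl: "NP.pt s u \<in> carrier NP.T" "NP.pt \<one>\<^bsub>S\<^esub> (act s u) \<in> carrier NP.T"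
      using s u one s'(1) by (simp_all add: NP.pure_closed act_closed)
    note idp = tensor_map_pure[OF SP.tensor_product_axioms NP.tensor_product_axioms idh id_left_hom]
    have "tensor_map B S P id id (NP.pt s u) = SP.pt s u"
      using idp[OF s u] by simp
    moreover have "tensor_map B S P id id (NP.pt \<one>\<^bsub>S\<^esub> (act s u)) = SP.pt \<one>\<^bsub>S\<^esub> (act s u)"
      using idp[OF one(2) act_closed[OF s'(1) u]] by simp
    ultimately have "tensor_map B S P id id ?d = \<zero>\<^bsub>SP.T\<^esub>"
      unfolding a_minus_def using cl s' u
      by (simp add: add_hom_add[OF idm] add_hom_a_inv[OF NP.abelian_group_tensor SP.abelian_group_tensor idm]
          SP.T.r_neg SP.pure_closed act_closed)
    moreover have "?d \<in> carrier NP.T"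
      using cl by simp
    ultimately obtain ws where ws: "set ws \<subseteq> a_kernel N S id \<times> carrier P" "?d = lsum NP.T (\<lambda>p. NP.pt (fst p) (snd p)) ws"
      using faithfully_flat_kernel[OF ff N SB.right_module_axioms assms(2,2) idh] by blast
    have "a_kernel N S id \<subseteq> {\<zero>\<^bsub>N\<^esub>}"
      by (auto simp: a_kernel_def' N_def)
    then have "NP.pt (fst p) (snd p) = \<zero>\<^bsub>NP.T\<^esub>" if "p \<in> set ws" for p
      using pairs_fst[OF ws(1) that] pairs_snd[OF ws(1) that] NP.pure_zero_left by auto
    then have "?d = \<zero>\<^bsub>NP.T\<^esub>"
      unfolding ws(2) by (rule NP.T.lsum_zero)
    then have "NP.pt s u = NP.pt \<one>\<^bsub>S\<^esub> (act s u)"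
      by (rule NP.T.minus_zeroD[OF _ cl])
    then show "\<exists>xs. set xs \<subseteq> K \<times> carrier P \<and> NP.pt s u = lsum NP.T (\<lambda>p. NP.pt (fst p) (snd p)) xs"
      using one(1) cl(2) act_closed[OF s'(1) u] NP.T.r_zero[OF cl(2)]
      by (intro exI[of _ "[(\<one>\<^bsub>S\<^esub>, act s u)]"]) (simp del: NP.T.r_zero)
  qed
  moreover have "t \<in> carrier N"
    using t t_act by (simp add: N_def X_def)
  ultimately have "t \<in> K" ..
  then show ?thesis
    unfolding K_def by (rule imageE) (rule bexI)
qed

end

section \<open>The comatrix coring and the endomorphism ring\<close>

text \<open>Here \<open>P\<close> is \<Sigma> and, below, \<open>Q\<close> its right dual. The
  assumption concerns the particular basis selected by \<open>dual_basis\<close>, since the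
  comultiplication of \<open>comatrix_coring\<close> is computed with it.\<close>

locale comatrix = Sg: bimodule B A P
  for A :: "'a ring" and B :: "'b ring" and P :: "('b, 'a, 'm) bimodule" +
  assumes dual_basis: "is_dual_basis A P (dual_basis A P)"
begin

declare Sg.ract_closed [simp] Sg.lact_closed [simp]

abbreviation "Q \<equiv> right_dual A P"
abbreviation "S \<equiv> end_ring A P"
abbreviation "C \<equiv> tensor B Q P"
abbreviation "CC \<equiv> tensor A C C"
abbreviation "tens \<equiv> pure_tensor B Q P"
abbreviation "tens2 \<equiv> pure_tensor A C C"
abbreviation "cmp \<equiv> compose (carrier P)"
abbreviation "cm \<equiv> canonical_map P"
text \<open>The image of v \<otimes> f under the isomorphism of \<Sigma> \<otimes> \<Sigma>^* over A
  with S.\<close>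

abbreviation "rk v f \<equiv> (\<lambda>x\<in>carrier P. ract P v (f x))"

lemma S_sel [simp]:
  "carrier S = right_hom A P P \<inter> extensional (carrier P)" "monoid.mult S = cmp" "one S = (\<lambda>x\<in>carrier P. x)"
  "zero S = (\<lambda>x\<in>carrier P. \<zero>\<^bsub>P\<^esub>)" "add S = (\<lambda>f g. \<lambda>x\<in>carrier P. f x \<oplus>\<^bsub>P\<^esub> g x)"
  "lact S b s = cmp (cm b) s" "ract S s b = cmp s (cm b)"
  by (simp_all add: end_ring_def)

lemma Q_sel [simp]:
  "zero Q = (\<lambda>x\<in>carrier P. \<zero>\<^bsub>A\<^esub>)" "add Q = (\<lambda>f g. \<lambda>x\<in>carrier P. f x \<oplus>\<^bsub>A\<^esub> g x)"
  "lact Q a f = (\<lambda>x\<in>carrier P. a \<otimes>\<^bsub>A\<^esub> f x)"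
  by (simp_all add: right_dual_def)

lemma S_iff: "s \<in> carrier S \<longleftrightarrow> s \<in> extensional (carrier P) \<and> (\<forall>u\<in>carrier P. s u \<in> carrier P) \<and>
   (\<forall>u\<in>carrier P. \<forall>v\<in>carrier P. s (u \<oplus>\<^bsub>P\<^esub> v) = s u \<oplus>\<^bsub>P\<^esub> s v) \<and>
   (\<forall>u\<in>carrier P. \<forall>a\<in>carrier A. s (ract P u a) = ract P (s u) a)"
  by (auto simp: right_hom_def hom_def)

lemma Q_iff: "f \<in> carrier Q \<longleftrightarrow> f \<in> extensional (carrier P) \<and> (\<forall>u\<in>carrier P. f u \<in> carrier A) \<and>
   (\<forall>u\<in>carrier P. \<forall>v\<in>carrier P. f (u \<oplus>\<^bsub>P\<^esub> v) = f u \<oplus>\<^bsub>A\<^esub> f v) \<and>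
   (\<forall>u\<in>carrier P. \<forall>a\<in>carrier A. f (ract P u a) = f u \<otimes>\<^bsub>A\<^esub> a)"
  by (auto simp: right_dual_def right_hom_def hom_def)

declare S_sel(1) [simp del]

lemma S_app: "s \<in> carrier S \<Longrightarrow> u \<in> carrier P \<Longrightarrow> s u \<in> carrier P"
  and S_add: "s \<in> carrier S \<Longrightarrow> u \<in> carrier P \<Longrightarrow> v \<in> carrier P \<Longrightarrow> s (u \<oplus>\<^bsub>P\<^esub> v) = s u \<oplus>\<^bsub>P\<^esub> s v"
  and S_ract: "s \<in> carrier S \<Longrightarrow> u \<in> carrier P \<Longrightarrow> a \<in> carrier A \<Longrightarrow> s (ract P u a) = ract P (s u) a"
  by (simp_all add: S_iff)

lemma Q_app: "f \<in> carrier Q \<Longrightarrow> u \<in> carrier P \<Longrightarrow> f u \<in> carrier A"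
  and Q_add: "f \<in> carrier Q \<Longrightarrow> u \<in> carrier P \<Longrightarrow> v \<in> carrier P \<Longrightarrow> f (u \<oplus>\<^bsub>P\<^esub> v) = f u \<oplus>\<^bsub>A\<^esub> f v"
  and Q_ract: "f \<in> carrier Q \<Longrightarrow> u \<in> carrier P \<Longrightarrow> a \<in> carrier A \<Longrightarrow> f (ract P u a) = f u \<otimes>\<^bsub>A\<^esub> a"
  by (simp_all add: Q_iff)

lemma S_eqI: "s \<in> carrier S \<Longrightarrow> t \<in> carrier S \<Longrightarrow> (\<And>u. u \<in> carrier P \<Longrightarrow> s u = t u) \<Longrightarrow> s = t"
  by (auto simp: S_iff intro: extensionalityI)

lemma Q_eqI: "f \<in> carrier Q \<Longrightarrow> g \<in> carrier Q \<Longrightarrow> (\<And>u. u \<in> carrier P \<Longrightarrow> f u = g u) \<Longrightarrow> f = g"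
  by (auto simp: Q_iff intro: extensionalityI)

lemma cmp_app [simp]: "u \<in> carrier P \<Longrightarrow> cmp f s u = f (s u)"
  by (simp add: compose_eq)

lemma cm_app [simp]: "u \<in> carrier P \<Longrightarrow> cm b u = lact P b u"
  by (simp add: canonical_map_def)

lemma cm_in_S: "b \<in> carrier B \<Longrightarrow> cm b \<in> carrier S"
  by (simp add: S_iff Sg.lact_closed Sg.lact_r_distr Sg.lact_ract) (simp add: canonical_map_def)

lemma cmp_S: "s \<in> carrier S \<Longrightarrow> t \<in> carrier S \<Longrightarrow> cmp s t \<in> carrier S"
  by (simp add: S_iff)

lemma cmp_Q: "f \<in> carrier Q \<Longrightarrow> t \<in> carrier S \<Longrightarrow> cmp f t \<in> carrier Q"
  by (simp add: S_iff Q_iff)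

lemma rk_S: "v \<in> carrier P \<Longrightarrow> f \<in> carrier Q \<Longrightarrow> rk v f \<in> carrier S"
  by (simp add: S_iff Q_iff Sg.ract_closed Sg.ract_r_distr Sg.ract_assoc)

lemma one_S: "(\<lambda>x\<in>carrier P. x) \<in> carrier S"
  by (simp add: S_iff Sg.ract_closed)

lemma S_ring: "ring S"
proof (rule ringI)
  show "abelian_group S"
  proof (rule abelian_groupI)
    fix s assume s: "s \<in> carrier S"
    have "(\<lambda>x\<in>carrier P. \<ominus>\<^bsub>P\<^esub> s x) \<in> carrier S"
      using s add_hom_a_inv[OF Sg.M.abelian_group_axioms Sg.M.abelian_group_axioms, of "\<lambda>x. ract P x a" for a]
      by (auto simp: S_iff Sg.M.minus_add hom_def Sg.ract_closed Sg.ract_l_distr)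
    then show "\<exists>t\<in>carrier S. t \<oplus>\<^bsub>S\<^esub> s = \<zero>\<^bsub>S\<^esub>"
      using s by (intro bexI[of _ "\<lambda>x\<in>carrier P. \<ominus>\<^bsub>P\<^esub> s x"]) (auto simp: Sg.M.l_neg S_iff)
  next
    have "ract P \<zero>\<^bsub>P\<^esub> a = \<zero>\<^bsub>P\<^esub>" if "a \<in> carrier A" for a
      using add_hom_zero[OF Sg.M.abelian_group_axioms Sg.M.abelian_group_axioms, of "\<lambda>x. ract P x a"] that
      by (simp add: hom_def Sg.ract_closed Sg.ract_l_distr)
    then show "\<zero>\<^bsub>S\<^esub> \<in> carrier S" by (simp add: S_iff)
  qed (auto simp: S_iff Sg.M.a_ac Sg.ract_l_distr fun_eq_iff extensional_def)
  show "monoid S"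
  proof (rule monoidI)
    show "\<one>\<^bsub>S\<^esub> \<otimes>\<^bsub>S\<^esub> s = s" "s \<otimes>\<^bsub>S\<^esub> \<one>\<^bsub>S\<^esub> = s" if "s \<in> carrier S" for s
      using that by (auto intro!: S_eqI simp: cmp_S one_S S_app)
    show "s \<otimes>\<^bsub>S\<^esub> t \<otimes>\<^bsub>S\<^esub> r = s \<otimes>\<^bsub>S\<^esub> (t \<otimes>\<^bsub>S\<^esub> r)"
      if "s \<in> carrier S" "t \<in> carrier S" "r \<in> carrier S" for s t r
      using that by (auto intro!: S_eqI simp: cmp_S S_app)
  qed (simp_all add: cmp_S one_S)
  show "(s \<oplus>\<^bsub>S\<^esub> t) \<otimes>\<^bsub>S\<^esub> r = s \<otimes>\<^bsub>S\<^esub> r \<oplus>\<^bsub>S\<^esub> t \<otimes>\<^bsub>S\<^esub> r"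
    "r \<otimes>\<^bsub>S\<^esub> (s \<oplus>\<^bsub>S\<^esub> t) = r \<otimes>\<^bsub>S\<^esub> s \<oplus>\<^bsub>S\<^esub> r \<otimes>\<^bsub>S\<^esub> t"
    if "s \<in> carrier S" "t \<in> carrier S" "r \<in> carrier S" for s t r
    using that by (auto simp: fun_eq_iff compose_def S_app S_add)
qed

sublocale S: ring S by (rule S_ring)

lemma cm_mult: "b \<in> carrier B \<Longrightarrow> c \<in> carrier B \<Longrightarrow> cm (b \<otimes>\<^bsub>B\<^esub> c) = cmp (cm b) (cm c)"
  by (auto intro!: S_eqI simp: cm_in_S cmp_S Sg.lact_assoc Sg.lact_closed)

lemma cm_add: "b \<in> carrier B \<Longrightarrow> c \<in> carrier B \<Longrightarrow> cm (b \<oplus>\<^bsub>B\<^esub> c) = cm b \<oplus>\<^bsub>S\<^esub> cm c"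
  by (auto simp: canonical_map_def fun_eq_iff Sg.lact_l_distr)

lemma cm_one: "cm \<one>\<^bsub>B\<^esub> = \<one>\<^bsub>S\<^esub>"
  by (auto simp: canonical_map_def fun_eq_iff Sg.lact_one)

lemma cmp_assoc:
  "s \<in> carrier S \<Longrightarrow> t \<in> carrier S \<Longrightarrow> r \<in> carrier S \<Longrightarrow> cmp (cmp s t) r = cmp s (cmp t r)"
  using S.m_assoc by simp

lemma cmp_assoc_Q:
  "f \<in> carrier Q \<Longrightarrow> t \<in> carrier S \<Longrightarrow> r \<in> carrier S \<Longrightarrow> cmp (cmp f t) r = cmp f (cmp t r)"
  by (auto intro!: Q_eqI simp: cmp_S cmp_Q S_app)

lemma ract_Q: "ract Q f b = cmp f (cm b)"
  by (auto simp: right_dual_def compose_def fun_eq_iff)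

lemma S_bimodule: "bimodule B B S"
proof (intro bimodule.intro left_module.intro right_module.intro left_module_axioms.intro
        right_module_axioms.intro bimodule_axioms.intro)
  show "ring B" "ring B" by (fact Sg.L.ring_axioms)+
  show "abelian_group S" "abelian_group S" by (fact S.abelian_group_axioms)+
qed (use S.l_distr S.r_distr in \<open>simp_all add: cm_in_S cmp_S cm_mult cm_one cmp_assoc cm_add del: S_sel(5)\<close>,
    use S.l_one S.r_one in simp_all)

lemma Q_bimodule: "bimodule A B Q"
proof (intro bimodule.intro left_module.intro right_module.intro left_module_axioms.intro
        right_module_axioms.intro bimodule_axioms.intro)
  show "ring A" "ring B" by (fact Sg.L.ring_axioms Sg.R.ring_axioms)+
  show "abelian_group Q"
  proof (rule abelian_groupI)
    fix f assume f: "f \<in> carrier Q"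
    then show "\<exists>t\<in>carrier Q. t \<oplus>\<^bsub>Q\<^esub> f = \<zero>\<^bsub>Q\<^esub>"
      by (intro bexI[of _ "\<lambda>x\<in>carrier P. \<ominus>\<^bsub>A\<^esub> f x"])
        (auto simp: Sg.R.l_neg Q_iff Sg.R.minus_add Sg.R.l_minus)
  qed (auto simp: Q_iff Sg.R.a_ac Sg.R.l_distr fun_eq_iff extensional_def)
  then show "abelian_group Q" .
qed (auto simp: ract_Q cmp_Q cm_in_S cm_mult cmp_assoc_Q Q_iff Sg.R.m_assoc Sg.R.l_distr Sg.R.r_distr
    Sg.lact_closed Sg.lact_l_distr Sg.lact_r_distr Sg.lact_assoc Sg.lact_one Sg.lact_ract[symmetric]
    fun_eq_iff extensional_def compose_def)

sublocale SB: bimodule B B S by (rule S_bimodule)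
sublocale Q: bimodule A B Q by (rule Q_bimodule)

sublocale C: tensor_bimodule_left A B Q P
  using Q.bimodule_axioms Sg.left_module_axioms by (rule tensor_bimodule_left.intro)

sublocale Cr: tensor_bimodule_right A B Q P
  using Q.right_module_axioms Sg.bimodule_axioms by (rule tensor_bimodule_right.intro)

sublocale C: bimodule A A C
  by (rule bimodule_tensor[OF Q.bimodule_axioms Sg.bimodule_axioms])

sublocale CC: tensor_bimodule_left A A C C
  using C.bimodule_axioms C.left_module_axioms by (rule tensor_bimodule_left.intro)

declare S_sel(4,5) [simp del] Q_sel [simp del]

lemma S_plus_app: "u \<in> carrier P \<Longrightarrow> (s \<oplus>\<^bsub>S\<^esub> t) u = s u \<oplus>\<^bsub>P\<^esub> t u"
  by (simp add: S_sel)

lemma Q_plus_app: "u \<in> carrier P \<Longrightarrow> (f \<oplus>\<^bsub>Q\<^esub> g) u = f u \<oplus>\<^bsub>A\<^esub> g u"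
  and Q_lact_app: "u \<in> carrier P \<Longrightarrow> lact Q a f u = a \<otimes>\<^bsub>A\<^esub> f u"
  by (simp_all add: Q_sel)

lemma app_hom: "s \<in> carrier S \<Longrightarrow> s \<in> add_hom P P"
  by (simp add: hom_def S_app S_add)

lemma eval_hom: "u \<in> carrier P \<Longrightarrow> (\<lambda>s. s u) \<in> add_hom S P"
  by (simp add: hom_def S_app S_plus_app)

lemma Q_app_hom: "f \<in> carrier Q \<Longrightarrow> f \<in> add_hom P A"
  by (simp add: hom_def Q_app Q_add)

lemma Q_eval_hom: "u \<in> carrier P \<Longrightarrow> (\<lambda>f. f u) \<in> add_hom Q A"
  by (simp add: hom_def Q_app Q_plus_app)

lemma cmp_Q_hom: "t \<in> carrier S \<Longrightarrow> (\<lambda>f. cmp f t) \<in> add_hom Q Q"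
  by (auto simp: hom_def cmp_Q Q_plus_app S_app intro!: Q_eqI)

lemma cmp_Q_hom': "f \<in> carrier Q \<Longrightarrow> cmp f \<in> add_hom S Q"
  by (auto simp: hom_def cmp_Q Q_plus_app S_plus_app S_app Q_add intro!: Q_eqI)

lemma cmp_S_hom: "t \<in> carrier S \<Longrightarrow> (\<lambda>f. cmp f t) \<in> add_hom S S"
  using S.l_distr by (simp add: hom_def cmp_S)

lemma cmp_S_hom': "f \<in> carrier S \<Longrightarrow> cmp f \<in> add_hom S S"
  using S.r_distr by (simp add: hom_def cmp_S)

lemma rk_hom: "f \<in> carrier Q \<Longrightarrow> (\<lambda>v. rk v f) \<in> add_hom P S"
  by (auto simp: hom_def rk_S S_plus_app Sg.ract_l_distr Q_app intro!: S_eqI)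

lemma rk_hom': "v \<in> carrier P \<Longrightarrow> (\<lambda>f. rk v f) \<in> add_hom Q S"
  by (auto simp: hom_def rk_S S_plus_app Q_plus_app Sg.ract_r_distr Q_app intro!: S_eqI)

lemma cmp_rk: "s \<in> carrier S \<Longrightarrow> v \<in> carrier P \<Longrightarrow> f \<in> carrier Q \<Longrightarrow> cmp s (rk v f) = rk (s v) f"
  by (rule S_eqI) (simp_all add: cmp_S rk_S S_app S_ract Q_app)

lemma rk_cmp: "s \<in> carrier S \<Longrightarrow> v \<in> carrier P \<Longrightarrow> f \<in> carrier Q \<Longrightarrow> cmp (rk v f) s = rk v (cmp f s)"
  by (rule S_eqI) (simp_all add: cmp_S cmp_Q rk_S S_app Q_app)

lemma cmp_Q_rk: "g \<in> carrier Q \<Longrightarrow> v \<in> carrier P \<Longrightarrow> f \<in> carrier Q \<Longrightarrow> cmp g (rk v f) = lact Q (g v) f"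
  by (rule Q_eqI) (simp_all add: cmp_Q rk_S Q_app Q_ract Q_lact_app Q.lact_closed)

section \<open>Sums over the dual basis\<close>

definition ds :: "('m \<times> ('m \<Rightarrow> 'a)) list" where
  "ds = (SOME xs. set xs = dual_basis A P \<and> distinct xs)"

lemma set_ds: "set ds = dual_basis A P" and distinct_ds: "distinct ds"
proof -
  have "\<exists>xs. set xs = dual_basis A P \<and> distinct xs"
    using dual_basis by (intro finite_distinct_list) (simp add: is_dual_basis_def)
  then have "set ds = dual_basis A P \<and> distinct ds"
    unfolding ds_def by (rule someI_ex)
  then show "set ds = dual_basis A P" "distinct ds" by simp_all
qed

lemma ds_in: "e \<in> set ds \<Longrightarrow> fst e \<in> carrier P" "e \<in> set ds \<Longrightarrow> snd e \<in> carrier Q"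
  using dual_basis by (auto simp: set_ds is_dual_basis_def)

lemma dual_expand:
  assumes "u \<in> carrier P"
  shows "lsum P (\<lambda>e. ract P (fst e) (snd e u)) ds = u"
proof -
  have "u = (\<Oplus>\<^bsub>P\<^esub>e\<in>set ds. ract P (fst e) (snd e u))"
    using dual_basis assms by (simp add: is_dual_basis_def set_ds)
  also have "\<dots> = lsum P (\<lambda>e. ract P (fst e) (snd e u)) ds"
    using assms by (intro Sg.M.finsum_eq_lsum distinct_ds) (simp add: ds_in Q_app)
  finally show ?thesis by simp
qed

lemma lsum_S_app: "(\<And>i. i \<in> set xs \<Longrightarrow> h i \<in> carrier S) \<Longrightarrow> u \<in> carrier P \<Longrightarrow>
    lsum S h xs u = lsum P (\<lambda>i. h i u) xs"
  by (rule add_hom_lsum[OF S.abelian_group_axioms Sg.M.abelian_group_axioms eval_hom])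

lemma lsum_Q_app: "(\<And>i. i \<in> set xs \<Longrightarrow> h i \<in> carrier Q) \<Longrightarrow> u \<in> carrier P \<Longrightarrow>
    lsum Q h xs u = lsum A (\<lambda>i. h i u) xs"
  by (rule add_hom_lsum[OF Q.M.abelian_group_axioms Sg.R.abelian_group_axioms Q_eval_hom])

lemma dual_one: "lsum S (\<lambda>e. rk (fst e) (snd e)) ds = \<one>\<^bsub>S\<^esub>"
proof (rule S_eqI)
  have in_S: "rk (fst e) (snd e) \<in> carrier S" if "e \<in> set ds" for e
    using that by (simp add: rk_S ds_in)
  then show "lsum S (\<lambda>e. rk (fst e) (snd e)) ds \<in> carrier S"
    by (rule S.lsum_closed)
  show "lsum S (\<lambda>e. rk (fst e) (snd e)) ds u = \<one>\<^bsub>S\<^esub> u" if "u \<in> carrier P" for u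
    using that dual_expand[OF that] by (simp add: lsum_S_app[OF in_S])
qed (simp add: one_S)

text \<open>Insert 1 = \<Sum> e_i e_i^* between s and t; the rank-one maps absorb s on the left and
  t on the right.\<close>

lemma dual_cmp:
  assumes "s \<in> carrier S" and "t \<in> carrier S"
  shows "lsum S (\<lambda>e. rk (s (fst e)) (cmp (snd e) t)) ds = cmp s t"
proof -
  have "lsum S (\<lambda>e. rk (s (fst e)) (cmp (snd e) t)) ds = lsum S (\<lambda>e. cmp (cmp s (rk (fst e) (snd e))) t) ds"
    using assms by (intro lsum_cong) (simp add: cmp_rk rk_cmp ds_in S_app)
  also have "\<dots> = cmp (cmp s (lsum S (\<lambda>e. rk (fst e) (snd e)) ds)) t"
    using assms by (intro add_hom_lsum[OF S.abelian_group_axioms S.abelian_group_axioms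
          add_hom_compose[OF cmp_S_hom' cmp_S_hom], symmetric]) (simp_all add: rk_S ds_in)
  also have "\<dots> = cmp s t"
    using assms S.r_one by (simp add: dual_one)
  finally show ?thesis .
qed

lemma cmp_Q_one: "f \<in> carrier Q \<Longrightarrow> cmp f \<one>\<^bsub>S\<^esub> = f"
  by (rule Q_eqI) (simp_all add: cmp_Q one_S)

lemma dual_S:
  assumes "s \<in> carrier S"
  shows "lsum S (\<lambda>e. rk (s (fst e)) (snd e)) ds = s"
proof -
  have "lsum S (\<lambda>e. rk (s (fst e)) (snd e)) ds = lsum S (\<lambda>e. rk (s (fst e)) (cmp (snd e) \<one>\<^bsub>S\<^esub>)) ds"
    by (rule lsum_cong) (simp only: cmp_Q_one ds_in)
  then show ?thesis
    using dual_cmp[OF assms S.one_closed] S.r_one[OF assms] by simp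
qed

lemma dual_Q:
  assumes "f \<in> carrier Q"
  shows "lsum Q (\<lambda>e. lact Q (f (fst e)) (snd e)) ds = f"
proof -
  have "lsum Q (\<lambda>e. lact Q (f (fst e)) (snd e)) ds = lsum Q (\<lambda>e. cmp f (rk (fst e) (snd e))) ds"
    using assms by (intro lsum_cong) (simp add: cmp_Q_rk ds_in)
  also have "\<dots> = cmp f (lsum S (\<lambda>e. rk (fst e) (snd e)) ds)"
    by (rule add_hom_lsum[OF S.abelian_group_axioms Q.M.abelian_group_axioms cmp_Q_hom', symmetric])
      (simp_all add: assms rk_S ds_in)
  also have "\<dots> = f"
    unfolding dual_one by (rule cmp_Q_one[OF assms])
  finally show ?thesis .
qed

text \<open>The element \<Sum> e_i \<otimes> e_i^* of \<Sigma> \<otimes> \<Sigma>^* commutes with S,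
  as it corresponds to 1. It is expressed through balanced maps \<gamma>, without forming that
  tensor product. The proof expands e_i^* t in the dual basis, moves the coefficients across
  \<gamma> and collects them by \<open>dual_expand\<close>.\<close>

lemma casimir:
  assumes "abelian_group G" and "balanced A P Q G \<gamma>" and "s \<in> carrier S" and "t \<in> carrier S"
  shows "lsum G (\<lambda>e. \<gamma> (s (fst e)) (cmp (snd e) t)) ds = lsum G (\<lambda>e. \<gamma> (s (t (fst e))) (snd e)) ds"
proof -
  interpret G: abelian_group G by fact
  note \<gamma> = balancedD[OF assms(2)]
  have c: "snd e (t (fst e')) \<in> carrier A" if "e \<in> set ds" "e' \<in> set ds" for e e'
    using that assms by (simp add: ds_in S_app Q_app)
  have "lsum G (\<lambda>e. \<gamma> (s (fst e)) (cmp (snd e) t)) ds =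
      lsum G (\<lambda>e. lsum G (\<lambda>e'. \<gamma> (ract P (s (fst e)) (snd e (t (fst e')))) (snd e')) ds) ds"
  proof (rule lsum_cong)
    fix e assume e: "e \<in> set ds"
    have "\<gamma> (s (fst e)) (cmp (snd e) t) = \<gamma> (s (fst e)) (lsum Q (\<lambda>e'. lact Q (cmp (snd e) t (fst e')) (snd e')) ds)"
      using e assms by (subst dual_Q) (simp_all add: cmp_Q ds_in)
    also have "\<dots> = lsum G (\<lambda>e'. \<gamma> (s (fst e)) (lact Q (cmp (snd e) t (fst e')) (snd e'))) ds"
      using e assms c by (intro add_hom_lsum[OF Q.M.abelian_group_axioms assms(1) \<gamma>(1)])
        (simp_all add: S_app ds_in Q.lact_closed)
    also have "\<dots> = lsum G (\<lambda>e'. \<gamma> (ract P (s (fst e)) (snd e (t (fst e')))) (snd e')) ds"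
      using e assms c by (intro lsum_cong) (simp add: \<gamma>(3) ds_in S_app)
    finally show "\<gamma> (s (fst e)) (cmp (snd e) t) =
        lsum G (\<lambda>e'. \<gamma> (ract P (s (fst e)) (snd e (t (fst e')))) (snd e')) ds" .
  qed
  also have "\<dots> = lsum G (\<lambda>e'. lsum G (\<lambda>e. \<gamma> (ract P (s (fst e)) (snd e (t (fst e')))) (snd e')) ds) ds"
    using assms c by (intro G.lsum_commute) (simp add: \<gamma>(4) ds_in S_app)
  also have "\<dots> = lsum G (\<lambda>e'. \<gamma> (s (t (fst e'))) (snd e')) ds"
  proof (rule lsum_cong)
    fix e' assume e': "e' \<in> set ds"
    have "lsum G (\<lambda>e. \<gamma> (ract P (s (fst e)) (snd e (t (fst e')))) (snd e')) ds =
        lsum G (\<lambda>e. \<gamma> (s (ract P (fst e) (snd e (t (fst e'))))) (snd e')) ds"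
      using e' assms c by (intro lsum_cong) (simp add: S_ract ds_in)
    also have "\<dots> = \<gamma> (s (lsum P (\<lambda>e. ract P (fst e) (snd e (t (fst e')))) ds)) (snd e')"
      using e' assms c by (intro add_hom_lsum[OF Sg.M.abelian_group_axioms assms(1)
            add_hom_compose[OF app_hom \<gamma>(2)], symmetric]) (simp_all add: ds_in)
    also have "\<dots> = \<gamma> (s (t (fst e'))) (snd e')"
      using e' assms by (subst dual_expand) (simp_all add: S_app ds_in)
    finally show "lsum G (\<lambda>e. \<gamma> (ract P (s (fst e)) (snd e (t (fst e')))) (snd e')) ds = \<gamma> (s (t (fst e'))) (snd e')" .
  qed
  finally show ?thesis .
qed

section \<open>Comultiplication and counit of the comatrix coring on pure tensors\<close>

abbreviation "D \<equiv> comatrix_coring A B P"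

lemma D_sel [simp]: "carrier D = carrier C" "add D = add C" "zero D = zero C" "lact D = lact C" "ract D = ract C"
  and comult_D: "comult D = tensor_lift CC (\<lambda>f u. \<Oplus>\<^bsub>CC\<^esub>p\<in>dual_basis A P. tens2 (tens f (fst p)) (tens (snd p) u))"
  and counit_D: "counit D = tensor_lift A (\<lambda>f u. f u)"
  by (simp_all add: comatrix_coring_def comatrix_bimodule_def Let_def bimodule.defs coring.defs)

text \<open>\<open>D\<close> and \<open>C\<close> are records of different types, but a tensor
  product only reads carrier, addition, zero and the actions; so coring morphisms of
  \<open>D\<close> can be described with \<open>CC\<close> alone.\<close>

lemma tensor_D: "pure_tensor A D D = tens2" "tensor_map A D D = tensor_map A C C"
proof -
  have "tensor_rels A D D = tensor_rels A C C"
    by (simp add: tensor_rels_def)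
  then have *: "tensor_kernel A D D = tensor_kernel A C C"
    by (simp add: tensor_kernel_def)
  then show pt: "pure_tensor A D D = tens2"
    by (intro ext) (simp add: pure_tensor_def)
  have g: "tensor_group A D D = tensor_group A C C"
    using * by (simp add: tensor_group_def)
  have "tensor A D D = CC"
    by (simp add: tensor_def tensor_ring_def g pt)
  then show "tensor_map A D D = tensor_map A C C"
    by (intro ext) (simp add: tensor_map_def pt)
qed

lemma tens_closed: "f \<in> carrier Q \<Longrightarrow> u \<in> carrier P \<Longrightarrow> tens f u \<in> carrier C"
  by (rule C.pure_closed)

lemma tens_cm: "f \<in> carrier Q \<Longrightarrow> b \<in> carrier B \<Longrightarrow> u \<in> carrier P \<Longrightarrow> tens (cmp f (cm b)) u = tens f (lact P b u)"
  using C.pure_balanced[of f b u] by (simp add: ract_Q)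

lemma balanced_CC: "f \<in> carrier Q \<Longrightarrow> u \<in> carrier P \<Longrightarrow> balanced A P Q CC (\<lambda>v g. tens2 (tens f v) (tens g u))"
  by (rule balancedI) (simp_all add: tens_closed CC.pure_closed C.pure_add_left C.pure_add_right
      CC.pure_add_left CC.pure_add_right CC.pure_balanced flip: C.tensor_lact_pure Cr.tensor_ract_pure)

text \<open>Compatibility with B is the identity \<open>casimir\<close> for the endomorphism given
  by b: fb \<otimes> e_i becomes f \<otimes> b e_i, then b passes to e_i^*, and e_i^* b \<otimes> u
  becomes e_i^* \<otimes> bu.\<close>

lemma balanced_comult:
  "balanced B Q P CC (\<lambda>f u. \<Oplus>\<^bsub>CC\<^esub>p\<in>dual_basis A P. tens2 (tens f (fst p)) (tens (snd p) u))"
  (is "balanced B Q P CC ?\<beta>")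
  and comult_lsum: "f \<in> carrier Q \<Longrightarrow> u \<in> carrier P \<Longrightarrow>
     (\<Oplus>\<^bsub>CC\<^esub>p\<in>dual_basis A P. tens2 (tens f (fst p)) (tens (snd p) u)) =
     lsum CC (\<lambda>e. tens2 (tens f (fst e)) (tens (snd e) u)) ds"
proof -
  have cl: "tens2 (tens f (fst e)) (tens (snd e) u) \<in> carrier CC"
    if "f \<in> carrier Q" "u \<in> carrier P" "e \<in> set ds" for f u e
    using that by (simp add: tens_closed CC.pure_closed ds_in)
  show eq: "?\<beta> f u = lsum CC (\<lambda>e. tens2 (tens f (fst e)) (tens (snd e) u)) ds"
    if "f \<in> carrier Q" "u \<in> carrier P" for f u
    unfolding set_ds[symmetric] using that by (intro CC.T.finsum_eq_lsum distinct_ds cl)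
  show "balanced B Q P CC ?\<beta>"
  proof (rule balancedI)
    fix f u assume "f \<in> carrier Q" "u \<in> carrier P"
    then show "?\<beta> f u \<in> carrier CC"
      by (simp add: eq CC.T.lsum_closed cl)
  next
    fix f f' u assume "f \<in> carrier Q" "f' \<in> carrier Q" "u \<in> carrier P"
    then show "?\<beta> (f \<oplus>\<^bsub>Q\<^esub> f') u = ?\<beta> f u \<oplus>\<^bsub>CC\<^esub> ?\<beta> f' u"
      by (simp add: eq cl tens_closed ds_in C.pure_add_left CC.pure_add_left flip: CC.T.lsum_add cong: lsum_cong)
  next
    fix f u u' assume "f \<in> carrier Q" "u \<in> carrier P" "u' \<in> carrier P"
    then show "?\<beta> f (u \<oplus>\<^bsub>P\<^esub> u') = ?\<beta> f u \<oplus>\<^bsub>CC\<^esub> ?\<beta> f u'"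
      by (simp add: eq cl tens_closed ds_in C.pure_add_right CC.pure_add_right flip: CC.T.lsum_add cong: lsum_cong)
  next
    fix f b u assume *: "f \<in> carrier Q" "b \<in> carrier B" "u \<in> carrier P"
    have "?\<beta> (ract Q f b) u = lsum CC (\<lambda>e. tens2 (tens f (\<one>\<^bsub>S\<^esub> (cm b (fst e)))) (tens (snd e) u)) ds"
      using * by (subst eq) (simp_all add: ract_Q cmp_Q cm_in_S tens_cm ds_in cong: lsum_cong)
    also have "\<dots> = lsum CC (\<lambda>e. tens2 (tens f (\<one>\<^bsub>S\<^esub> (fst e))) (tens (cmp (snd e) (cm b)) u)) ds"
      using * by (intro casimir[OF CC.abelian_group_tensor balanced_CC, symmetric] S.one_closed cm_in_S)
    also have "\<dots> = ?\<beta> f (lact P b u)"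
      using * by (subst eq) (simp_all add: tens_cm ds_in cong: lsum_cong)
    finally show "?\<beta> (ract Q f b) u = ?\<beta> f (lact P b u)" .
  qed
qed

lemma comult_hom: "comult D \<in> add_hom C CC"
  unfolding comult_D by (rule C.tensor_lift_hom[OF CC.abelian_group_tensor balanced_comult])

lemma comult_tens:
  "f \<in> carrier Q \<Longrightarrow> u \<in> carrier P \<Longrightarrow>
     comult D (tens f u) = lsum CC (\<lambda>e. tens2 (tens f (fst e)) (tens (snd e) u)) ds"
  unfolding comult_D by (simp add: C.tensor_lift_pure[OF CC.abelian_group_tensor balanced_comult] comult_lsum)

lemma balanced_counit: "balanced B Q P A (\<lambda>f u. f u)"
  by (rule balancedI) (simp_all add: Q_app Q_plus_app Q_add ract_Q)

lemma counit_hom: "counit D \<in> add_hom C A"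
  unfolding counit_D by (rule C.tensor_lift_hom[OF Sg.R.abelian_group_axioms balanced_counit])

lemma counit_tens: "f \<in> carrier Q \<Longrightarrow> u \<in> carrier P \<Longrightarrow> counit D (tens f u) = f u"
  unfolding counit_D by (simp add: C.tensor_lift_pure[OF Sg.R.abelian_group_axioms balanced_counit])

end

section \<open>Invertible sub-bimodules and coring automorphisms\<close>

context comatrix
begin

declare S_sel(3) [simp del]

lemma one_app [simp]: "u \<in> carrier P \<Longrightarrow> \<one>\<^bsub>S\<^esub> u = u"
  by (simp add: S_sel(3))

section \<open>Coring morphisms and the automorphism group\<close>

abbreviation "tmap \<equiv> tensor_map A C C"

lemma coring_hom_iff: "\<phi> \<in> coring_hom A D D \<longleftrightarrow> \<phi> \<in> add_hom C C \<and>
    (\<forall>a\<in>carrier A. \<forall>c\<in>carrier C. \<phi> (lact C a c) = lact C a (\<phi> c)) \<and>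
    (\<forall>c\<in>carrier C. \<forall>a\<in>carrier A. \<phi> (ract C c a) = ract C (\<phi> c) a) \<and>
    (\<forall>c\<in>carrier C. comult D (\<phi> c) = tmap \<phi> \<phi> (comult D c)) \<and>
    (\<forall>c\<in>carrier C. counit D (\<phi> c) = counit D c)"
  by (auto simp: coring_hom_def left_hom_def right_hom_def tensor_D hom_def)

lemma coring_homD:
  assumes "\<phi> \<in> coring_hom A D D"
  shows "\<phi> \<in> add_hom C C"
    and "\<And>a c. a \<in> carrier A \<Longrightarrow> c \<in> carrier C \<Longrightarrow> \<phi> (lact C a c) = lact C a (\<phi> c)"
    and "\<And>a c. a \<in> carrier A \<Longrightarrow> c \<in> carrier C \<Longrightarrow> \<phi> (ract C c a) = ract C (\<phi> c) a"
    and "\<And>c. c \<in> carrier C \<Longrightarrow> comult D (\<phi> c) = tmap \<phi> \<phi> (comult D c)"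
    and "\<And>c. c \<in> carrier C \<Longrightarrow> counit D (\<phi> c) = counit D c"
    and "\<And>c. c \<in> carrier C \<Longrightarrow> \<phi> c \<in> carrier C"
    and "\<phi> \<in> left_hom A C C" and "\<phi> \<in> right_hom A C C"
proof -
  show hom: "\<phi> \<in> add_hom C C"
    using assms by (simp add: coring_hom_iff)
  show "\<phi> c \<in> carrier C" if "c \<in> carrier C" for c
    using that by (rule add_hom_closed[OF hom])
qed (use assms in \<open>auto simp: coring_hom_iff left_hom_def right_hom_def\<close>)

lemma tmap_hom: "\<phi> \<in> right_hom A C C \<Longrightarrow> \<psi> \<in> left_hom A C C \<Longrightarrow> tmap \<phi> \<psi> \<in> add_hom CC CC"
  and tmap_pure: "\<phi> \<in> right_hom A C C \<Longrightarrow> \<psi> \<in> left_hom A C C \<Longrightarrow> c \<in> carrier C \<Longrightarrow> d \<in> carrier C \<Longrightarrow>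
      tmap \<phi> \<psi> (tens2 c d) = tens2 (\<phi> c) (\<psi> d)"
  by (rule tensor_map_hom[OF CC.tensor_product_axioms CC.tensor_product_axioms]
      tensor_map_pure[OF CC.tensor_product_axioms CC.tensor_product_axioms]; assumption)+

text \<open>The map \<chi> has to agree with the composite on the carrier, since the group
  multiplication is the restricted \<open>compose\<close> whereas proofs also work with unrestricted
  composites.\<close>

lemma left_right_hom_compose:
  assumes "\<And>c. c \<in> carrier C \<Longrightarrow> \<chi> c = \<phi> (\<psi> c)"
    and "\<phi> \<in> left_hom A C C" "\<psi> \<in> left_hom A C C" "\<phi> \<in> right_hom A C C" "\<psi> \<in> right_hom A C C"
  shows "\<chi> \<in> left_hom A C C" "\<chi> \<in> right_hom A C C"
  using assms by (auto simp: left_hom_def right_hom_def hom_def Pi_def C.lact_closed C.ract_closed)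

lemma tmap_compose:
  assumes "\<And>c. c \<in> carrier C \<Longrightarrow> \<chi> c = \<phi> (\<psi> c)"
    and "\<phi> \<in> left_hom A C C" "\<psi> \<in> left_hom A C C" "\<phi> \<in> right_hom A C C" "\<psi> \<in> right_hom A C C"
    and "t \<in> carrier CC"
  shows "tmap \<chi> \<chi> t = tmap \<phi> \<phi> (tmap \<psi> \<psi> t)"
proof -
  note \<chi> = left_right_hom_compose[OF assms(1-5)]
  show ?thesis
  proof (rule CC.add_hom_tensor_eqI[OF CC.abelian_group_tensor tmap_hom[OF \<chi>(2,1)]
          add_hom_compose[OF tmap_hom[OF assms(5,3)] tmap_hom[OF assms(4,2)]] _ assms(6)])
    fix c d assume cd: "c \<in> carrier C" "d \<in> carrier C"
    then have "\<psi> c \<in> carrier C" "\<psi> d \<in> carrier C"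
      by (simp_all add: add_hom_closed[OF left_hom_add_hom[OF assms(3)]])
    then show "tmap \<chi> \<chi> (tens2 c d) = tmap \<phi> \<phi> (tmap \<psi> \<psi> (tens2 c d))"
      using cd by (simp add: tmap_pure[OF \<chi>(2,1)] tmap_pure[OF assms(5,3)] tmap_pure[OF assms(4,2)] assms(1))
  qed
qed

lemma tmap_id:
  assumes "\<And>c. c \<in> carrier C \<Longrightarrow> \<chi> c = c" and "t \<in> carrier CC"
  shows "tmap \<chi> \<chi> t = t"
proof -
  have \<chi>: "\<chi> \<in> left_hom A C C" "\<chi> \<in> right_hom A C C"
    using assms(1) by (auto simp: left_hom_def right_hom_def hom_def C.lact_closed C.ract_closed)
  show ?thesis
    by (rule CC.add_hom_tensor_eqI[OF CC.abelian_group_tensor tmap_hom[OF \<chi>(2,1)] add_hom_id _ assms(2)])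
      (simp add: tmap_pure \<chi> assms(1))
qed

lemma coring_hom_compose:
  assumes "\<phi> \<in> coring_hom A D D" and "\<psi> \<in> coring_hom A D D"
    and "\<And>c. c \<in> carrier C \<Longrightarrow> \<chi> c = \<phi> (\<psi> c)"
  shows "\<chi> \<in> coring_hom A D D"
proof -
  note \<phi> = coring_homD[OF assms(1)] and \<psi> = coring_homD[OF assms(2)]
  note \<chi> = left_right_hom_compose[OF assms(3) \<phi>(7) \<psi>(7) \<phi>(8) \<psi>(8)]
  have "comult D (\<chi> c) = tmap \<chi> \<chi> (comult D c)" if "c \<in> carrier C" for c
    using that \<phi>(4) \<psi>(4,6) add_hom_closed[OF comult_hom that]
    by (simp add: assms(3) tmap_compose[OF assms(3) \<phi>(7) \<psi>(7) \<phi>(8) \<psi>(8)])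
  then show ?thesis
    using \<chi> \<phi>(5) \<psi>(5,6) assms(3) by (auto simp: coring_hom_iff left_hom_def right_hom_def)
qed

lemma coring_hom_id:
  assumes "\<And>c. c \<in> carrier C \<Longrightarrow> \<chi> c = c"
  shows "\<chi> \<in> coring_hom A D D"
  using assms tmap_id[OF assms] add_hom_closed[OF comult_hom]
  by (auto simp: coring_hom_iff hom_def C.lact_closed C.ract_closed)

lemma coring_hom_ident: "(\<lambda>c. c) \<in> coring_hom A D D"
  by (rule coring_hom_id) (rule refl)

text \<open>Apply \<psi> \<otimes> \<psi> to \<Delta>\<phi> = (\<phi> \<otimes> \<phi>)\<Delta> at
  the element \<psi>(c); linearity of \<psi> comes from injectivity of \<phi>.\<close>

lemma coring_hom_inverse:
  assumes "\<phi> \<in> coring_hom A D D" and "\<And>c. c \<in> carrier C \<Longrightarrow> \<psi> c \<in> carrier C"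
    and "\<And>c. c \<in> carrier C \<Longrightarrow> \<phi> (\<psi> c) = c" and "\<And>c. c \<in> carrier C \<Longrightarrow> \<psi> (\<phi> c) = c"
  shows "\<psi> \<in> coring_hom A D D"
proof -
  note \<phi> = coring_homD[OF assms(1)]
  have inj: "x = y" if "\<phi> x = \<phi> y" "x \<in> carrier C" "y \<in> carrier C" for x y
    using that assms(4) by metis
  have add: "\<psi> \<in> add_hom C C"
  proof (rule add_homI)
    show "\<psi> (x \<oplus>\<^bsub>C\<^esub> y) = \<psi> x \<oplus>\<^bsub>C\<^esub> \<psi> y" if "x \<in> carrier C" "y \<in> carrier C" for x y
      by (rule inj) (use that assms(2,3) in \<open>simp_all add: add_hom_add[OF \<phi>(1)]\<close>)
  qed (rule assms(2))
  have lact: "\<psi> (lact C a x) = lact C a (\<psi> x)" and ract: "\<psi> (ract C x a) = ract C (\<psi> x) a"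
    if "x \<in> carrier C" "a \<in> carrier A" for x a
    by (rule inj; use that assms(2,3) in \<open>simp add: \<phi>(2,3) C.lact_closed C.ract_closed\<close>)+
  have \<psi>: "\<psi> \<in> left_hom A C C" "\<psi> \<in> right_hom A C C"
    unfolding left_hom_def right_hom_def using add lact ract by simp_all
  have "comult D (\<psi> c) = tmap \<psi> \<psi> (comult D c)" if c: "c \<in> carrier C" for c
  proof -
    have "tmap \<psi> \<psi> (comult D (\<phi> (\<psi> c))) = tmap \<psi> \<psi> (tmap \<phi> \<phi> (comult D (\<psi> c)))"
      using assms(2)[OF c] by (simp add: \<phi>(4))
    also have "\<dots> = tmap (\<lambda>c. \<psi> (\<phi> c)) (\<lambda>c. \<psi> (\<phi> c)) (comult D (\<psi> c))"
      by (rule tmap_compose[symmetric]) (use \<psi> \<phi> add_hom_closed[OF comult_hom assms(2)[OF c]] in simp_all)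
    also have "\<dots> = comult D (\<psi> c)"
      by (rule tmap_id) (use assms(4) add_hom_closed[OF comult_hom assms(2)[OF c]] in simp_all)
    finally show ?thesis
      using assms(3)[OF c] by simp
  qed
  moreover have "counit D (\<psi> c) = counit D c" if "c \<in> carrier C" for c
    using \<phi>(5)[OF assms(2)[OF that]] assms(3)[OF that] by simp
  ultimately show ?thesis
    using \<psi> by (auto simp: coring_hom_iff left_hom_def right_hom_def)
qed

abbreviation "Aut \<equiv> Bij (carrier C) \<inter> coring_hom A D D"
abbreviation "G \<equiv> coring_aut_group A D"

lemma Aut_inverse:
  assumes "\<phi> \<in> Aut"
  obtains \<psi> where "\<psi> \<in> Aut" and "\<And>c. c \<in> carrier C \<Longrightarrow> \<phi> (\<psi> c) = c" and "\<And>c. c \<in> carrier C \<Longrightarrow> \<psi> (\<phi> c) = c"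
    and "inv\<^bsub>BijGroup (carrier C)\<^esub> \<phi> = \<psi>"
proof
  let ?\<psi> = "\<lambda>x\<in>carrier C. inv_into (carrier C) \<phi> x"
  have bij: "bij_betw \<phi> (carrier C) (carrier C)"
    using assms by (simp add: Bij_def)
  show inv: "inv\<^bsub>BijGroup (carrier C)\<^esub> \<phi> = ?\<psi>"
    using assms by (intro inv_BijGroup) simp
  show 1: "\<phi> (?\<psi> c) = c" and 2: "?\<psi> (\<phi> c) = c" if "c \<in> carrier C" for c
    using that bij bij_betw_apply[OF bij that]
    by (simp_all add: bij_betw_inv_into_right bij_betw_inv_into_left)
  have cl: "?\<psi> c \<in> carrier C" if "c \<in> carrier C" for c
    using that bij_betw_apply[OF bij_betw_inv_into[OF bij] that] by simp
  have "?\<psi> \<in> coring_hom A D D"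
    by (rule coring_hom_inverse[OF _ cl 1 2]) (use assms in blast)
  then show "?\<psi> \<in> Aut"
    using assms restrict_inv_into_Bij[of \<phi>] by simp
qed

lemma subgroup_Aut: "subgroup Aut (BijGroup (carrier C))"
proof (rule group.subgroupI[OF group_BijGroup])
  show "Aut \<subseteq> carrier (BijGroup (carrier C))"
    by (auto simp: BijGroup_def)
  have "(\<lambda>x\<in>carrier C. x) \<in> Aut"
    using coring_hom_id[of "\<lambda>x\<in>carrier C. x"] by (simp add: id_Bij)
  then show "Aut \<noteq> {}" by blast
  show "inv\<^bsub>BijGroup (carrier C)\<^esub> \<phi> \<in> Aut" if "\<phi> \<in> Aut" for \<phi>
    using that by (rule Aut_inverse) simp
  show "\<phi> \<otimes>\<^bsub>BijGroup (carrier C)\<^esub> \<psi> \<in> Aut" if "\<phi> \<in> Aut" "\<psi> \<in> Aut" for \<phi> \<psi>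
    using that coring_hom_compose[of \<phi> \<psi> "compose (carrier C) \<phi> \<psi>"]
    by (simp add: BijGroup_def compose_Bij compose_eq)
qed

lemma G_sel: "carrier G = Aut" "\<one>\<^bsub>G\<^esub> = (\<lambda>x\<in>carrier C. x)"
  "\<phi> \<in> Aut \<Longrightarrow> \<psi> \<in> Aut \<Longrightarrow> \<phi> \<otimes>\<^bsub>G\<^esub> \<psi> = compose (carrier C) \<phi> \<psi>"
  by (auto simp: coring_aut_group_def BijGroup_def)

lemma group_G: "group G"
  using subgroup.subgroup_is_group[OF subgroup_Aut group_BijGroup] by (simp add: coring_aut_group_def)

sublocale G: group G by (rule group_G)

section \<open>The sub-bimodule attached to a coring endomorphism\<close>

definition J :: "((('m \<Rightarrow> 'a) \<times> 'm \<Rightarrow>\<^sub>0 int) set \<Rightarrow> (('m \<Rightarrow> 'a) \<times> 'm \<Rightarrow>\<^sub>0 int) set) \<Rightarrow> ('m \<Rightarrow> 'm) set" where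
  "J \<phi> = {s \<in> carrier S. \<forall>f\<in>carrier Q. \<forall>u\<in>carrier P. \<phi> (tens (cmp f s) u) = tens f (s u)}"

abbreviation "M \<equiv> sub_bimodule_monoid A B P"

lemma M_sel: "carrier M = {I. sub_bimodule B B S I}" "I \<otimes>\<^bsub>M\<^esub> K = ideal_prod S I K" "\<one>\<^bsub>M\<^esub> = cm ` carrier B"
  by (simp_all add: sub_bimodule_monoid_def)

lemma tens_hom: "f \<in> carrier Q \<Longrightarrow> (\<lambda>u. tens f u) \<in> add_hom P C"
  and tens_hom': "u \<in> carrier P \<Longrightarrow> (\<lambda>f. tens f u) \<in> add_hom Q C"
  using balancedD(1,2)[OF C.balanced_pure] by auto

text \<open>Multiplication by b on the left of s is moved across the tensor sign after \<phi> has
  acted, multiplication on the right before it acts.\<close>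

lemma sub_bimodule_J:
  assumes "\<phi> \<in> coring_hom A D D"
  shows "sub_bimodule B B S (J \<phi>)"
  unfolding sub_bimodule_def
proof (intro conjI ballI)
  have "J \<phi> = {s \<in> carrier S. \<forall>p\<in>carrier Q \<times> carrier P. \<phi> (tens (cmp (fst p) s) (snd p)) = tens (fst p) (s (snd p))}"
    by (auto simp: J_def)
  also have "additive_subgroup \<dots> S"
  proof (rule equalizer_subgroup[OF S.abelian_group_axioms C.abelian_group_tensor])
    fix p assume p: "p \<in> carrier Q \<times> carrier P"
    then show "(\<lambda>s. \<phi> (tens (cmp (fst p) s) (snd p))) \<in> add_hom S C"
      by (auto intro!: add_hom_compose[OF add_hom_compose[OF cmp_Q_hom' tens_hom'] coring_homD(1)[OF assms]])
    show "(\<lambda>s. tens (fst p) (s (snd p))) \<in> add_hom S C"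
      using p by (auto intro!: add_hom_compose[OF eval_hom tens_hom])
  qed
  finally show "additive_subgroup (J \<phi>) S" .
  fix b s assume b: "b \<in> carrier B" and s: "s \<in> J \<phi>"
  have s': "s \<in> carrier S" "\<And>f u. f \<in> carrier Q \<Longrightarrow> u \<in> carrier P \<Longrightarrow> \<phi> (tens (cmp f s) u) = tens f (s u)"
    using s by (auto simp: J_def)
  show "lact S b s \<in> J \<phi>"
    using b s' by (simp add: J_def cmp_S cm_in_S cmp_Q tens_cm S_app flip: cmp_assoc_Q)
  show "ract S s b \<in> J \<phi>"
    using b s' by (simp add: J_def cmp_S cm_in_S cmp_Q tens_cm S_app flip: cmp_assoc_Q)
qed

lemma sub_bimoduleD:
  assumes "sub_bimodule B B S I"
  shows "additive_subgroup I S" "\<And>b s. b \<in> carrier B \<Longrightarrow> s \<in> I \<Longrightarrow> cmp (cm b) s \<in> I"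
    "\<And>b s. b \<in> carrier B \<Longrightarrow> s \<in> I \<Longrightarrow> cmp s (cm b) \<in> I" "I \<subseteq> carrier S"
    "\<And>s t. s \<in> I \<Longrightarrow> t \<in> I \<Longrightarrow> s \<oplus>\<^bsub>S\<^esub> t \<in> I"
  using assms additive_subgroup.a_subset[of I S] subgroup.m_closed[OF additive_subgroup.a_subgroup, of I S]
  by (auto simp: sub_bimodule_def)

text \<open>Turns 1 \<in> KI into an explicit family of pairs x_k, y_k.\<close>

lemma ideal_prod_list:
  assumes "I \<subseteq> carrier S" and "K \<subseteq> carrier S" and "x \<in> ideal_prod S I K"
  obtains xs where "set xs \<subseteq> I \<times> K" and "x = lsum S (\<lambda>p. cmp (fst p) (snd p)) xs"
proof -
  have "\<exists>xs. set xs \<subseteq> I \<times> K \<and> x = lsum S (\<lambda>p. cmp (fst p) (snd p)) xs"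
    using assms(3)
  proof (induction rule: ideal_prod.induct)
    case (prod i j)
    then show ?case
      using assms(1,2) S.r_zero[OF cmp_S[of i j]]
      by (intro exI[of _ "[(i, j)]"]) (auto simp: subset_iff)
  next
    case (sum s t)
    then obtain xs ys where xs: "set xs \<subseteq> I \<times> K" "s = lsum S (\<lambda>p. cmp (fst p) (snd p)) xs"
      and ys: "set ys \<subseteq> I \<times> K" "t = lsum S (\<lambda>p. cmp (fst p) (snd p)) ys"
      by blast
    have "cmp (fst p) (snd p) \<in> carrier S" if "p \<in> set xs \<union> set ys" for p
    proof -
      have "p \<in> I \<times> K"
        using that xs(1) ys(1) by blast
      then show ?thesis
        using assms(1,2) by (auto intro!: cmp_S)
    qed
    then have "lsum S (\<lambda>p. cmp (fst p) (snd p)) (xs @ ys) = s \<oplus>\<^bsub>S\<^esub> t"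
      unfolding xs(2) ys(2) by (intro S.lsum_append) auto
    then show ?case
      using xs(1) ys(1) by (intro exI[of _ "xs @ ys"]) auto
  qed
  then show thesis using that by blast
qed

lemma ideal_prod_subset:
  assumes "sub_bimodule B B S L" and "\<And>i k. i \<in> I \<Longrightarrow> k \<in> K \<Longrightarrow> cmp i k \<in> L"
  shows "ideal_prod S I K \<subseteq> L"
proof
  fix x assume "x \<in> ideal_prod S I K"
  then show "x \<in> L"
    by (induction rule: ideal_prod.induct) (auto simp: assms(2) intro: sub_bimoduleD(5)[OF assms(1)])
qed

lemma ideal_prodI: "i \<in> I \<Longrightarrow> k \<in> K \<Longrightarrow> cmp i k \<in> ideal_prod S I K"
  using ideal_prod.prod[of i I k K S] by simp

lemma ideal_prod_carrier: "I \<subseteq> carrier S \<Longrightarrow> K \<subseteq> carrier S \<Longrightarrow> ideal_prod S I K \<subseteq> carrier S"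
proof
  fix x assume *: "I \<subseteq> carrier S" "K \<subseteq> carrier S" and "x \<in> ideal_prod S I K"
  from this(3) show "x \<in> carrier S"
  proof (induction rule: ideal_prod.induct)
    case (prod i j)
    then have "i \<in> carrier S" "j \<in> carrier S"
      using * by blast+
    then show ?case by (rule S.m_closed)
  qed (rule S.a_closed)
qed

text \<open>Negatives are the point to watch: \<open>ideal_prod\<close> is generated by products and
  sums, and -(ij) = (-i)j stays inside because I is a subgroup.\<close>

lemma sub_bimodule_ideal_prod:
  assumes "sub_bimodule B B S I" and "sub_bimodule B B S K"
  shows "sub_bimodule B B S (ideal_prod S I K)"
proof -
  note I = sub_bimoduleD[OF assms(1)] and K = sub_bimoduleD[OF assms(2)]
  have IS: "i \<in> carrier S" if "i \<in> I" for i using that I(4) by auto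
  have KS: "i \<in> carrier S" if "i \<in> K" for i using that K(4) by auto
  note sub = ideal_prod_carrier[OF I(4) K(4)]
  have neg: "\<ominus>\<^bsub>S\<^esub> x \<in> ideal_prod S I K" if "x \<in> ideal_prod S I K" for x
    using that
  proof (induction rule: ideal_prod.induct)
    case (prod i j)
    have "\<ominus>\<^bsub>S\<^esub> (i \<otimes>\<^bsub>S\<^esub> j) = (\<ominus>\<^bsub>S\<^esub> i) \<otimes>\<^bsub>S\<^esub> j"
      using IS KS prod by (simp only: S.l_minus)
    then show ?case
      using prod additive_subgroup.a_inv_closed[OF I(1)] by (auto simp: S.abelian_group_axioms ideal_prodI)
  next
    case (sum s t)
    have "\<ominus>\<^bsub>S\<^esub> (s \<oplus>\<^bsub>S\<^esub> t) = \<ominus>\<^bsub>S\<^esub> s \<oplus>\<^bsub>S\<^esub> \<ominus>\<^bsub>S\<^esub> t"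
      using sum sub by (intro S.minus_add) auto
    then show ?case using ideal_prod.sum[OF sum.IH] by simp
  qed
  have "additive_subgroup (ideal_prod S I K) S"
  proof (intro additive_subgroup.intro group.subgroupI[OF S.a_group])
    show "ideal_prod S I K \<noteq> {}"
      using ideal_prodI[OF additive_subgroup.zero_closed[OF I(1)] additive_subgroup.zero_closed[OF K(1)]] by blast
  qed (use sub neg ideal_prod.sum[of _ S I K] in \<open>auto simp flip: a_inv_def\<close>)
  moreover have "cmp (cm b) x \<in> ideal_prod S I K" if b: "b \<in> carrier B" and x: "x \<in> ideal_prod S I K" for b x
    using x
  proof (induction rule: ideal_prod.induct)
    case (prod i j)
    then show ?case
      using I(2)[OF b, of i] ideal_prodI[of "cmp (cm b) i" I j K] IS KS b by (simp add: cmp_assoc cm_in_S)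
  next
    case (sum s t)
    then show ?case
      using subsetD[OF sub] add_hom_add[OF cmp_S_hom'[OF cm_in_S[OF b]]] ideal_prod.sum[OF sum.IH] by simp
  qed
  moreover have "cmp x (cm b) \<in> ideal_prod S I K" if b: "b \<in> carrier B" and x: "x \<in> ideal_prod S I K" for b x
    using x
  proof (induction rule: ideal_prod.induct)
    case (prod i j)
    then show ?case
      using K(3)[OF b, of j] ideal_prodI[of i I "cmp j (cm b)" K] IS KS b by (simp add: cmp_assoc cm_in_S)
  next
    case (sum s t)
    then show ?case
      using subsetD[OF sub] add_hom_add[OF cmp_S_hom[OF cm_in_S[OF b]]] ideal_prod.sum[OF sum.IH] by simp
  qed
  ultimately show ?thesis
    by (simp add: sub_bimodule_def)
qed

lemma sub_bimodule_unit: "sub_bimodule B B S (cm ` carrier B)"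
proof -
  have hom: "cm \<in> add_hom B S"
    by (rule add_homI) (simp_all add: cm_in_S cm_add)
  have "additive_subgroup (cm ` carrier B) S"
  proof (intro additive_subgroup.intro group.subgroupI[OF S.a_group])
    show "inv\<^bsub>add_monoid S\<^esub> x \<in> cm ` carrier B" if "x \<in> cm ` carrier B" for x
      using that add_hom_a_inv[OF Sg.L.abelian_group_axioms S.abelian_group_axioms hom]
      by (auto simp flip: a_inv_def intro!: image_eqI[OF _ Sg.L.a_inv_closed])
    show "x \<otimes>\<^bsub>add_monoid S\<^esub> y \<in> cm ` carrier B" if "x \<in> cm ` carrier B" "y \<in> cm ` carrier B" for x y
      using that by (auto simp flip: cm_add)
  qed (use Sg.L.zero_closed cm_in_S in auto)
  then show ?thesis
    by (auto simp: sub_bimodule_def simp flip: cm_mult)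
qed

lemma monoid_M: "monoid M"
proof (rule monoidI)
  fix I K assume IK: "I \<in> carrier M" "K \<in> carrier M"
  then show "I \<otimes>\<^bsub>M\<^esub> K \<in> carrier M"
    by (simp add: M_sel sub_bimodule_ideal_prod)
  fix L assume L: "L \<in> carrier M"
  note sub = IK[unfolded M_sel, simplified] L[unfolded M_sel, simplified]
  have *: "cmp x k \<in> ideal_prod S I (ideal_prod S K L)" if "x \<in> ideal_prod S I K" "k \<in> L" for x k
    using that(1)
  proof (induction rule: ideal_prod.induct)
    case (prod i j)
    then show ?case
      using that sub[THEN sub_bimoduleD(4)] ideal_prodI[of i I "cmp j k"] ideal_prodI[of j K k L]
      by (simp add: cmp_assoc subset_iff)
  next
    case (sum s t)
    then show ?case
      using subsetD[OF sub(3)[THEN sub_bimoduleD(4)] that(2)] add_hom_add[OF cmp_S_hom[of k], of s t]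
        subsetD[OF ideal_prod_carrier[of I K]] sub(1,2)[THEN sub_bimoduleD(4)] ideal_prod.sum[OF sum.IH] by simp
  qed
  have **: "cmp i x \<in> ideal_prod S (ideal_prod S I K) L" if "i \<in> I" "x \<in> ideal_prod S K L" for x i
    using that(2)
  proof (induction rule: ideal_prod.induct)
    case (prod j k)
    then show ?case
      using that sub[THEN sub_bimoduleD(4)] ideal_prodI[of "cmp i j" _ k L] ideal_prodI[of i I j K]
      by (simp add: subset_iff flip: cmp_assoc)
  next
    case (sum s t)
    then show ?case
      using subsetD[OF sub(1)[THEN sub_bimoduleD(4)] that(1)] add_hom_add[OF cmp_S_hom'[of i], of s t]
        subsetD[OF ideal_prod_carrier[of K L]] sub(2,3)[THEN sub_bimoduleD(4)] ideal_prod.sum[OF sum.IH] by simp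
  qed
  show "I \<otimes>\<^bsub>M\<^esub> K \<otimes>\<^bsub>M\<^esub> L = I \<otimes>\<^bsub>M\<^esub> (K \<otimes>\<^bsub>M\<^esub> L)"
    unfolding M_sel
    by (intro subset_antisym ideal_prod_subset sub_bimodule_ideal_prod sub * **)
next
  show "\<one>\<^bsub>M\<^esub> \<in> carrier M"
    by (simp add: M_sel sub_bimodule_unit)
  fix I assume "I \<in> carrier M"
  then have I: "sub_bimodule B B S I" by (simp add: M_sel)
  have one: "\<one>\<^bsub>S\<^esub> \<in> cm ` carrier B"
    unfolding cm_one[symmetric] by simp
  have mem: "i \<in> ideal_prod S (cm ` carrier B) I" "i \<in> ideal_prod S I (cm ` carrier B)" if "i \<in> I" for i
    using ideal_prod.prod[OF one that, of S] ideal_prod.prod[OF that one, of S] that sub_bimoduleD(4)[OF I]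
      S.l_one[of i] S.r_one[of i] by auto
  show "\<one>\<^bsub>M\<^esub> \<otimes>\<^bsub>M\<^esub> I = I" "I \<otimes>\<^bsub>M\<^esub> \<one>\<^bsub>M\<^esub> = I"
    unfolding M_sel using mem sub_bimoduleD(2,3)[OF I]
    by (intro subset_antisym ideal_prod_subset I subsetI; auto)+
qed

lemma J_compose:
  assumes "\<phi> \<in> coring_hom A D D" and "\<psi> \<in> coring_hom A D D" and "\<chi> \<in> coring_hom A D D"
    and "\<And>c. c \<in> carrier C \<Longrightarrow> \<chi> c = \<phi> (\<psi> c)"
  shows "ideal_prod S (J \<phi>) (J \<psi>) \<subseteq> J \<chi>"
  by (rule ideal_prod_subset[OF sub_bimodule_J[OF assms(3)]])
    (simp add: J_def assms(4) cmp_S cmp_Q tens_closed S_app flip: cmp_assoc_Q)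

end

text \<open>The interface that all three hypotheses have to meet. The assumption \<open>base\<close>
  is J(id) \<subseteq> B with \<open>J\<close> unfolded; \<open>unit\<close> is what remains of
  J(\<phi>)J(\<psi>) = B for mutually inverse \<phi> and \<psi>.\<close>

locale comatrix_descent = comatrix +
  assumes base: "\<lbrakk>t \<in> carrier S; \<And>f u. f \<in> carrier Q \<Longrightarrow> u \<in> carrier P \<Longrightarrow> tens (cmp f t) u = tens f (t u)\<rbrakk>
      \<Longrightarrow> t \<in> cm ` carrier B"
    and unit: "\<lbrakk>\<phi> \<in> Aut; \<psi> \<in> Aut; \<And>c. c \<in> carrier C \<Longrightarrow> \<phi> (\<psi> c) = c; \<And>c. c \<in> carrier C \<Longrightarrow> \<psi> (\<phi> c) = c\<rbrakk>
      \<Longrightarrow> \<one>\<^bsub>S\<^esub> \<in> ideal_prod S (J \<phi>) (J \<psi>)"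
begin

lemma J_id: "(\<And>c. c \<in> carrier C \<Longrightarrow> \<chi> c = c) \<Longrightarrow> J \<chi> \<subseteq> cm ` carrier B"
  using base by (auto simp: J_def tens_closed cmp_Q)

text \<open>The product lies in J(id), hence in B; as a sub-bimodule containing 1 it also contains
  B.\<close>

lemma J_inverse:
  assumes "\<phi> \<in> Aut" and "\<psi> \<in> Aut" and "\<And>c. c \<in> carrier C \<Longrightarrow> \<phi> (\<psi> c) = c" and "\<And>c. c \<in> carrier C \<Longrightarrow> \<psi> (\<phi> c) = c"
  shows "ideal_prod S (J \<phi>) (J \<psi>) = cm ` carrier B"
proof
  have "ideal_prod S (J \<phi>) (J \<psi>) \<subseteq> J (\<lambda>c. c)"
    by (rule J_compose[OF _ _ coring_hom_ident]) (use assms in auto)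
  also have "\<dots> \<subseteq> cm ` carrier B"
    by (rule J_id) (rule refl)
  finally show "ideal_prod S (J \<phi>) (J \<psi>) \<subseteq> cm ` carrier B" .
  have "sub_bimodule B B S (ideal_prod S (J \<phi>) (J \<psi>))"
    using assms by (intro sub_bimodule_ideal_prod sub_bimodule_J) auto
  from sub_bimoduleD(2)[OF this _ unit[OF assms]] show "cm ` carrier B \<subseteq> ideal_prod S (J \<phi>) (J \<psi>)"
    using S.r_one[OF cm_in_S] by auto
qed

lemma J_unit:
  assumes "\<phi> \<in> Aut"
  shows "J \<phi> \<in> Units M"
proof -
  obtain \<psi> where \<psi>: "\<psi> \<in> Aut" "\<And>c. c \<in> carrier C \<Longrightarrow> \<phi> (\<psi> c) = c" "\<And>c. c \<in> carrier C \<Longrightarrow> \<psi> (\<phi> c) = c"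
    using Aut_inverse[OF assms] by metis
  show ?thesis
    unfolding Units_def
  proof (intro CollectI conjI bexI[of _ "J \<psi>"])
    show "J \<phi> \<in> carrier M" "J \<psi> \<in> carrier M"
      using assms \<psi>(1) by (simp_all add: M_sel sub_bimodule_J)
    show "J \<psi> \<otimes>\<^bsub>M\<^esub> J \<phi> = \<one>\<^bsub>M\<^esub>" "J \<phi> \<otimes>\<^bsub>M\<^esub> J \<psi> = \<one>\<^bsub>M\<^esub>"
      unfolding M_sel using assms \<psi> by (intro J_inverse; simp)+
  qed
qed

text \<open>One inclusion is \<open>J_compose\<close>. For the other, let \<psi>' be the inverse of
  \<psi> and insert J(\<psi>')J(\<psi>) = B: then J(\<phi>\<psi>) =
  J(\<phi>\<psi>)J(\<psi>')J(\<psi>) lies in J(\<phi>)J(\<psi>), again by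
  \<open>J_compose\<close>.\<close>

lemma J_hom: "J \<in> hom G (units_of M)"
proof (rule homI)
  interpret M: monoid M by (rule monoid_M)
  show "J \<phi> \<in> carrier (units_of M)" if "\<phi> \<in> carrier G" for \<phi>
    using that by (simp add: G_sel units_of_carrier J_unit)
  fix \<phi> \<psi> assume "\<phi> \<in> carrier G" "\<psi> \<in> carrier G"
  then have \<phi>: "\<phi> \<in> Aut" and \<psi>: "\<psi> \<in> Aut" by (simp_all add: G_sel)
  let ?\<chi> = "compose (carrier C) \<phi> \<psi>"
  have \<chi>: "?\<chi> \<in> Aut"
    using G.m_closed[of \<phi> \<psi>] \<phi> \<psi> by (simp add: G_sel)
  obtain \<psi>' where \<psi>': "\<psi>' \<in> Aut" "\<And>c. c \<in> carrier C \<Longrightarrow> \<psi> (\<psi>' c) = c" "\<And>c. c \<in> carrier C \<Longrightarrow> \<psi>' (\<psi> c) = c"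
    using Aut_inverse[OF \<psi>] by metis
  have cl: "\<psi>' c \<in> carrier C" if "c \<in> carrier C" for c
    using coring_homD(6)[of \<psi>'] \<psi>'(1) that by auto
  have U: "J ?\<chi> \<in> carrier M" "J \<phi> \<in> carrier M" "J \<psi> \<in> carrier M" "J \<psi>' \<in> carrier M"
    using \<chi> \<phi> \<psi> \<psi>'(1) by (simp_all add: M_sel sub_bimodule_J)
  have "J \<phi> \<otimes>\<^bsub>M\<^esub> J \<psi> \<subseteq> J ?\<chi>"
    unfolding M_sel using \<phi> \<psi> \<chi> by (intro J_compose) (simp_all add: compose_eq)
  moreover have "J ?\<chi> \<subseteq> J \<phi> \<otimes>\<^bsub>M\<^esub> J \<psi>"
  proof -
    have "J ?\<chi> = J ?\<chi> \<otimes>\<^bsub>M\<^esub> (J \<psi>' \<otimes>\<^bsub>M\<^esub> J \<psi>)"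
      using J_inverse[OF \<psi>'(1) \<psi> \<psi>'(3,2)] M.r_one[OF U(1)] by (simp add: M_sel)
    also have "\<dots> = (J ?\<chi> \<otimes>\<^bsub>M\<^esub> J \<psi>') \<otimes>\<^bsub>M\<^esub> J \<psi>"
      using U by (simp add: M.m_assoc)
    also have "\<dots> \<subseteq> J \<phi> \<otimes>\<^bsub>M\<^esub> J \<psi>"
    proof -
      have "J ?\<chi> \<otimes>\<^bsub>M\<^esub> J \<psi>' \<subseteq> J \<phi>"
        unfolding M_sel using \<phi> \<chi> \<psi>' cl by (intro J_compose) (simp_all add: compose_eq)
      moreover have "sub_bimodule B B S (J \<phi> \<otimes>\<^bsub>M\<^esub> J \<psi>)"
        using M.m_closed[OF U(2,3)] by (simp add: M_sel)
      ultimately show ?thesis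
        unfolding M_sel by (intro ideal_prod_subset) (auto intro: ideal_prodI)
    qed
    finally show ?thesis .
  qed
  ultimately show "J (\<phi> \<otimes>\<^bsub>G\<^esub> \<psi>) = J \<phi> \<otimes>\<^bsub>units_of M\<^esub> J \<psi>"
    using \<phi> \<psi> by (simp add: G_sel units_of_mult)
qed

text \<open>If J(\<phi>) = B then 1 is in J(\<phi>), which says that \<phi> fixes all pure
  tensors.\<close>

lemma J_inj: "inj_on J (carrier G)"
proof -
  interpret M: monoid M by (rule monoid_M)
  interpret group_hom G "units_of M" J
    using M.units_group J_hom by (simp add: group_hom_def group_hom_axioms_def group_G)
  show ?thesis
    unfolding inj_on_one_iff
  proof (intro allI impI)
    fix \<phi> assume "\<phi> \<in> carrier G" and J: "J \<phi> = \<one>\<^bsub>units_of M\<^esub>"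
    then have \<phi>: "\<phi> \<in> Aut" by (simp add: G_sel)
    have "\<one>\<^bsub>S\<^esub> \<in> J \<phi>"
      unfolding J units_of_one M_sel cm_one[symmetric] by simp
    then have tens_fix: "\<phi> (tens f u) = tens f u" if "f \<in> carrier Q" "u \<in> carrier P" for f u
      using that by (simp add: J_def cmp_Q_one)
    have "\<phi> c = c" if "c \<in> carrier C" for c
      by (rule C.add_hom_tensor_eqI[OF C.abelian_group_tensor coring_homD(1) add_hom_id tens_fix that]) (use \<phi> in auto)
    then show "\<phi> = \<one>\<^bsub>G\<^esub>"
      using \<phi> Bij_imp_extensional[of \<phi>] by (auto simp: G_sel intro!: extensionalityI[of _ "carrier C"])
  qed
qed

end

section \<open>The automorphism attached to an invertible sub-bimodule\<close>

context comatrix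
begin

text \<open>Restricted to the carrier because members of \<open>Bij\<close> are extensional.\<close>

definition rep_map ::
    "(('m \<Rightarrow> 'm) \<times> ('m \<Rightarrow> 'm)) list \<Rightarrow> (('m \<Rightarrow> 'a) \<times> 'm \<Rightarrow>\<^sub>0 int) set \<Rightarrow> (('m \<Rightarrow> 'a) \<times> 'm \<Rightarrow>\<^sub>0 int) set"
  where "rep_map xs =
    (\<lambda>c\<in>carrier C. tensor_lift C (\<lambda>f u. lsum C (\<lambda>p. tens (cmp f (fst p)) (snd p u)) xs) c)"

lemma tens_cm': "t \<in> cm ` carrier B \<Longrightarrow> f \<in> carrier Q \<Longrightarrow> u \<in> carrier P \<Longrightarrow> tens (cmp f t) u = tens f (t u)"
  by (auto simp: tens_cm)

lemma lact_tens: "a \<in> carrier A \<Longrightarrow> f \<in> carrier Q \<Longrightarrow> u \<in> carrier P \<Longrightarrow> lact C a (tens f u) = tens (lact Q a f) u"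
  by (rule C.tensor_lact_pure)

lemma ract_tens: "a \<in> carrier A \<Longrightarrow> f \<in> carrier Q \<Longrightarrow> u \<in> carrier P \<Longrightarrow> ract C (tens f u) a = tens f (ract P u a)"
  by (rule Cr.tensor_ract_pure)

lemma cmp_lact_Q: "a \<in> carrier A \<Longrightarrow> f \<in> carrier Q \<Longrightarrow> s \<in> carrier S \<Longrightarrow> cmp (lact Q a f) s = lact Q a (cmp f s)"
  by (rule Q_eqI) (simp_all add: cmp_Q Q.lact_closed Q_lact_app S_app)

lemma lsum_tens:
  assumes "set xs \<subseteq> carrier S \<times> carrier S" and "f \<in> carrier Q" and "u \<in> carrier P" and "p \<in> set xs"
  shows "tens (cmp f (fst p)) (snd p u) \<in> carrier C"
  using pairs_fst[OF assms(1,4)] pairs_snd[OF assms(1,4)] assms(2,3) by (simp add: tens_closed cmp_Q S_app)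

text \<open>Products yx with y in I and x in K lie in B, so they pass across the tensor sign. With
  \<Sum> x_k y_k = 1 this gives two rules: \<open>slide\<close>, f \<otimes> xu \<mapsto> fx
  \<otimes> u for x in K, and \<open>slide'\<close>, fy \<otimes> u \<mapsto> f \<otimes> yu for y
  in I. Balancedness and compatibility with \<Delta> rest on the first, membership in
  \<open>J\<close> on the second.\<close>

lemma rep_map:
  assumes I: "sub_bimodule B B S I" and K: "sub_bimodule B B S K"
    and xs: "set xs \<subseteq> K \<times> I" and one: "lsum S (\<lambda>p. cmp (fst p) (snd p)) xs = \<one>\<^bsub>S\<^esub>"
    and prods: "\<forall>y\<in>I. \<forall>x\<in>K. cmp y x \<in> cm ` carrier B"
  shows "rep_map xs \<in> coring_hom A D D"
    and "y \<in> I \<Longrightarrow> f \<in> carrier Q \<Longrightarrow> u \<in> carrier P \<Longrightarrow> rep_map xs (tens (cmp f y) u) = tens f (y u)"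
    and "f \<in> carrier Q \<Longrightarrow> u \<in> carrier P \<Longrightarrow>
      rep_map xs (tens f u) = lsum C (\<lambda>p. tens (cmp f (fst p)) (snd p u)) xs"
proof -
  have IK: "cmp y x \<in> cm ` carrier B" if "y \<in> I" "x \<in> K" for y x
    using prods that by blast
  have x: "fst p \<in> K" "snd p \<in> I" "fst p \<in> carrier S" "snd p \<in> carrier S" if "p \<in> set xs" for p
    using pairs_fst[OF xs that] pairs_snd[OF xs that] sub_bimoduleD(4)[OF I] sub_bimoduleD(4)[OF K] by auto
  have xsS: "set xs \<subseteq> carrier S \<times> carrier S"
    using xs sub_bimoduleD(4)[OF I] sub_bimoduleD(4)[OF K] by auto
  have KS: "s \<in> carrier S" if "s \<in> K" for s
    using that sub_bimoduleD(4)[OF K] by auto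
  have IS: "s \<in> carrier S" if "s \<in> I" for s
    using that sub_bimoduleD(4)[OF I] by auto
  have one_P: "lsum P (\<lambda>p. fst p (snd p u)) xs = u" if u: "u \<in> carrier P" for u
  proof -
    have "lsum S (\<lambda>p. cmp (fst p) (snd p)) xs u = lsum P (\<lambda>p. cmp (fst p) (snd p) u) xs"
      using x u by (intro lsum_S_app) (simp_all add: cmp_S)
    then show ?thesis
      using u by (simp add: one)
  qed
  have one_Q: "lsum Q (\<lambda>p. cmp (cmp f (fst p)) (snd p)) xs = f" if f: "f \<in> carrier Q" for f
  proof -
    have "lsum Q (\<lambda>p. cmp (cmp f (fst p)) (snd p)) xs = lsum Q (\<lambda>p. cmp f (cmp (fst p) (snd p))) xs"
      using x f by (intro lsum_cong) (simp add: cmp_assoc_Q)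
    also have "\<dots> = cmp f (lsum S (\<lambda>p. cmp (fst p) (snd p)) xs)"
      using x by (intro add_hom_lsum[OF S.abelian_group_axioms Q.M.abelian_group_axioms cmp_Q_hom'[OF f], symmetric])
        (simp add: cmp_S)
    also have "\<dots> = f"
      unfolding one by (rule cmp_Q_one[OF f])
    finally show ?thesis .
  qed
  have slide: "lsum C (\<lambda>p. tens (cmp f (fst p)) (snd p (x u))) xs = tens (cmp f x) u"
    if "x \<in> K" "f \<in> carrier Q" "u \<in> carrier P" for x f u
  proof -
    have "lsum C (\<lambda>p. tens (cmp f (fst p)) (snd p (x u))) xs = lsum C (\<lambda>p. tens (cmp (cmp (cmp f (fst p)) (snd p)) x) u) xs"
    proof (rule lsum_cong)
      fix p assume p: "p \<in> set xs"
      have "tens (cmp f (fst p)) (snd p (x u)) = tens (cmp f (fst p)) (cmp (snd p) x u)"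
        using that by simp
      also have "\<dots> = tens (cmp (cmp f (fst p)) (cmp (snd p) x)) u"
        using x[OF p] that by (intro tens_cm'[symmetric] IK cmp_Q)
      finally show "tens (cmp f (fst p)) (snd p (x u)) = tens (cmp (cmp (cmp f (fst p)) (snd p)) x) u"
        using x[OF p] that cmp_assoc_Q[of "cmp f (fst p)" "snd p" x] by (simp add: cmp_Q KS)
    qed
    also have "\<dots> = tens (cmp (lsum Q (\<lambda>p. cmp (cmp f (fst p)) (snd p)) xs) x) u"
      using x that by (intro add_hom_lsum[OF Q.M.abelian_group_axioms C.abelian_group_tensor
            add_hom_compose[OF cmp_Q_hom tens_hom'], symmetric]) (simp_all add: cmp_Q KS)
    finally show ?thesis
      using that by (simp add: one_Q)
  qed
  have slide': "lsum C (\<lambda>p. tens (cmp (cmp f y) (fst p)) (snd p u)) xs = tens f (y u)"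
    if "y \<in> I" "f \<in> carrier Q" "u \<in> carrier P" for y f u
  proof -
    have "lsum C (\<lambda>p. tens (cmp (cmp f y) (fst p)) (snd p u)) xs = lsum C (\<lambda>p. tens f (y (fst p (snd p u)))) xs"
    proof (rule lsum_cong)
      fix p assume p: "p \<in> set xs"
      have "tens (cmp (cmp f y) (fst p)) (snd p u) = tens (cmp f (cmp y (fst p))) (snd p u)"
        using x[OF p] that by (simp add: cmp_assoc_Q IS)
      also have "\<dots> = tens f (cmp y (fst p) (snd p u))"
        using x[OF p] that by (intro tens_cm' IK) (simp_all add: S_app)
      finally show "tens (cmp (cmp f y) (fst p)) (snd p u) = tens f (y (fst p (snd p u)))"
        using x[OF p] that by (simp add: S_app)
    qed
    also have "\<dots> = tens f (y (lsum P (\<lambda>p. fst p (snd p u)) xs))"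
      using x that by (intro add_hom_lsum[OF Sg.M.abelian_group_axioms C.abelian_group_tensor
            add_hom_compose[OF app_hom tens_hom], symmetric]) (simp_all add: S_app IS)
    finally show ?thesis
      using that by (simp add: one_P)
  qed
  let ?\<beta> = "\<lambda>f u. lsum C (\<lambda>p. tens (cmp f (fst p)) (snd p u)) xs"
  have cl: "tens (cmp f (fst p)) (snd p u) \<in> carrier C" if "f \<in> carrier Q" "u \<in> carrier P" "p \<in> set xs" for f u p
    by (rule lsum_tens[OF xsS that])
  have bal: "balanced B Q P C ?\<beta>"
  proof (rule balancedI)
    fix f u assume "f \<in> carrier Q" "u \<in> carrier P"
    then show "?\<beta> f u \<in> carrier C"
      by (intro C.T.lsum_closed cl)
  next
    fix f f' u assume "f \<in> carrier Q" "f' \<in> carrier Q" "u \<in> carrier P"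
    then show "?\<beta> (f \<oplus>\<^bsub>Q\<^esub> f') u = ?\<beta> f u \<oplus>\<^bsub>C\<^esub> ?\<beta> f' u"
      using x by (subst C.T.lsum_add[symmetric])
        (auto simp: cl add_hom_add[OF cmp_Q_hom] C.pure_add_left cmp_Q S_app cong: lsum_cong)
  next
    fix f u u' assume "f \<in> carrier Q" "u \<in> carrier P" "u' \<in> carrier P"
    then show "?\<beta> f (u \<oplus>\<^bsub>P\<^esub> u') = ?\<beta> f u \<oplus>\<^bsub>C\<^esub> ?\<beta> f u'"
      using x by (subst C.T.lsum_add[symmetric])
        (auto simp: cl S_add C.pure_add_right cmp_Q S_app cong: lsum_cong)
  next
    fix f b u assume *: "f \<in> carrier Q" "b \<in> carrier B" "u \<in> carrier P"
    have bx: "cmp (cm b) (fst p) \<in> K" if "p \<in> set xs" for p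
      using x(1)[OF that] *(2) by (rule sub_bimoduleD(2)[OF K, rotated])
    \<comment> \<open>b x_q is again in K, so \<open>slide\<close>, read backwards, puts it behind
      the y_p; summing over q then uses \<Sum> x_q y_q = 1.\<close>
    have "?\<beta> (ract Q f b) u = lsum C (\<lambda>q. lsum C (\<lambda>p. tens (cmp f (fst p)) (snd p (lact P b (fst q (snd q u))))) xs) xs"
    proof (rule lsum_cong)
      fix q assume q: "q \<in> set xs"
      have "tens (cmp (ract Q f b) (fst q)) (snd q u) = tens (cmp f (cmp (cm b) (fst q))) (snd q u)"
        using * x[OF q] by (simp add: ract_Q cmp_assoc_Q cm_in_S)
      also have "\<dots> = lsum C (\<lambda>p. tens (cmp f (fst p)) (snd p (cmp (cm b) (fst q) (snd q u)))) xs"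
        using * x[OF q] bx[OF q] by (intro slide[symmetric]) (simp_all add: S_app)
      finally show "tens (cmp (ract Q f b) (fst q)) (snd q u) =
          lsum C (\<lambda>p. tens (cmp f (fst p)) (snd p (lact P b (fst q (snd q u))))) xs"
        using * x[OF q] by (simp add: S_app)
    qed
    also have "\<dots> = lsum C (\<lambda>p. lsum C (\<lambda>q. tens (cmp f (fst p)) (snd p (lact P b (fst q (snd q u))))) xs) xs"
      using * x by (intro C.T.lsum_commute tens_closed) (simp_all add: cmp_Q S_app)
    also have "\<dots> = ?\<beta> f (lact P b u)"
    proof (rule lsum_cong)
      fix p assume p: "p \<in> set xs"
      have "(\<lambda>v. tens (cmp f (fst p)) (snd p (lact P b v))) \<in> add_hom P C"
        using * x[OF p] by (intro add_homI) (simp_all add: tens_closed cmp_Q S_app S_add Sg.lact_r_distr C.pure_add_right)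
      from add_hom_lsum[OF Sg.M.abelian_group_axioms C.abelian_group_tensor this, of xs "\<lambda>q. fst q (snd q u)"]
      show "lsum C (\<lambda>q. tens (cmp f (fst p)) (snd p (lact P b (fst q (snd q u))))) xs = tens (cmp f (fst p)) (snd p (lact P b u))"
        using * x by (simp add: one_P S_app)
    qed
    finally show "?\<beta> (ract Q f b) u = ?\<beta> f (lact P b u)" .
  qed
  define \<phi> where "\<phi> = rep_map xs"
  have \<phi>_tens: "\<phi> (tens f u) = ?\<beta> f u" if "f \<in> carrier Q" "u \<in> carrier P" for f u
    using that by (simp add: \<phi>_def rep_map_def tens_closed C.tensor_lift_pure[OF C.abelian_group_tensor bal])
  then show "f \<in> carrier Q \<Longrightarrow> u \<in> carrier P \<Longrightarrow> rep_map xs (tens f u) = ?\<beta> f u"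
    by (simp add: \<phi>_def)
  show "y \<in> I \<Longrightarrow> f \<in> carrier Q \<Longrightarrow> u \<in> carrier P \<Longrightarrow> rep_map xs (tens (cmp f y) u) = tens f (y u)"
    using \<phi>_tens[of "cmp f y" u] by (simp add: \<phi>_def cmp_Q IS slide')
  have hom: "\<phi> \<in> add_hom C C"
    using C.tensor_lift_hom[OF C.abelian_group_tensor bal]
    by (simp add: \<phi>_def rep_map_def hom_def Pi_def)
  have \<phi>_closed: "\<phi> c \<in> carrier C" if "c \<in> carrier C" for c
    using that by (rule add_hom_closed[OF hom])
  have lact: "\<phi> (lact C a c) = lact C a (\<phi> c)" if a: "a \<in> carrier A" and c: "c \<in> carrier C" for a c
  proof (rule C.add_hom_tensor_eqI[OF C.abelian_group_tensor
        add_hom_compose[OF C.tensor_lact_hom[OF a] hom] add_hom_compose[OF hom C.tensor_lact_hom[OF a]] _ c])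
    fix f u assume fu: "f \<in> carrier Q" "u \<in> carrier P"
    have "\<phi> (lact C a (tens f u)) = lsum C (\<lambda>p. lact C a (tens (cmp f (fst p)) (snd p u))) xs"
      using fu a x by (auto simp: lact_tens \<phi>_tens Q.lact_closed cmp_lact_Q cmp_Q S_app cong: lsum_cong)
    also have "\<dots> = lact C a (\<phi> (tens f u))"
      using fu a x unfolding \<phi>_tens[OF fu]
      by (intro add_hom_lsum[OF C.abelian_group_tensor C.abelian_group_tensor C.tensor_lact_hom[OF a], symmetric] cl)
    finally show "\<phi> (lact C a (tens f u)) = lact C a (\<phi> (tens f u))" .
  qed
  have ract: "\<phi> (ract C c a) = ract C (\<phi> c) a" if a: "a \<in> carrier A" and c: "c \<in> carrier C" for a c
  proof (rule C.add_hom_tensor_eqI[OF C.abelian_group_tensor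
        add_hom_compose[OF Cr.tensor_ract_hom[OF a] hom] add_hom_compose[OF hom Cr.tensor_ract_hom[OF a]] _ c])
    fix f u assume fu: "f \<in> carrier Q" "u \<in> carrier P"
    have "\<phi> (ract C (tens f u) a) = lsum C (\<lambda>p. ract C (tens (cmp f (fst p)) (snd p u)) a) xs"
      using fu a x by (auto simp: ract_tens \<phi>_tens S_ract cmp_Q S_app cong: lsum_cong)
    also have "\<dots> = ract C (\<phi> (tens f u)) a"
      using fu a x unfolding \<phi>_tens[OF fu]
      by (intro add_hom_lsum[OF C.abelian_group_tensor C.abelian_group_tensor Cr.tensor_ract_hom[OF a], symmetric] cl)
    finally show "\<phi> (ract C (tens f u) a) = ract C (\<phi> (tens f u)) a" .
  qed
  have \<phi>_left: "\<phi> \<in> left_hom A C C" and \<phi>_right: "\<phi> \<in> right_hom A C C"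
    using hom lact ract by (auto simp: left_hom_def right_hom_def)
  have comult: "comult D (\<phi> c) = tmap \<phi> \<phi> (comult D c)" if c: "c \<in> carrier C" for c
  proof (rule C.add_hom_tensor_eqI[OF CC.abelian_group_tensor
        add_hom_compose[OF hom comult_hom] add_hom_compose[OF comult_hom tmap_hom[OF \<phi>_right \<phi>_left]] _ c])
    fix f u assume fu: "f \<in> carrier Q" "u \<in> carrier P"
    have bal2: "balanced A P Q CC (\<lambda>v g. tens2 (\<phi> (tens f v)) (tens g w))" if w: "w \<in> carrier P" for w
      using fu w by (intro balancedI)
        (simp_all add: tens_closed \<phi>_closed CC.pure_closed C.pure_add_left C.pure_add_right add_hom_add[OF hom]
          CC.pure_add_left CC.pure_add_right CC.pure_balanced flip: lact_tens ract_tens, simp add: ract \<phi>_closed tens_closed CC.pure_balanced)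
    have "tmap \<phi> \<phi> (comult D (tens f u)) = lsum CC (\<lambda>e. tens2 (\<phi> (tens f (fst e))) (\<phi> (tens (snd e) u))) ds"
      unfolding comult_tens[OF fu] using fu
      by (subst add_hom_lsum[OF CC.abelian_group_tensor CC.abelian_group_tensor tmap_hom[OF \<phi>_right \<phi>_left]])
        (simp_all add: tens_closed CC.pure_closed ds_in tmap_pure[OF \<phi>_right \<phi>_left] cong: lsum_cong)
    also have "\<dots> = lsum CC (\<lambda>e. lsum CC (\<lambda>q. tens2 (\<phi> (tens f (fst e))) (tens (cmp (snd e) (fst q)) (snd q u))) xs) ds"
    proof (rule lsum_cong)
      fix e assume e: "e \<in> set ds"
      show "tens2 (\<phi> (tens f (fst e))) (\<phi> (tens (snd e) u)) =
          lsum CC (\<lambda>q. tens2 (\<phi> (tens f (fst e))) (tens (cmp (snd e) (fst q)) (snd q u))) xs"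
        unfolding \<phi>_tens[OF ds_in(2)[OF e] fu(2)] using fu
        by (intro CC.pure_lsum_right cl \<phi>_closed tens_closed ds_in e)
    qed
    also have "\<dots> = lsum CC (\<lambda>q. lsum CC (\<lambda>e. tens2 (\<phi> (tens f (fst e))) (tens (cmp (snd e) (fst q)) (snd q u))) ds) xs"
      using fu by (intro CC.T.lsum_commute CC.pure_closed \<phi>_closed tens_closed cl ds_in)
    \<comment> \<open>By \<open>casimir\<close> the factor x_q leaves e_i^* and reappears at e_i
      under \<phi>, where \<open>slide\<close> takes it to f: \<phi>(f \<otimes> x_q e_i) = f x_q
      \<otimes> e_i. What remains is \<Delta>(f x_q \<otimes> y_q u).\<close>
    also have "\<dots> = lsum CC (\<lambda>q. lsum CC (\<lambda>e. tens2 (tens (cmp f (fst q)) (fst e)) (tens (snd e) (snd q u))) ds) xs"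
    proof (rule lsum_cong)
      fix q assume q: "q \<in> set xs"
      have "lsum CC (\<lambda>e. tens2 (\<phi> (tens f (\<one>\<^bsub>S\<^esub> (fst e)))) (tens (cmp (snd e) (fst q)) (snd q u))) ds =
          lsum CC (\<lambda>e. tens2 (\<phi> (tens f (\<one>\<^bsub>S\<^esub> (fst q (fst e))))) (tens (snd e) (snd q u))) ds"
        using fu x[OF q] by (intro casimir[OF CC.abelian_group_tensor bal2] S.one_closed) (simp_all add: S_app)
      moreover have "lsum CC (\<lambda>e. tens2 (\<phi> (tens f (\<one>\<^bsub>S\<^esub> (fst q (fst e))))) (tens (snd e) (snd q u))) ds =
          lsum CC (\<lambda>e. tens2 (tens (cmp f (fst q)) (fst e)) (tens (snd e) (snd q u))) ds"
        using fu x[OF q] by (intro lsum_cong) (simp add: ds_in S_app \<phi>_tens slide)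
      ultimately show "lsum CC (\<lambda>e. tens2 (\<phi> (tens f (fst e))) (tens (cmp (snd e) (fst q)) (snd q u))) ds =
          lsum CC (\<lambda>e. tens2 (tens (cmp f (fst q)) (fst e)) (tens (snd e) (snd q u))) ds"
        by (simp add: ds_in cong: lsum_cong)
    qed
    also have "\<dots> = lsum CC (\<lambda>q. comult D (tens (cmp f (fst q)) (snd q u))) xs"
      using fu x by (intro lsum_cong) (simp add: comult_tens cmp_Q S_app)
    also have "\<dots> = comult D (\<phi> (tens f u))"
      unfolding \<phi>_tens[OF fu] using fu
      by (intro add_hom_lsum[OF C.abelian_group_tensor CC.abelian_group_tensor comult_hom, symmetric] cl)
    finally show "comult D (\<phi> (tens f u)) = tmap \<phi> \<phi> (comult D (tens f u))" ..
  qed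
  have counit: "counit D (\<phi> c) = counit D c" if c: "c \<in> carrier C" for c
  proof (rule C.add_hom_tensor_eqI[OF Sg.R.abelian_group_axioms add_hom_compose[OF hom counit_hom] counit_hom _ c])
    fix f u assume fu: "f \<in> carrier Q" "u \<in> carrier P"
    have "counit D (\<phi> (tens f u)) = lsum A (\<lambda>p. counit D (tens (cmp f (fst p)) (snd p u))) xs"
      unfolding \<phi>_tens[OF fu] using fu
      by (intro add_hom_lsum[OF C.abelian_group_tensor Sg.R.abelian_group_axioms counit_hom] cl)
    also have "\<dots> = lsum A (\<lambda>p. f (fst p (snd p u))) xs"
      using fu x by (intro lsum_cong) (simp add: counit_tens cmp_Q S_app)
    also have "\<dots> = f (lsum P (\<lambda>p. fst p (snd p u)) xs)"
      using fu x by (intro add_hom_lsum[OF Sg.M.abelian_group_axioms Sg.R.abelian_group_axioms Q_app_hom, symmetric])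
        (simp_all add: S_app)
    finally show "counit D (\<phi> (tens f u)) = counit D (tens f u)"
      using fu by (simp add: one_P counit_tens)
  qed
  have "\<phi> \<in> coring_hom A D D"
    using hom lact ract comult counit by (auto simp: coring_hom_iff)
  then show "rep_map xs \<in> coring_hom A D D"
    by (simp add: \<phi>_def)
qed

text \<open>\<open>rep_map ys\<close> produces \<Sum> fy \<otimes> xu with y in I, and on such
  tensors \<open>rep_map xs\<close> takes y across; \<Sum> yx = 1 finishes. Exchanging I and K gives
  the other composite.\<close>

lemma rep_map_inverse:
  assumes I: "sub_bimodule B B S I" and K: "sub_bimodule B B S K"
    and xs: "set xs \<subseteq> K \<times> I" "lsum S (\<lambda>p. cmp (fst p) (snd p)) xs = \<one>\<^bsub>S\<^esub>"
    and ys: "set ys \<subseteq> I \<times> K" "lsum S (\<lambda>p. cmp (fst p) (snd p)) ys = \<one>\<^bsub>S\<^esub>"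
    and IK: "\<forall>y\<in>I. \<forall>x\<in>K. cmp y x \<in> cm ` carrier B"
    and KI: "\<forall>y\<in>K. \<forall>x\<in>I. cmp y x \<in> cm ` carrier B"
    and c: "c \<in> carrier C"
  shows "rep_map xs (rep_map ys c) = c"
proof -
  note \<phi> = rep_map[OF I K xs IK] and \<psi> = rep_map[OF K I ys KI]
  have y: "fst p \<in> I" "fst p \<in> carrier S" "snd p \<in> carrier S" if "p \<in> set ys" for p
    using pairs_fst[OF ys(1) that] pairs_snd[OF ys(1) that] sub_bimoduleD(4)[OF I] sub_bimoduleD(4)[OF K] by auto
  have ysS: "set ys \<subseteq> carrier S \<times> carrier S"
    using ys(1) sub_bimoduleD(4)[OF I] sub_bimoduleD(4)[OF K] by auto
  show ?thesis
  proof (rule C.add_hom_tensor_eqI[OF C.abelian_group_tensor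
        add_hom_compose[OF coring_homD(1)[OF \<psi>(1)] coring_homD(1)[OF \<phi>(1)]] add_hom_id _ c])
    fix f u assume fu: "f \<in> carrier Q" "u \<in> carrier P"
    have "rep_map xs (rep_map ys (tens f u)) = lsum C (\<lambda>p. rep_map xs (tens (cmp f (fst p)) (snd p u))) ys"
      unfolding \<psi>(3)[OF fu] using fu
      by (intro add_hom_lsum[OF C.abelian_group_tensor C.abelian_group_tensor coring_homD(1)[OF \<phi>(1)]] lsum_tens[OF ysS])
    also have "\<dots> = lsum C (\<lambda>p. tens f (cmp (fst p) (snd p) u)) ys"
      using fu y by (intro lsum_cong) (simp add: \<phi>(2) S_app)
    also have "\<dots> = tens f (lsum P (\<lambda>p. cmp (fst p) (snd p) u) ys)"
      using fu y by (intro add_hom_lsum[OF Sg.M.abelian_group_axioms C.abelian_group_tensor tens_hom, symmetric])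
        (simp_all add: S_app)
    also have "lsum P (\<lambda>p. cmp (fst p) (snd p) u) ys = lsum S (\<lambda>p. cmp (fst p) (snd p)) ys u"
      using fu y by (intro lsum_S_app[symmetric]) (simp_all add: cmp_S)
    finally show "rep_map xs (rep_map ys (tens f u)) = tens f u"
      using fu by (simp add: ys(2))
  qed
qed

end

context comatrix_descent
begin

lemma J_surj:
  assumes "I \<in> Units M"
  shows "I \<in> J ` carrier G"
proof -
  obtain K where K': "K \<in> carrier M" "K \<otimes>\<^bsub>M\<^esub> I = \<one>\<^bsub>M\<^esub>" "I \<otimes>\<^bsub>M\<^esub> K = \<one>\<^bsub>M\<^esub>" and I': "I \<in> carrier M"
    using assms by (auto simp: Units_def)
  have I: "sub_bimodule B B S I" and K: "sub_bimodule B B S K"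
    using I' K'(1) by (simp_all add: M_sel)
  have IK: "\<forall>y\<in>I. \<forall>x\<in>K. cmp y x \<in> cm ` carrier B"
    using ideal_prodI[of _ I _ K] K'(3) by (simp add: M_sel)
  have KI: "\<forall>y\<in>K. \<forall>x\<in>I. cmp y x \<in> cm ` carrier B"
    using ideal_prodI[of _ K _ I] K'(2) by (simp add: M_sel)
  have one: "\<one>\<^bsub>S\<^esub> \<in> ideal_prod S K I" "\<one>\<^bsub>S\<^esub> \<in> ideal_prod S I K"
    using K'(2,3) unfolding M_sel cm_one[symmetric] by auto
  obtain xs where xs: "set xs \<subseteq> K \<times> I" "\<one>\<^bsub>S\<^esub> = lsum S (\<lambda>p. cmp (fst p) (snd p)) xs"
    by (rule ideal_prod_list[OF sub_bimoduleD(4)[OF K] sub_bimoduleD(4)[OF I] one(1)])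
  note xs = xs(1) xs(2)[symmetric]
  obtain ys where ys: "set ys \<subseteq> I \<times> K" "\<one>\<^bsub>S\<^esub> = lsum S (\<lambda>p. cmp (fst p) (snd p)) ys"
    by (rule ideal_prod_list[OF sub_bimoduleD(4)[OF I] sub_bimoduleD(4)[OF K] one(2)])
  note ys = ys(1) ys(2)[symmetric]
  note \<phi> = rep_map[OF I K xs IK] and \<psi> = rep_map[OF K I ys KI]
  have inv: "rep_map xs (rep_map ys c) = c" "rep_map ys (rep_map xs c) = c" if "c \<in> carrier C" for c
    using rep_map_inverse[OF I K xs ys IK KI that] rep_map_inverse[OF K I ys xs KI IK that] by simp_all
  have "bij_betw (rep_map xs) (carrier C) (carrier C)"
    by (rule bij_betwI[where g = "rep_map ys"])
      (simp_all add: inv coring_homD(6)[OF \<phi>(1)] coring_homD(6)[OF \<psi>(1)])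
  then have Aut: "rep_map xs \<in> Aut"
    using \<phi>(1) by (simp add: Bij_def rep_map_def)
  have IJ: "I \<subseteq> J (rep_map xs)" and KJ: "K \<subseteq> J (rep_map ys)"
    using \<phi>(2) \<psi>(2) sub_bimoduleD(4)[OF I] sub_bimoduleD(4)[OF K] by (auto simp: J_def)
  have "J (rep_map xs) \<subseteq> I"
  proof
    fix s assume s: "s \<in> J (rep_map xs)"
    then have s': "s \<in> carrier S" by (simp add: J_def)
    have x: "fst p \<in> K" "snd p \<in> I" "fst p \<in> carrier S" "snd p \<in> carrier S" if "p \<in> set xs" for p
      using pairs_fst[OF xs(1) that] pairs_snd[OF xs(1) that] sub_bimoduleD(4)[OF I] sub_bimoduleD(4)[OF K] by auto
    \<comment> \<open>In s = \<Sum> (s x_k) y_k the factor s x_k lies in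
      J(\<phi>)J(\<phi>\<inverse>) \<subseteq> B, because x_k is in K \<subseteq>
      J(\<phi>\<inverse>); so every term is in I.\<close>
    have "s = cmp s (lsum S (\<lambda>p. cmp (fst p) (snd p)) xs)"
      using S.r_one[OF s'] by (simp add: xs(2))
    also have "\<dots> = lsum S (\<lambda>p. cmp s (cmp (fst p) (snd p))) xs"
      using x by (intro add_hom_lsum[OF S.abelian_group_axioms S.abelian_group_axioms cmp_S_hom'[OF s']]) (simp add: cmp_S)
    also have "\<dots> = lsum S (\<lambda>p. cmp (cmp s (fst p)) (snd p)) xs"
      using x s' by (intro lsum_cong) (simp add: cmp_assoc)
    also have "\<dots> \<in> I"
    proof (rule subgroup_lsum[OF sub_bimoduleD(1)[OF I]])
      fix p assume p: "p \<in> set xs"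
      have "cmp s (fst p) \<in> ideal_prod S (J (rep_map xs)) (J (rep_map ys))"
        using s x(1)[OF p] KJ by (intro ideal_prodI) auto
      also have "\<dots> \<subseteq> J (\<lambda>c. c)"
        by (rule J_compose[OF \<phi>(1) \<psi>(1) coring_hom_ident]) (simp add: inv)
      also have "\<dots> \<subseteq> cm ` carrier B"
        by (rule J_id) (rule refl)
      finally obtain b where "b \<in> carrier B" "cmp s (fst p) = cm b"
        by (rule imageE)
      then show "cmp (cmp s (fst p)) (snd p) \<in> I"
        using x(2)[OF p] by (simp add: sub_bimoduleD(2)[OF I])
    qed
    finally show "s \<in> I" .
  qed
  then have "J (rep_map xs) = I"
    using IJ by (rule subset_antisym)
  then show ?thesis
    using Aut by (auto simp: G_sel)
qed

lemma group_isomorphism: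
  "group (units_of M) \<and> group G \<and> (\<exists>\<Gamma>. \<Gamma> \<in> iso (units_of M) G)"
proof -
  have "J ` carrier G = carrier (units_of M)"
    using J_surj J_unit by (auto simp: units_of_carrier G_sel(1))
  then have "J \<in> iso G (units_of M)"
    using J_hom J_inj by (simp add: iso_def bij_betw_def)
  then have "inv_into (carrier G) J \<in> iso (units_of M) G"
    by (rule G.iso_set_sym)
  then show ?thesis
    using monoid.units_group[OF monoid_M] group_G by blast
qed

end

section \<open>Maps represented by elements of \<open>S \<otimes>\<^sub>B S\<close>\<close>

context comatrix
begin

text \<open>In contrast to \<open>rep_map\<close> no relation is imposed on the entries: the map
  \<phi> is given beforehand, and xs merely records its values on pure tensors.\<close>

definition represents where
  "represents xs \<phi> \<longleftrightarrow> set xs \<subseteq> carrier S \<times> carrier S \<and>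
     (\<forall>f\<in>carrier Q. \<forall>u\<in>carrier P. \<phi> (tens f u) = lsum C (\<lambda>p. tens (cmp f (fst p)) (snd p u)) xs)"

lemma representsD:
  assumes "represents xs \<phi>"
  shows "p \<in> set xs \<Longrightarrow> fst p \<in> carrier S" and "p \<in> set xs \<Longrightarrow> snd p \<in> carrier S"
    and "f \<in> carrier Q \<Longrightarrow> u \<in> carrier P \<Longrightarrow> \<phi> (tens f u) = lsum C (\<lambda>p. tens (cmp f (fst p)) (snd p u)) xs"
  using assms by (auto simp: represents_def)

text \<open>An \<open>A\<close>-bilinear map is determined by its values on \<open>e\<^sub>i\<^sup>* \<otimes> e\<^sub>j\<close>.\<close>

lemma represents_exists:
  assumes \<phi>: "\<phi> \<in> coring_hom A D D"
  obtains xs where "represents xs \<phi>"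
proof -
  note hom = coring_homD(1)[OF \<phi>]
  define W where "W e e' = (SOME ws. set ws \<subseteq> carrier Q \<times> carrier P \<and>
      \<phi> (tens (snd e) (fst e')) = lsum C (\<lambda>w. tens (fst w) (snd w)) ws)" for e e' :: "'m \<times> ('m \<Rightarrow> 'a)"
  have W: "set (W e e') \<subseteq> carrier Q \<times> carrier P"
      "\<phi> (tens (snd e) (fst e')) = lsum C (\<lambda>w. tens (fst w) (snd w)) (W e e')"
    if "e \<in> set ds" "e' \<in> set ds" for e e'
  proof -
    have "\<phi> (tens (snd e) (fst e')) \<in> carrier C"
      using that by (intro coring_homD(6)[OF \<phi>] tens_closed ds_in)
    then have "\<exists>ws. set ws \<subseteq> carrier Q \<times> carrier P \<and> \<phi> (tens (snd e) (fst e')) = lsum C (\<lambda>w. tens (fst w) (snd w)) ws"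
      by (rule C.tensor_list) blast
    then have "set (W e e') \<subseteq> carrier Q \<times> carrier P \<and> \<phi> (tens (snd e) (fst e')) = lsum C (\<lambda>w. tens (fst w) (snd w)) (W e e')"
      unfolding W_def by (rule someI_ex)
    then show "set (W e e') \<subseteq> carrier Q \<times> carrier P" "\<phi> (tens (snd e) (fst e')) = lsum C (\<lambda>w. tens (fst w) (snd w)) (W e e')"
      by simp_all
  qed
  \<comment> \<open>A term g \<otimes> v of \<phi>(e^* \<otimes> e') gives x = e g and y = v e'^*,
    both of rank one, where e^* is the functional paired with e. Then fx \<otimes> yu = f(e) g
    \<otimes> v e'^*(u), which is the term multiplied by coordinates of f and u.\<close>
  define R where "R e e' = map (\<lambda>w. (rk (fst e) (fst w), rk (snd w) (snd e'))) (W e e')" for e e'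
  define xs where "xs = concat (map (\<lambda>d. R (fst d) (snd d)) (List.product ds ds))"
  have R: "set (R e e') \<subseteq> carrier S \<times> carrier S" if "e \<in> set ds" "e' \<in> set ds" for e e'
  proof -
    have "fst w \<in> carrier Q" "snd w \<in> carrier P" if "w \<in> set (W e e')" for w
      using that W(1)[OF \<open>e \<in> set ds\<close> \<open>e' \<in> set ds\<close>] by (auto dest: pairs_fst pairs_snd)
    then show ?thesis
      using that by (auto simp: R_def rk_S ds_in)
  qed
  have xsS: "set xs \<subseteq> carrier S \<times> carrier S"
    using R by (fastforce simp: xs_def)
  have "\<phi> (tens f u) = lsum C (\<lambda>p. tens (cmp f (fst p)) (snd p u)) xs" if f: "f \<in> carrier Q" and u: "u \<in> carrier P" for f u
  proof -
    let ?t = "\<lambda>p. tens (cmp f (fst p)) (snd p u)"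
    have t: "?t p \<in> carrier C" if "e \<in> set ds" "e' \<in> set ds" "p \<in> set (R e e')" for e e' p
      by (rule lsum_tens[OF R[OF that(1,2)] f u that(3)])
    have "lsum C ?t xs = lsum C (\<lambda>d. lsum C ?t (R (fst d) (snd d))) (List.product ds ds)"
      unfolding xs_def using t by (intro lsum_concat_map[OF C.abelian_group_tensor]) auto
    also have "\<dots> = lsum C (\<lambda>e. lsum C (\<lambda>e'. lsum C ?t (R e e')) ds) ds"
      using t by (intro C.T.lsum_product C.T.lsum_closed)
    also have "\<dots> = lsum C (\<lambda>e. lsum C (\<lambda>e'. \<phi> (tens (lact Q (f (fst e)) (snd e)) (ract P (fst e') (snd e' u)))) ds) ds"
    proof (intro lsum_cong)
      fix e e' assume e: "e \<in> set ds" and e': "e' \<in> set ds"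
      let ?a = "f (fst e)" and ?b = "snd e' u"
      have ab: "?a \<in> carrier A" "?b \<in> carrier A"
        using e e' f u by (simp_all add: Q_app ds_in)
      have w: "fst w \<in> carrier Q" "snd w \<in> carrier P" if "w \<in> set (W e e')" for w
        using that W(1)[OF e e'] by (auto dest: pairs_fst pairs_snd)
      have hom': "(\<lambda>c. lact C ?a (ract C c ?b)) \<in> add_hom C C"
        by (rule add_hom_compose[OF Cr.tensor_ract_hom[OF ab(2)] C.tensor_lact_hom[OF ab(1)]])
      have "\<phi> (tens (lact Q ?a (snd e)) (ract P (fst e') ?b)) = \<phi> (lact C ?a (ract C (tens (snd e) (fst e')) ?b))"
        using ab e e' by (simp add: ract_tens lact_tens ds_in)
      also have "\<dots> = lact C ?a (ract C (\<phi> (tens (snd e) (fst e'))) ?b)"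
        using ab e e' by (simp add: coring_homD(2,3)[OF \<phi>] tens_closed ds_in C.ract_closed)
      also have "\<dots> = lsum C (\<lambda>w. lact C ?a (ract C (tens (fst w) (snd w)) ?b)) (W e e')"
        unfolding W(2)[OF e e'] using w
        by (intro add_hom_lsum[OF C.abelian_group_tensor C.abelian_group_tensor hom'] tens_closed)
      also have "\<dots> = lsum C (\<lambda>w. tens (cmp f (rk (fst e) (fst w))) (rk (snd w) (snd e') u)) (W e e')"
        using w ab f u e by (intro lsum_cong) (simp add: ract_tens lact_tens cmp_Q_rk ds_in)
      also have "\<dots> = lsum C ?t (R e e')"
        by (simp add: R_def lsum_map)
      finally show "lsum C ?t (R e e') = \<phi> (tens (lact Q ?a (snd e)) (ract P (fst e') ?b))" ..
    qed
    also have "\<dots> = lsum C (\<lambda>e. \<phi> (tens (lact Q (f (fst e)) (snd e)) u)) ds"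
    proof (rule lsum_cong)
      fix e assume e: "e \<in> set ds"
      have g: "lact Q (f (fst e)) (snd e) \<in> carrier Q"
        using e f by (simp add: Q.lact_closed Q_app ds_in)
      have "lsum C (\<lambda>e'. \<phi> (tens (lact Q (f (fst e)) (snd e)) (ract P (fst e') (snd e' u)))) ds =
          \<phi> (tens (lact Q (f (fst e)) (snd e)) (lsum P (\<lambda>e'. ract P (fst e') (snd e' u)) ds))"
        using u by (intro add_hom_lsum[OF Sg.M.abelian_group_axioms C.abelian_group_tensor
              add_hom_compose[OF tens_hom[OF g] hom], symmetric]) (simp add: ds_in Q_app)
      then show "lsum C (\<lambda>e'. \<phi> (tens (lact Q (f (fst e)) (snd e)) (ract P (fst e') (snd e' u)))) ds =
          \<phi> (tens (lact Q (f (fst e)) (snd e)) u)"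
        using u by (simp add: dual_expand)
    qed
    also have "\<dots> = \<phi> (tens (lsum Q (\<lambda>e. lact Q (f (fst e)) (snd e)) ds) u)"
      using f by (intro add_hom_lsum[OF Q.M.abelian_group_axioms C.abelian_group_tensor
              add_hom_compose[OF tens_hom'[OF u] hom], symmetric]) (simp add: ds_in Q_app Q.lact_closed)
    finally show ?thesis
      using f by (simp add: dual_Q)
  qed
  then have "represents xs \<phi>"
    using xsS by (simp add: represents_def)
  then show thesis by (rule that)
qed

lemma P_eqI:
  assumes "u \<in> carrier P" "v \<in> carrier P" and "\<And>f. f \<in> carrier Q \<Longrightarrow> f u = f v"
  shows "u = v"
proof -
  have "lsum P (\<lambda>e. ract P (fst e) (snd e u)) ds = lsum P (\<lambda>e. ract P (fst e) (snd e v)) ds"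
    by (rule lsum_cong) (simp only: assms(3)[OF ds_in(2)])
  then show ?thesis
    by (simp only: dual_expand assms(1,2))
qed

lemma counit_lsum:
  assumes xs: "\<And>i. i \<in> set xs \<Longrightarrow> g i \<in> carrier Q" "\<And>i. i \<in> set xs \<Longrightarrow> v i \<in> carrier P"
  shows "counit D (lsum C (\<lambda>i. tens (g i) (v i)) xs) = lsum A (\<lambda>i. g i (v i)) xs"
proof -
  have "counit D (lsum C (\<lambda>i. tens (g i) (v i)) xs) = lsum A (\<lambda>i. counit D (tens (g i) (v i))) xs"
    using xs by (intro add_hom_lsum[OF C.abelian_group_tensor Sg.R.abelian_group_axioms counit_hom] tens_closed)
  then show ?thesis
    using xs by (simp add: counit_tens cong: lsum_cong)
qed

text \<open>Evaluate \<epsilon>\<phi> = \<epsilon> at f \<otimes> u: this is f(\<Sum> x_k y_k u) =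
  f(u) for every f, and functionals separate points.\<close>

lemma represents_unit:
  assumes \<phi>: "\<phi> \<in> coring_hom A D D" and xs: "represents xs \<phi>" and u: "u \<in> carrier P"
  shows "lsum P (\<lambda>p. fst p (snd p u)) xs = u"
proof (rule P_eqI)
  note x = representsD(1,2)[OF xs]
  show "lsum P (\<lambda>p. fst p (snd p u)) xs \<in> carrier P"
    using x u by (intro Sg.M.lsum_closed) (simp add: S_app)
  fix f assume f: "f \<in> carrier Q"
  have "f (lsum P (\<lambda>p. fst p (snd p u)) xs) = lsum A (\<lambda>p. f (fst p (snd p u))) xs"
    using x u by (intro add_hom_lsum[OF Sg.M.abelian_group_axioms Sg.R.abelian_group_axioms Q_app_hom[OF f]]) (simp add: S_app)
  also have "\<dots> = counit D (\<phi> (tens f u))"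
    unfolding representsD(3)[OF xs f u] using x f u by (subst counit_lsum) (simp_all add: cmp_Q S_app cong: lsum_cong)
  also have "\<dots> = f u"
    using f u by (simp add: coring_homD(5)[OF \<phi>] tens_closed counit_tens)
  finally show "f (lsum P (\<lambda>p. fst p (snd p u)) xs) = f u" .
qed (rule u)

text \<open>The additive maps out of \<Sigma>^* \<otimes> S \<otimes> \<Sigma> over B, in curried
  form.\<close>

definition trilinear :: "('g, 'z) ring_scheme \<Rightarrow> (('m \<Rightarrow> 'a) \<Rightarrow> ('m \<Rightarrow> 'm) \<Rightarrow> 'm \<Rightarrow> 'g) \<Rightarrow> bool" where
  "trilinear H \<delta> \<longleftrightarrow>
    (\<forall>s\<in>carrier S. \<forall>u\<in>carrier P. (\<lambda>f. \<delta> f s u) \<in> add_hom Q H) \<and>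
    (\<forall>f\<in>carrier Q. \<forall>u\<in>carrier P. (\<lambda>s. \<delta> f s u) \<in> add_hom S H) \<and>
    (\<forall>f\<in>carrier Q. \<forall>s\<in>carrier S. \<delta> f s \<in> add_hom P H) \<and>
    (\<forall>f\<in>carrier Q. \<forall>b\<in>carrier B. \<forall>s\<in>carrier S. \<forall>u\<in>carrier P. \<delta> (cmp f (cm b)) s u = \<delta> f (cmp (cm b) s) u) \<and>
    (\<forall>f\<in>carrier Q. \<forall>b\<in>carrier B. \<forall>s\<in>carrier S. \<forall>u\<in>carrier P. \<delta> f (cmp s (cm b)) u = \<delta> f s (lact P b u))"

lemma trilinearI:
  assumes "\<And>f s u. f \<in> carrier Q \<Longrightarrow> s \<in> carrier S \<Longrightarrow> u \<in> carrier P \<Longrightarrow> \<delta> f s u \<in> carrier H"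
    and "\<And>f f' s u. f \<in> carrier Q \<Longrightarrow> f' \<in> carrier Q \<Longrightarrow> s \<in> carrier S \<Longrightarrow> u \<in> carrier P \<Longrightarrow>
      \<delta> (f \<oplus>\<^bsub>Q\<^esub> f') s u = \<delta> f s u \<oplus>\<^bsub>H\<^esub> \<delta> f' s u"
    and "\<And>f s s' u. f \<in> carrier Q \<Longrightarrow> s \<in> carrier S \<Longrightarrow> s' \<in> carrier S \<Longrightarrow> u \<in> carrier P \<Longrightarrow>
      \<delta> f (s \<oplus>\<^bsub>S\<^esub> s') u = \<delta> f s u \<oplus>\<^bsub>H\<^esub> \<delta> f s' u"
    and "\<And>f s u u'. f \<in> carrier Q \<Longrightarrow> s \<in> carrier S \<Longrightarrow> u \<in> carrier P \<Longrightarrow> u' \<in> carrier P \<Longrightarrow>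
      \<delta> f s (u \<oplus>\<^bsub>P\<^esub> u') = \<delta> f s u \<oplus>\<^bsub>H\<^esub> \<delta> f s u'"
    and "\<And>f b s u. f \<in> carrier Q \<Longrightarrow> b \<in> carrier B \<Longrightarrow> s \<in> carrier S \<Longrightarrow> u \<in> carrier P \<Longrightarrow>
      \<delta> (cmp f (cm b)) s u = \<delta> f (cmp (cm b) s) u"
    and "\<And>f b s u. f \<in> carrier Q \<Longrightarrow> b \<in> carrier B \<Longrightarrow> s \<in> carrier S \<Longrightarrow> u \<in> carrier P \<Longrightarrow>
      \<delta> f (cmp s (cm b)) u = \<delta> f s (lact P b u)"
  shows "trilinear H \<delta>"
  using assms by (auto simp: trilinear_def intro!: add_homI)

lemma trilinearD:
  assumes "trilinear H \<delta>"
  shows "s \<in> carrier S \<Longrightarrow> u \<in> carrier P \<Longrightarrow> (\<lambda>f. \<delta> f s u) \<in> add_hom Q H"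
    and "f \<in> carrier Q \<Longrightarrow> u \<in> carrier P \<Longrightarrow> (\<lambda>s. \<delta> f s u) \<in> add_hom S H"
    and "f \<in> carrier Q \<Longrightarrow> s \<in> carrier S \<Longrightarrow> \<delta> f s \<in> add_hom P H"
    and "f \<in> carrier Q \<Longrightarrow> b \<in> carrier B \<Longrightarrow> s \<in> carrier S \<Longrightarrow> u \<in> carrier P \<Longrightarrow>
      \<delta> (cmp f (cm b)) s u = \<delta> f (cmp (cm b) s) u"
    and "f \<in> carrier Q \<Longrightarrow> b \<in> carrier B \<Longrightarrow> s \<in> carrier S \<Longrightarrow> u \<in> carrier P \<Longrightarrow>
      \<delta> f (cmp s (cm b)) u = \<delta> f s (lact P b u)"
    and "f \<in> carrier Q \<Longrightarrow> s \<in> carrier S \<Longrightarrow> u \<in> carrier P \<Longrightarrow> \<delta> f s u \<in> carrier H"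
  using assms add_hom_closed[of "\<delta> f s" P H u] by (auto simp: trilinear_def)

text \<open>The reason is \<open>C \<otimes>\<^sub>A C \<cong> \<Sigma>\<^sup>* \<otimes>\<^sub>B S \<otimes>\<^sub>B \<Sigma>\<close>.\<close>

lemma trilinear_lift:
  assumes H: "abelian_group H" and \<delta>: "trilinear H \<delta>"
  obtains E where "balanced A C C H E"
    and "\<And>f v g w. f \<in> carrier Q \<Longrightarrow> v \<in> carrier P \<Longrightarrow> g \<in> carrier Q \<Longrightarrow> w \<in> carrier P \<Longrightarrow>
      E (tens f v) (tens g w) = \<delta> f (rk v g) w"
proof
  note d = trilinearD[OF \<delta>]
  have rk_cm: "rk (lact P b v) g = cmp (cm b) (rk v g)" if "b \<in> carrier B" "v \<in> carrier P" "g \<in> carrier Q" for b v g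
    using that by (simp add: cmp_rk cm_in_S)
  \<comment> \<open>The lift is built in two rounds: over f \<otimes> v with g and w fixed, giving
    \<open>L\<close>, then over g \<otimes> w with c fixed, giving \<open>E\<close>.\<close>
  define L where "L g w = tensor_lift H (\<lambda>f v. \<delta> f (rk v g) w)" for g w
  have L_bal: "balanced B Q P H (\<lambda>f v. \<delta> f (rk v g) w)" if "g \<in> carrier Q" "w \<in> carrier P" for g w
    using that by (intro balancedI)
      (simp_all add: d(4,6) rk_S add_hom_add[OF d(1)] add_hom_add[OF d(2)] add_hom_add[OF rk_hom] ract_Q rk_cm)
  have L_hom: "L g w \<in> add_hom C H" if "g \<in> carrier Q" "w \<in> carrier P" for g w
    unfolding L_def by (rule C.tensor_lift_hom[OF H L_bal[OF that]])
  have L_tens: "L g w (tens f v) = \<delta> f (rk v g) w" if "g \<in> carrier Q" "w \<in> carrier P" "f \<in> carrier Q" "v \<in> carrier P" for f v g w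
    unfolding L_def by (rule C.tensor_lift_pure[OF H L_bal[OF that(1,2)] that(3,4)])
  have L_bal2: "balanced B Q P H (\<lambda>g w. L g w c)" if c: "c \<in> carrier C" for c
  proof (rule balancedI)
    show "L g w c \<in> carrier H" if "g \<in> carrier Q" "w \<in> carrier P" for g w
      using c by (rule add_hom_closed[OF L_hom[OF that]])
    show "L (g \<oplus>\<^bsub>Q\<^esub> g') w c = L g w c \<oplus>\<^bsub>H\<^esub> L g' w c"
      if "g \<in> carrier Q" "g' \<in> carrier Q" "w \<in> carrier P" for g g' w
      by (rule C.add_hom_tensor_eqI[OF H L_hom add_hom_plus[OF H L_hom L_hom] _ c])
        (use that in \<open>simp_all add: L_tens add_hom_add[OF rk_hom'] add_hom_add[OF d(2)] rk_S\<close>)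
    show "L g (w \<oplus>\<^bsub>P\<^esub> w') c = L g w c \<oplus>\<^bsub>H\<^esub> L g w' c"
      if "g \<in> carrier Q" "w \<in> carrier P" "w' \<in> carrier P" for g w w'
      by (rule C.add_hom_tensor_eqI[OF H L_hom add_hom_plus[OF H L_hom L_hom] _ c])
        (use that in \<open>simp_all add: L_tens add_hom_add[OF d(3)] rk_S\<close>)
    show "L (ract Q g b) w c = L g (lact P b w) c"
      if "g \<in> carrier Q" "b \<in> carrier B" "w \<in> carrier P" for g b w
      by (rule C.add_hom_tensor_eqI[OF H L_hom L_hom _ c])
        (use that in \<open>simp_all add: L_tens Q.ract_closed d(5)[symmetric] rk_S rk_cmp cm_in_S\<close>, simp add: ract_Q)
  qed
  define E where "E c = tensor_lift H (\<lambda>g w. L g w c)" for c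
  have E_hom: "E c \<in> add_hom C H" if "c \<in> carrier C" for c
    unfolding E_def by (rule C.tensor_lift_hom[OF H L_bal2[OF that]])
  have E_tens: "E c (tens g w) = L g w c" if "c \<in> carrier C" "g \<in> carrier Q" "w \<in> carrier P" for c g w
    unfolding E_def by (rule C.tensor_lift_pure[OF H L_bal2[OF that(1)] that(2,3)])
  show "E (tens f v) (tens g w) = \<delta> f (rk v g) w"
    if "f \<in> carrier Q" "v \<in> carrier P" "g \<in> carrier Q" "w \<in> carrier P" for f v g w
    using that by (simp add: E_tens L_tens tens_closed)
  show "balanced A C C H E"
  proof (rule balancedI)
    show "E c c' \<in> carrier H" if "c \<in> carrier C" "c' \<in> carrier C" for c c'
      using that(2) by (rule add_hom_closed[OF E_hom[OF that(1)]])
    show "E c (x \<oplus>\<^bsub>C\<^esub> y) = E c x \<oplus>\<^bsub>H\<^esub> E c y" if "c \<in> carrier C" "x \<in> carrier C" "y \<in> carrier C" for c x y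
      using that by (simp add: add_hom_add[OF E_hom])
    show "E (x \<oplus>\<^bsub>C\<^esub> y) c = E x c \<oplus>\<^bsub>H\<^esub> E y c" if "x \<in> carrier C" "y \<in> carrier C" "c \<in> carrier C" for x y c
      by (rule C.add_hom_tensor_eqI[OF H E_hom add_hom_plus[OF H E_hom E_hom] _ that(3)])
        (use that in \<open>simp_all add: E_tens add_hom_add[OF L_hom]\<close>)
    show "E (ract C x a) c = E x (lact C a c)" if x: "x \<in> carrier C" and a: "a \<in> carrier A" and c: "c \<in> carrier C" for x a c
    proof (rule C.add_hom_tensor_eqI[OF H E_hom add_hom_compose[OF C.tensor_lact_hom[OF a] E_hom[OF x]] _ c])
      show "ract C x a \<in> carrier C"
        using x a by (rule C.ract_closed)
      fix g w assume gw: "g \<in> carrier Q" "w \<in> carrier P"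
      have "L g w (ract C x a) = L (lact Q a g) w x"
      proof (rule C.add_hom_tensor_eqI[OF H add_hom_compose[OF Cr.tensor_ract_hom[OF a] L_hom[OF gw]] L_hom _ x])
        fix f v assume fv: "f \<in> carrier Q" "v \<in> carrier P"
        \<comment> \<open>Balancedness over A comes down to this identity (va) g = v (ag) of
          rank-one maps.\<close>
        have "rk (ract P v a) g = rk v (lact Q a g)"
          using fv gw a by (intro S_eqI rk_S) (simp_all add: Sg.ract_assoc Q_app Q_lact_app Q.lact_closed)
        then show "L g w (ract C (tens f v) a) = L (lact Q a g) w (tens f v)"
          using fv gw a by (simp add: ract_tens L_tens Q.lact_closed)
      qed (use gw a in \<open>simp_all add: Q.lact_closed\<close>)
      then show "E (ract C x a) (tens g w) = E x (lact C a (tens g w))"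
        using gw x a by (simp add: E_tens lact_tens C.ract_closed Q.lact_closed)
    qed
  qed
qed

text \<open>This is \<open>\<Sum>x\<^sub>k \<otimes> 1 \<otimes> y\<^sub>k = \<Sum>x\<^sub>k \<otimes> y\<^sub>kx\<^sub>l \<otimes> y\<^sub>l\<close>, tested against trilinear maps so that no
  threefold tensor product has to be formed.\<close>

lemma represents_comult:
  assumes \<phi>: "\<phi> \<in> coring_hom A D D" and xs: "represents xs \<phi>"
    and H: "abelian_group H" and \<delta>: "trilinear H \<delta>"
    and f: "f \<in> carrier Q" and u: "u \<in> carrier P"
  shows "lsum H (\<lambda>p. \<delta> (cmp f (fst p)) \<one>\<^bsub>S\<^esub> (snd p u)) xs =
    lsum H (\<lambda>p. lsum H (\<lambda>q. \<delta> (cmp f (fst p)) (cmp (snd p) (fst q)) (snd q u)) xs) xs"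
proof -
  interpret H: abelian_group H by fact
  note x = representsD(1,2)[OF xs] and d = trilinearD[OF \<delta>]
  obtain E where E: "balanced A C C H E" and
    E_tens: "\<And>f v g w. f \<in> carrier Q \<Longrightarrow> v \<in> carrier P \<Longrightarrow> g \<in> carrier Q \<Longrightarrow> w \<in> carrier P \<Longrightarrow>
      E (tens f v) (tens g w) = \<delta> f (rk v g) w"
    by (rule trilinear_lift[OF H \<delta>]) blast
  let ?E = "tensor_lift H E"
  have E_hom: "?E \<in> add_hom CC H"
    by (rule CC.tensor_lift_hom[OF H E])
  have E_pure: "?E (tens2 c c') = E c c'" if "c \<in> carrier C" "c' \<in> carrier C" for c c'
    by (rule CC.tensor_lift_pure[OF H E that])
  \<comment> \<open>Comultiplication inserts \<Sum> e_i \<otimes> e_i^*, whose image in S is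
    1.\<close>
  have E_comult: "?E (comult D (tens g w)) = \<delta> g \<one>\<^bsub>S\<^esub> w" if "g \<in> carrier Q" "w \<in> carrier P" for g w
  proof -
    have "?E (comult D (tens g w)) = lsum H (\<lambda>e. ?E (tens2 (tens g (fst e)) (tens (snd e) w))) ds"
      unfolding comult_tens[OF that] using that
      by (intro add_hom_lsum[OF CC.abelian_group_tensor H E_hom] CC.pure_closed tens_closed ds_in)
    also have "\<dots> = lsum H (\<lambda>e. \<delta> g (rk (fst e) (snd e)) w) ds"
      using that by (intro lsum_cong) (simp add: E_pure E_tens tens_closed ds_in)
    also have "\<dots> = \<delta> g (lsum S (\<lambda>e. rk (fst e) (snd e)) ds) w"
      using that by (intro add_hom_lsum[OF S.abelian_group_axioms H d(2), symmetric]) (simp_all add: rk_S ds_in)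
    finally show ?thesis
      by (simp add: dual_one)
  qed
  have "lsum H (\<lambda>p. \<delta> (cmp f (fst p)) \<one>\<^bsub>S\<^esub> (snd p u)) xs = lsum H (\<lambda>p. ?E (comult D (tens (cmp f (fst p)) (snd p u)))) xs"
    using x f u by (intro lsum_cong) (simp add: E_comult cmp_Q S_app)
  also have "\<dots> = ?E (comult D (\<phi> (tens f u)))"
    unfolding representsD(3)[OF xs f u] using x f u
    by (intro add_hom_lsum[OF C.abelian_group_tensor H add_hom_compose[OF comult_hom E_hom], symmetric])
      (simp add: tens_closed cmp_Q S_app)
  also have "\<dots> = ?E (tmap \<phi> \<phi> (comult D (tens f u)))"
    using f u by (simp add: coring_homD(4)[OF \<phi>] tens_closed)
  also have "\<dots> = lsum H (\<lambda>e. ?E (tmap \<phi> \<phi> (tens2 (tens f (fst e)) (tens (snd e) u)))) ds"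
    unfolding comult_tens[OF f u] using f u
    by (intro add_hom_lsum[OF CC.abelian_group_tensor H add_hom_compose[OF tmap_hom[OF coring_homD(8,7)[OF \<phi>]] E_hom]]
        CC.pure_closed tens_closed ds_in)
  also have "\<dots> = lsum H (\<lambda>e. lsum H (\<lambda>p. lsum H (\<lambda>q. \<delta> (cmp f (fst p)) (rk (snd p (fst e)) (cmp (snd e) (fst q))) (snd q u)) xs) xs) ds"
  proof (rule lsum_cong)
    fix e assume e: "e \<in> set ds"
    have t: "tens (cmp f (fst p)) (snd p (fst e)) \<in> carrier C" "tens (cmp (snd e) (fst p)) (snd p u) \<in> carrier C" if "p \<in> set xs" for p
      using x[OF that] e f u by (simp_all add: tens_closed cmp_Q S_app ds_in)
    have "?E (tmap \<phi> \<phi> (tens2 (tens f (fst e)) (tens (snd e) u))) = E (\<phi> (tens f (fst e))) (\<phi> (tens (snd e) u))"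
      using e f u by (simp add: tmap_pure[OF coring_homD(8,7)[OF \<phi>]] tens_closed ds_in E_pure coring_homD(6)[OF \<phi>])
    also have "\<dots> = lsum H (\<lambda>p. E (tens (cmp f (fst p)) (snd p (fst e))) (\<phi> (tens (snd e) u))) xs"
      unfolding representsD(3)[OF xs f ds_in(1)[OF e]] using e u t
      by (intro add_hom_lsum[OF C.abelian_group_tensor H balancedD(2)[OF E]] coring_homD(6)[OF \<phi>]) (simp_all add: tens_closed ds_in)
    also have "\<dots> = lsum H (\<lambda>p. lsum H (\<lambda>q. E (tens (cmp f (fst p)) (snd p (fst e))) (tens (cmp (snd e) (fst q)) (snd q u))) xs) xs"
      unfolding representsD(3)[OF xs ds_in(2)[OF e] u] using t
      by (intro lsum_cong[OF add_hom_lsum[OF C.abelian_group_tensor H balancedD(1)[OF E]]])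
    also have "\<dots> = lsum H (\<lambda>p. lsum H (\<lambda>q. \<delta> (cmp f (fst p)) (rk (snd p (fst e)) (cmp (snd e) (fst q))) (snd q u)) xs) xs"
      using x e f u by (intro lsum_cong) (simp add: E_tens cmp_Q S_app ds_in)
    finally show "?E (tmap \<phi> \<phi> (tens2 (tens f (fst e)) (tens (snd e) u))) =
        lsum H (\<lambda>p. lsum H (\<lambda>q. \<delta> (cmp f (fst p)) (rk (snd p (fst e)) (cmp (snd e) (fst q))) (snd q u)) xs) xs" .
  qed
  also have "\<dots> = lsum H (\<lambda>p. lsum H (\<lambda>e. lsum H (\<lambda>q. \<delta> (cmp f (fst p)) (rk (snd p (fst e)) (cmp (snd e) (fst q))) (snd q u)) xs) ds) xs"
    using x f u by (intro H.lsum_commute H.lsum_closed d(6)) (simp_all add: cmp_Q S_app rk_S ds_in)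
  also have "\<dots> = lsum H (\<lambda>p. lsum H (\<lambda>q. \<delta> (cmp f (fst p)) (cmp (snd p) (fst q)) (snd q u)) xs) xs"
  proof (rule lsum_cong)
    fix p assume p: "p \<in> set xs"
    have "lsum H (\<lambda>e. lsum H (\<lambda>q. \<delta> (cmp f (fst p)) (rk (snd p (fst e)) (cmp (snd e) (fst q))) (snd q u)) xs) ds =
      lsum H (\<lambda>q. lsum H (\<lambda>e. \<delta> (cmp f (fst p)) (rk (snd p (fst e)) (cmp (snd e) (fst q))) (snd q u)) ds) xs"
      using x x[OF p] f u by (intro H.lsum_commute d(6)) (simp_all add: cmp_Q S_app rk_S ds_in)
    \<comment> \<open>Summed over the dual basis, the composites y_p e_i e_i^* x_q of rank one give
      y_p x_q.\<close>
    also have "\<dots> = lsum H (\<lambda>q. \<delta> (cmp f (fst p)) (cmp (snd p) (fst q)) (snd q u)) xs"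
    proof (rule lsum_cong)
      fix q assume q: "q \<in> set xs"
      have "lsum H (\<lambda>e. \<delta> (cmp f (fst p)) (rk (snd p (fst e)) (cmp (snd e) (fst q))) (snd q u)) ds =
        \<delta> (cmp f (fst p)) (lsum S (\<lambda>e. rk (snd p (fst e)) (cmp (snd e) (fst q))) ds) (snd q u)"
        using x[OF p] x[OF q] f u by (intro add_hom_lsum[OF S.abelian_group_axioms H d(2), symmetric])
          (simp_all add: cmp_Q S_app rk_S ds_in)
      then show "lsum H (\<lambda>e. \<delta> (cmp f (fst p)) (rk (snd p (fst e)) (cmp (snd e) (fst q))) (snd q u)) ds =
        \<delta> (cmp f (fst p)) (cmp (snd p) (fst q)) (snd q u)"
        using x[OF p] x[OF q] by (simp add: dual_cmp)
    qed
    finally show "lsum H (\<lambda>e. lsum H (\<lambda>q. \<delta> (cmp f (fst p)) (rk (snd p (fst e)) (cmp (snd e) (fst q))) (snd q u)) xs) ds =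
      lsum H (\<lambda>q. \<delta> (cmp f (fst p)) (cmp (snd p) (fst q)) (snd q u)) xs" .
  qed
  finally show ?thesis .
qed

section \<open>Reduction to an ideal of B\<close>

lemma preimage_ideal:
  assumes "sub_bimodule B B S L"
  shows "additive_subgroup {b \<in> carrier B. cm b \<in> L} B"
    and "b \<in> {b \<in> carrier B. cm b \<in> L} \<Longrightarrow> c \<in> carrier B \<Longrightarrow> b \<otimes>\<^bsub>B\<^esub> c \<in> {b \<in> carrier B. cm b \<in> L}"
    and "b \<in> {b \<in> carrier B. cm b \<in> L} \<Longrightarrow> c \<in> carrier B \<Longrightarrow> c \<otimes>\<^bsub>B\<^esub> b \<in> {b \<in> carrier B. cm b \<in> L}"
proof -
  note L = sub_bimoduleD[OF assms]
  have hom: "cm \<in> add_hom B S"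
    by (rule add_homI) (simp_all add: cm_in_S cm_add)
  note ag = Sg.L.abelian_group_axioms S.abelian_group_axioms
  show "additive_subgroup {b \<in> carrier B. cm b \<in> L} B"
  proof (intro additive_subgroup.intro group.subgroupI[OF Sg.L.a_group])
    have "\<zero>\<^bsub>B\<^esub> \<in> {b \<in> carrier B. cm b \<in> L}"
      using add_hom_zero[OF ag hom] additive_subgroup.zero_closed[OF L(1)] by simp
    then show "{b \<in> carrier B. cm b \<in> L} \<noteq> {}" by blast
    show "inv\<^bsub>add_monoid B\<^esub> b \<in> {b \<in> carrier B. cm b \<in> L}" if "b \<in> {b \<in> carrier B. cm b \<in> L}" for b
      unfolding a_inv_def[symmetric] using that additive_subgroup.a_inv_closed[OF L(1)]
      by (simp add: add_hom_a_inv[OF ag hom])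
  qed (auto simp: cm_add L(5))
  show "b \<in> {b \<in> carrier B. cm b \<in> L} \<Longrightarrow> c \<in> carrier B \<Longrightarrow> b \<otimes>\<^bsub>B\<^esub> c \<in> {b \<in> carrier B. cm b \<in> L}"
    "b \<in> {b \<in> carrier B. cm b \<in> L} \<Longrightarrow> c \<in> carrier B \<Longrightarrow> c \<otimes>\<^bsub>B\<^esub> b \<in> {b \<in> carrier B. cm b \<in> L}"
    by (auto simp: cm_mult L(2,3))
qed

text \<open>The b in B whose image lies in J(\<phi>)J(\<psi>) form an ideal, and 1 is in the product
  once this ideal is B. The last premise inside \<open>ideal\<close> records what J(id) = B
  contributes: every product st is the image of such a b.\<close>

lemma unit_from_ideal:
  assumes base: "\<And>t. t \<in> carrier S \<Longrightarrow> \<forall>f\<in>carrier Q. \<forall>u\<in>carrier P. tens (cmp f t) u = tens f (t u) \<Longrightarrow> t \<in> cm ` carrier B"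
    and ideal: "\<And>\<phi> \<psi>. \<phi> \<in> Aut \<Longrightarrow> \<psi> \<in> Aut \<Longrightarrow> \<forall>c\<in>carrier C. \<phi> (\<psi> c) = c \<Longrightarrow> \<forall>c\<in>carrier C. \<psi> (\<phi> c) = c \<Longrightarrow>
      \<forall>s\<in>J \<phi>. \<forall>t\<in>J \<psi>. \<exists>b\<in>carrier B. cmp s t = cm b \<and> cm b \<in> ideal_prod S (J \<phi>) (J \<psi>) \<Longrightarrow>
      carrier B \<subseteq> {b \<in> carrier B. cm b \<in> ideal_prod S (J \<phi>) (J \<psi>)}"
  shows "comatrix_descent A B P"
proof (intro comatrix_descent.intro comatrix_descent_axioms.intro comatrix_axioms)
  fix \<phi> \<psi> assume *: "\<phi> \<in> Aut" "\<psi> \<in> Aut" "\<And>c. c \<in> carrier C \<Longrightarrow> \<phi> (\<psi> c) = c" "\<And>c. c \<in> carrier C \<Longrightarrow> \<psi> (\<phi> c) = c"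
  have "\<exists>b\<in>carrier B. cmp s t = cm b \<and> cm b \<in> ideal_prod S (J \<phi>) (J \<psi>)" if "s \<in> J \<phi>" "t \<in> J \<psi>" for s t
  proof -
    have st: "cmp s t \<in> ideal_prod S (J \<phi>) (J \<psi>)"
      using that by (rule ideal_prodI)
    have "ideal_prod S (J \<phi>) (J \<psi>) \<subseteq> J (\<lambda>c. c)"
      by (rule J_compose[OF _ _ coring_hom_ident]) (use * in auto)
    also have "\<dots> \<subseteq> cm ` carrier B"
      using base by (auto simp: J_def)
    finally obtain b where "b \<in> carrier B" "cmp s t = cm b"
      using st by auto
    then show ?thesis
      using st by auto
  qed
  then have "carrier B \<subseteq> {b \<in> carrier B. cm b \<in> ideal_prod S (J \<phi>) (J \<psi>)}"
    using * by (intro ideal) blast+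
  then show "\<one>\<^bsub>S\<^esub> \<in> ideal_prod S (J \<phi>) (J \<psi>)"
    unfolding cm_one[symmetric] using Sg.L.one_closed by blast
qed (use base in blast)

lemma sub_bimodule_JJ: "\<phi> \<in> Aut \<Longrightarrow> \<psi> \<in> Aut \<Longrightarrow> sub_bimodule B B S (ideal_prod S (J \<phi>) (J \<psi>))"
  by (intro sub_bimodule_ideal_prod sub_bimodule_J) auto

text \<open>Applying \<open>gen\<close> twice gives \<Sigma> = J(\<phi>)J(\<psi>)\<Sigma>, and each
  st acts as a member of the ideal I of B; so I\<Sigma> = \<Sigma>, and \<open>ideal\<close> yields
  I = B. This is the part common to the separable case and the case of a faithfully flat
  \<Sigma>.\<close>

lemma comatrix_descent_left:
  assumes base: "\<And>t. t \<in> carrier S \<Longrightarrow> \<forall>f\<in>carrier Q. \<forall>u\<in>carrier P. tens (cmp f t) u = tens f (t u) \<Longrightarrow> t \<in> cm ` carrier B"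
    and gen: "\<And>\<phi> \<psi> u. \<phi> \<in> Aut \<Longrightarrow> \<psi> \<in> Aut \<Longrightarrow> \<forall>c\<in>carrier C. \<phi> (\<psi> c) = c \<Longrightarrow> \<forall>c\<in>carrier C. \<psi> (\<phi> c) = c \<Longrightarrow>
      u \<in> carrier P \<Longrightarrow> \<exists>ws. set ws \<subseteq> J \<phi> \<times> carrier P \<and> u = lsum P (\<lambda>w. fst w (snd w)) ws"
    and ideal: "\<And>I. additive_subgroup I B \<Longrightarrow> \<forall>x\<in>I. \<forall>b\<in>carrier B. x \<otimes>\<^bsub>B\<^esub> b \<in> I \<Longrightarrow>
      \<forall>u\<in>carrier P. \<exists>ws. set ws \<subseteq> I \<times> carrier P \<and> u = lsum P (\<lambda>w. lact P (fst w) (snd w)) ws \<Longrightarrow> carrier B \<subseteq> I"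
  shows "comatrix_descent A B P"
proof (rule unit_from_ideal[OF base])
  fix \<phi> \<psi>
  assume *: "\<phi> \<in> Aut" "\<psi> \<in> Aut" "\<forall>c\<in>carrier C. \<phi> (\<psi> c) = c" "\<forall>c\<in>carrier C. \<psi> (\<phi> c) = c"
    and st: "\<forall>s\<in>J \<phi>. \<forall>t\<in>J \<psi>. \<exists>b\<in>carrier B. cmp s t = cm b \<and> cm b \<in> ideal_prod S (J \<phi>) (J \<psi>)"
  define I where "I = {b \<in> carrier B. cm b \<in> ideal_prod S (J \<phi>) (J \<psi>)}"
  note I = preimage_ideal[OF sub_bimodule_JJ[OF *(1,2)], folded I_def]
  have J: "s \<in> carrier S" if "s \<in> J \<phi> \<or> s \<in> J \<psi>" for s
    using that by (auto simp: J_def)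
  let ?h = "\<lambda>w. lact P (fst w) (snd w)"
  have h: "?h w \<in> carrier P" if "w \<in> I \<times> carrier P" for w
    using that by (auto simp: I_def)
  have "\<exists>ws. set ws \<subseteq> I \<times> carrier P \<and> u = lsum P ?h ws" if u: "u \<in> carrier P" for u
  proof -
    obtain ws where ws: "set ws \<subseteq> J \<phi> \<times> carrier P" "u = lsum P (\<lambda>w. fst w (snd w)) ws"
      using gen[OF * u] by blast
    show ?thesis
      unfolding ws(2)
    proof (rule lsum_list_choice[OF Sg.M.abelian_group_axioms h], assumption)
      fix w assume w: "w \<in> set ws"
      have s: "fst w \<in> J \<phi>" and v: "snd w \<in> carrier P"
        using pairs_fst[OF ws(1) w] pairs_snd[OF ws(1) w] by simp_all
      \<comment> \<open>The second application is to \<psi>, the roles of the two inverse maps being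
        exchanged.\<close>
      obtain zs where zs: "set zs \<subseteq> J \<psi> \<times> carrier P" "snd w = lsum P (\<lambda>z. fst z (snd z)) zs"
        using gen[OF *(2,1,4,3) v] by blast
      have z: "fst z \<in> J \<psi>" "snd z \<in> carrier P" if "z \<in> set zs" for z
        using pairs_fst[OF zs(1) that] pairs_snd[OF zs(1) that] by simp_all
      have "fst w (snd w) = lsum P (\<lambda>z. fst w (fst z (snd z))) zs"
        unfolding zs(2) using s z J by (intro add_hom_lsum[OF Sg.M.abelian_group_axioms Sg.M.abelian_group_axioms app_hom])
          (simp_all add: S_app)
      moreover have "\<exists>vs. set vs \<subseteq> I \<times> carrier P \<and> lsum P (\<lambda>z. fst w (fst z (snd z))) zs = lsum P ?h vs"
      proof (rule lsum_list_choice[OF Sg.M.abelian_group_axioms h], assumption)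
        fix z assume "z \<in> set zs"
        note z = z[OF this]
        from st s z(1) obtain b where b: "b \<in> carrier B" "cmp (fst w) (fst z) = cm b" "cm b \<in> ideal_prod S (J \<phi>) (J \<psi>)"
          by blast
        have "fst w (fst z (snd z)) = cmp (fst w) (fst z) (snd z)"
          using z by simp
        also have "\<dots> = lact P b (snd z)"
          using z unfolding b(2) by simp
        finally show "\<exists>vs. set vs \<subseteq> I \<times> carrier P \<and> fst w (fst z (snd z)) = lsum P ?h vs"
          using b z by (intro exI[of _ "[(b, snd z)]"]) (simp add: I_def)
      qed
      ultimately show "\<exists>vs. set vs \<subseteq> I \<times> carrier P \<and> fst w (snd w) = lsum P ?h vs"
        by simp
    qed
  qed
  then show "carrier B \<subseteq> {b \<in> carrier B. cm b \<in> ideal_prod S (J \<phi>) (J \<psi>)}"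
    unfolding I_def[symmetric] using I(1,2) by (intro ideal) blast+
qed

text \<open>S acts on \<Sigma>^* from the right, so the order of peeling is reversed: f = \<Sum> g t
  with t in J(\<psi>), then g = \<Sum> h s with s in J(\<phi>), whence f is a sum of terms h
  (st).\<close>

lemma comatrix_descent_right:
  assumes base: "\<And>t. t \<in> carrier S \<Longrightarrow> \<forall>f\<in>carrier Q. \<forall>u\<in>carrier P. tens (cmp f t) u = tens f (t u) \<Longrightarrow> t \<in> cm ` carrier B"
    and gen: "\<And>\<phi> f. \<phi> \<in> Aut \<Longrightarrow> f \<in> carrier Q \<Longrightarrow>
      \<exists>ws. set ws \<subseteq> J \<phi> \<times> carrier Q \<and> f = lsum Q (\<lambda>w. cmp (snd w) (fst w)) ws"
    and ideal: "\<And>I. additive_subgroup I B \<Longrightarrow> \<forall>x\<in>I. \<forall>b\<in>carrier B. b \<otimes>\<^bsub>B\<^esub> x \<in> I \<Longrightarrow>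
      \<forall>f\<in>carrier Q. \<exists>ws. set ws \<subseteq> I \<times> carrier Q \<and> f = lsum Q (\<lambda>w. ract Q (snd w) (fst w)) ws \<Longrightarrow> carrier B \<subseteq> I"
  shows "comatrix_descent A B P"
proof (rule unit_from_ideal[OF base])
  fix \<phi> \<psi>
  assume *: "\<phi> \<in> Aut" "\<psi> \<in> Aut" "\<forall>c\<in>carrier C. \<phi> (\<psi> c) = c" "\<forall>c\<in>carrier C. \<psi> (\<phi> c) = c"
    and st: "\<forall>s\<in>J \<phi>. \<forall>t\<in>J \<psi>. \<exists>b\<in>carrier B. cmp s t = cm b \<and> cm b \<in> ideal_prod S (J \<phi>) (J \<psi>)"
  define I where "I = {b \<in> carrier B. cm b \<in> ideal_prod S (J \<phi>) (J \<psi>)}"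
  note I = preimage_ideal[OF sub_bimodule_JJ[OF *(1,2)], folded I_def]
  have J: "s \<in> carrier S" if "s \<in> J \<phi> \<or> s \<in> J \<psi>" for s
    using that by (auto simp: J_def)
  let ?h = "\<lambda>w. ract Q (snd w) (fst w)"
  have h: "?h w \<in> carrier Q" if "w \<in> I \<times> carrier Q" for w
    using that Q.ract_closed by (auto simp: I_def)
  have "\<exists>ws. set ws \<subseteq> I \<times> carrier Q \<and> f = lsum Q ?h ws" if f: "f \<in> carrier Q" for f
  proof -
    obtain ws where ws: "set ws \<subseteq> J \<psi> \<times> carrier Q" "f = lsum Q (\<lambda>w. cmp (snd w) (fst w)) ws"
      using gen[OF *(2) f] by blast
    show ?thesis
      unfolding ws(2)
    proof (rule lsum_list_choice[OF Q.M.abelian_group_axioms h], assumption)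
      fix w assume w: "w \<in> set ws"
      have t: "fst w \<in> J \<psi>" and g: "snd w \<in> carrier Q"
        using pairs_fst[OF ws(1) w] pairs_snd[OF ws(1) w] by simp_all
      obtain zs where zs: "set zs \<subseteq> J \<phi> \<times> carrier Q" "snd w = lsum Q (\<lambda>z. cmp (snd z) (fst z)) zs"
        using gen[OF *(1) g] by blast
      have z: "fst z \<in> J \<phi>" "snd z \<in> carrier Q" if "z \<in> set zs" for z
        using pairs_fst[OF zs(1) that] pairs_snd[OF zs(1) that] by simp_all
      have "cmp (snd w) (fst w) = lsum Q (\<lambda>z. cmp (cmp (snd z) (fst z)) (fst w)) zs"
        unfolding zs(2) using t z J by (intro add_hom_lsum[OF Q.M.abelian_group_axioms Q.M.abelian_group_axioms cmp_Q_hom])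
          (simp_all add: cmp_Q)
      moreover have "\<exists>vs. set vs \<subseteq> I \<times> carrier Q \<and> lsum Q (\<lambda>z. cmp (cmp (snd z) (fst z)) (fst w)) zs = lsum Q ?h vs"
      proof (rule lsum_list_choice[OF Q.M.abelian_group_axioms h], assumption)
        fix z assume "z \<in> set zs"
        note z = z[OF this]
        from st t z(1) obtain b where b: "b \<in> carrier B" "cmp (fst z) (fst w) = cm b" "cm b \<in> ideal_prod S (J \<phi>) (J \<psi>)"
          by blast
        have "cmp (cmp (snd z) (fst z)) (fst w) = ract Q (snd z) b"
          using z t J by (simp add: cmp_assoc_Q b(2) ract_Q)
        then show "\<exists>vs. set vs \<subseteq> I \<times> carrier Q \<and> cmp (cmp (snd z) (fst z)) (fst w) = lsum Q ?h vs"
          using b z Q.r_zero[OF Q.ract_closed[OF z(2) b(1)]] by (intro exI[of _ "[(b, snd z)]"]) (simp add: I_def)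
      qed
      ultimately show "\<exists>vs. set vs \<subseteq> I \<times> carrier Q \<and> cmp (snd w) (fst w) = lsum Q ?h vs"
        by simp
    qed
  qed
  then show "carrier B \<subseteq> {b \<in> carrier B. cm b \<in> ideal_prod S (J \<phi>) (J \<psi>)}"
    unfolding I_def[symmetric] using I(1,3) by (intro ideal) blast+
qed

section \<open>The separable case\<close>

text \<open>E splits B \<rightarrow> S as a map of bimodules and takes the place of faithful
  flatness in three tasks: t = E(t) for t in J(id), a map \<open>\<pi>\<close> from S into J(\<psi>)
  that decomposes u, and E applied to 1 = \<Sum> e_i e_i^* to find 1 in an ideal I with I\<Sigma> =
  \<Sigma>.\<close>

lemma comatrix_descent_split:
  assumes E: "E \<in> add_hom S B" and E_one: "E \<one>\<^bsub>S\<^esub> = \<one>\<^bsub>B\<^esub>"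
    and E_left: "\<And>b s. b \<in> carrier B \<Longrightarrow> s \<in> carrier S \<Longrightarrow> E (cmp (cm b) s) = b \<otimes>\<^bsub>B\<^esub> E s"
    and E_right: "\<And>b s. b \<in> carrier B \<Longrightarrow> s \<in> carrier S \<Longrightarrow> E (cmp s (cm b)) = E s \<otimes>\<^bsub>B\<^esub> b"
  shows "comatrix_descent A B P"
proof (rule comatrix_descent_left)
  have E_in: "E s \<in> carrier B" if "s \<in> carrier S" for s
    using that by (rule add_hom_closed[OF E])
  fix t assume t: "t \<in> carrier S" and tt: "\<forall>f\<in>carrier Q. \<forall>u\<in>carrier P. tens (cmp f t) u = tens f (t u)"
  \<comment> \<open>Right linearity of E makes f \<otimes> u \<mapsto> E(vf) u well defined. Applied
    to both sides of ft \<otimes> u = f \<otimes> tu with v = e_i and f = e_i^*, and summed over i,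
    it yields E(t) u = tu.\<close>
  have bal: "balanced B Q P P (\<lambda>f u. lact P (E (rk v f)) u)" if v: "v \<in> carrier P" for v
    using v by (intro balancedI)
      (simp_all add: E_in rk_S add_hom_add[OF rk_hom'] add_hom_add[OF E] Sg.lact_l_distr Sg.lact_r_distr
        ract_Q cm_in_S E_right Sg.lact_assoc flip: rk_cmp)
  have lift: "tensor_lift P (\<lambda>f u. lact P (E (rk v f)) u) (tens f u) = lact P (E (rk v f)) u"
    if "v \<in> carrier P" "f \<in> carrier Q" "u \<in> carrier P" for v f u
    by (rule C.tensor_lift_pure[OF Sg.M.abelian_group_axioms bal[OF that(1)] that(2,3)])
  have act: "(\<lambda>s. lact P (E s) u) \<in> add_hom S P" if u: "u \<in> carrier P" for u
    using u by (intro add_homI) (simp_all add: E_in add_hom_add[OF E] Sg.lact_l_distr)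
  have "t = cm (E t)"
  proof (rule S_eqI)
    fix u assume u: "u \<in> carrier P"
    have "lact P (E t) u = lsum P (\<lambda>e. lact P (E (rk (\<one>\<^bsub>S\<^esub> (fst e)) (cmp (snd e) t))) u) ds"
      using u t S.l_one[OF t]
      by (subst add_hom_lsum[OF S.abelian_group_axioms Sg.M.abelian_group_axioms act[OF u], symmetric])
        (simp_all add: rk_S cmp_Q ds_in dual_cmp S_app)
    also have "\<dots> = lsum P (\<lambda>e. lact P (E (rk (fst e) (snd e))) (t u)) ds"
    proof (rule lsum_cong)
      fix e assume e: "e \<in> set ds"
      have "lact P (E (rk (fst e) (cmp (snd e) t))) u = lact P (E (rk (fst e) (snd e))) (t u)"
        using lift[of "fst e" "cmp (snd e) t" u] lift[of "fst e" "snd e" "t u"] e t u tt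
        by (simp add: cmp_Q ds_in S_app)
      then show "lact P (E (rk (\<one>\<^bsub>S\<^esub> (fst e)) (cmp (snd e) t))) u = lact P (E (rk (fst e) (snd e))) (t u)"
        using e by (simp add: ds_in)
    qed
    also have "\<dots> = lact P (E (lsum S (\<lambda>e. rk (fst e) (snd e)) ds)) (t u)"
      using u t by (intro add_hom_lsum[OF S.abelian_group_axioms Sg.M.abelian_group_axioms act, symmetric])
        (simp_all add: rk_S ds_in S_app)
    also have "\<dots> = t u"
      using u t by (simp add: dual_one E_one Sg.lact_one S_app)
    finally show "t u = cm (E t) u"
      using u by simp
  qed (simp_all add: t cm_in_S E_in)
  then show "t \<in> cm ` carrier B"
    using E_in[OF t] by blast
next
  have E_in: "E s \<in> carrier B" if "s \<in> carrier S" for s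
    using that by (rule add_hom_closed[OF E])
  \<comment> \<open>The names are exchanged against \<open>comatrix_descent_left\<close>: a
    presentation of \<phi> produces elements of J of its inverse, here \<psi>.\<close>
  fix \<psi> \<phi> u assume "\<psi> \<in> Aut" "\<phi> \<in> Aut" and inv: "\<forall>c\<in>carrier C. \<psi> (\<phi> c) = c" "\<forall>c\<in>carrier C. \<phi> (\<psi> c) = c"
    and u: "u \<in> carrier P"
  then have \<phi>: "\<phi> \<in> coring_hom A D D" and \<psi>: "\<psi> \<in> coring_hom A D D" by auto
  obtain xs where xs: "represents xs \<phi>"
    by (rule represents_exists[OF \<phi>])
  note x = representsD(1,2)[OF xs]
  define \<pi> where "\<pi> s = lsum S (\<lambda>p. cmp (fst p) (cm (E (cmp (snd p) s)))) xs" for s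
  have E_rk: "E (rk (lact P b v) g) = b \<otimes>\<^bsub>B\<^esub> E (rk v g)" if "b \<in> carrier B" "v \<in> carrier P" "g \<in> carrier Q" for b v g
    using that E_left[of b "rk v g"] by (simp add: cmp_rk cm_in_S rk_S)
  have term_hom: "(\<lambda>s. cmp (fst p) (cm (E (cmp (snd p) s)))) \<in> add_hom S S" if "p \<in> set xs" for p
    using x[OF that] by (intro add_homI)
      (simp_all add: cmp_S cm_in_S E_in add_hom_add[OF cmp_S_hom'] add_hom_add[OF E] cm_add)
  have \<pi>_hom: "\<pi> \<in> add_hom S S"
    unfolding \<pi>_def by (rule add_hom_lsum_fun[OF S.abelian_group_axioms term_hom])
  have \<pi>_app: "\<pi> s v = lsum P (\<lambda>p. fst p (lact P (E (cmp (snd p) s)) v)) xs" if "s \<in> carrier S" "v \<in> carrier P" for s v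
    unfolding \<pi>_def using x that by (subst lsum_S_app) (simp_all add: cmp_S cm_in_S E_in)
  have \<pi>_rk: "\<pi> (rk w g) \<in> J \<psi>" if w: "w \<in> carrier P" and g: "g \<in> carrier Q" for w g
  proof -
    have \<pi>_in: "\<pi> (rk w g) \<in> carrier S"
      using rk_S[OF w g] by (rule add_hom_closed[OF \<pi>_hom])
    have "\<phi> (tens f (\<pi> (rk w g) v)) = tens (cmp f (\<pi> (rk w g))) v" if f: "f \<in> carrier Q" and v: "v \<in> carrier P" for f v
    proof -
      \<comment> \<open>For s = wg of rank one, E(ys) = E((yw) g) depends on y only through yw, so
        the comultiplication identity can be evaluated at w. Its left side is f\<pi>(s) \<otimes> v,
        its right side \<phi>(f \<otimes> \<pi>(s) v).\<close>
      let ?\<delta> = "\<lambda>f s u. tens f (s (lact P (E (rk u g)) v))"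
      have "trilinear C ?\<delta>"
        using g v by (intro trilinearI)
          (simp_all add: tens_closed S_app E_in rk_S C.pure_add_left C.pure_add_right S_plus_app S_add add_hom_add[OF rk_hom]
            add_hom_add[OF E] Sg.lact_l_distr tens_cm E_rk cm_in_S Sg.lact_assoc)
      from represents_comult[OF \<phi> xs C.abelian_group_tensor this f w]
      have "lsum C (\<lambda>p. tens (cmp f (fst p)) (lact P (E (rk (snd p w) g)) v)) xs =
        lsum C (\<lambda>p. lsum C (\<lambda>q. tens (cmp f (fst p)) (snd p (fst q (lact P (E (rk (snd q w) g)) v)))) xs) xs"
        using x w g v by (simp add: E_in rk_S S_app cong: lsum_cong)
      moreover have "lsum C (\<lambda>p. tens (cmp f (fst p)) (lact P (E (rk (snd p w) g)) v)) xs = tens (cmp f (\<pi> (rk w g))) v"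
      proof -
        have "tens (cmp f (\<pi> (rk w g))) v = lsum C (\<lambda>p. tens (cmp f (cmp (fst p) (cm (E (cmp (snd p) (rk w g)))))) v) xs"
          unfolding \<pi>_def using x w g
          by (intro add_hom_lsum[OF S.abelian_group_axioms C.abelian_group_tensor add_hom_compose[OF cmp_Q_hom'[OF f] tens_hom'[OF v]]])
            (simp add: cmp_S cm_in_S E_in rk_S)
        also have "\<dots> = lsum C (\<lambda>p. tens (cmp f (fst p)) (lact P (E (rk (snd p w) g)) v)) xs"
          using x w g f v
          by (intro lsum_cong) (simp add: cmp_rk cm_in_S E_in rk_S S_app cmp_Q tens_cm flip: cmp_assoc_Q)
        finally show ?thesis ..
      qed
      moreover have "lsum C (\<lambda>p. lsum C (\<lambda>q. tens (cmp f (fst p)) (snd p (fst q (lact P (E (rk (snd q w) g)) v)))) xs) xs =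
        \<phi> (tens f (\<pi> (rk w g) v))"
        unfolding representsD(3)[OF xs f S_app[OF \<pi>_in v]]
      proof (rule lsum_cong)
        fix p assume p: "p \<in> set xs"
        have "tens (cmp f (fst p)) (snd p (\<pi> (rk w g) v)) =
          lsum C (\<lambda>q. tens (cmp f (fst p)) (snd p (fst q (lact P (E (cmp (snd q) (rk w g))) v)))) xs"
          unfolding \<pi>_app[OF rk_S[OF w g] v] using x x[OF p] w g v f
          by (intro add_hom_lsum[OF Sg.M.abelian_group_axioms C.abelian_group_tensor add_hom_compose[OF app_hom tens_hom]])
            (simp_all add: S_app cmp_Q E_in cmp_S rk_S)
        then show "lsum C (\<lambda>q. tens (cmp f (fst p)) (snd p (fst q (lact P (E (rk (snd q w) g)) v)))) xs =
            tens (cmp f (fst p)) (snd p (\<pi> (rk w g) v))"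
          using x w g by (simp add: cmp_rk cong: lsum_cong)
      qed
      ultimately show ?thesis by simp
    qed
    then have "\<psi> (tens (cmp f (\<pi> (rk w g))) v) = tens f (\<pi> (rk w g) v)" if "f \<in> carrier Q" "v \<in> carrier P" for f v
      using that inv(1) \<pi>_in by (metis tens_closed S_app)
    then show ?thesis
      using \<pi>_in by (simp add: J_def)
  qed
  \<comment> \<open>Every s is a sum of rank-one maps, by the dual basis.\<close>
  have \<pi>_J: "\<pi> s \<in> J \<psi>" if s: "s \<in> carrier S" for s
  proof -
    have "\<pi> s = \<pi> (lsum S (\<lambda>e. rk (s (fst e)) (snd e)) ds)"
      using s by (simp add: dual_S)
    also have "\<dots> = lsum S (\<lambda>e. \<pi> (rk (s (fst e)) (snd e))) ds"
      using s by (intro add_hom_lsum[OF S.abelian_group_axioms S.abelian_group_axioms \<pi>_hom]) (simp add: rk_S S_app ds_in)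
    also have "\<dots> \<in> J \<psi>"
      using s by (intro subgroup_lsum[OF sub_bimoduleD(1)[OF sub_bimodule_J[OF \<psi>]]] \<pi>_rk) (simp_all add: S_app ds_in)
    finally show ?thesis .
  qed
  have "u = lsum P (\<lambda>q. \<pi> (fst q) (snd q u)) xs"
  proof (rule P_eqI)
    have \<pi>_in: "\<pi> (fst q) \<in> carrier S" if "q \<in> set xs" for q
      using x(1)[OF that] by (rule add_hom_closed[OF \<pi>_hom])
    show "lsum P (\<lambda>q. \<pi> (fst q) (snd q u)) xs \<in> carrier P"
      using x u \<pi>_in by (intro Sg.M.lsum_closed) (simp add: S_app)
    fix f assume f: "f \<in> carrier Q"
    \<comment> \<open>This test map turns the comultiplication identity into f(\<Sum> x_p y_p u) =
      \<Sum> f(x_p E(y_p x_q) y_q u): the left side is f(u) by the counit, the right side is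
      f(\<Sum> \<pi>(x_q) y_q u).\<close>
    let ?\<delta> = "\<lambda>f s u. f (lact P (E s) u)"
    have "trilinear A ?\<delta>"
      by (intro trilinearI)
        (simp_all add: Q_app E_in Q_plus_app Q_add add_hom_add[OF E] Sg.lact_l_distr Sg.lact_r_distr E_left E_right Sg.lact_assoc)
    from represents_comult[OF \<phi> xs Sg.R.abelian_group_axioms this f u]
    have *: "lsum A (\<lambda>p. f (fst p (snd p u))) xs =
        lsum A (\<lambda>p. lsum A (\<lambda>q. f (fst p (lact P (E (cmp (snd p) (fst q))) (snd q u)))) xs) xs"
      using x u by (simp add: E_one Sg.lact_one S_app E_in cmp_S cong: lsum_cong)
    have fu: "f u = lsum A (\<lambda>p. f (fst p (snd p u))) xs"
      using x u f add_hom_lsum[OF Sg.M.abelian_group_axioms Sg.R.abelian_group_axioms Q_app_hom[OF f],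
          of xs "\<lambda>p. fst p (snd p u)"] by (simp add: represents_unit[OF \<phi> xs u] S_app)
    have "f (lsum P (\<lambda>q. \<pi> (fst q) (snd q u)) xs) = lsum A (\<lambda>q. f (\<pi> (fst q) (snd q u))) xs"
      using x u \<pi>_in by (intro add_hom_lsum[OF Sg.M.abelian_group_axioms Sg.R.abelian_group_axioms Q_app_hom[OF f]])
        (simp add: S_app)
    also have "\<dots> = lsum A (\<lambda>q. lsum A (\<lambda>p. f (fst p (lact P (E (cmp (snd p) (fst q))) (snd q u)))) xs) xs"
    proof (rule lsum_cong)
      fix q assume q: "q \<in> set xs"
      show "f (\<pi> (fst q) (snd q u)) = lsum A (\<lambda>p. f (fst p (lact P (E (cmp (snd p) (fst q))) (snd q u)))) xs"
        unfolding \<pi>_app[OF x(1)[OF q] S_app[OF x(2)[OF q] u]] using x x[OF q] u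
        by (intro add_hom_lsum[OF Sg.M.abelian_group_axioms Sg.R.abelian_group_axioms Q_app_hom[OF f]])
          (simp add: S_app E_in cmp_S)
    qed
    also have "\<dots> = lsum A (\<lambda>p. lsum A (\<lambda>q. f (fst p (lact P (E (cmp (snd p) (fst q))) (snd q u)))) xs) xs"
      using x u f by (intro Sg.R.lsum_commute) (simp add: Q_app S_app E_in cmp_S)
    finally show "f u = f (lsum P (\<lambda>q. \<pi> (fst q) (snd q u)) xs)"
      using * fu by simp
  qed (rule u)
  then have "u = lsum P (\<lambda>w. fst w (snd w)) (map (\<lambda>q. (\<pi> (fst q), snd q u)) xs)"
    by (simp add: lsum_map)
  then show "\<exists>ws. set ws \<subseteq> J \<psi> \<times> carrier P \<and> u = lsum P (\<lambda>w. fst w (snd w)) ws"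
    using x u \<pi>_J by (intro exI[of _ "map (\<lambda>q. (\<pi> (fst q), snd q u)) xs"]) (auto simp: S_app)
next
  have E_in: "E s \<in> carrier B" if "s \<in> carrier S" for s
    using that by (rule add_hom_closed[OF E])
  fix I assume I: "additive_subgroup I B" "\<forall>x\<in>I. \<forall>b\<in>carrier B. x \<otimes>\<^bsub>B\<^esub> b \<in> I"
    and gen: "\<forall>u\<in>carrier P. \<exists>ws. set ws \<subseteq> I \<times> carrier P \<and> u = lsum P (\<lambda>w. lact P (fst w) (snd w)) ws"
  have sub: "I \<subseteq> carrier B"
    by (rule additive_subgroup.a_subset[OF I(1)])
  \<comment> \<open>u lies in I\<Sigma> and E is left linear, so E(uf) lies in I B \<subseteq>
    I.\<close>
  have "E (rk u f) \<in> I" if u: "u \<in> carrier P" and f: "f \<in> carrier Q" for u f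
  proof -
    obtain ws where ws: "set ws \<subseteq> I \<times> carrier P" "u = lsum P (\<lambda>w. lact P (fst w) (snd w)) ws"
      using gen u by blast
    have w: "fst w \<in> I" "fst w \<in> carrier B" "snd w \<in> carrier P" if "w \<in> set ws" for w
      using pairs_fst[OF ws(1) that] pairs_snd[OF ws(1) that] sub by auto
    have "E (rk u f) = lsum B (\<lambda>w. E (rk (lact P (fst w) (snd w)) f)) ws"
      unfolding ws(2) using w
      by (intro add_hom_lsum[OF Sg.M.abelian_group_axioms Sg.L.abelian_group_axioms add_hom_compose[OF rk_hom[OF f] E]]) simp
    also have "\<dots> \<in> I"
    proof (rule subgroup_lsum[OF I(1)])
      fix p assume p: "p \<in> set ws"
      have "E (rk (lact P (fst p) (snd p)) f) = E (cmp (cm (fst p)) (rk (snd p) f))"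
        using w[OF p] f by (simp add: cmp_rk cm_in_S)
      then show "E (rk (lact P (fst p) (snd p)) f) \<in> I"
        using w[OF p] f I(2) by (simp add: E_left rk_S E_in)
    qed
    finally show ?thesis .
  qed
  then have "lsum B (\<lambda>e. E (rk (fst e) (snd e))) ds \<in> I"
    by (intro subgroup_lsum[OF I(1)]) (simp add: ds_in)
  moreover have "E (lsum S (\<lambda>e. rk (fst e) (snd e)) ds) = lsum B (\<lambda>e. E (rk (fst e) (snd e))) ds"
    by (intro add_hom_lsum[OF S.abelian_group_axioms Sg.L.abelian_group_axioms E]) (simp add: rk_S ds_in)
  ultimately have "\<one>\<^bsub>B\<^esub> \<in> I"
    by (simp add: dual_one E_one)
  then show "carrier B \<subseteq> I"
    using I(2) Sg.L.l_one by force
qed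

text \<open>The sum over the basis undoes the functional: identities that hold with e_i^* s in
  front, multiplied by e_i and summed, say something about s itself. The second version inserts s at
  the vectors e_i, as the opposite case requires.\<close>

lemma dual_sum:
  assumes "abelian_group H" and "F \<in> add_hom S H" and "s \<in> carrier S"
  shows "lsum H (\<lambda>e. F (rk (fst e) (cmp (snd e) s))) ds = F s"
    and "lsum H (\<lambda>e. F (rk (s (fst e)) (snd e))) ds = F s"
proof -
  have "lsum S (\<lambda>e. rk (fst e) (cmp (snd e) s)) ds = lsum S (\<lambda>e. rk (\<one>\<^bsub>S\<^esub> (fst e)) (cmp (snd e) s)) ds"
    by (rule lsum_cong) (simp add: ds_in)
  then have 1: "lsum S (\<lambda>e. rk (fst e) (cmp (snd e) s)) ds = s"
    using dual_cmp[OF S.one_closed assms(3)] S.l_one[OF assms(3)] by simp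
  have "lsum H (\<lambda>e. F (rk (fst e) (cmp (snd e) s))) ds = F (lsum S (\<lambda>e. rk (fst e) (cmp (snd e) s)) ds)"
    using assms by (intro add_hom_lsum[OF S.abelian_group_axioms assms(1,2), symmetric]) (simp add: rk_S cmp_Q ds_in)
  then show "lsum H (\<lambda>e. F (rk (fst e) (cmp (snd e) s))) ds = F s"
    by (simp only: 1)
  have "lsum H (\<lambda>e. F (rk (s (fst e)) (snd e))) ds = F (lsum S (\<lambda>e. rk (s (fst e)) (snd e)) ds)"
    using assms by (intro add_hom_lsum[OF S.abelian_group_axioms assms(1,2), symmetric]) (simp add: rk_S S_app ds_in)
  then show "lsum H (\<lambda>e. F (rk (s (fst e)) (snd e))) ds = F s"
    by (simp only: dual_S[OF assms(3)])
qed

lemma dual_sum_one: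
  assumes "abelian_group H" and "F \<in> add_hom S H"
  shows "lsum H (\<lambda>e. F (rk (fst e) (snd e))) ds = F \<one>\<^bsub>S\<^esub>"
proof -
  have "lsum H (\<lambda>e. F (rk (fst e) (snd e))) ds = lsum H (\<lambda>e. F (rk (\<one>\<^bsub>S\<^esub> (fst e)) (snd e))) ds"
    by (rule lsum_cong) (simp add: ds_in)
  then show ?thesis
    by (simp only: dual_sum(2)[OF assms S.one_closed])
qed

section \<open>The faithfully flat cases\<close>

lemma left_extension: "extension_module B S P (\<lambda>s u. s u)"
proof (intro extension_module.intro extension_module_axioms.intro S.ring_axioms S_bimodule Sg.left_module_axioms)
  show "s \<otimes>\<^bsub>S\<^esub> ract S t b = ract S (s \<otimes>\<^bsub>S\<^esub> t) b" if "s \<in> carrier S" "t \<in> carrier S" "b \<in> carrier B" for s t b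
    using that by (simp add: cmp_assoc cm_in_S)
  show "lact S b \<one>\<^bsub>S\<^esub> = ract S \<one>\<^bsub>S\<^esub> b" if "b \<in> carrier B" for b
    using S.l_one[OF cm_in_S[OF that]] S.r_one[OF cm_in_S[OF that]] by simp
  show "balanced B S P P (\<lambda>s u. s u)"
    by (rule balancedI) (simp_all add: S_app S_add S_plus_app)
qed simp

text \<open>Composition f \<mapsto> fs is a left action of the opposite ring of S.\<close>

lemma right_extension: "extension_module (op_ring B) (op_module S) (op_module Q) (\<lambda>s f. cmp f s)"
proof (intro extension_module.intro extension_module_axioms.intro bimodule_op S_bimodule left_module_op Q.right_module_axioms)
  show "ring (op_module S)"
    by (rule ring_op_module[OF S.ring_axioms])
  show "s \<otimes>\<^bsub>op_module S\<^esub> ract (op_module S) t b = ract (op_module S) (s \<otimes>\<^bsub>op_module S\<^esub> t) b"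
    if "s \<in> carrier (op_module S)" "t \<in> carrier (op_module S)" "b \<in> carrier (op_ring B)" for s t b
    using that by (simp add: cmp_assoc cm_in_S)
  show "lact (op_module S) b \<one>\<^bsub>op_module S\<^esub> = ract (op_module S) \<one>\<^bsub>op_module S\<^esub> b" if "b \<in> carrier (op_ring B)" for b
    using that S.l_one[OF cm_in_S] S.r_one[OF cm_in_S] by simp
  show "balanced (op_ring B) (op_module S) (op_module Q) (op_module Q) (\<lambda>s f. cmp f s)"
    by (rule balancedI) (simp_all add: cmp_Q add_hom_add[OF cmp_Q_hom] add_hom_add[OF cmp_Q_hom'] cmp_assoc_Q cm_in_S ract_Q)
qed (simp add: cmp_Q_one)

text \<open>The three injections carry the modules to which faithful flatness is applied into the
  test type: B for the ideal, S for J(id) = B, and S together with S \<otimes> S for the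
  decomposition of u.\<close>

lemma comatrix_descent_flat_left:
  fixes hB :: "'b \<Rightarrow> 'u" and hS :: "('m \<Rightarrow> 'm) \<Rightarrow> 'u" and hSS :: "(('m \<Rightarrow> 'm) \<times> ('m \<Rightarrow> 'm) \<Rightarrow>\<^sub>0 int) set \<Rightarrow> 'u"
  assumes ff: "faithfully_flat_left TYPE('u) B P" and hB: "inj hB" and hS: "inj hS" and hSS: "inj hSS"
  shows "comatrix_descent A B P"
proof -
  interpret L: extension_module B S P "\<lambda>s u. s u" by (rule left_extension)
  show ?thesis
  proof (rule comatrix_descent_left)
    fix t assume t: "t \<in> carrier S" and tt: "\<forall>f\<in>carrier Q. \<forall>u\<in>carrier P. tens (cmp f t) u = tens f (t u)"
    \<comment> \<open>Putting v in front maps C to S \<otimes> \<Sigma>; with v = e_i and f = e_i^*,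
      summation over i turns ft \<otimes> u = f \<otimes> tu into t \<otimes> u = 1 \<otimes>
      tu.\<close>
    have bal: "balanced B Q P L.SP.T (\<lambda>f u. L.SP.pt (rk v f) u)" if "v \<in> carrier P" for v
      using that by (intro balancedI) (simp_all add: rk_S L.SP.pure_closed add_hom_add[OF rk_hom'] L.SP.pure_add_left
          L.SP.pure_add_right L.SP.pure_balanced ract_Q cm_in_S flip: rk_cmp L.SP.pure_balanced)
    have lift: "tensor_lift L.SP.T (\<lambda>f u. L.SP.pt (rk v f) u) (tens f u) = L.SP.pt (rk v f) u"
      if "v \<in> carrier P" "f \<in> carrier Q" "u \<in> carrier P" for v f u
      by (rule C.tensor_lift_pure[OF L.SP.abelian_group_tensor bal[OF that(1)] that(2,3)])
    have "L.SP.pt t u = L.SP.pt \<one>\<^bsub>S\<^esub> (t u)" if u: "u \<in> carrier P" for u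
    proof -
      have F: "(\<lambda>s. L.SP.pt s v) \<in> add_hom S L.SP.T" if "v \<in> carrier P" for v
        using that by (rule balancedD(2)[OF L.SP.balanced_pure])
      have "L.SP.pt t u = lsum L.SP.T (\<lambda>e. L.SP.pt (rk (fst e) (cmp (snd e) t)) u) ds"
        by (rule dual_sum(1)[OF L.SP.abelian_group_tensor F[OF u] t, symmetric])
      also have "\<dots> = lsum L.SP.T (\<lambda>e. L.SP.pt (rk (fst e) (snd e)) (t u)) ds"
      proof (rule lsum_cong)
        fix e assume e: "e \<in> set ds"
        show "L.SP.pt (rk (fst e) (cmp (snd e) t)) u = L.SP.pt (rk (fst e) (snd e)) (t u)"
          using lift[of "fst e" "cmp (snd e) t" u] lift[of "fst e" "snd e" "t u"] tt e t u
          by (simp add: ds_in cmp_Q S_app)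
      qed
      also have "\<dots> = L.SP.pt \<one>\<^bsub>S\<^esub> (t u)"
        by (rule dual_sum_one[OF L.SP.abelian_group_tensor F[OF S_app[OF t u]]])
      finally show ?thesis .
    qed
    then obtain b where "b \<in> carrier B" "t = ract S \<one>\<^bsub>S\<^esub> b"
      using L.faithfully_flat_base[OF ff hS t] by blast
    then show "t \<in> cm ` carrier B"
      using S.l_one[OF cm_in_S] by simp
  next
    fix \<psi> \<phi> u
    assume "\<psi> \<in> Aut" "\<phi> \<in> Aut" and inv: "\<forall>c\<in>carrier C. \<psi> (\<phi> c) = c" "\<forall>c\<in>carrier C. \<phi> (\<psi> c) = c"
      and u: "u \<in> carrier P"
    then have \<phi>: "\<phi> \<in> coring_hom A D D" by auto
    obtain xs where xs: "represents xs \<phi>"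
      by (rule represents_exists[OF \<phi>])
    note x = representsD(1,2)[OF xs]
    have xsS: "set xs \<subseteq> carrier S \<times> carrier S"
      using xs by (simp add: represents_def)
    \<comment> \<open>With v = e_i and first argument e_i^* x_p the rank-one maps add up to x_p; so
      these test maps together produce the identity in S \<otimes> S \<otimes> \<Sigma> that
      \<open>faithfully_flat_descend\<close> calls \<open>cocycle\<close>.\<close>
    let ?\<delta> = "\<lambda>v f s w. L.SSP.pt (L.SS.pt (rk v f) s) w"
    have tri: "trilinear L.SSP.T (?\<delta> v)" if v: "v \<in> carrier P" for v
    proof (rule trilinearI)
      fix f b s w assume "f \<in> carrier Q" "b \<in> carrier B" "s \<in> carrier S" "w \<in> carrier P"
      then show "?\<delta> v (cmp f (cm b)) s w = ?\<delta> v f (cmp (cm b) s) w"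
        using v L.SS.pure_balanced[of "rk v f" b s] by (simp add: rk_S rk_cmp cm_in_S)
      show "?\<delta> v f (cmp s (cm b)) w = ?\<delta> v f s (lact P b w)"
        if *: "f \<in> carrier Q" "b \<in> carrier B" "s \<in> carrier S" "w \<in> carrier P" for f b s w
        using * v L.SSP.pure_balanced[of "L.SS.pt (rk v f) s" b w] by (simp add: rk_S L.SS.pure_closed L.SS.tensor_ract_pure)
    qed (use v in \<open>simp_all add: rk_S L.SS.pure_closed L.SSP.pure_closed add_hom_add[OF rk_hom'] L.SS.pure_add_left
        L.SS.pure_add_right L.SSP.pure_add_left L.SSP.pure_add_right\<close>)
    have F: "(\<lambda>s. L.SSP.pt (L.SS.pt s t) w) \<in> add_hom S L.SSP.T" if "t \<in> carrier S" "w \<in> carrier P" for t w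
      using that by (intro add_homI) (simp_all add: L.SS.pure_closed L.SSP.pure_closed L.SS.pure_add_left L.SSP.pure_add_left)
    have "lsum L.SSP.T (\<lambda>p. L.SSP.pt (L.SS.pt (fst p) \<one>\<^bsub>S\<^esub>) (snd p u)) xs =
        lsum L.SSP.T (\<lambda>p. lsum L.SSP.T (\<lambda>e. ?\<delta> (fst e) (cmp (snd e) (fst p)) \<one>\<^bsub>S\<^esub> (snd p u)) ds) xs"
      using x u by (intro lsum_cong dual_sum(1)[OF L.SSP.abelian_group_tensor F, symmetric]) (simp_all add: S_app)
    also have "\<dots> = lsum L.SSP.T (\<lambda>e. lsum L.SSP.T (\<lambda>p. ?\<delta> (fst e) (cmp (snd e) (fst p)) \<one>\<^bsub>S\<^esub> (snd p u)) xs) ds"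
      using x u by (intro L.SSP.T.lsum_commute L.SSP.pure_closed L.SS.pure_closed) (simp_all add: rk_S cmp_Q S_app ds_in)
    also have "\<dots> = lsum L.SSP.T (\<lambda>e. lsum L.SSP.T (\<lambda>p. lsum L.SSP.T (\<lambda>q.
        ?\<delta> (fst e) (cmp (snd e) (fst p)) (cmp (snd p) (fst q)) (snd q u)) xs) xs) ds"
    proof (rule lsum_cong)
      fix e assume e: "e \<in> set ds"
      show "lsum L.SSP.T (\<lambda>p. ?\<delta> (fst e) (cmp (snd e) (fst p)) \<one>\<^bsub>S\<^esub> (snd p u)) xs =
        lsum L.SSP.T (\<lambda>p. lsum L.SSP.T (\<lambda>q. ?\<delta> (fst e) (cmp (snd e) (fst p)) (cmp (snd p) (fst q)) (snd q u)) xs) xs"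
        by (rule represents_comult[OF \<phi> xs L.SSP.abelian_group_tensor tri[OF ds_in(1)[OF e]] ds_in(2)[OF e] u])
    qed
    also have "\<dots> = lsum L.SSP.T (\<lambda>p. lsum L.SSP.T (\<lambda>e. lsum L.SSP.T (\<lambda>q.
        ?\<delta> (fst e) (cmp (snd e) (fst p)) (cmp (snd p) (fst q)) (snd q u)) xs) ds) xs"
      using x u by (intro L.SSP.T.lsum_commute L.SSP.T.lsum_closed L.SSP.pure_closed L.SS.pure_closed)
        (simp_all add: rk_S cmp_Q cmp_S S_app ds_in)
    also have "\<dots> = lsum L.SSP.T (\<lambda>p. lsum L.SSP.T (\<lambda>q. L.SSP.pt (L.SS.pt (fst p) (cmp (snd p) (fst q))) (snd q u)) xs) xs"
    proof (rule lsum_cong)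
      fix p assume p: "p \<in> set xs"
      have "lsum L.SSP.T (\<lambda>e. lsum L.SSP.T (\<lambda>q. ?\<delta> (fst e) (cmp (snd e) (fst p)) (cmp (snd p) (fst q)) (snd q u)) xs) ds =
        lsum L.SSP.T (\<lambda>q. lsum L.SSP.T (\<lambda>e. ?\<delta> (fst e) (cmp (snd e) (fst p)) (cmp (snd p) (fst q)) (snd q u)) ds) xs"
        using x x[OF p] u by (intro L.SSP.T.lsum_commute L.SSP.pure_closed L.SS.pure_closed)
          (simp_all add: rk_S cmp_Q cmp_S S_app ds_in)
      also have "\<dots> = lsum L.SSP.T (\<lambda>q. L.SSP.pt (L.SS.pt (fst p) (cmp (snd p) (fst q))) (snd q u)) xs"
        using x x[OF p] u by (intro lsum_cong dual_sum(1)[OF L.SSP.abelian_group_tensor F]) (simp_all add: S_app cmp_S)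
      finally show "lsum L.SSP.T (\<lambda>e. lsum L.SSP.T (\<lambda>q. ?\<delta> (fst e) (cmp (snd e) (fst p)) (cmp (snd p) (fst q)) (snd q u)) xs) ds =
        lsum L.SSP.T (\<lambda>q. L.SSP.pt (L.SS.pt (fst p) (cmp (snd p) (fst q))) (snd q u)) xs" .
    qed
    also have "\<dots> = lsum L.SSP.T (\<lambda>q. lsum L.SSP.T (\<lambda>p. L.SSP.pt (L.SS.pt (fst p) (cmp (snd p) (fst q))) (snd q u)) xs) xs"
      using x u by (intro L.SSP.T.lsum_commute L.SSP.pure_closed L.SS.pure_closed) (simp_all add: cmp_S S_app)
    finally have cocycle: "lsum L.SSP.T (\<lambda>q. lsum L.SSP.T (\<lambda>p. L.SSP.pt (L.SS.pt (fst p) (snd p \<otimes>\<^bsub>S\<^esub> fst q)) (snd q u)) xs) xs =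
        lsum L.SSP.T (\<lambda>p. L.SSP.pt (L.SS.pt (fst p) \<one>\<^bsub>S\<^esub>) (snd p u)) xs"
      by simp
    obtain ws where ws: "set ws \<subseteq> {s \<in> carrier S. lsum L.SS.T (\<lambda>p. L.SS.pt (fst p) (snd p \<otimes>\<^bsub>S\<^esub> s)) xs = L.SS.pt s \<one>\<^bsub>S\<^esub>} \<times> carrier P"
      "u = lsum P (\<lambda>p. fst p (snd p)) ws"
      by (rule L.faithfully_flat_descend[OF ff hS hSS xsS u cocycle represents_unit[OF \<phi> xs u]])
    \<comment> \<open>Apply t \<otimes> r \<mapsto> ft \<otimes> rv to \<Sum> x_k \<otimes> y_k s =
      s \<otimes> 1: the result reads \<phi>(f \<otimes> sv) = fs \<otimes> v, and the inverse
      \<psi> turns it around.\<close>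
    have "s \<in> J \<psi>" if s: "s \<in> carrier S" and eq: "lsum L.SS.T (\<lambda>p. L.SS.pt (fst p) (cmp (snd p) s)) xs = L.SS.pt s \<one>\<^bsub>S\<^esub>" for s
    proof -
      have "\<phi> (tens f (s v)) = tens (cmp f s) v" if f: "f \<in> carrier Q" and v: "v \<in> carrier P" for f v
      proof -
        have bal: "balanced B S S C (\<lambda>t r. tens (cmp f t) (r v))"
          using f v by (intro balancedI) (simp_all add: tens_closed cmp_Q S_app add_hom_add[OF cmp_Q_hom'] C.pure_add_left
              C.pure_add_right S_plus_app cm_in_S tens_cm flip: cmp_assoc_Q)
        have lift: "tensor_lift C (\<lambda>t r. tens (cmp f t) (r v)) (L.SS.pt t r) = tens (cmp f t) (r v)"
          if "t \<in> carrier S" "r \<in> carrier S" for t r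
          by (rule L.SS.tensor_lift_pure[OF C.abelian_group_tensor bal that])
        have "\<phi> (tens f (s v)) = lsum C (\<lambda>p. tensor_lift C (\<lambda>t r. tens (cmp f t) (r v)) (L.SS.pt (fst p) (cmp (snd p) s))) xs"
          unfolding representsD(3)[OF xs f S_app[OF s v]] using x s v by (intro lsum_cong) (simp add: lift cmp_S)
        also have "\<dots> = tensor_lift C (\<lambda>t r. tens (cmp f t) (r v)) (L.SS.pt s \<one>\<^bsub>S\<^esub>)"
          unfolding eq[symmetric] using x s
          by (intro add_hom_lsum[OF L.SS.abelian_group_tensor C.abelian_group_tensor
                L.SS.tensor_lift_hom[OF C.abelian_group_tensor bal], symmetric] L.SS.pure_closed cmp_S)
        also have "\<dots> = tens (cmp f s) v"
          using s v by (simp add: lift)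
        finally show ?thesis .
      qed
      then have "\<psi> (tens (cmp f s) v) = tens f (s v)" if "f \<in> carrier Q" "v \<in> carrier P" for f v
        using that inv(1) s by (metis tens_closed S_app)
      then show ?thesis
        using s by (simp add: J_def)
    qed
    then show "\<exists>ws. set ws \<subseteq> J \<psi> \<times> carrier P \<and> u = lsum P (\<lambda>w. fst w (snd w)) ws"
      using ws by (intro exI[of _ ws]) auto
  next
    fix I assume "additive_subgroup I B" "\<forall>x\<in>I. \<forall>b\<in>carrier B. x \<otimes>\<^bsub>B\<^esub> b \<in> I"
      and "\<forall>u\<in>carrier P. \<exists>ws. set ws \<subseteq> I \<times> carrier P \<and> u = lsum P (\<lambda>w. lact P (fst w) (snd w)) ws"
    then show "carrier B \<subseteq> I"
      by (intro L.faithfully_flat_ideal[OF ff hB]) blast+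
  qed
qed

text \<open>In the original order of factors the kernel condition becomes \<Sum> s x_k \<otimes> y_k
  = 1 \<otimes> s, which puts s into J(\<phi>) itself instead of J of the inverse.\<close>

lemma comatrix_descent_flat_right:
  fixes hB :: "'b \<Rightarrow> 'u" and hS :: "('m \<Rightarrow> 'm) \<Rightarrow> 'u" and hSS :: "(('m \<Rightarrow> 'm) \<times> ('m \<Rightarrow> 'm) \<Rightarrow>\<^sub>0 int) set \<Rightarrow> 'u"
  assumes "faithfully_flat_right TYPE('u) B Q" and hB: "inj hB" and hS: "inj hS" and hSS: "inj hSS"
  shows "comatrix_descent A B P"
proof -
  interpret R: extension_module "op_ring B" "op_module S" "op_module Q" "\<lambda>s f. cmp f s" by (rule right_extension)
  have ff: "faithfully_flat_left TYPE('u) (op_ring B) (op_module Q)"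
    by (rule faithfully_flat_right_op[OF assms(1)])
  \<comment> \<open>Facts about the opposite records involve exchanged actions and reversed
    products; simplification restates them in terms of S and \<open>Q\<close>.\<close>
  note SPb = R.SP.pure_balanced[simplified] and SSb = R.SS.pure_balanced[simplified] and SSPb = R.SSP.pure_balanced[simplified]
  note SSr = R.SS.tensor_ract_pure[simplified]
  note SPc = R.SP.pure_closed[simplified] and SSc = R.SS.pure_closed[simplified] and SSPc = R.SSP.pure_closed[simplified]
  note SPa = R.SP.pure_add_left[simplified] R.SP.pure_add_right[simplified]
  note SSa = R.SS.pure_add_left[simplified] R.SS.pure_add_right[simplified]
  note SSPa = R.SSP.pure_add_left[simplified] R.SSP.pure_add_right[simplified]
  show ?thesis
  proof (rule comatrix_descent_right)
    fix t assume t: "t \<in> carrier S" and tt: "\<forall>f\<in>carrier Q. \<forall>u\<in>carrier P. tens (cmp f t) u = tens f (t u)"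
    \<comment> \<open>The mirror image multiplies u by a functional g, f \<otimes> u \<mapsto> ug
      \<otimes> f. It is applied to ft \<otimes> e_i = f \<otimes> t e_i with g = e_i^* and summed
      over i.\<close>
    have bal: "balanced B Q P R.SP.T (\<lambda>f u. R.SP.pt (rk u g) f)" if "g \<in> carrier Q" for g
    proof (rule balancedI)
      show "R.SP.pt (rk u g) (ract Q f b) = R.SP.pt (rk (lact P b u) g) f"
        if "f \<in> carrier Q" "b \<in> carrier B" "u \<in> carrier P" for f b u
        using that \<open>g \<in> carrier Q\<close> SPb[of "rk u g" b f] by (simp add: rk_S cmp_rk cm_in_S)
    qed (use that in \<open>simp_all add: rk_S SPc SPa add_hom_add[OF rk_hom]\<close>)
    have lift: "tensor_lift R.SP.T (\<lambda>f u. R.SP.pt (rk u g) f) (tens f u) = R.SP.pt (rk u g) f"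
      if "g \<in> carrier Q" "f \<in> carrier Q" "u \<in> carrier P" for g f u
      by (rule C.tensor_lift_pure[OF R.SP.abelian_group_tensor bal[OF that(1)] that(2,3)])
    have F: "(\<lambda>s. R.SP.pt s f) \<in> add_hom S R.SP.T" if "f \<in> carrier Q" for f
      using that by (intro add_homI) (simp_all add: SPc SPa)
    have "R.SP.pt t f = R.SP.pt \<one>\<^bsub>S\<^esub> (cmp f t)" if f: "f \<in> carrier Q" for f
    proof -
      have "R.SP.pt t f = lsum R.SP.T (\<lambda>e. R.SP.pt (rk (t (fst e)) (snd e)) f) ds"
        by (rule dual_sum(2)[OF R.SP.abelian_group_tensor F[OF f] t, symmetric])
      also have "\<dots> = lsum R.SP.T (\<lambda>e. R.SP.pt (rk (fst e) (snd e)) (cmp f t)) ds"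
      proof (rule lsum_cong)
        fix e assume e: "e \<in> set ds"
        show "R.SP.pt (rk (t (fst e)) (snd e)) f = R.SP.pt (rk (fst e) (snd e)) (cmp f t)"
          using lift[of "snd e" "cmp f t" "fst e"] lift[of "snd e" f "t (fst e)"] tt e t f
          by (simp add: ds_in cmp_Q S_app)
      qed
      also have "\<dots> = R.SP.pt \<one>\<^bsub>S\<^esub> (cmp f t)"
        by (rule dual_sum_one[OF R.SP.abelian_group_tensor F[OF cmp_Q[OF f t]]])
      finally show ?thesis .
    qed
    then obtain b where "b \<in> carrier B" "t = cmp (cm b) \<one>\<^bsub>S\<^esub>"
      using R.faithfully_flat_base[OF ff hS, simplified, OF t] by auto
    then show "t \<in> cm ` carrier B"
      using S.r_one[OF cm_in_S] by simp
  next
    fix \<phi> f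
    assume "\<phi> \<in> Aut" and f: "f \<in> carrier Q"
    then have \<phi>: "\<phi> \<in> coring_hom A D D" by auto
    obtain xs where xs: "represents xs \<phi>"
      by (rule represents_exists[OF \<phi>])
    note x = representsD(1,2)[OF xs]
    \<comment> \<open>Over the opposite rings the factors of S \<otimes> S trade places, so y_k
      comes first.\<close>
    define ys where "ys = map (\<lambda>p. (snd p, fst p)) xs"
    have ysS: "set ys \<subseteq> carrier (op_module S) \<times> carrier (op_module S)"
      using x by (auto simp: ys_def)
    have unit: "lsum (op_module Q) (\<lambda>q. cmp (cmp f (snd q)) (fst q)) ys = f"
    proof (rule Q_eqI)
      have "lsum (op_module Q) (\<lambda>q. cmp (cmp f (snd q)) (fst q)) ys = lsum Q (\<lambda>q. cmp (cmp f (fst q)) (snd q)) xs"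
        by (simp add: ys_def lsum_map lsum_op)
      note eq = this
      have in_Q: "cmp (cmp f (fst q)) (snd q) \<in> carrier Q" if "q \<in> set xs" for q
        using x[OF that] f by (simp add: cmp_Q)
      show "lsum (op_module Q) (\<lambda>q. cmp (cmp f (snd q)) (fst q)) ys \<in> carrier Q"
        unfolding eq by (rule Q.M.lsum_closed[OF in_Q])
      fix u assume u: "u \<in> carrier P"
      have "lsum Q (\<lambda>q. cmp (cmp f (fst q)) (snd q)) xs u = lsum A (\<lambda>q. f (fst q (snd q u))) xs"
        using x u by (subst lsum_Q_app[OF in_Q u]) (simp_all add: S_app cong: lsum_cong)
      also have "\<dots> = f (lsum P (\<lambda>q. fst q (snd q u)) xs)"
        using x u by (intro add_hom_lsum[OF Sg.M.abelian_group_axioms Sg.R.abelian_group_axioms Q_app_hom[OF f], symmetric])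
          (simp add: S_app)
      finally show "lsum (op_module Q) (\<lambda>q. cmp (cmp f (snd q)) (fst q)) ys u = f u"
        unfolding eq by (simp add: represents_unit[OF \<phi> xs u])
    qed (rule f)
    let ?\<delta> = "\<lambda>g f s w. R.SSP.pt (R.SS.pt (rk w g) s) f"
    have tri: "trilinear R.SSP.T (?\<delta> g)" if g: "g \<in> carrier Q" for g
    proof (rule trilinearI)
      fix f b s w assume *: "f \<in> carrier Q" "b \<in> carrier B" "s \<in> carrier S" "w \<in> carrier P"
      show "?\<delta> g (cmp f (cm b)) s w = ?\<delta> g f (cmp (cm b) s) w"
        using * g SSPb[of "R.SS.pt (rk w g) s" b f] SSr[of b "rk w g" s] by (simp add: rk_S ract_Q SSc)
      show "?\<delta> g f (cmp s (cm b)) w = ?\<delta> g f s (lact P b w)"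
        using * g SSb[of "rk w g" b s] by (simp add: rk_S cmp_rk cm_in_S)
    qed (use g in \<open>simp_all add: rk_S SSc SSPc add_hom_add[OF rk_hom] SSa SSPa\<close>)
    have F: "(\<lambda>s. R.SSP.pt (R.SS.pt s t) g) \<in> add_hom S R.SSP.T" if "t \<in> carrier S" "g \<in> carrier Q" for t g
      using that by (intro add_homI) (simp_all add: SSc SSPc SSa SSPa)
    have "lsum R.SSP.T (\<lambda>p. R.SSP.pt (R.SS.pt (snd p) \<one>\<^bsub>S\<^esub>) (cmp f (fst p))) xs =
        lsum R.SSP.T (\<lambda>p. lsum R.SSP.T (\<lambda>e. ?\<delta> (snd e) (cmp f (fst p)) \<one>\<^bsub>S\<^esub> (snd p (fst e))) ds) xs"
      using x f by (intro lsum_cong dual_sum(2)[OF R.SSP.abelian_group_tensor F, symmetric]) (simp_all add: cmp_Q)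
    also have "\<dots> = lsum R.SSP.T (\<lambda>e. lsum R.SSP.T (\<lambda>p. ?\<delta> (snd e) (cmp f (fst p)) \<one>\<^bsub>S\<^esub> (snd p (fst e))) xs) ds"
      using x f by (intro R.SSP.T.lsum_commute SSPc SSc) (simp_all add: rk_S cmp_Q S_app ds_in)
    also have "\<dots> = lsum R.SSP.T (\<lambda>e. lsum R.SSP.T (\<lambda>p. lsum R.SSP.T (\<lambda>q.
        ?\<delta> (snd e) (cmp f (fst p)) (cmp (snd p) (fst q)) (snd q (fst e))) xs) xs) ds"
    proof (rule lsum_cong)
      fix e assume e: "e \<in> set ds"
      show "lsum R.SSP.T (\<lambda>p. ?\<delta> (snd e) (cmp f (fst p)) \<one>\<^bsub>S\<^esub> (snd p (fst e))) xs =
        lsum R.SSP.T (\<lambda>p. lsum R.SSP.T (\<lambda>q. ?\<delta> (snd e) (cmp f (fst p)) (cmp (snd p) (fst q)) (snd q (fst e))) xs) xs"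
        by (rule represents_comult[OF \<phi> xs R.SSP.abelian_group_tensor tri[OF ds_in(2)[OF e]] f ds_in(1)[OF e]])
    qed
    also have "\<dots> = lsum R.SSP.T (\<lambda>p. lsum R.SSP.T (\<lambda>e. lsum R.SSP.T (\<lambda>q.
        ?\<delta> (snd e) (cmp f (fst p)) (cmp (snd p) (fst q)) (snd q (fst e))) xs) ds) xs"
      using x f by (intro R.SSP.T.lsum_commute R.SSP.T.lsum_closed SSPc SSc)
        (simp_all add: rk_S cmp_Q cmp_S S_app ds_in)
    also have "\<dots> = lsum R.SSP.T (\<lambda>p. lsum R.SSP.T (\<lambda>q. R.SSP.pt (R.SS.pt (snd q) (cmp (snd p) (fst q))) (cmp f (fst p))) xs) xs"
    proof (rule lsum_cong)
      fix p assume p: "p \<in> set xs"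
      have "lsum R.SSP.T (\<lambda>e. lsum R.SSP.T (\<lambda>q. ?\<delta> (snd e) (cmp f (fst p)) (cmp (snd p) (fst q)) (snd q (fst e))) xs) ds =
        lsum R.SSP.T (\<lambda>q. lsum R.SSP.T (\<lambda>e. ?\<delta> (snd e) (cmp f (fst p)) (cmp (snd p) (fst q)) (snd q (fst e))) ds) xs"
        using x x[OF p] f by (intro R.SSP.T.lsum_commute SSPc SSc) (simp_all add: rk_S cmp_Q cmp_S S_app ds_in)
      also have "\<dots> = lsum R.SSP.T (\<lambda>q. R.SSP.pt (R.SS.pt (snd q) (cmp (snd p) (fst q))) (cmp f (fst p))) xs"
        using x x[OF p] f by (intro lsum_cong dual_sum(2)[OF R.SSP.abelian_group_tensor F]) (simp_all add: cmp_Q cmp_S)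
      finally show "lsum R.SSP.T (\<lambda>e. lsum R.SSP.T (\<lambda>q. ?\<delta> (snd e) (cmp f (fst p)) (cmp (snd p) (fst q)) (snd q (fst e))) xs) ds =
        lsum R.SSP.T (\<lambda>q. R.SSP.pt (R.SS.pt (snd q) (cmp (snd p) (fst q))) (cmp f (fst p))) xs" .
    qed
    finally have cocycle: "lsum R.SSP.T (\<lambda>q. lsum R.SSP.T (\<lambda>p. R.SSP.pt (R.SS.pt (fst p) (snd p \<otimes>\<^bsub>op_module S\<^esub> fst q)) (cmp f (snd q))) ys) ys =
        lsum R.SSP.T (\<lambda>q. R.SSP.pt (R.SS.pt (fst q) \<one>\<^bsub>op_module S\<^esub>) (cmp f (snd q))) ys"
      by (simp add: ys_def lsum_map)
    obtain ws where ws: "set ws \<subseteq> {s \<in> carrier (op_module S). lsum R.SS.T (\<lambda>p. R.SS.pt (fst p) (snd p \<otimes>\<^bsub>op_module S\<^esub> s)) ys =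
        R.SS.pt s \<one>\<^bsub>op_module S\<^esub>} \<times> carrier (op_module Q)"
      "f = lsum (op_module Q) (\<lambda>p. cmp (snd p) (fst p)) ws"
      using R.faithfully_flat_descend[OF ff hS hSS ysS _ cocycle unit] f by auto
    have "s \<in> J \<phi>" if s: "s \<in> carrier S" and eq: "lsum R.SS.T (\<lambda>p. R.SS.pt (snd p) (cmp s (fst p))) xs = R.SS.pt s \<one>\<^bsub>S\<^esub>" for s
    proof -
      have "\<phi> (tens (cmp g s) v) = tens g (s v)" if g: "g \<in> carrier Q" and v: "v \<in> carrier P" for g v
      proof -
        have bal: "balanced (op_ring B) (op_module S) (op_module S) C (\<lambda>r t. tens (cmp g t) (r v))"
          using g v by (intro balancedI) (simp_all add: tens_closed cmp_Q S_app add_hom_add[OF cmp_Q_hom'] C.pure_add_left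
              C.pure_add_right S_plus_app cm_in_S tens_cm flip: cmp_assoc_Q)
        have lift: "tensor_lift C (\<lambda>r t. tens (cmp g t) (r v)) (R.SS.pt r t) = tens (cmp g t) (r v)"
          if "t \<in> carrier S" "r \<in> carrier S" for t r
          using that by (intro R.SS.tensor_lift_pure[OF C.abelian_group_tensor bal]) simp_all
        have "\<phi> (tens (cmp g s) v) = lsum C (\<lambda>p. tensor_lift C (\<lambda>r t. tens (cmp g t) (r v)) (R.SS.pt (snd p) (cmp s (fst p)))) xs"
          unfolding representsD(3)[OF xs cmp_Q[OF g s] v] using x s g v by (intro lsum_cong) (simp add: lift cmp_S cmp_assoc_Q)
        also have "\<dots> = tensor_lift C (\<lambda>r t. tens (cmp g t) (r v)) (R.SS.pt s \<one>\<^bsub>S\<^esub>)"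
          unfolding eq[symmetric] using x s
          by (intro add_hom_lsum[OF R.SS.abelian_group_tensor C.abelian_group_tensor
                R.SS.tensor_lift_hom[OF C.abelian_group_tensor bal], symmetric] SSc cmp_S)
        also have "\<dots> = tens g (s v)"
          using s g by (simp add: lift cmp_Q_one)
        finally show ?thesis .
      qed
      then show ?thesis
        using s by (simp add: J_def)
    qed
    then show "\<exists>ws. set ws \<subseteq> J \<phi> \<times> carrier Q \<and> f = lsum Q (\<lambda>w. cmp (snd w) (fst w)) ws"
      using ws by (intro exI[of _ ws]) (auto simp: lsum_op ys_def lsum_map)
  next
    fix I assume I: "additive_subgroup I B" "\<forall>x\<in>I. \<forall>b\<in>carrier B. b \<otimes>\<^bsub>B\<^esub> x \<in> I"
      and gen: "\<forall>f\<in>carrier Q. \<exists>ws. set ws \<subseteq> I \<times> carrier Q \<and> f = lsum Q (\<lambda>w. ract Q (snd w) (fst w)) ws"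
    have "additive_subgroup I (op_ring B)"
      using additive_subgroup.a_subgroup[OF I(1)] by (simp add: additive_subgroup_def subgroup_def m_inv_def)
    then have "carrier (op_ring B) \<subseteq> I"
      using I(2) gen by (intro R.faithfully_flat_ideal[OF ff hB]) (simp_all add: lsum_op)
    then show "carrier B \<subseteq> I" by simp
  qed
qed

section \<open>The bimodule retraction S \<rightarrow> B of a separable bimodule\<close>

lemma left_dual_sel [simp]:
  "zero (left_dual B P) = (\<lambda>x\<in>carrier P. \<zero>\<^bsub>B\<^esub>)" "add (left_dual B P) = (\<lambda>f g. \<lambda>x\<in>carrier P. f x \<oplus>\<^bsub>B\<^esub> g x)"
  "lact (left_dual B P) a f = (\<lambda>x\<in>carrier P. f (ract P x a))" "ract (left_dual B P) f b = (\<lambda>x\<in>carrier P. f x \<otimes>\<^bsub>B\<^esub> b)"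
  by (simp_all add: left_dual_def)

lemma left_dual_iff: "f \<in> carrier (left_dual B P) \<longleftrightarrow> f \<in> extensional (carrier P) \<and> (\<forall>u\<in>carrier P. f u \<in> carrier B) \<and>
   (\<forall>u\<in>carrier P. \<forall>v\<in>carrier P. f (u \<oplus>\<^bsub>P\<^esub> v) = f u \<oplus>\<^bsub>B\<^esub> f v) \<and>
   (\<forall>b\<in>carrier B. \<forall>u\<in>carrier P. f (lact P b u) = b \<otimes>\<^bsub>B\<^esub> f u)"
  by (auto simp: left_dual_def left_hom_def hom_def)

lemma left_dual_bimodule: "bimodule A B (left_dual B P)"
proof (intro bimodule.intro left_module.intro right_module.intro left_module_axioms.intro
        right_module_axioms.intro bimodule_axioms.intro)
  show "ring A" "ring B" by (fact Sg.L.ring_axioms Sg.R.ring_axioms)+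
  show "abelian_group (left_dual B P)"
  proof (rule abelian_groupI)
    fix f assume f: "f \<in> carrier (left_dual B P)"
    then show "\<exists>t\<in>carrier (left_dual B P). t \<oplus>\<^bsub>left_dual B P\<^esub> f = \<zero>\<^bsub>left_dual B P\<^esub>"
      by (intro bexI[of _ "\<lambda>x\<in>carrier P. \<ominus>\<^bsub>B\<^esub> f x"])
        (auto simp: Sg.L.l_neg left_dual_iff Sg.L.minus_add Sg.L.r_minus)
  qed (auto simp: left_dual_iff Sg.L.a_ac Sg.L.r_distr fun_eq_iff extensional_def)
  then show "abelian_group (left_dual B P)" .
qed (auto simp: left_dual_iff Sg.L.m_assoc Sg.L.l_distr Sg.L.r_distr Sg.ract_l_distr Sg.ract_r_distr Sg.ract_assoc
    Sg.ract_one Sg.lact_ract fun_eq_iff extensional_def)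

text \<open>The section gives c = \<sigma>(1) = \<Sum> x_i \<otimes> g_i with bc = cb, and the
  retraction is E(s) = \<Sum> g_i(s x_i). Evaluation sends c to 1, so E(1) = 1; left linearity is
  that of the g_i. Finally E(sb) is obtained from E(s) by replacing c with bc = cb, hence equals
  E(s) b.\<close>

lemma comatrix_descent_separable:
  assumes "separable_bimodule B A P"
  shows "comatrix_descent A B P"
proof -
  let ?L = "left_dual B P" and ?T = "tensor A P (left_dual B P)" and ?pt = "pure_tensor A P (left_dual B P)"
  interpret L: bimodule A B ?L by (rule left_dual_bimodule)
  interpret Tl: tensor_bimodule_left B A P ?L
    using Sg.bimodule_axioms L.left_module_axioms by (rule tensor_bimodule_left.intro)
  interpret Tr: tensor_bimodule_right B A P ?L
    using Sg.right_module_axioms L.bimodule_axioms by (rule tensor_bimodule_right.intro)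
  obtain \<sigma> where \<sigma>: "\<sigma> \<in> left_hom B (regular_bimodule B) ?T" "\<sigma> \<in> right_hom B (regular_bimodule B) ?T"
    "\<forall>b\<in>carrier B. left_evaluation B (\<sigma> b) = b"
    using assms by (auto simp: separable_bimodule_def Let_def)
  define c where "c = \<sigma> \<one>\<^bsub>B\<^esub>"
  have c: "c \<in> carrier ?T"
    unfolding c_def by (rule add_hom_closed[OF left_hom_add_hom[OF \<sigma>(1)]]) simp
  have central: "lact ?T b c = ract ?T c b" if "b \<in> carrier B" for b
    using that left_hom_lact[OF \<sigma>(1), of b "\<one>\<^bsub>B\<^esub>"] right_hom_ract[OF \<sigma>(2), of b "\<one>\<^bsub>B\<^esub>"] by (simp add: c_def)
  note B = Sg.L.abelian_group_axioms
  define V where "V s = tensor_lift B (\<lambda>x g. g (s x))" for s :: "'m \<Rightarrow> 'm"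
  have bal: "balanced A P ?L B (\<lambda>x g. g (s x))" if "s \<in> carrier S" for s
    using that by (intro balancedI) (auto simp: left_dual_iff S_app S_add S_ract)
  have V_hom: "V s \<in> add_hom ?T B" if "s \<in> carrier S" for s
    unfolding V_def by (rule Tl.tensor_lift_hom[OF B bal[OF that]])
  have V_pure: "V s (?pt x g) = g (s x)" if "s \<in> carrier S" "x \<in> carrier P" "g \<in> carrier ?L" for s x g
    unfolding V_def by (rule Tl.tensor_lift_pure[OF B bal[OF that(1)] that(2,3)])
  have g: "g u \<in> carrier B" "g (u \<oplus>\<^bsub>P\<^esub> v) = g u \<oplus>\<^bsub>B\<^esub> g v" "b \<in> carrier B \<Longrightarrow> g (lact P b u) = b \<otimes>\<^bsub>B\<^esub> g u"
    if "g \<in> carrier ?L" "u \<in> carrier P" "v \<in> carrier P" for g u v b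
    using that by (auto simp: left_dual_iff)
  show ?thesis
  proof (rule comatrix_descent_split[of "\<lambda>s. V s c"])
    show "(\<lambda>s. V s c) \<in> add_hom S B"
    proof (rule add_homI)
      show "V s c \<in> carrier B" if "s \<in> carrier S" for s
        using c by (rule add_hom_closed[OF V_hom[OF that]])
      show "V (s \<oplus>\<^bsub>S\<^esub> t) c = V s c \<oplus>\<^bsub>B\<^esub> V t c" if "s \<in> carrier S" "t \<in> carrier S" for s t
        by (rule Tl.add_hom_tensor_eqI[OF B V_hom add_hom_plus[OF B V_hom V_hom] _ c])
          (use that in \<open>simp_all add: V_pure S_plus_app S_app g\<close>)
    qed
    have "left_evaluation B c = \<one>\<^bsub>B\<^esub>"
      using \<sigma>(3) by (simp add: c_def)
    moreover have "left_evaluation B c = V \<one>\<^bsub>S\<^esub> c"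
    proof -
      have bal': "balanced A P ?L B (\<lambda>x g. g x)"
        by (intro balancedI) (auto simp: left_dual_iff)
      show ?thesis
        unfolding left_evaluation_def
        by (rule Tl.add_hom_tensor_eqI[OF B Tl.tensor_lift_hom[OF B bal'] V_hom _ c])
          (simp_all add: V_pure Tl.tensor_lift_pure[OF B bal'])
    qed
    ultimately show "V \<one>\<^bsub>S\<^esub> c = \<one>\<^bsub>B\<^esub>" by simp
    fix b s assume b: "b \<in> carrier B" and s: "s \<in> carrier S"
    have mult: "(\<lambda>x. b \<otimes>\<^bsub>B\<^esub> x) \<in> add_hom B B" "(\<lambda>x. x \<otimes>\<^bsub>B\<^esub> b) \<in> add_hom B B"
      by (rule add_homI; simp add: b Sg.L.r_distr Sg.L.l_distr)+
    show "V (cmp (cm b) s) c = b \<otimes>\<^bsub>B\<^esub> V s c"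
      by (rule Tl.add_hom_tensor_eqI[OF B V_hom add_hom_compose[OF V_hom[OF s] mult(1)] _ c])
        (use b s in \<open>simp_all add: V_pure cmp_S cm_in_S S_app g\<close>)
    have "V (cmp s (cm b)) c = V s (lact ?T b c)"
      by (rule Tl.add_hom_tensor_eqI[OF B V_hom add_hom_compose[OF Tl.tensor_lact_hom[OF b] V_hom[OF s]] _ c])
        (use b s in \<open>simp_all add: V_pure cmp_S cm_in_S Tl.tensor_lact_pure\<close>)
    also have "\<dots> = V s (ract ?T c b)"
      by (simp only: central[OF b])
    also have "\<dots> = V s c \<otimes>\<^bsub>B\<^esub> b"
      by (rule Tl.add_hom_tensor_eqI[OF B add_hom_compose[OF Tr.tensor_ract_hom[OF b] V_hom[OF s]]
            add_hom_compose[OF V_hom[OF s] mult(2)] _ c])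
        (use b s L.ract_closed in \<open>simp_all add: V_pure Tr.tensor_ract_pure S_app del: left_dual_sel, simp add: S_app\<close>)
    finally show "V (cmp s (cm b)) c = V s c \<otimes>\<^bsub>B\<^esub> b" .
  qed
qed

end

section \<open>Existence of dual bases\<close>

lemma abelian_group_free_right_module:
  assumes "ring R"
  shows "abelian_group (free_right_module R X)"
proof -
  interpret ring R by fact
  show ?thesis
  proof (rule abelian_groupI)
    fix f g assume fg: "f \<in> carrier (free_right_module R X)" "g \<in> carrier (free_right_module R X)"
    have "finite ({x \<in> X. f x \<noteq> \<zero>\<^bsub>R\<^esub>} \<union> {x \<in> X. g x \<noteq> \<zero>\<^bsub>R\<^esub>})"
      using fg by (simp add: free_right_module_def)
    moreover have "{x \<in> X. f x \<oplus>\<^bsub>R\<^esub> g x \<noteq> \<zero>\<^bsub>R\<^esub>} \<subseteq> {x \<in> X. f x \<noteq> \<zero>\<^bsub>R\<^esub>} \<union> {x \<in> X. g x \<noteq> \<zero>\<^bsub>R\<^esub>}"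
      by auto
    ultimately have "finite {x \<in> X. f x \<oplus>\<^bsub>R\<^esub> g x \<noteq> \<zero>\<^bsub>R\<^esub>}"
      by (rule finite_subset[rotated])
    then show "f \<oplus>\<^bsub>free_right_module R X\<^esub> g \<in> carrier (free_right_module R X)"
      using fg by (auto simp: free_right_module_def PiE_iff cong: conj_cong)
  next
    fix f assume f: "f \<in> carrier (free_right_module R X)"
    have "{x \<in> X. \<ominus>\<^bsub>R\<^esub> f x \<noteq> \<zero>\<^bsub>R\<^esub>} \<subseteq> {x \<in> X. f x \<noteq> \<zero>\<^bsub>R\<^esub>}"
      by auto
    then have "finite {x \<in> X. \<ominus>\<^bsub>R\<^esub> f x \<noteq> \<zero>\<^bsub>R\<^esub>}"
      using f by (auto simp: free_right_module_def intro: finite_subset)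
    then show "\<exists>g\<in>carrier (free_right_module R X). g \<oplus>\<^bsub>free_right_module R X\<^esub> f = \<zero>\<^bsub>free_right_module R X\<^esub>"
      using f by (intro bexI[of _ "\<lambda>x\<in>X. \<ominus>\<^bsub>R\<^esub> f x"])
        (auto simp: free_right_module_def PiE_iff l_neg fun_eq_iff cong: conj_cong)
  qed (auto simp: free_right_module_def PiE_iff a_ac fun_eq_iff extensional_def Pi_iff cong: conj_cong)
qed

text \<open>A dual basis is a set of pairs, so pairs with the same functional have to be merged first;
  otherwise a repeated pair would be lost.\<close>

lemma merge_dual_pairs:
  assumes "right_module R M" and "set ps \<subseteq> carrier M \<times> carrier (right_dual R M)"
  obtains qs where "distinct (map snd qs)" and "set qs \<subseteq> carrier M \<times> carrier (right_dual R M)"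
    and "\<And>x. x \<in> carrier M \<Longrightarrow>
      lsum M (\<lambda>p. ract M (fst p) (snd p x)) qs = lsum M (\<lambda>p. ract M (fst p) (snd p x)) ps"
proof -
  interpret right_module R M by fact
  let ?h = "\<lambda>x p. ract M (fst p) (snd p x)"
  have f_in: "f x \<in> carrier R" if "f \<in> carrier (right_dual R M)" "x \<in> carrier M" for f x
    using that by (auto simp: right_dual_def right_hom_def hom_def)
  have h: "?h x p \<in> carrier M" if "x \<in> carrier M" "p \<in> carrier M \<times> carrier (right_dual R M)" for x p
    using that f_in by (auto simp: ract_closed)
  have "\<exists>qs. distinct (map snd qs) \<and> set qs \<subseteq> carrier M \<times> carrier (right_dual R M) \<and>
      (\<forall>x\<in>carrier M. lsum M (?h x) qs = lsum M (?h x) ps)"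
    using assms(2)
  proof (induction ps)
    case Nil
    show ?case by (rule exI[of _ "[]"]) simp
  next
    case (Cons p ps)
    then obtain qs where qs: "distinct (map snd qs)" "set qs \<subseteq> carrier M \<times> carrier (right_dual R M)"
      "\<forall>x\<in>carrier M. lsum M (?h x) qs = lsum M (?h x) ps"
      by auto
    obtain e f where p: "p = (e, f)" "e \<in> carrier M" "f \<in> carrier (right_dual R M)"
      using Cons.prems by auto
    show ?case
    proof (cases "f \<in> snd ` set qs")
      case False
      then show ?thesis
        using qs p by (intro exI[of _ "p # qs"]) auto
    next
      case True
      then obtain e' where "(e', f) \<in> set qs" by auto
      then obtain as bs where split: "qs = as @ (e', f) # bs"
        by (meson split_list)
      have sub: "set as \<subseteq> carrier M \<times> carrier (right_dual R M)" "set bs \<subseteq> carrier M \<times> carrier (right_dual R M)" "e' \<in> carrier M"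
        using qs(2) split by auto
      have "lsum M (?h x) (as @ (e \<oplus>\<^bsub>M\<^esub> e', f) # bs) = lsum M (?h x) (p # ps)" if x: "x \<in> carrier M" for x
      proof -
        have cl: "lsum M (?h x) as \<in> carrier M" "lsum M (?h x) bs \<in> carrier M"
          "ract M e (f x) \<in> carrier M" "ract M e' (f x) \<in> carrier M"
          using sub x p h by (auto intro!: M.lsum_closed ract_closed f_in)
        have app: "lsum M (?h x) (as @ (y, f) # bs) = lsum M (?h x) as \<oplus>\<^bsub>M\<^esub> (ract M y (f x) \<oplus>\<^bsub>M\<^esub> lsum M (?h x) bs)"
          if "y \<in> carrier M" for y
          using that sub x p h by (subst M.lsum_append) (auto intro!: ract_closed f_in)
        have "lsum M (?h x) (p # ps) = ract M e (f x) \<oplus>\<^bsub>M\<^esub> lsum M (?h x) (as @ (e', f) # bs)"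
          using qs(3) x p(1) split by simp
        then show ?thesis
          using cl p sub f_in[OF p(3) x] by (simp add: app ract_l_distr M.a_ac)
      qed
      then show ?thesis
        using qs split sub p by (intro exI[of _ "as @ (e \<oplus>\<^bsub>M\<^esub> e', f) # bs"]) auto
    qed
  qed
  then show thesis using that by blast
qed

text \<open>The dual basis lemma: the functionals are coordinates of \<iota>, the vectors are the
  images under \<pi> of the unit vectors, and finite generation cuts the index set down to a finite
  one.\<close>

lemma is_dual_basis_dual_basis:
  fixes M :: "('l, 'r, 'm, 'z) bimodule_scheme"
  assumes "fin_gen_right_module R M" and "projective_right_module R M"
  shows "is_dual_basis R M (dual_basis R M)"
proof -
  obtain G where M: "right_module R M" and G: "finite G" "G \<subseteq> carrier M"
    "\<forall>y\<in>carrier M. \<exists>c\<in>G \<rightarrow> carrier R. y = (\<Oplus>\<^bsub>M\<^esub>x\<in>G. ract M x (c x))"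
    using assms(1) by (auto simp: fin_gen_right_module_def)
  interpret right_module R M by fact
  obtain X :: "'m set" and \<iota> \<pi> where \<iota>: "\<iota> \<in> right_hom R M (free_right_module R X)"
    and \<pi>: "\<pi> \<in> right_hom R (free_right_module R X) M" and \<pi>\<iota>: "\<forall>x\<in>carrier M. \<pi> (\<iota> x) = x"
    using assms(2) by (auto simp: projective_right_module_def)
  let ?F = "free_right_module R X"
  have F: "abelian_group ?F"
    by (rule abelian_group_free_right_module[OF R.ring_axioms])
  have \<iota>_in: "\<iota> x \<in> X \<rightarrow>\<^sub>E carrier R" "finite {y \<in> X. \<iota> x y \<noteq> \<zero>\<^bsub>R\<^esub>}" if "x \<in> carrier M" for x
    using add_hom_closed[OF right_hom_add_hom[OF \<iota>] that] by (simp_all add: free_right_module_def)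
  have coord_in: "\<iota> x y \<in> carrier R" if "x \<in> carrier M" "y \<in> X" for x y
    using \<iota>_in(1)[OF that(1)] that(2) by auto
  have coord_add: "\<iota> (x \<oplus>\<^bsub>M\<^esub> x') y = \<iota> x y \<oplus>\<^bsub>R\<^esub> \<iota> x' y" if "x \<in> carrier M" "x' \<in> carrier M" "y \<in> X" for x x' y
    using that add_hom_add[OF right_hom_add_hom[OF \<iota>]] by (simp add: free_right_module_def)
  have coord_ract: "\<iota> (ract M x a) y = \<iota> x y \<otimes>\<^bsub>R\<^esub> a" if "x \<in> carrier M" "a \<in> carrier R" "y \<in> X" for x a y
    using that right_hom_ract[OF \<iota>] by (simp add: free_right_module_def)
  \<comment> \<open>The union of the supports of \<iota> on the finitely many generators; by
    linearity every \<iota>(m) is supported in it.\<close>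
  define Y where "Y = (\<Union>x\<in>G. {y \<in> X. \<iota> x y \<noteq> \<zero>\<^bsub>R\<^esub>})"
  have "finite Y"
    unfolding Y_def using G(1,2) \<iota>_in(2) by blast
  then obtain ys where ys: "set ys = Y" "distinct ys"
    using finite_distinct_list by blast
  have YX: "Y \<subseteq> X"
    by (auto simp: Y_def)
  obtain gs where gs: "set gs = G" "distinct gs"
    using finite_distinct_list[OF G(1)] by blast
  have outside: "\<iota> m y = \<zero>\<^bsub>R\<^esub>" if m: "m \<in> carrier M" and y: "y \<in> X" "y \<notin> Y" for m y
  proof -
    obtain c where c: "c \<in> G \<rightarrow> carrier R" "m = (\<Oplus>\<^bsub>M\<^esub>x\<in>G. ract M x (c x))"
      using G(3) m by blast
    have in_M: "ract M x (c x) \<in> carrier M" if "x \<in> set gs" for x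
      using that c(1) G(2) gs(1) by (auto intro: ract_closed)
    have "m = lsum M (\<lambda>x. ract M x (c x)) gs"
      unfolding c(2) gs(1)[symmetric] by (rule M.finsum_eq_lsum[OF gs(2) in_M])
    moreover have "(\<lambda>x. \<iota> x y) \<in> add_hom M R"
      using y by (intro add_homI coord_in coord_add)
    ultimately have "\<iota> m y = lsum R (\<lambda>x. \<iota> (ract M x (c x)) y) gs"
      using add_hom_lsum[OF M.abelian_group_axioms R.abelian_group_axioms, of "\<lambda>x. \<iota> x y" gs "\<lambda>x. ract M x (c x)"] in_M
      by simp
    also have "\<dots> = \<zero>\<^bsub>R\<^esub>"
    proof (rule R.lsum_zero)
      fix x assume x: "x \<in> set gs"
      then have "\<iota> x y = \<zero>\<^bsub>R\<^esub>"
        using y gs(1) by (auto simp: Y_def)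
      then show "\<iota> (ract M x (c x)) y = \<zero>\<^bsub>R\<^esub>"
        using x gs(1) G(2) c(1) y by (auto simp: coord_ract Pi_iff subset_iff)
    qed
    finally show ?thesis .
  qed
  define \<delta> where "\<delta> y = (\<lambda>x\<in>X. if x = y then \<one>\<^bsub>R\<^esub> else \<zero>\<^bsub>R\<^esub>)" for y
  have \<delta>: "\<delta> y \<in> carrier ?F" for y
  proof -
    have "{x \<in> X. \<delta> y x \<noteq> \<zero>\<^bsub>R\<^esub>} \<subseteq> {y}"
      by (auto simp: \<delta>_def)
    then have "finite {x \<in> X. \<delta> y x \<noteq> \<zero>\<^bsub>R\<^esub>}"
      by (rule finite_subset) simp
    then show ?thesis
      by (auto simp: free_right_module_def \<delta>_def)
  qed
  have \<delta>_ract: "ract ?F (\<delta> y) a \<in> carrier ?F" if "a \<in> carrier R" for y a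
  proof -
    have "{x \<in> X. \<delta> y x \<otimes>\<^bsub>R\<^esub> a \<noteq> \<zero>\<^bsub>R\<^esub>} \<subseteq> {y}"
      using that by (auto simp: \<delta>_def)
    then have "finite {x \<in> X. \<delta> y x \<otimes>\<^bsub>R\<^esub> a \<noteq> \<zero>\<^bsub>R\<^esub>}"
      by (rule finite_subset) simp
    then show ?thesis
      using that by (auto simp: free_right_module_def \<delta>_def cong: conj_cong)
  qed
  have expand: "\<iota> m = lsum ?F (\<lambda>y. ract ?F (\<delta> y) (\<iota> m y)) ys" if m: "m \<in> carrier M" for m
  proof (rule extensionalityI[of _ X])
    have app: "lsum ?F h zs x = lsum R (\<lambda>y. h y x) zs" if "x \<in> X" for h :: "_ \<Rightarrow> _ \<Rightarrow> _" and zs x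
      using that by (induction zs) (simp_all add: free_right_module_def)
    have ext: "lsum ?F h zs \<in> extensional X" for h :: "_ \<Rightarrow> _ \<Rightarrow> _" and zs
      by (cases zs) (simp_all add: free_right_module_def)
    show "\<iota> m \<in> extensional X"
      using \<iota>_in(1)[OF m] by (simp add: PiE_iff)
    show "lsum ?F (\<lambda>y. ract ?F (\<delta> y) (\<iota> m y)) ys \<in> extensional X"
      by (rule ext)
    fix x assume x: "x \<in> X"
    have "lsum R (\<lambda>y. (if x = y then \<one>\<^bsub>R\<^esub> else \<zero>\<^bsub>R\<^esub>) \<otimes>\<^bsub>R\<^esub> \<iota> m y) zs = (if x \<in> set zs then \<iota> m x else \<zero>\<^bsub>R\<^esub>)"
      if "distinct zs" "set zs \<subseteq> X" for zs
      using that m x by (induction zs) (auto simp: coord_in)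
    then have "lsum R (\<lambda>y. (if x = y then \<one>\<^bsub>R\<^esub> else \<zero>\<^bsub>R\<^esub>) \<otimes>\<^bsub>R\<^esub> \<iota> m y) ys = \<iota> m x"
      using ys YX outside[OF m x] by simp
    then show "\<iota> m x = lsum ?F (\<lambda>y. ract ?F (\<delta> y) (\<iota> m y)) ys x"
      using x by (simp add: app) (simp add: free_right_module_def \<delta>_def)
  qed
  let ?ps = "map (\<lambda>y. (\<pi> (\<delta> y), \<lambda>m\<in>carrier M. \<iota> m y)) ys"
  have "set ?ps \<subseteq> carrier M \<times> carrier (right_dual R M)"
  proof -
    have "(\<lambda>m\<in>carrier M. \<iota> m y) \<in> carrier (right_dual R M)" if "y \<in> set ys" for y
    proof -
      have "y \<in> X" using that ys(1) YX by blast
      then show ?thesis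
        by (auto simp: right_dual_def right_hom_def hom_def coord_in coord_add coord_ract ract_closed)
    qed
    then show ?thesis
      using add_hom_closed[OF right_hom_add_hom[OF \<pi>] \<delta>] by auto
  qed
  then obtain qs where qs: "distinct (map snd qs)" "set qs \<subseteq> carrier M \<times> carrier (right_dual R M)"
    "\<And>x. x \<in> carrier M \<Longrightarrow> lsum M (\<lambda>p. ract M (fst p) (snd p x)) qs = lsum M (\<lambda>p. ract M (fst p) (snd p x)) ?ps"
    by (rule merge_dual_pairs[OF M]) blast
  have sum: "lsum M (\<lambda>p. ract M (fst p) (snd p m)) ?ps = m" if m: "m \<in> carrier M" for m
  proof -
    have "m = \<pi> (lsum ?F (\<lambda>y. ract ?F (\<delta> y) (\<iota> m y)) ys)"
      using \<pi>\<iota> m expand[OF m] by simp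
    also have "\<dots> = lsum M (\<lambda>y. \<pi> (ract ?F (\<delta> y) (\<iota> m y))) ys"
      using m ys(1) YX by (intro add_hom_lsum[OF F M.abelian_group_axioms right_hom_add_hom[OF \<pi>]] \<delta>_ract coord_in) auto
    also have "\<dots> = lsum M (\<lambda>y. ract M (\<pi> (\<delta> y)) (\<iota> m y)) ys"
      using m ys(1) YX by (intro lsum_cong right_hom_ract[OF \<pi>] coord_in \<delta>) auto
    finally show ?thesis
      using m by (simp add: lsum_map)
  qed
  have "is_dual_basis R M (set qs)"
    unfolding is_dual_basis_def
  proof (intro conjI ballI)
    show "finite (set qs)" "set qs \<subseteq> carrier M \<times> carrier (right_dual R M)"
      using qs(2) by simp_all
    fix x assume x: "x \<in> carrier M"
    have "distinct qs"
      using qs(1) by (simp add: distinct_map)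
    moreover have "ract M (fst p) (snd p x) \<in> carrier M" if "p \<in> set qs" for p
      using pairs_fst[OF qs(2) that] pairs_snd[OF qs(2) that] x
      by (auto intro!: ract_closed simp: right_dual_def right_hom_def hom_def)
    ultimately have "(\<Oplus>\<^bsub>M\<^esub>p\<in>set qs. ract M (fst p) (snd p x)) = lsum M (\<lambda>p. ract M (fst p) (snd p x)) qs"
      by (rule M.finsum_eq_lsum)
    then show "x = (\<Oplus>\<^bsub>M\<^esub>p\<in>set qs. ract M (fst p) (snd p x))"
      using qs(3)[OF x] sum[OF x] by simp
  qed
  then show ?thesis
    unfolding dual_basis_def by (rule someI)
qed

text \<open>Elements of the test type are sets of formal combinations of pairs; a type that injects
  into the base type is embedded by singletons of diagonal generators.\<close>

lemma inj_frag_pair: "inj e \<Longrightarrow> inj (\<lambda>x. {frag_of (e x, e x)})"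
  by (rule injI) (auto simp: frag_of_eq dest: injD)

text \<open>Elements of S \<otimes> S are themselves sets of formal combinations, so they are
  embedded by relabelling both components of each pair; relabelling with the inverse of e undoes
  this.\<close>

lemma inj_frag_image:
  assumes "inj e"
  shows "inj (\<lambda>X. frag_extend (frag_of \<circ> map_prod e e) ` X)"
proof -
  have "frag_extend (frag_of \<circ> map_prod (inv_into UNIV e) (inv_into UNIV e)) (frag_extend (frag_of \<circ> map_prod e e) c) = c" for c
    using frag_expansion[of c] assms
    by (simp add: frag_extend_compose comp_assoc map_prod.comp map_prod.id)
  then have "inj (frag_extend (frag_of \<circ> map_prod e e))"
    by (rule inj_on_inverseI)
  then show ?thesis
    by (simp add: inj_def inj_image_eq_iff)
qed

theorem theorem2p5:
  fixes K :: "'k ring" and A :: "'a ring" and B :: "'b ring"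
    and \<eta>\<^sub>A :: "'k \<Rightarrow> 'a" and \<eta>\<^sub>B :: "'k \<Rightarrow> 'b" and \<Sigma> :: "('b, 'a, 'm) bimodule"
  assumes "unital_algebra K A \<eta>\<^sub>A" and "unital_algebra K B \<eta>\<^sub>B"
    and "central_bimodule K B \<eta>\<^sub>B A \<eta>\<^sub>A \<Sigma>"
    and "faithful_left_module B \<Sigma>"
    and "fin_gen_right_module A \<Sigma>" and "projective_right_module A \<Sigma>"
    and "(faithfully_flat_left TYPE(('a, 'b, 'm) test_universe) B \<Sigma> \<or>
          faithfully_flat_right TYPE(('a, 'b, 'm) test_universe) B (right_dual A \<Sigma>)) \<or>
         separable_bimodule B A \<Sigma>"
  shows "group (invertible_sub_bimodules A B \<Sigma>) \<and>
         group (coring_aut_group A (comatrix_coring A B \<Sigma>)) \<and>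
         (\<exists>\<Gamma>. \<Gamma> \<in> iso (invertible_sub_bimodules A B \<Sigma>)
                      (coring_aut_group A (comatrix_coring A B \<Sigma>)))"
proof -
  interpret comatrix A B \<Sigma>
    using assms(3,5,6) is_dual_basis_dual_basis
    by (simp add: comatrix_def comatrix_axioms_def central_bimodule_def)
  \<comment> \<open>The second and the last summand of \<open>test_base\<close> are the types of the
    elements of B and of S.\<close>
  let ?eB = "\<lambda>b. Inr (Inl b) :: ('a, 'b, 'm) test_base"
  let ?eS = "\<lambda>s. Inr (Inr (Inr (Inr s))) :: ('a, 'b, 'm) test_base"
  have eB: "inj ?eB" and eS: "inj ?eS"
    by (simp_all add: inj_def)
  note inj = inj_frag_pair[OF eB] inj_frag_pair[OF eS] inj_frag_image[OF eS]
  have "comatrix_descent A B \<Sigma>"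
    using assms(7) comatrix_descent_flat_left[OF _ inj] comatrix_descent_flat_right[OF _ inj]
      comatrix_descent_separable by blast
  then show ?thesis
    unfolding invertible_sub_bimodules_def by (rule comatrix_descent.group_isomorphism)
qed

end
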